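(* Let $\rho^\sharp:=\tfrac{3232}{27\pi^6}\approx0.1245$ (which equals $\lambda_{\min}(H_2)$, where $H_2=\operatorname{Hess}f_2(\mathbf 0)$). The square $\square=Q_{\mathbf 0}$ is the unique maximizer of $|Q_{\mathbf p}|\mu_1(Q_{\mathbf p})$ on $\overline{B(\mathbf 0,\rho^\sharp)}\cap\mathcal P$ (i.e. $\mathbf p=\mathbf 0$ is the unique maximizer of $\mathbf p\mapsto|Q_{\mathbf p}|\mu_1(Q_{\mathbf p})$ there).
   Context: $\mu_1(\Omega)$ is the first nonzero Neumann eigenvalue of the Laplacian on $\Omega$. For $\mathbf x,\mathbf y\in\mathbb R^2$, $\mathbf x\times\mathbf y:=x_1y_2-x_2y_1$. Let $\square=[-\tfrac12,\tfrac12]^2$ with vertices $\mathbf v_1^0=(-\tfrac12,-\tfrac12)$, $\mathbf v_2^0=(\tfrac12,-\tfrac12)$, $\mathbf v_3^0=(\tfrac12,\tfrac12)$, $\mathbf v_4^0=(-\tfrac12,\tfrac12)$. For $\mathbf p=(a,b,c,d)\in\mathbb R^4$ define $\Phi_{\mathbf p}(u,v)=(u-au-dv-2buv,\ v-du+av+2cuv)$ on $\square$; $Q_{\mathbf p}$ is the quadrilateral with vertices $\mathbf v_i(\mathbf p)=\Phi_{\mathbf p}(\mathbf v_i^0)$ in this cyclic order, with area $|Q_{\mathbf p}|=1-a^2-d^2$, and $Q_{\mathbf 0}=\square$. Put $c_i(\mathbf p):=(\mathbf v_{i+1}-\mathbf v_i)\times(\mathbf v_{i+2}-\mathbf v_i)$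 (indices mod 4) and $\mathcal P:=\{\mathbf p: c_i(\mathbf p)\ge0,\ i=1,\dots,4\}$. Let $J=\det D\Phi_{\mathbf p}$ and let $g_1,\dots,g_5$ be the functions $\cos(m\pi(x_1+\tfrac12))\cos(n\pi(x_2+\tfrac12))$ for $(m,n)=(1,0),(0,1),(1,1),(2,0),(0,2)$. The $5\times5$ matrices are $$K_{ij}(\mathbf p)=\int_\square(\nabla g_i\cdot\nabla g_j)(\Phi_{\mathbf p})\,J\,du\,dv,$$ $$M_{ij}(\mathbf p)=\int_\square g_i(\Phi_{\mathbf p})g_j(\Phi_{\mathbf p})J\,du\,dv-\frac1{|Q_{\mathbf p}|}\int_\square g_i(\Phi_{\mathbf p})J\,du\,dv\int_\square g_j(\Phi_{\mathbf p})J\,du\,dv.$$ $\lambda_1(\mathbf p)\le\lambda_2(\mathbf p)$ are the two smallest generalized eigenvalues of $K(\mathbf p)x=\lambda M(\mathbf p)x$, and $f_2(\mathbf p):=\frac1{2|Q_{\mathbf p}|}(\frac1{\lambda_1(\mathbf p)}+\frac1{\lambda_2(\mathbf p)})$. Balls are Euclidean balls in $\mathbb R^4$. *)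

theory Defs
  imports "HOL-Analysis.Analysis"
begin

section \<open>The Neumann eigenvalue \<open>\<mu>\<^sub>1\<close> of a planar open set\<close>

primrec C_k :: "nat \<Rightarrow> (real^2 \<Rightarrow> real) \<Rightarrow> bool" where
  "C_k 0 f \<longleftrightarrow> continuous_on UNIV f"
| "C_k (Suc k) f \<longleftrightarrow>
     (\<exists>G :: real^2 \<Rightarrow> real^2. (\<forall>x. (f has_derivative (\<lambda>h. G x \<bullet> h)) (at x)) \<and>
       (\<forall>i. C_k k (\<lambda>x. G x $ i)))"

definition test_function :: "(real^2) set \<Rightarrow> (real^2 \<Rightarrow> real) \<Rightarrow> bool" where
  "test_function \<Omega> \<phi> \<longleftrightarrow>
     (\<forall>k. C_k k \<phi>) \<and> compact (closure {x. \<phi> x \<noteq> 0}) \<and> closure {x. \<phi> x \<noteq> 0} \<subseteq> \<Omega>"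

definition gradient :: "(real^2 \<Rightarrow> real) \<Rightarrow> real^2 \<Rightarrow> real^2" where
  "gradient f x = (\<chi> i. frechet_derivative f (at x) (axis i 1))"

text \<open>\<open>H1 \<Omega> u G\<close>: \<open>u\<close> belongs to the Sobolev space \<open>H\<^sup>1(\<Omega>)\<close> and \<open>G\<close> is a version
  of its weak gradient.\<close>

definition H1 :: "(real^2) set \<Rightarrow> (real^2 \<Rightarrow> real) \<Rightarrow> (real^2 \<Rightarrow> real^2) \<Rightarrow> bool" where
  "H1 \<Omega> u G \<longleftrightarrow>
     u \<in> borel_measurable (lebesgue_on \<Omega>) \<and> integrable (lebesgue_on \<Omega>) (\<lambda>x. (u x)\<^sup>2) \<and>
     G \<in> borel_measurable (lebesgue_on \<Omega>) \<and> integrable (lebesgue_on \<Omega>) (\<lambda>x. (norm (G x))\<^sup>2) \<and>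
     (\<forall>\<phi>. test_function \<Omega> \<phi> \<longrightarrow>
       (\<forall>i. (LINT x|lebesgue_on \<Omega>. u x * gradient \<phi> x $ i)
           = - (LINT x|lebesgue_on \<Omega>. G x $ i * \<phi> x)))"

text \<open>Weak form of \<open>-\<Delta>u = \<mu>u\<close> in \<open>\<Omega>\<close>, \<open>\<partial>u/\<partial>n = 0\<close> on the boundary.\<close>

definition neumann_eigenvalue :: "(real^2) set \<Rightarrow> real \<Rightarrow> bool" where
  "neumann_eigenvalue \<Omega> \<mu> \<longleftrightarrow>
     (\<exists>u G. H1 \<Omega> u G \<and> \<not> (AE x in lebesgue_on \<Omega>. u x = 0) \<and>
       (\<forall>v F. H1 \<Omega> v F \<longrightarrow>
         (LINT x|lebesgue_on \<Omega>. G x \<bullet> F x) = \<mu> * (LINT x|lebesgue_on \<Omega>. u x * v x)))"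

text \<open>Testing with \<open>v = u\<close> shows that Neumann eigenvalues are nonnegative; for bounded
  Lipschitz domains they are discrete, so the infimum below is a minimum.\<close>

definition mu1 :: "(real^2) set \<Rightarrow> real" where
  "mu1 \<Omega> = Inf {\<mu>. neumann_eigenvalue \<Omega> \<mu> \<and> \<mu> \<noteq> 0}"


section \<open>The family of quadrilaterals\<close>

definition cross :: "real^2 \<Rightarrow> real^2 \<Rightarrow> real" where
  "cross x y = x$1 * y$2 - x$2 * y$1"

definition square :: "(real^2) set" where
  "square = cbox (vector [-1/2, -1/2]) (vector [1/2, 1/2])"

text \<open>Vertices are indexed by the four-element type \<^typ>\<open>4\<close>, whose arithmetic is modulo 4
  (so \<open>4 = 0\<close> in it).\<close>

definition vertex0 :: "4 \<Rightarrow> real^2" where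
  "vertex0 i = (vector [vector [-1/2, -1/2], vector [1/2, -1/2],
                        vector [1/2, 1/2], vector [-1/2, 1/2]] :: real^2^4) $ i"

text \<open>A parameter \<open>p = (a,b,c,d)\<close> is a vector in \<^typ>\<open>real^4\<close>.\<close>

definition Phi :: "real^4 \<Rightarrow> real^2 \<Rightarrow> real^2" where
  "Phi p w = (let a = p$1; b = p$2; c = p$3; d = p$4; u = w$1; v = w$2 in
     vector [u - a * u - d * v - 2 * b * u * v, v - d * u + a * v + 2 * c * u * v])"

definition vertex :: "real^4 \<Rightarrow> 4 \<Rightarrow> real^2" where
  "vertex p i = Phi p (vertex0 i)"

text \<open>The closed region enclosed by the polygon that joins the vertices in cyclic order.\<close>

definition quad :: "real^4 \<Rightarrow> (real^2) set" where
  "quad p = (let \<Gamma> = (\<Union>i. closed_segment (vertex p i) (vertex p (i + 1))) in \<Gamma> \<union> inside \<Gamma>)"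

definition area :: "real^4 \<Rightarrow> real" where
  "area p = measure lebesgue (quad p)"

definition corner :: "real^4 \<Rightarrow> 4 \<Rightarrow> real" where
  "corner p i = cross (vertex p (i + 1) - vertex p i) (vertex p (i + 2) - vertex p i)"

definition admissible :: "(real^4) set" where
  "admissible = {p. \<forall>i. corner p i \<ge> 0}"


section \<open>The Galerkin matrices and \<open>f\<^sub>2\<close>\<close>

definition Jac :: "real^4 \<Rightarrow> real^2 \<Rightarrow> real" where
  "Jac p w = det (matrix (frechet_derivative (Phi p) (at w)))"

definition trial :: "5 \<Rightarrow> real^2 \<Rightarrow> real" where
  "trial i x = (let m = (vector [1, 0, 1, 2, 0] :: real^5) $ i;
                n = (vector [0, 1, 1, 0, 2] :: real^5) $ i in
     cos (m * pi * (x$1 + 1/2)) * cos (n * pi * (x$2 + 1/2)))"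

definition stiffness :: "real^4 \<Rightarrow> real^5^5" where
  "stiffness p = (\<chi> i j. LINT w|lebesgue_on square.
            (gradient (trial i) (Phi p w) \<bullet> gradient (trial j) (Phi p w)) * Jac p w)"

definition mass :: "real^4 \<Rightarrow> real^5^5" where
  "mass p = (\<chi> i j. (LINT w|lebesgue_on square. trial i (Phi p w) * trial j (Phi p w) * Jac p w)
            - 1 / area p * (LINT w|lebesgue_on square. trial i (Phi p w) * Jac p w)
                         * (LINT w|lebesgue_on square. trial j (Phi p w) * Jac p w))"

definition gen_eigenspace :: "real^'n^'n \<Rightarrow> real^'n^'n \<Rightarrow> real \<Rightarrow> (real^'n) set" where
  "gen_eigenspace A B l = {x. A *v x = l *\<^sub>R (B *v x)}"

definition gen_eigenvalues :: "real^'n^'n \<Rightarrow> real^'n^'n \<Rightarrow> real set" where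
  "gen_eigenvalues A B = {l. \<exists>x. x \<noteq> 0 \<and> A *v x = l *\<^sub>R (B *v x)}"

text \<open>The \<open>k\<close>-th smallest generalized eigenvalue (\<open>k \<ge> 1\<close>), counted with multiplicity: the
  least \<open>t\<close> such that at least \<open>k\<close> eigenvalues, with multiplicity, are \<open>\<le> t\<close>.  It is meant
  for symmetric \<open>A\<close> and symmetric positive definite \<open>B\<close>, where the multiplicity of an
  eigenvalue is the dimension of its eigenspace.\<close>

definition gen_eigenvalue :: "nat \<Rightarrow> real^'n^'n \<Rightarrow> real^'n^'n \<Rightarrow> real" where
  "gen_eigenvalue k A B =
     Inf {t. k \<le> (\<Sum>l \<in> gen_eigenvalues A B \<inter> {..t}. dim (gen_eigenspace A B l))}"

definition f2 :: "real^4 \<Rightarrow> real" where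
  "f2 p = 1 / (2 * area p) *
     (1 / gen_eigenvalue 1 (stiffness p) (mass p) + 1 / gen_eigenvalue 2 (stiffness p) (mass p))"


section \<open>Hessians\<close>

text \<open>\<open>f\<close> is differentiable near \<open>x\<close>, its gradient is differentiable at \<open>x\<close>, and \<open>H\<close> is the
  (necessarily unique) derivative matrix of the gradient.\<close>

definition has_hessian :: "(real^'n \<Rightarrow> real) \<Rightarrow> real^'n^'n \<Rightarrow> real^'n \<Rightarrow> bool" where
  "has_hessian f H x \<longleftrightarrow>
     (\<exists>G :: real^'n \<Rightarrow> real^'n.
        (\<forall>\<^sub>F y in nhds x. (f has_derivative (\<lambda>h. G y \<bullet> h)) (at y)) \<and>
        (G has_derivative (\<lambda>h. H *v h)) (at x))"

definition least_eigenvalue :: "real^'n^'n \<Rightarrow> real" where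
  "least_eigenvalue A = Min {l. \<exists>x. x \<noteq> 0 \<and> A *v x = l *\<^sub>R x}"

definition rho_sharp :: real where
  "rho_sharp = 3232 / (27 * pi ^ 6)"

end

theory Submission
 imports Defs "HOL-Library.Diagonal_Subsequence"
begin

text \<open>On the square, expansion in cosine modes gives the sharp Poincare inequality and hence
 \<open>\<mu>\<^sub>1(\<square>) \<ge> \<pi>\<^sup>2\<close>.  For \<open>\<bar>p\<bar> <= 1/8\<close> the map \<open>\<Phi>\<^sub>p\<close> is a diffeomorphism of the square onto \<open>Q\<^sub>p\<close>; test functions are
 transported by the Piola transform, so functions in \<open>H\<^sup>1(Q\<^sub>p)\<close> pull back to \<open>H\<^sup>1(\<square>)\<close>, which yields compactness and
 thus an eigenfunction attaining the minimal Rayleigh quotient.  With \<open>J = A(1 + z)\<close> and \<open>1/(1+z) <= 1 - z + 5/4 z\<^sup>2\<close>,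
 the trial functions \<open>sin \<pi>u (1 - hv)\<close>, \<open>sin \<pi>v (1 - h'u)\<close> (when \<open>(b,c)\<close> dominates) and
 \<open>sin \<pi>u\<close>, \<open>sin \<pi>v\<close>, \<open>sin \<pi>u \<plusminus> sin \<pi>v\<close> (when \<open>(a,d)\<close> dominates) show \<open>A \<mu>\<^sub>1(Q\<^sub>p) < \<pi>\<^sup>2\<close> for \<open>p \<noteq> 0\<close>.

 For the Hessian, the two eigenspaces near the double eigenvalue at \<open>p = 0\<close> form the graph of a matrix \<open>X(p)\<close>, given by the
 inverse function theorem applied to \<open>M[I;X] = K[I;X]B\<close>; then \<open>f\<^sub>2 = tr B / (2A)\<close>, and the gradient of \<open>tr B\<close> involves
 no derivative of \<open>X\<close>.\<close>

text \<open>At the square the eigenvalue pi^2 is double, so \<open>mu1\<close> need not be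
  differentiable there, and a local expansion would not reach a fixed radius; hence explicit trial
  functions, for all \<open>norm p <= 1/8\<close>. The parameters act at different orders. The pair
  (a,d) splits the double eigenvalue at first order, and some branch always moves down. The pair
  (b,c) acts only at second order, and there sin pi u and sin pi v fail: their summed energy excess
  is bounded only by about +4.5 (b^2 + c^2), which the tilts h = 4b, h' = -4c turn into about -4.6
  (b^2 + c^2). Since \<open>mu1\<close> is an infimum over weak eigenvalues, a Rayleigh quotient
  bounds it only after an eigenvalue below the quotient is known to exist; this is what compactness
  is for. In \<open>f2\<close> the single eigenvalues split at p = 0, but the sum of the two
  reciprocals stays smooth, which is why the pencil is inverted to M x = nu K x. The inverse
  function theorem supplies one derivative of X while the Hessian asks for two of tr B; the gradient
  formula free of derivatives of X bridges this.\<close>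

lemmas lint_cong = Bochner_Integration.integral_cong[OF refl]
lemmas lint_add = Bochner_Integration.integral_add
lemmas lint_integrable_add = Bochner_Integration.integrable_add
lemmas lint_cong0 = Bochner_Integration.integral_cong
abbreviation contU :: "('a::topological_space => 'b::topological_space) => bool" where
 "contU f \<equiv> continuous_on UNIV f"

section \<open>Cut-off functions\<close>

lemma has_derivative_vec2_iff:
 fixes f :: "real^2 => real"
 shows "(%h. G \<bullet> h) = (%h::real^2. G$1 * h$1 + G$2 * h$2)"
 by (simp add: inner_vec_def sum_2)

lemma continuous_vec_nth [continuous_intros]: "continuous_on S (%x::real^'n. x $ i)"
 by (intro continuous_intros)

lemma has_derivative_nth [derivative_intros]:
 "((%x::real^'n. x $ i) has_derivative (%h. h $ i)) F"
 using bounded_linear_imp_has_derivative bounded_linear_vec_nth by blast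

lemma C_k_SucI:
 assumes "!!x. (f has_derivative (%h. g1 x * h$1 + g2 x * h$2)) (at x)" "C_k k g1" "C_k k g2"
 shows "C_k (Suc k) f"
 unfolding C_k.simps
proof (intro exI[of _ "%x. vector [g1 x, g2 x]"] conjI allI)
 fix x show "(f has_derivative (%h. vector [g1 x, g2 x] \<bullet> h)) (at x)"
  unfolding has_derivative_vec2_iff using assms(1)[of x] by simp
next
 fix i :: 2 show "C_k k (%x. vector [g1 x, g2 x] $ i)"
  using exhaust_2[of i] assms by auto
qed

lemma C_k_SucE:
 assumes "C_k (Suc k) f"
 obtains g1 g2 where "!!x. (f has_derivative (%h. g1 x * h$1 + g2 x * h$2)) (at x)" "C_k k g1" "C_k k g2"
proof -
 obtain G where G: "\<forall>x. (f has_derivative (%h. G x \<bullet> h)) (at x)" "\<forall>i. C_k k (%x. G x $ i)"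
  using assms unfolding C_k.simps by blast
 show ?thesis
  using that[of "%x. G x $ 1" "%x. G x $ 2"] G unfolding has_derivative_vec2_iff by blast
qed

lemma C_k_imp_continuous: "C_k k f ==> contU f"
proof (cases k)
 case (Suc n)
 assume "C_k k f"
 then show ?thesis unfolding Suc
  using has_derivative_continuous by (force intro: continuous_at_imp_continuous_on)
qed simp

declare C_k.simps(2) [simp del]

lemma C_k_Suc_D: "C_k (Suc k) f ==> C_k k f"
proof (induction k arbitrary: f)
 case 0
 then show ?case using C_k_imp_continuous by simp
next
 case (Suc k)
 from Suc.prems obtain g1 g2 where "!!x. (f has_derivative (%h. g1 x * h$1 + g2 x * h$2)) (at x)"
  "C_k (Suc k) g1" "C_k (Suc k) g2" by (rule C_k_SucE) blast
 with Suc.IH show ?case by (intro C_k_SucI) auto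
qed

lemma C_k_const [simp]: "C_k k (%x. c)"
proof (induction k arbitrary: c)
 case (Suc k)
 show ?case by (rule C_k_SucI[of _ "%x. 0" "%x. 0"]) (use Suc in auto)
qed simp

lemma C_k_add: "C_k k f ==> C_k k g ==> C_k k (%x. f x + g x)"
proof (induction k arbitrary: f g)
 case 0
 then show ?case by (simp add: continuous_on_add)
next
 case (Suc k)
 from Suc.prems(1) obtain f1 f2 where f: "!!x. (f has_derivative (%h. f1 x * h$1 + f2 x * h$2)) (at x)"
  "C_k k f1" "C_k k f2" by (rule C_k_SucE) blast
 from Suc.prems(2) obtain g1 g2 where g: "!!x. (g has_derivative (%h. g1 x * h$1 + g2 x * h$2)) (at x)"
  "C_k k g1" "C_k k g2" by (rule C_k_SucE) blast
 show ?case
  by (rule C_k_SucI[of _ "%x. f1 x + g1 x" "%x. f2 x + g2 x"])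
   (use f g Suc.IH in \<open>auto intro!: derivative_eq_intros simp: algebra_simps\<close>)
qed

lemma C_k_mult: "C_k k f ==> C_k k g ==> C_k k (%x. f x * g x)"
proof (induction k arbitrary: f g)
 case 0
 then show ?case by (simp add: continuous_on_mult)
next
 case (Suc k)
 from Suc.prems(1) obtain f1 f2 where f: "!!x. (f has_derivative (%h. f1 x * h$1 + f2 x * h$2)) (at x)"
  "C_k k f1" "C_k k f2" by (rule C_k_SucE) blast
 from Suc.prems(2) obtain g1 g2 where g: "!!x. (g has_derivative (%h. g1 x * h$1 + g2 x * h$2)) (at x)"
  "C_k k g1" "C_k k g2" by (rule C_k_SucE) blast
 have "C_k k f" "C_k k g" using Suc.prems by (auto intro: C_k_Suc_D)
 then show ?case
  by (intro C_k_SucI[of _ "%x. f x * g1 x + f1 x * g x" "%x. f x * g2 x + f2 x * g x"])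
   (use f g Suc.IH in \<open>auto intro!: derivative_eq_intros C_k_add simp: algebra_simps\<close>)
qed

lemma C_k_cmult: "C_k k f ==> C_k k (%x. c * f x)"
 by (intro C_k_mult) auto

lemma C_k_minus: "C_k k f ==> C_k k (%x. - f x)"
 using C_k_cmult[of k f "-1"] by simp

lemma C_k_diff: "C_k k f ==> C_k k g ==> C_k k (%x. f x - g x)"
 using C_k_add[of k f "%x. - g x"] C_k_minus by simp

lemma C_k_nth: "C_k k (%x. x $ i)"
proof (cases k)
 case (Suc n)
 show ?thesis unfolding Suc
  using exhaust_2[of i] by (intro C_k_SucI[of _ "%x. if i = 1 then 1 else 0" "%x. if i = 2 then 1 else 0"])
   (auto intro!: derivative_eq_intros)
qed (simp add: continuous_vec_nth)

text \<open>Only functions of one affine coordinate are composed. This covers the trigonometric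
  modes and the cut-offs and avoids a general chain rule for \<open>C_k\<close>.\<close>

lemma C_k_chain1:
 assumes f: "!!y. (f has_real_derivative f' y) (at y)" "C_k k (%x. f' (\<alpha> * x $ i + \<beta>))"
 shows "C_k (Suc k) (%x. f (\<alpha> * x $ i + \<beta>))"
proof -
 have d: "((%x. f (\<alpha> * x $ i + \<beta>)) has_derivative (%h. f' (\<alpha> * x $ i + \<beta>) * (\<alpha> * h $ i))) (at x)" for x :: "real^2"
  using f(1)[THEN has_field_derivative_imp_has_derivative]
  by (rule has_derivative_compose[rotated]) (auto intro!: derivative_eq_intros)
 show ?thesis
  by (rule C_k_SucI[of _ "%x. f' (\<alpha> * x $ i + \<beta>) * (if i = 1 then \<alpha> else 0)"
     "%x. f' (\<alpha> * x $ i + \<beta>) * (if i = 2 then \<alpha> else 0)"])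
   (use d exhaust_2[of i] f(2) in \<open>auto intro!: C_k_mult simp: mult.assoc\<close>)
qed

lemma C_k_sin_cos: "C_k k (%x. sin (\<alpha> * x $ i + \<beta>)) \<and> C_k k (%x. cos (\<alpha> * x $ i + \<beta>))"
proof (induction k)
 case 0
 show ?case by (auto intro!: continuous_intros)
next
 case (Suc k)
 then show ?case
  by (intro conjI C_k_chain1[of sin cos] C_k_chain1[of cos "%x. - sin x"] C_k_minus)
   (auto intro!: derivative_eq_intros)
qed

lemma C_k_sin: "C_k k (%x. sin (\<alpha> * x $ i + \<beta>))" and C_k_cos: "C_k k (%x. cos (\<alpha> * x $ i + \<beta>))"
 using C_k_sin_cos by auto

text \<open>The standard smooth non-analytic function exp(-1/x), divided by x^n: the span of the
  family over all n is closed under differentiation, which makes smoothness an induction.\<close>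

definition flat :: "nat => real => real" where
 "flat n x = (if x <= 0 then 0 else exp (- 1 / x) / x ^ n)"

lemma flat_nonneg: "flat n x \<ge> 0"
 by (simp add: flat_def)

text \<open>A single term of the exponential series, (1/x)^(n+1)/(n+1)! <= exp(1/x), beats the
  factor x^-n with one power of x to spare.\<close>

lemma flat_le: "flat n x <= fact (n + 1) * \<bar>x\<bar>"
proof (cases "x > 0")
 case True
 have "(1 / x) ^ (n + 1) / fact (n + 1) <= exp (1 / x)"
 proof -
  have "(\<Sum>k\<in>{n+1}. (1/x) ^ k /\<^sub>R fact k) <= exp (1 / x)"
   unfolding exp_def by (rule sum_le_suminf) (use True summable_exp[of "1/x"] in auto)
  then show ?thesis by (simp add: divide_inverse mult.commute)
 qed
 then have "exp (- 1 / x) * ((1 / x) ^ (n + 1) / fact (n + 1)) <= exp (- 1 / x) * exp (1 / x)"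
  by (intro mult_left_mono) auto
 also have "\<dots> = 1" by (simp flip: exp_add)
 finally have "exp (- 1 / x) * ((1 / x) ^ (n + 1) / fact (n + 1)) * (fact (n + 1) * x) <= 1 * (fact (n + 1) * x)"
  using True by (intro mult_right_mono) auto
 moreover have "exp (- 1 / x) * ((1 / x) ^ (n + 1) / fact (n + 1)) * (fact (n + 1) * x) = flat n x"
  using True by (simp add: flat_def power_one_over del: fact_Suc)
 ultimately show ?thesis using True by simp
next
 case False
 then have "flat n x = 0" by (simp add: flat_def)
 moreover have "0 <= fact (n + 1) * \<bar>x\<bar>" by (intro mult_nonneg_nonneg) auto
 ultimately show ?thesis by linarith
qed

lemma flat_Suc: "flat n x = x * flat (Suc n) x"
 by (simp add: flat_def)

lemma isCont_flat_0: "isCont (flat n) 0"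
proof -
 have "(flat n \<longlongrightarrow> 0) (at 0)"
 proof (rule tendsto_sandwich[of "%x. 0" _ _ "%x. fact (n + 1) * \<bar>x\<bar>"])
  show "((%x::real. fact (n + 1) * \<bar>x\<bar>) \<longlongrightarrow> 0) (at 0)"
   by (auto intro!: tendsto_eq_intros)
 qed (use flat_nonneg flat_le in \<open>auto intro!: always_eventually\<close>)
 then show ?thesis by (simp add: isCont_def flat_def)
qed

lemma DERIV_flat: "(flat n has_real_derivative flat (n + 2) x - real n * flat (n + 1) x) (at x)"
proof -
 consider "x < 0" | "x = 0" | "x > 0" by linarith
 then show ?thesis
 proof cases
  case 1
  have "((%x. 0) has_real_derivative 0) (at x)" by simp
  then have "(flat n has_real_derivative 0) (at x)"
   by (rule has_field_derivative_transform_within_open[where S = "{..<0}"]) (use 1 in \<open>auto simp: flat_def\<close>)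
  then show ?thesis using 1 by (simp add: flat_def)
 next
  case 2
  \<comment> \<open>Caratheodory's form of the derivative: the slope function at 0 is
    \<open>flat (Suc n)\<close>, continuous there with value 0.\<close>
  have "(flat n has_real_derivative 0) (at 0)"
   unfolding CARAT_DERIV
   by (rule exI[of _ "flat (Suc n)"]) (use flat_Suc[of n] isCont_flat_0 in \<open>auto simp: flat_def\<close>)
  then show ?thesis using 2 by (simp add: flat_def)
 next
  case 3
  have "((%x. exp (- 1 / x) / x ^ n) has_real_derivative flat (n + 2) x - real n * flat (n + 1) x) (at x)"
  proof -
   have "((%x. exp (- 1 / x) / x ^ n) has_real_derivative
     (exp (- 1 / x) / x^2 * x ^ n - exp (- 1 / x) * (real n * x ^ (n - 1))) / (x ^ n * x ^ n)) (at x)"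
    using 3 by (auto intro!: derivative_eq_intros simp: power2_eq_square)
   moreover have "(exp (- 1 / x) / x^2 * x ^ n - exp (- 1 / x) * (real n * x ^ (n - 1))) / (x ^ n * x ^ n)
     = flat (n + 2) x - real n * flat (n + 1) x"
    using 3 by (cases n) (auto simp: flat_def field_simps power2_eq_square)
   ultimately show ?thesis by simp
  qed
  then show ?thesis
   by (rule has_field_derivative_transform_within_open[where S = "{0<..}"]) (use 3 in \<open>auto simp: flat_def\<close>)
 qed
qed

lemma continuous_flat: "contU (flat n)"
 by (meson DERIV_flat DERIV_isCont continuous_at_imp_continuous_on)

lemma C_k_flat: "C_k k (%x. flat n (\<alpha> * x $ i + \<beta>))"
proof (induction k arbitrary: n)
 case 0
 have "contU (%x::real^2. flat n (\<alpha> * x $ i + \<beta>))"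
  by (rule continuous_on_compose2[OF continuous_flat]) (auto intro!: continuous_intros)
 then show ?case by simp
next
 case (Suc k)
 then show ?case
  by (intro C_k_chain1[OF DERIV_flat] C_k_diff C_k_cmult)
qed

text \<open>With s + 1 equal to N times the distance to a side, this controls distance times
  derivative of the cut-off. For s < 1 the bound is 2 times 3!, for s >= 1 the estimate flat 2 s <=
  1/s^2 suffices.\<close>

lemma flat_2_bound: "\<bar>(s + 1) * flat 2 s\<bar> <= 12"
proof -
 consider "s <= 0" | "0 < s" "s < 1" | "s \<ge> 1" by linarith
 then show ?thesis
 proof cases
  case 2
  have "(s + 1) * flat 2 s <= 2 * 6"
   using flat_le[of 2 s] 2 flat_nonneg[of 2 s] by (intro mult_mono) (auto simp: fact_numeral)
  then show ?thesis using 2 flat_nonneg[of 2 s] by simp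
 next
  case 3
  have "flat 2 s <= 1 / s ^ 2" using 3 by (auto simp: flat_def intro!: divide_right_mono)
  then have "(s + 1) * flat 2 s <= (2 * s) * (1 / s ^ 2)"
   using 3 flat_nonneg[of 2 s] by (intro mult_mono) auto
  also have "\<dots> <= 12" using 3 by (simp add: power2_eq_square field_simps)
  finally show ?thesis using 3 flat_nonneg[of 2 s] by simp
 qed (simp add: flat_def)
qed

lemma flat_0_le_1: "flat 0 s <= 1"
 by (simp add: flat_def)

section \<open>Square integrable functions\<close>

text \<open>Functions rather than classes modulo null sets; convergence is expressed by integrals of
  squared differences.\<close>

definition L2 :: "'a measure => ('a => real) set" where
 "L2 M = {f \<in> borel_measurable M. integrable M (%x. (f x)\<^sup>2)}"

lemma L2_I: "f \<in> borel_measurable M ==> integrable M (%x. (f x)\<^sup>2) ==> f \<in> L2 M"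
 by (simp add: L2_def)

lemma L2_measurable [measurable_dest]: "f \<in> L2 M ==> f \<in> borel_measurable M"
 and L2_integrable: "f \<in> L2 M ==> integrable M (%x. (f x)\<^sup>2)"
 by (auto simp: L2_def)

lemma L2_mult_integrable:
 assumes "f \<in> L2 M" "g \<in> L2 M"
 shows "integrable M (%x. f x * g x)"
proof (rule Bochner_Integration.integrable_bound[of M "%x. (f x)\<^sup>2 + (g x)^2"])
 show "integrable M (%x. (f x)\<^sup>2 + (g x)^2)" by (intro lint_integrable_add L2_integrable assms)
 have "\<bar>a * b\<bar> <= \<bar>a\<^sup>2 + b^2\<bar>" for a b :: real
 proof -
  have "2 * (\<bar>a\<bar> * \<bar>b\<bar>) <= a\<^sup>2 + b^2"
   using sum_squares_bound[of "\<bar>a\<bar>" "\<bar>b\<bar>"] by simp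
  then show ?thesis by (simp add: abs_mult) (smt (verit) abs_ge_zero mult_nonneg_nonneg)
 qed
 then show "AE x in M. norm (f x * g x) <= norm ((f x)^2 + (g x)^2)" by simp
qed (use assms in measurable)

lemma L2_add: "f \<in> L2 M ==> g \<in> L2 M ==> (%x. f x + g x) \<in> L2 M"
 by (rule L2_I) (auto simp: power2_sum mult.assoc L2_integrable L2_mult_integrable L2_measurable)

lemma L2_cmult: "f \<in> L2 M ==> (%x. c * f x) \<in> L2 M"
 by (rule L2_I) (auto simp: power_mult_distrib L2_integrable L2_measurable)

lemma L2_diff: "f \<in> L2 M ==> g \<in> L2 M ==> (%x. f x - g x) \<in> L2 M"
 using L2_add[of f M "%x. -1 * g x"] L2_cmult[of g M "-1"] by simp

lemma L2_zero [simp]: "(%x. 0) \<in> L2 M"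
 by (simp add: L2_def)

lemma L2_sum: "finite I ==> (!!i. i \<in> I ==> f i \<in> L2 M) ==> (%x. \<Sum>i\<in>I. f i x) \<in> L2 M"
 by (induction rule: finite_induct) (auto intro: L2_add)

lemma L2_bounded:
 assumes "f \<in> borel_measurable M" "finite_measure M" "!!x. x \<in> space M ==> \<bar>f x\<bar> <= B"
 shows "f \<in> L2 M"
proof (rule L2_I)
 interpret finite_measure M by fact
 have "(f x)^2 <= B\<^sup>2" if "x \<in> space M" for x
  using power_mono[OF assms(3)[OF that] abs_ge_zero, of 2] by simp
 then show "integrable M (%x. (f x)\<^sup>2)"
  using assms(1) by (intro integrable_const_bound[of _ "B^2"]) auto
qed fact

lemma L2_mult_bounded:
 assumes "f \<in> L2 M" "g \<in> borel_measurable M" "!!x. x \<in> space M ==> \<bar>g x\<bar> <= B"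
 shows "(%x. f x * g x) \<in> L2 M"
proof (rule L2_I)
 have le: "(f x * g x)^2 <= B\<^sup>2 * (f x)^2" if "x \<in> space M" for x
 proof -
  have "(g x)^2 <= B\<^sup>2" using power_mono[OF assms(3)[OF that] abs_ge_zero, of 2] by simp
  then have "(f x)^2 * (g x)^2 <= (f x)\<^sup>2 * B^2" by (rule mult_left_mono) simp
  then show ?thesis by (simp add: power_mult_distrib mult.commute)
 qed
 have "f \<in> borel_measurable M" using assms(1) by (rule L2_measurable)
 show "integrable M (%x. (f x * g x)\<^sup>2)"
 proof (rule Bochner_Integration.integrable_bound[of M "%x. B\<^sup>2 * (f x)^2"])
  show "integrable M (%x. B\<^sup>2 * (f x)^2)" using L2_integrable[OF assms(1)] by simp
  show "AE x in M. norm ((f x * g x)^2) <= norm (B^2 * (f x)^2)" using le by (auto intro!: AE_I2)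
 qed (use \<open>f \<in> borel_measurable M\<close> assms(2) in measurable)
 show "(%x. f x * g x) \<in> borel_measurable M"
  using \<open>f \<in> borel_measurable M\<close> assms(2) by measurable
qed

text \<open>Serves twice: for the Cauchy-Schwarz inequality, and for the first variation of the
  Rayleigh quotient, where a = 0 forces b = 0.\<close>

lemma quadratic_nonneg_discriminant:
 fixes a b c :: real
 assumes "!!t. a + 2 * t * b + t^2 * c \<ge> 0" "c \<ge> 0"
 shows "b^2 <= a * c"
proof (cases "c = 0")
 case True
 have "b = 0"
 proof (rule ccontr)
  assume "b \<noteq> 0"
  then show False using assms(1)[of "- (a + 1) / (2 * b)"] True by (simp add: field_simps)
 qed
 then show ?thesis using True by simp
next
 case False
 then have "c > 0" using assms by simp
 have "0 <= a + 2 * (- b / c) * b + (- b / c)^2 * c" by (rule assms)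
 also have "\<dots> = (a * c - b\<^sup>2) / c"
  using \<open>c > 0\<close> by (simp add: field_simps power2_eq_square)
 finally show ?thesis using \<open>c > 0\<close> by (simp add: zero_le_divide_iff)
qed

lemma integral_square_expand:
 assumes "f \<in> L2 M" "g \<in> L2 M"
 shows "(LINT x|M. (f x + t * g x)\<^sup>2)
  = (LINT x|M. (f x)\<^sup>2) + 2 * t * (LINT x|M. f x * g x) + t^2 * (LINT x|M. (g x)\<^sup>2)"
proof -
 have "(%x. (f x + t * g x)\<^sup>2) = (%x. ((f x)^2 + 2 * t * (f x * g x)) + t^2 * (g x)^2)"
  by (simp add: power2_eq_square algebra_simps)
 then show ?thesis
  using assms by (simp add: L2_mult_integrable L2_integrable)
qed

lemma L2_Cauchy_Schwarz:
 assumes "f \<in> L2 M" "g \<in> L2 M"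
 shows "(LINT x|M. f x * g x)^2 <= (LINT x|M. (f x)\<^sup>2) * (LINT x|M. (g x)\<^sup>2)"
 by (rule quadratic_nonneg_discriminant)
  (simp_all add: integral_square_expand[OF assms, symmetric])

lemma L2_sum_le:
 assumes "f \<in> L2 M" "g \<in> L2 M"
 shows "(LINT x|M. (f x + g x)\<^sup>2) <= 2 * (LINT x|M. (f x)\<^sup>2) + 2 * (LINT x|M. (g x)\<^sup>2)"
proof -
 have "(LINT x|M. (f x + g x)\<^sup>2) <= (LINT x|M. 2 * (f x)^2 + 2 * (g x)^2)"
  using assms L2_add[OF assms]
  by (intro integral_mono) (auto simp: L2_integrable, smt (verit) power2_sum sum_squares_bound)
 then show ?thesis using assms by (simp add: L2_integrable)
qed

lemma L2_product_tendsto: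
 assumes f: "f \<in> L2 M" "!!n. F n \<in> L2 M" "(%n. LINT x|M. (F n x - f x)\<^sup>2) \<longlonglongrightarrow> 0" and g: "g \<in> L2 M"
 shows "(%n. LINT x|M. F n x * g x) \<longlonglongrightarrow> (LINT x|M. f x * g x)"
proof -
 have "(%n. (LINT x|M. (F n x - f x) * g x)\<^sup>2) \<longlonglongrightarrow> 0"
 proof (rule tendsto_sandwich[of "%x. 0"])
  show "(%n. (LINT x|M. (F n x - f x)\<^sup>2) * (LINT x|M. (g x)\<^sup>2)) \<longlonglongrightarrow> 0"
   using tendsto_mult_right[OF f(3), of "LINT x|M. (g x)\<^sup>2"] by simp
 qed (use f g in \<open>auto intro!: always_eventually L2_Cauchy_Schwarz L2_diff\<close>)
 from tendsto_real_sqrt[OF this] have "(%n. LINT x|M. (F n x - f x) * g x) \<longlonglongrightarrow> 0"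
  by (simp add: tendsto_rabs_zero_iff)
 moreover have "(LINT x|M. (F n x - f x) * g x) = (LINT x|M. F n x * g x) - (LINT x|M. f x * g x)" for n
  using L2_mult_integrable[OF f(2) g] L2_mult_integrable[OF f(1) g] by (simp add: left_diff_distrib)
 ultimately show ?thesis by (simp add: LIM_zero_iff)
qed

lemma L2_norm_tendsto:
 assumes f: "f \<in> L2 M" "!!n. F n \<in> L2 M" "(%n. LINT x|M. (F n x - f x)\<^sup>2) \<longlonglongrightarrow> 0"
 shows "(%n. LINT x|M. (F n x)\<^sup>2) \<longlonglongrightarrow> (LINT x|M. (f x)\<^sup>2)"
proof -
 have "(LINT x|M. (F n x)\<^sup>2) = (LINT x|M. (F n x - f x)\<^sup>2) + 2 * (LINT x|M. F n x * f x) - (LINT x|M. (f x)\<^sup>2)" for n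
  using integral_square_expand[OF f(2)[of n] f(1), of "-1"] by simp
 moreover have "(%n. (LINT x|M. (F n x - f x)\<^sup>2) + 2 * (LINT x|M. F n x * f x) - (LINT x|M. (f x)\<^sup>2))
   \<longlonglongrightarrow> 0 + 2 * (LINT x|M. f x * f x) - (LINT x|M. (f x)\<^sup>2)"
  by (intro tendsto_intros f L2_product_tendsto)
 ultimately show ?thesis by (simp add: power2_eq_square)
qed

text \<open>Completeness.  The measure is finite, so that an \<open>L\<^sup>2\<close> Cauchy sequence is \<open>L\<^sup>1\<close> Cauchy
 and has an almost everywhere convergent subsequence.\<close>

lemma L2_complete:
 assumes fin: "finite_measure M" and f: "!!n. f n \<in> L2 M"
  and cauchy: "!!e. e > 0 ==> \<exists>N. \<forall>m\<ge>N. \<forall>n\<ge>N. (LINT x|M. (f m x - f n x)\<^sup>2) < e"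
 obtains g where "g \<in> L2 M" "(%n. LINT x|M. (f n x - g x)\<^sup>2) \<longlonglongrightarrow> 0"
proof -
 interpret finite_measure M by fact
 have one: "(%x. 1) \<in> L2 M" by (simp add: L2_def)
 have int: "integrable M (f n)" for n using L2_mult_integrable[OF f[of n] one] by simp
 \<comment> \<open>Cauchy-Schwarz against the constant 1 passes from L2 to L1 distances; V is the
   total mass plus 1, so that it may be divided by.\<close>
 have "\<exists>N. \<forall>i\<ge>N. \<forall>j\<ge>N. (LINT x|M. norm (f i x - f j x)) < e" if "e > 0" for e
 proof -
  define V where "V = measure M (space M) + 1"
  have V: "V > 0" using measure_nonneg by (simp add: V_def add_nonneg_pos)
  obtain N where N: "\<forall>m\<ge>N. \<forall>n\<ge>N. (LINT x|M. (f m x - f n x)\<^sup>2) < e\<^sup>2 / V"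
   using cauchy[of "e^2 / V"] \<open>e > 0\<close> V by auto
  have "(LINT x|M. norm (f i x - f j x)) < e" if "i \<ge> N" "j \<ge> N" for i j
  proof -
   have d: "(%x. f i x - f j x) \<in> L2 M" using f by (intro L2_diff)
   have d': "(%x. \<bar>f i x - f j x\<bar>) \<in> L2 M" using d by (auto simp: L2_def)
   have "(LINT x|M. \<bar>f i x - f j x\<bar> * 1)^2 <= (LINT x|M. \<bar>f i x - f j x\<bar>\<^sup>2) * (LINT x|M. 1\<^sup>2)"
    using L2_Cauchy_Schwarz[OF d' one] by simp
   also have "\<dots> <= (LINT x|M. (f i x - f j x)\<^sup>2) * V"
    by (intro mult_mono) (auto simp: V_def)
   also have "\<dots> < e\<^sup>2 / V * V" using N that V by (intro mult_strict_right_mono) auto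
   finally have "(LINT x|M. \<bar>f i x - f j x\<bar>)^2 < e\<^sup>2" using V by simp
   then show ?thesis using \<open>e > 0\<close> by (simp add: power_less_imp_less_base)
  qed
  then show ?thesis by blast
 qed
 then obtain r where r: "strict_mono r" "AE x in M. Cauchy (%i. f (r i) x)"
  using cauchy_L1_AE_cauchy_subseq[of M f, OF int] by blast
 define g where "g = (%x. lim (%i. f (r i) x))"
 have [measurable]: "f n \<in> borel_measurable M" for n using f L2_measurable by blast
 have gm [measurable]: "g \<in> borel_measurable M" unfolding g_def by measurable
 have lim: "AE x in M. (%i. f (r i) x) \<longlonglongrightarrow> g x"
  using r(2) by (auto simp: g_def Cauchy_convergent_iff convergent_LIMSEQ_iff)
 \<comment> \<open>Fatou's lemma along the subsequence: the squared distance from \<open>f n\<close>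
   to the limit is at most the liminf of those from \<open>f n\<close> to
   \<open>f (r i)\<close>.\<close>
 have key: "(\<integral>\<^sup>+x. ennreal ((f n x - g x)^2) \<partial>M) <= ennreal e"
  if N: "\<forall>m\<ge>N. \<forall>n\<ge>N. (LINT x|M. (f m x - f n x)\<^sup>2) < e" and "n \<ge> N" for e n N
 proof -
  have "(\<integral>\<^sup>+x. ennreal ((f n x - g x)^2) \<partial>M) = (\<integral>\<^sup>+x. liminf (%i. ennreal ((f n x - f (r i) x)^2)) \<partial>M)"
  proof (rule nn_integral_cong_AE)
   show "AE x in M. ennreal ((f n x - g x)^2) = liminf (%i. ennreal ((f n x - f (r i) x)^2))"
    using lim
   proof eventually_elim
    case (elim x)
    have "(%i. ennreal ((f n x - f (r i) x)^2)) \<longlonglongrightarrow> ennreal ((f n x - g x)^2)"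
     by (intro tendsto_ennrealI tendsto_intros elim)
    from lim_imp_Liminf[OF _ this] show ?case by simp
   qed
  qed
  also have "\<dots> <= liminf (%i. \<integral>\<^sup>+x. ennreal ((f n x - f (r i) x)^2) \<partial>M)"
   by (rule nn_integral_liminf) measurable
  also have "\<dots> <= ennreal e"
  proof (rule Liminf_le)
   show "\<forall>\<^sub>F i in sequentially. (\<integral>\<^sup>+x. ennreal ((f n x - f (r i) x)^2) \<partial>M) <= ennreal e"
    unfolding eventually_sequentially
   proof (intro exI[of _ N] allI impI)
    fix i assume "N <= i"
    then have "N <= r i" using r(1) by (meson order_trans seq_suble)
    have "(\<integral>\<^sup>+x. ennreal ((f n x - f (r i) x)^2) \<partial>M) = ennreal (LINT x|M. (f n x - f (r i) x)\<^sup>2)"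
     by (intro nn_integral_eq_integral L2_integrable L2_diff f) simp
    also have "\<dots> <= ennreal e" using N \<open>n \<ge> N\<close> \<open>N <= r i\<close> by (intro ennreal_leI) (simp add: less_imp_le)
    finally show "(\<integral>\<^sup>+x. ennreal ((f n x - f (r i) x)^2) \<partial>M) <= ennreal e" .
   qed
  qed simp
  finally show ?thesis .
 qed
 have dL2: "(%x. f n x - g x) \<in> L2 M \<and> (LINT x|M. (f n x - g x)\<^sup>2) <= e"
  if N: "\<forall>m\<ge>N. \<forall>n\<ge>N. (LINT x|M. (f m x - f n x)\<^sup>2) < e" and "n \<ge> N" "e > 0" for e n N
 proof -
  have nn: "(\<integral>\<^sup>+x. ennreal ((f n x - g x)^2) \<partial>M) <= ennreal e" using key[OF N \<open>n \<ge> N\<close>] .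
  have "integrable M (%x. (f n x - g x)\<^sup>2)"
   using nn by (intro integrableI_bounded) (auto intro: le_less_trans)
  then show ?thesis using nn \<open>e > 0\<close>
   by (auto simp: L2_def integral_eq_nn_integral enn2real_leI)
 qed
 obtain N1 where N1: "\<forall>m\<ge>N1. \<forall>n\<ge>N1. (LINT x|M. (f m x - f n x)\<^sup>2) < 1" using cauchy[of 1] zero_less_one by blast
 have "(%x. f N1 x - (f N1 x - g x)) \<in> L2 M"
  by (rule L2_diff[OF f conjunct1[OF dL2[OF N1]]]) simp_all
 then have "g \<in> L2 M" by simp
 moreover have "(%n. LINT x|M. (f n x - g x)\<^sup>2) \<longlonglongrightarrow> 0"
 proof (rule LIMSEQ_I)
  fix e :: real assume "e > 0"
  then obtain N where N: "\<forall>m\<ge>N. \<forall>n\<ge>N. (LINT x|M. (f m x - f n x)\<^sup>2) < e/2" using cauchy[of "e/2"] by (meson half_gt_zero)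
  show "\<exists>N. \<forall>n\<ge>N. norm ((LINT x|M. (f n x - g x)\<^sup>2) - 0) < e"
  proof (intro exI[of _ N] allI impI)
   fix n assume "n \<ge> N"
   have "(LINT x|M. (f n x - g x)\<^sup>2) <= e/2" using dL2[OF N \<open>n \<ge> N\<close>] \<open>e > 0\<close> by simp
   moreover have "0 <= (LINT x|M. (f n x - g x)\<^sup>2)" by simp
   ultimately show "norm ((LINT x|M. (f n x - g x)\<^sup>2) - 0) < e" using \<open>e > 0\<close> unfolding real_norm_def by linarith
  qed
 qed
 ultimately show ?thesis by (rule that)
qed

section \<open>Integration over the open and the closed unit square\<close>

definition osq :: "(real^2) set" where
 "osq = box (vector [-1/2, -1/2]) (vector [1/2, 1/2])"

lemma UNIV_Basis2: "(Basis :: (real^2) set) = {axis 1 1, axis 2 1}"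
 by (auto simp: Basis_vec_def UNIV_2)

lemma axis12_neq: "axis 1 (1::real) \<noteq> (axis 2 1 :: real^2)"
 by (simp add: axis_eq_axis)

lemma mem_box2: "x \<in> box l u \<longleftrightarrow> l$1 < x$1 \<and> x$1 < u$1 \<and> l$2 < x$2 \<and> x$2 < (u::real^2)$2"
 by (auto simp: mem_box UNIV_Basis2 inner_axis)

lemma mem_osq: "x \<in> osq \<longleftrightarrow> \<bar>x$1\<bar> < 1/2 \<and> \<bar>x$2\<bar> < 1/2"
 by (auto simp: osq_def mem_box2)

lemma mem_square: "x \<in> square \<longleftrightarrow> \<bar>x$1\<bar> <= 1/2 \<and> \<bar>x$2\<bar> <= 1/2"
 by (auto simp: square_def mem_box UNIV_Basis2 inner_axis)

lemma osq_subset: "osq \<subseteq> square"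
 using mem_osq mem_square less_imp_le by blast

lemma interior_square: "interior square = osq" by (simp add: square_def osq_def interior_cbox)

lemma open_osq: "open osq" by (simp add: osq_def open_box)

lemma sets_osq [measurable]: "osq \<in> sets borel" "square \<in> sets borel"
 by (auto simp: osq_def square_def)

text \<open>Agreement on boxes determines \<open>lborel\<close>; this transfers Fubini's theorem
  from pairs to \<open>real^2\<close>.\<close>

lemma lborel_real2: "distr (lborel \<Otimes>\<^sub>M lborel) borel (%p. vector [fst p, snd p] :: real^2) = lborel"
proof (rule lborel_eqI[symmetric])
 have cont: "contU (%p. vector [fst p, snd p] :: real^2)"
  by (subst continuous_on_componentwise)
    (auto simp: UNIV_Basis2 inner_axis intro!: continuous_intros)
 have [measurable]: "(%p. vector [fst p, snd p] :: real^2) \<in> borel_measurable (lborel \<Otimes>\<^sub>M lborel)"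
  using borel_measurable_continuous_onI[OF cont] by (simp add: lborel_prod)
 fix l u :: "real^2" assume le: "!!b. b \<in> Basis ==> l \<bullet> b <= u \<bullet> b"
 have le': "l$1 <= u$1" "l$2 <= u$2" using le[of "axis 1 1"] le[of "axis 2 1"]
  by (auto simp: UNIV_Basis2 inner_axis)
 have "emeasure (distr (lborel \<Otimes>\<^sub>M lborel) borel (%p. vector [fst p, snd p] :: real^2)) (box l u)
  = emeasure (lborel \<Otimes>\<^sub>M lborel) ({l$1<..<u$1} \<times> {l$2<..<u$2})"
  by (subst emeasure_distr) (auto simp: mem_box2 space_pair_measure intro!: arg_cong[where f="emeasure _"])
 also have "\<dots> = ennreal (u$1 - l$1) * ennreal (u$2 - l$2)"
  using le' by (simp add: sigma_finite_measure.emeasure_pair_measure_Times sigma_finite_lborel)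
 also have "\<dots> = (\<Prod>b\<in>Basis. (u - l) \<bullet> b)"
  using le' by (simp add: UNIV_Basis2 axis12_neq inner_axis ennreal_mult prod.insert)
 finally show "emeasure (distr (lborel \<Otimes>\<^sub>M lborel) borel (%p. vector [fst p, snd p] :: real^2)) (box l u)
  = ennreal (\<Prod>b\<in>Basis. (u - l) \<bullet> b)" .
qed simp

lemma integral_lborel2_product:
 fixes f g :: "real => real"
 assumes f: "integrable lborel f" and g: "integrable lborel g"
 shows "(LINT w::real^2|lborel. f (w$1) * g (w$2)) = (LINT x|lborel. f x) * (LINT y|lborel. g y)"
proof -
 have cont: "contU (%p. vector [fst p, snd p] :: real^2)"
  by (subst continuous_on_componentwise)
    (auto simp: UNIV_Basis2 inner_axis intro!: continuous_intros)
 have [measurable]: "(%p. vector [fst p, snd p] :: real^2) \<in> borel_measurable (lborel \<Otimes>\<^sub>M lborel)"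
  using borel_measurable_continuous_onI[OF cont] by (simp add: lborel_prod)
 have [measurable]: "f \<in> borel_measurable borel" "g \<in> borel_measurable borel"
  using f g by auto
 have int: "integrable (lborel \<Otimes>\<^sub>M lborel) (%p. f (fst p) * g (snd p))"
  by (rule lborel_pair.Fubini_integrable) (use f g in \<open>auto simp: abs_mult\<close>)
 have "(LINT w::real^2|lborel. f (w$1) * g (w$2))
  = (LINT w|distr (lborel \<Otimes>\<^sub>M lborel) borel (%p. vector [fst p, snd p] :: real^2). f (w$1) * g (w$2))"
  by (simp only: lborel_real2)
 also have "\<dots> = (LINT p|(lborel \<Otimes>\<^sub>M lborel). f (fst p) * g (snd p))"
  by (subst integral_distr) auto
 also have "\<dots> = (LINT x|lborel. (LINT y|lborel. f x * g y))"
  using lborel_pair.integral_fst'[OF int] by simp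
 finally show ?thesis by simp
qed

abbreviation I1 :: "(real => real) => real" where "I1 f \<equiv> integral {-1/2..1/2} f"

lemma lebesgue_on_eq_lborel:
 fixes F :: "real^2 => real"
 assumes "contU F" "A \<in> sets borel"
 shows "(LINT w|lebesgue_on A. F w) = (LINT w|lborel. indicator A w * F w)"
proof -
 have [measurable]: "F \<in> borel_measurable borel" "A \<in> sets borel"
  using assms borel_measurable_continuous_onI by auto
 show ?thesis
  using assms by (subst integral_restrict_space) (auto simp: integral_completion)
qed

lemma integral_square_product:
 assumes f: "contU f" and g: "contU g"
 shows "(LINT w|lebesgue_on square. f (w$1) * g (w$2)) = I1 f * I1 g"
proof -
 have cont: "contU (%w::real^2. f (w$1) * g (w$2))"
  by (intro continuous_on_mult continuous_on_compose2[OF f] continuous_on_compose2[OF g] continuous_vec_nth) auto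
 have 1: "set_integrable lborel {-1/2..1/2} f" if "contU f" for f :: "real => real"
  using that borel_integrable_atLeastAtMost'[of "-1/2" "1/2" f] continuous_on_subset by blast
 have 2: "(LINT x|lborel. indicator {-1/2..1/2} x * f x) = I1 f" if "contU f" for f :: "real => real"
  using set_borel_integral_eq_integral(2)[OF 1[OF that]] by (simp add: set_lebesgue_integral_def)
 have "(LINT w|lebesgue_on square. f (w$1) * g (w$2)) = (LINT w|lborel. indicator square w * (f (w$1) * g (w$2)))"
  by (rule lebesgue_on_eq_lborel[OF cont]) simp
 also have "\<dots> = (LINT w::real^2|lborel. (indicator {-1/2..1/2} (w$1) * f (w$1)) * (indicator {-1/2..1/2} (w$2) * g (w$2)))"
  by (rule lint_cong0) (auto simp: indicator_def mem_square)
 also have "\<dots> = I1 f * I1 g"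
  using integral_lborel2_product[OF 1[OF f, unfolded set_integrable_def real_scaleR_def]
   1[OF g, unfolded set_integrable_def real_scaleR_def]] unfolding 2[OF f] 2[OF g] .
 finally show ?thesis .
qed

lemma AE_osq: "(AE x in lebesgue. indicator osq x = (indicator square x :: real))"
proof -
 have "negligible (square - osq)"
  unfolding square_def osq_def using negligible_frontier_interval by blast
 then have "AE x in lebesgue. x \<notin> square - osq"
  by (intro AE_not_in) (simp add: negligible_iff_null_sets)
 then show ?thesis
 proof eventually_elim
  case (elim x)
  then show ?case using osq_subset by (cases "x \<in> osq") auto
 qed
qed

lemma integral_osq:
 fixes F :: "real^2 => real"
 assumes F: "contU F"
 shows "(LINT w|lebesgue_on osq. F w) = (LINT w|lebesgue_on square. F w)"
proof -
 have [measurable]: "F \<in> borel_measurable lebesgue" 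
  using borel_measurable_continuous_onI[OF F] by (simp add: measurable_completion)
 have [measurable]: "square \<in> sets lebesgue" "osq \<in> sets lebesgue" by auto
 have "(LINT w|lebesgue. indicator osq w *\<^sub>R F w) = (LINT w|lebesgue. indicator square w *\<^sub>R F w)"
  by (rule integral_cong_AE; (measurable)?) (use AE_osq in \<open>auto elim!: eventually_mono\<close>)
 then show ?thesis by (simp add: integral_restrict_space)
qed

lemma finite_measure_lebesgue_on_bounded:
 fixes A :: "'a::euclidean_space set"
 assumes "bounded A" "A \<in> sets lebesgue"
 shows "finite_measure (lebesgue_on A)"
proof -
 have "A \<in> lmeasurable" using assms by (simp add: bounded_set_imp_lmeasurable)
 then show ?thesis by (simp add: finite_measure_lebesgue_on)
qed

text \<open>Difference quotients of a compactly supported function integrate to zero by translation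
  invariance, and they converge to the partial derivative under an integrable majorant.\<close>

lemma integral_derivative_eq_0:
 fixes \<psi> :: "real^2 => real"
 assumes der: "!!x. (\<psi> has_derivative (%h. G x \<bullet> h)) (at x)" and cont: "contU G"
  and K: "compact K" "!!x. x \<notin> K ==> \<psi> x = 0"
 shows "(LINT x|lborel. G x $ i) = 0"
proof -
 have G0: "G x = 0" if "x \<notin> K" for x
 proof -
  have "((%x. 0) has_derivative (%h. G x \<bullet> h)) (at x)"
   by (rule has_derivative_transform_within_open[OF der, of "- K"])
     (use K that in \<open>auto simp: compact_imp_closed open_Compl\<close>)
  then have "(%h. G x \<bullet> h) = (%h. 0)" using has_derivative_const has_derivative_unique by blast
  then show ?thesis by (metis inner_eq_zero_iff)
 qed
 obtain B where B: "!!x. norm (G x) <= B" "B > 0"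
 proof -
  have "compact (G ` K)" using K cont by (meson compact_continuous_image continuous_on_subset subset_UNIV)
  then obtain b where "b > 0" "!!x. x \<in> K ==> norm (G x) <= b"
   using compact_imp_bounded[of "G ` K"] unfolding bounded_pos by auto
  then have "norm (G x) <= b" for x by (cases "x \<in> K") (simp_all add: G0)
  then show ?thesis using that \<open>b > 0\<close> by blast
 qed
 have lip: "\<bar>\<psi> (x + h) - \<psi> x\<bar> <= B * norm h" for x h
 proof -
  have "norm (\<psi> (x + h) - \<psi> x) <= B * norm (x + h - x)"
  proof (rule differentiable_bound[of UNIV \<psi> "%x h. G x \<bullet> h"])
   fix x show "onorm (%h. G x \<bullet> h) <= B"
   proof (rule onorm_bound)
   show "norm (G x \<bullet> h) <= B * norm h" for h
    using Cauchy_Schwarz_ineq2[of "G x" h] mult_right_mono[OF B(1)[of x] norm_ge_zero[of h]] by simp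
  qed (use B in simp)
  qed (auto intro: der has_derivative_at_withinI)
  then show ?thesis by simp
 qed
 define e where "e = (axis i 1 :: real^2)"
 have ne: "norm e = 1" by (simp add: e_def)
 define q where "q = (%n x. real (Suc n) * (\<psi> (x + (1 / real (Suc n)) *\<^sub>R e) - \<psi> x))"
 obtain R where R: "K \<subseteq> cball 0 R"
  using compact_imp_bounded[OF K(1)] by (auto simp: bounded_iff subset_eq)
 \<comment> \<open>Majorant of all quotients: the Lipschitz constant \<open>B\<close> on a ball
   whose radius exceeds \<open>R\<close> by one, since the shifts have length at most 1.\<close>
 define W where "W = (%x::real^2. indicator (cball 0 (R + 1)) x * B :: real)"
 have contpsi: "contU \<psi>"
  using der has_derivative_continuous continuous_at_imp_continuous_on by blast
 have [measurable]: "\<psi> \<in> borel_measurable borel" "G \<in> borel_measurable borel"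
  using contpsi cont borel_measurable_continuous_onI by auto
 have [measurable]: "(%x. G x $ i) \<in> borel_measurable borel"
  by (intro borel_measurable_continuous_onI continuous_intros cont)
 have [measurable]: "(%x. \<psi> (x + c)) \<in> borel_measurable borel" for c
  by (intro borel_measurable_continuous_onI continuous_on_compose2[OF contpsi]) (auto intro!: continuous_intros)
 have psi_int: "integrable lborel \<psi>"
 proof -
  have "integrable lborel (%x. indicator K x *\<^sub>R \<psi> x)"
   using K contpsi by (intro borel_integrable_compact) (auto intro: continuous_on_subset)
  then show ?thesis by (rule Bochner_Integration.integrable_cong[THEN iffD1, rotated 2]) (use K in \<open>auto simp: indicator_def\<close>)
 qed
 have q0: "(LINT x|lborel. q n x) = 0" for n
 proof -
  let ?v = "(1 / real (Suc n)) *\<^sub>R e"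
  have tr: "(LINT x|lborel. \<psi> (x + ?v)) = (LINT x|lborel. \<psi> x)" "integrable lborel (%x. \<psi> (x + ?v))"
  proof -
   have d: "distr lborel borel ((+) ?v) = lborel" by (simp add: lborel_distr_plus)
   show "(LINT x|lborel. \<psi> (x + ?v)) = (LINT x|lborel. \<psi> x)"
    using integral_distr[of "(+) ?v" lborel borel \<psi>] unfolding d by (simp add: add.commute)
   show "integrable lborel (%x. \<psi> (x + ?v))"
    using integrable_distr[of "(+) ?v" lborel borel \<psi>] psi_int unfolding d by (simp add: add.commute)
  qed
  show ?thesis unfolding q_def using tr psi_int by simp
 qed
 have "(%n. LINT x|lborel. q n x) \<longlonglongrightarrow> (LINT x|lborel. G x $ i)"
 proof (rule integral_dominated_convergence[where w = W])
  show "integrable lborel W"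
   unfolding W_def by (intro integrable_mult_left integrable_real_indicator) (use emeasure_lborel_cball_finite[of 0 "R + 1"] in auto)
  show "AE x in lborel. (%n. q n x) \<longlonglongrightarrow> G x $ i"
  proof (rule AE_I2)
   fix x
   have "((%t. \<psi> (x + t *\<^sub>R e)) has_real_derivative G x $ i) (at 0)"
   proof -
    have "((%t. \<psi> (x + t *\<^sub>R e)) has_derivative (%t. G x \<bullet> (t *\<^sub>R e))) (at 0)"
     by (rule has_derivative_compose[of "%t. x + t *\<^sub>R e"]) (use der[of x] in \<open>auto intro!: derivative_eq_intros\<close>)
    then show ?thesis
     by (simp add: has_field_derivative_def e_def inner_axis mult_commute_abs)
   qed
   then have "((%h. (\<psi> (x + h *\<^sub>R e) - \<psi> x) / h) \<longlongrightarrow> G x $ i) (at 0)"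
    by (simp add: DERIV_def)
   moreover have "filterlim (%n. 1 / real (Suc n)) (at 0) sequentially"
    using LIMSEQ_inverse_real_of_nat by (auto simp: filterlim_at inverse_eq_divide simp del: of_nat_Suc)
   ultimately have "(%n. (\<psi> (x + (1 / real (Suc n)) *\<^sub>R e) - \<psi> x) / (1 / real (Suc n))) \<longlonglongrightarrow> G x $ i"
    by (rule filterlim_compose)
   then show "(%n. q n x) \<longlonglongrightarrow> G x $ i" by (simp add: q_def mult.commute)
  qed
  fix n
  show "AE x in lborel. norm (q n x) <= W x"
  proof (rule AE_I2)
   fix x
   let ?v = "(1 / real (Suc n)) *\<^sub>R e"
   have nv: "norm ?v <= 1" using ne by simp
   show "norm (q n x) <= W x"
   proof (cases "x \<in> cball 0 (R + 1)")
    case True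
    have "norm (q n x) = real (Suc n) * \<bar>\<psi> (x + ?v) - \<psi> x\<bar>" by (simp add: q_def abs_mult)
    also have "\<dots> <= real (Suc n) * (B * norm ?v)" by (intro mult_left_mono lip) auto
    also have "\<dots> = B" using ne by simp
    finally show ?thesis using True by (simp add: W_def)
   next
    case False
    have "norm x <= norm (x + ?v) + norm ?v" using norm_triangle_ineq4[of "x + ?v" ?v] by simp
    moreover have k1: "norm y <= R" if "y \<in> K" for y using R that by auto
    moreover have "\<not> norm x <= R + 1" using False by simp
    ultimately have "x + ?v \<notin> K" using nv k1[of "x + ?v"] by argo
    moreover have "x \<notin> K" using \<open>\<not> norm x <= R + 1\<close> k1[of x] by linarith
    ultimately show ?thesis using K False by (simp add: q_def W_def)
   qed
  qed
 qed (unfold q_def, measurable)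
 then show ?thesis using q0 LIMSEQ_unique[OF _ tendsto_const] by simp
qed

lemma test_functionE:
 assumes "test_function \<Omega> \<phi>"
 obtains G K where "!!x. (\<phi> has_derivative (%h. G x \<bullet> h)) (at x)" "contU G"
  "compact K" "K \<subseteq> \<Omega>" "!!x. x \<notin> K ==> \<phi> x = 0" "!!x. gradient \<phi> x = G x" "contU \<phi>"
proof -
 have "C_k 1 \<phi>" using assms by (simp add: test_function_def)
 then obtain G where G: "!!x. (\<phi> has_derivative (%h. G x \<bullet> h)) (at x)" "!!i. contU (%x. G x $ i)"
  by (auto simp: C_k.simps(2))
 have "contU G"
  by (subst continuous_on_componentwise) (auto simp: UNIV_Basis2 inner_axis G)
 have grad: "gradient \<phi> x = G x" for x
  unfolding gradient_def using frechet_derivative_at[OF G(1)[of x], symmetric]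
  by (simp add: vec_eq_iff inner_axis)
 show ?thesis
 proof (rule that[of G "closure {x. \<phi> x \<noteq> 0}"])
  show "\<phi> x = 0" if "x \<notin> closure {x. \<phi> x \<noteq> 0}" for x
   using that closure_subset[of "{x. \<phi> x \<noteq> 0}"] by blast
  show "contU \<phi>" using C_k_imp_continuous[OF \<open>C_k 1 \<phi>\<close>] .
  show "compact (closure {x. \<phi> x \<noteq> 0})" "closure {x. \<phi> x \<noteq> 0} \<subseteq> \<Omega>"
   using assms unfolding test_function_def by blast+
 qed (fact G(1) \<open>contU G\<close> grad)+
qed

section \<open>Green's formula and the spectral estimate on the square\<close>

lemma H1_D:
 assumes "H1 \<Omega> u G"
 shows "u \<in> L2 (lebesgue_on \<Omega>)" "(%x. G x $ i) \<in> L2 (lebesgue_on \<Omega>)"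
  "integrable (lebesgue_on \<Omega>) (%x. (norm (G x))\<^sup>2)"
  "test_function \<Omega> \<phi> ==> (LINT x|lebesgue_on \<Omega>. u x * gradient \<phi> x $ i)
      = - (LINT x|lebesgue_on \<Omega>. G x $ i * \<phi> x)"
proof -
 have [measurable]: "G \<in> borel_measurable (lebesgue_on \<Omega>)" using assms by (simp add: H1_def)
 show "u \<in> L2 (lebesgue_on \<Omega>)" using assms by (simp add: H1_def L2_def)
 show int: "integrable (lebesgue_on \<Omega>) (%x. (norm (G x))\<^sup>2)" using assms by (simp add: H1_def)
 have "(%v::real^2. v $ i) \<in> borel_measurable borel"
  by (intro borel_measurable_continuous_onI continuous_vec_nth)
 then have m: "(%x. G x $ i) \<in> borel_measurable (lebesgue_on \<Omega>)"
  by (rule measurable_compose[rotated]) measurable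
 show "(%x. G x $ i) \<in> L2 (lebesgue_on \<Omega>)"
 proof (rule L2_I)
  show "integrable (lebesgue_on \<Omega>) (%x. (G x $ i)\<^sup>2)"
  proof (rule Bochner_Integration.integrable_bound[OF int])
   show "AE x in lebesgue_on \<Omega>. norm ((G x $ i)^2) <= norm ((norm (G x))^2)"
    using power_mono[OF component_le_norm_cart abs_ge_zero, of _ i 2] by simp
  qed (use m in measurable)
 qed (rule m)
 show "test_function \<Omega> \<phi> ==> (LINT x|lebesgue_on \<Omega>. u x * gradient \<phi> x $ i)
      = - (LINT x|lebesgue_on \<Omega>. G x $ i * \<phi> x)"
  using assms by (simp add: H1_def)
qed

lemma norm_vec2_sq: "(norm (x::real^2))^2 = (x$1)^2 + (x$2)^2"
 by (simp add: norm_vec_def L2_set_def sum_2)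

lemma integral_norm_sq:
 assumes "!!i. (%x. G x $ i) \<in> L2 M"
 shows "(LINT x|M. (norm (G x :: real^2))\<^sup>2) = (LINT x|M. (G x $ 1)\<^sup>2) + (LINT x|M. (G x $ 2)\<^sup>2)"
 unfolding norm_vec2_sq using assms by (intro lint_add L2_integrable)

text \<open>The two arguments are N(1/2 + t) - 1 and N(1/2 - t) - 1, so for N >= 1 the support keeps
  distance 1/N from the ends, while the values tend to 1 inside.\<close>

definition cutoff :: "nat => real => real" where
 "cutoff N t = flat 0 (real N * t + (real N / 2 - 1)) * flat 0 (- real N * t + (real N / 2 - 1))"

definition dcutoff :: "nat => real => real" where
 "dcutoff N t = real N * flat 2 (real N * t + (real N / 2 - 1)) * flat 0 (- real N * t + (real N / 2 - 1))
  - flat 0 (real N * t + (real N / 2 - 1)) * (real N * flat 2 (- real N * t + (real N / 2 - 1)))"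

lemma cutoff_nonneg: "cutoff N t \<ge> 0" and cutoff_le_1: "cutoff N t <= 1"
 unfolding cutoff_def using flat_nonneg flat_0_le_1 by (auto intro!: mult_le_one)

lemma DERIV_cutoff: "(cutoff N has_real_derivative dcutoff N t) (at t)"
proof -
 have f: "(flat 0 has_real_derivative flat 2 x) (at x)" for x using DERIV_flat[of 0 x] by (simp add: numeral_2_eq_2)
 show ?thesis
  unfolding cutoff_def[abs_def] dcutoff_def
  by (rule derivative_eq_intros DERIV_chain2[OF f] refl)+ simp
qed

lemma C_k_cutoff: "C_k k (%x. cutoff N (x $ i))"
 unfolding cutoff_def by (intro C_k_mult C_k_flat)

lemma cutoff_support: "cutoff N t \<noteq> 0 ==> real N * \<bar>t\<bar> <= real N / 2 - 1"
 by (cases "t \<ge> 0") (auto simp: cutoff_def flat_def split: if_splits)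

lemma flat_0_tendsto: "(flat 0 \<longlongrightarrow> 1) at_top"
proof -
 have "((%x::real. exp (- inverse x)) \<longlongrightarrow> exp (- 0)) at_top"
  by (intro tendsto_intros tendsto_inverse_0_at_top filterlim_ident)
 then have "((%x::real. exp (- 1 / x)) \<longlongrightarrow> 1) at_top" by (simp add: inverse_eq_divide)
 then show ?thesis
  by (rule Lim_transform_eventually) (auto intro!: eventually_mono[OF eventually_gt_at_top[of 0]] simp: flat_def)
qed

lemma flat_2_tendsto: "((%s. (s + 1) * flat 2 s) \<longlongrightarrow> 0) at_top"
proof (rule tendsto_sandwich[of "%s. 0" _ _ "%s. 2 * inverse s"])
 show "\<forall>\<^sub>F s in at_top. (s + 1) * flat 2 s <= 2 * inverse s"
  using eventually_ge_at_top[of 1]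
 proof eventually_elim
  case (elim s)
  have "flat 2 s <= 1 / s ^ 2" using elim by (auto simp: flat_def intro!: divide_right_mono)
  then have "(s + 1) * flat 2 s <= (2 * s) * (1 / s ^ 2)"
   using elim flat_nonneg[of 2 s] by (intro mult_mono) auto
  also have "\<dots> = 2 * inverse s" using elim by (simp add: power2_eq_square field_simps)
  finally show ?case .
 qed
 show "\<forall>\<^sub>F s in at_top. 0 <= (s + 1) * flat 2 s"
  using eventually_ge_at_top[of 1] by eventually_elim (auto simp: flat_nonneg)
 show "((%s::real. 2 * inverse s) \<longlongrightarrow> 0) at_top"
  using tendsto_mult_right_zero[OF tendsto_inverse_0_at_top[OF filterlim_ident]] by simp
qed simp

lemma scale_at_top: "\<tau> > 0 ==> filterlim (%N::nat. real N * \<tau> - 1) at_top sequentially"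
proof -
 assume "\<tau> > 0"
 then have "filterlim (%N::nat. \<tau> * real N) at_top sequentially"
  by (rule filterlim_tendsto_pos_mult_at_top[OF tendsto_const _ filterlim_real_sequentially])
 then have "filterlim (%N::nat. real N * \<tau>) at_top sequentially" by (simp add: mult.commute)
 then have "filterlim (%N::nat. - 1 + real N * \<tau>) at_top sequentially"
  by (rule filterlim_tendsto_add_at_top[OF tendsto_const])
 then show ?thesis by simp
qed

lemma cutoff_arg: "real N * t + (real N / 2 - 1) = real N * (1/2 + t) - 1"
  "- real N * t + (real N / 2 - 1) = real N * (1/2 - t) - 1"
 by (auto simp: algebra_simps)

lemma cutoff_tendsto: 
 assumes "\<bar>t\<bar> < 1/2"
 shows "(%N. cutoff N t) \<longlonglongrightarrow> 1"
proof -
 have "(%N. flat 0 (real N * (1/2 + t) - 1) * flat 0 (real N * (1/2 - t) - 1)) \<longlonglongrightarrow> 1 * 1"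
  using assms by (intro tendsto_mult filterlim_compose[OF flat_0_tendsto] scale_at_top) auto
 then show ?thesis unfolding cutoff_def cutoff_arg by simp
qed

lemma abs_sin_le: "\<bar>sin (real m * pi * (t + 1/2))\<bar> <= real m * pi * \<bar>1/2 + t\<bar>"
 "\<bar>sin (real m * pi * (t + 1/2))\<bar> <= real m * pi * \<bar>1/2 - t\<bar>"
proof -
 show "\<bar>sin (real m * pi * (t + 1/2))\<bar> <= real m * pi * \<bar>1/2 + t\<bar>"
  using abs_sin_x_le_abs_x[of "real m * pi * (t + 1/2)"] by (simp add: abs_mult add.commute)
 have "sin (real m * pi * (t + 1/2)) = sin (real m * pi - real m * pi * (1/2 - t))"
  by (simp add: algebra_simps)
 also have "\<dots> = - ((-1) ^ m) * sin (real m * pi * (1/2 - t))"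
  by (simp add: sin_diff)
 finally have "\<bar>sin (real m * pi * (t + 1/2))\<bar> = \<bar>sin (real m * pi * (1/2 - t))\<bar>"
  by (simp add: abs_mult power_abs)
 also have "\<dots> <= real m * pi * \<bar>1/2 - t\<bar>"
  using abs_sin_x_le_abs_x[of "real m * pi * (1/2 - t)"] by (simp add: abs_mult)
 finally show "\<bar>sin (real m * pi * (t + 1/2))\<bar> <= real m * pi * \<bar>1/2 - t\<bar>" .
qed

text \<open>The sine factor vanishes linearly at both ends and so compensates for the growth of the
 derivative of the cutoff.\<close>

lemma sin_dcutoff_bound:
 assumes "\<bar>t\<bar> < 1/2"
 shows "\<bar>sin (real m * pi * (t + 1/2)) * dcutoff N t\<bar>
  <= real m * pi * (\<bar>(real N * (1/2 + t) - 1 + 1) * flat 2 (real N * (1/2 + t) - 1)\<bar>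
   + \<bar>(real N * (1/2 - t) - 1 + 1) * flat 2 (real N * (1/2 - t) - 1)\<bar>)"
proof -
 define S where "S = sin (real m * pi * (t + 1/2))"
 define a b where "a = flat 2 (real N * (1/2 + t) - 1)" and "b = flat 2 (real N * (1/2 - t) - 1)"
 define p q where "p = flat 0 (real N * (1/2 + t) - 1)" and "q = flat 0 (real N * (1/2 - t) - 1)"
 have nn: "a \<ge> 0" "b \<ge> 0" "p \<ge> 0" "q \<ge> 0" "p <= 1" "q <= 1"
  by (auto simp: a_def b_def p_def q_def flat_nonneg flat_0_le_1)
 have S: "\<bar>S\<bar> <= real m * pi * (1/2 + t)" "\<bar>S\<bar> <= real m * pi * (1/2 - t)"
  using abs_sin_le[of m t] assms by (auto simp: S_def)
 have "\<bar>S * dcutoff N t\<bar> = \<bar>S * (real N * a * q) - S * (p * (real N * b))\<bar>"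
  unfolding dcutoff_def cutoff_arg a_def b_def p_def q_def right_diff_distrib ..
 also have "\<dots> <= \<bar>S\<bar> * (real N * a * q) + \<bar>S\<bar> * (p * (real N * b))"
  using nn by (intro order_trans[OF abs_triangle_ineq4]) (simp add: abs_mult)
 also have "\<dots> <= (real m * pi * (1/2 + t)) * (real N * a * 1) + (real m * pi * (1/2 - t)) * (1 * (real N * b))"
  using S nn assms by (intro add_mono mult_mono) auto
 also have "\<dots> = real m * pi * (\<bar>(real N * (1/2 + t) - 1 + 1) * a\<bar> + \<bar>(real N * (1/2 - t) - 1 + 1) * b\<bar>)"
 proof -
  have "0 <= real N * (1/2 + t) * a" "0 <= real N * (1/2 - t) * b"
   using nn assms by (auto intro!: mult_nonneg_nonneg)
  then show ?thesis by (simp only: diff_add_cancel abs_of_nonneg) (simp add: algebra_simps)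
 qed
 finally show ?thesis by (simp add: S_def a_def b_def)
qed

lemma sin_dcutoff_le:
 assumes "\<bar>t\<bar> < 1/2"
 shows "\<bar>sin (real m * pi * (t + 1/2)) * dcutoff N t\<bar> <= 24 * real m * pi"
proof -
 have "real m * pi * (\<bar>(real N * (1/2 + t) - 1 + 1) * flat 2 (real N * (1/2 + t) - 1)\<bar>
   + \<bar>(real N * (1/2 - t) - 1 + 1) * flat 2 (real N * (1/2 - t) - 1)\<bar>) <= real m * pi * (12 + 12)"
  by (intro mult_left_mono add_mono flat_2_bound) auto
 then show ?thesis using sin_dcutoff_bound[OF assms, of m N] by simp
qed

lemma sin_dcutoff_tendsto:
 assumes "\<bar>t\<bar> < 1/2"
 shows "(%N. sin (real m * pi * (t + 1/2)) * dcutoff N t) \<longlonglongrightarrow> 0"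
proof (rule tendsto_rabs_zero_cancel, rule tendsto_sandwich[of "%_. 0"])
 have "(%N. real m * pi * (\<bar>(real N * (1/2 + t) - 1 + 1) * flat 2 (real N * (1/2 + t) - 1)\<bar>
   + \<bar>(real N * (1/2 - t) - 1 + 1) * flat 2 (real N * (1/2 - t) - 1)\<bar>)) \<longlonglongrightarrow> real m * pi * (0 + 0)"
  using assms by (intro tendsto_intros tendsto_rabs_zero filterlim_compose[OF flat_2_tendsto] scale_at_top) auto
 then show "(%N. real m * pi * (\<bar>(real N * (1/2 + t) - 1 + 1) * flat 2 (real N * (1/2 + t) - 1)\<bar>
   + \<bar>(real N * (1/2 - t) - 1 + 1) * flat 2 (real N * (1/2 - t) - 1)\<bar>)) \<longlonglongrightarrow> 0" by simp
 show "\<forall>\<^sub>F N in sequentially. \<bar>sin (real m * pi * (t + 1/2)) * dcutoff N t\<bar> <=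
   real m * pi * (\<bar>(real N * (1/2 + t) - 1 + 1) * flat 2 (real N * (1/2 + t) - 1)\<bar>
   + \<bar>(real N * (1/2 - t) - 1 + 1) * flat 2 (real N * (1/2 - t) - 1)\<bar>)"
  using sin_dcutoff_bound[OF assms] by (intro always_eventually allI)
qed auto

definition cmode :: "nat => nat => real^2 => real" where
 "cmode m n w = cos (real m * pi * (w $ 1 + 1/2)) * cos (real n * pi * (w $ 2 + 1/2))"

lemma lebesgue_on_osq_finite: "finite_measure (lebesgue_on osq)"
 by (rule finite_measure_lebesgue_on_bounded) (auto simp: osq_def)

lemma space_osq [simp]: "space (lebesgue_on osq) = osq"
 by simp

text \<open>Green's formula for the field \<open>sin (m \<pi> (x\<^sub>i + 1/2)) cos (n \<pi> (x\<^sub>j + 1/2)) e\<^sub>i\<close>, whose normal component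
 vanishes on the boundary of the square.\<close>

lemma square_Green:
 assumes H: "H1 osq u G" and ij: "i \<noteq> (j::2)"
 shows "(LINT w|lebesgue_on osq. u w * (real m * pi * (cos (real m * pi * (w $ i + 1/2)) * cos (real n * pi * (w $ j + 1/2)))))
  = - (LINT w|lebesgue_on osq. G w $ i * (sin (real m * pi * (w $ i + 1/2)) * cos (real n * pi * (w $ j + 1/2))))"
proof -
 define S where "S = (%t. sin (real m * pi * (t + 1/2)))"
 define C where "C = (%t. cos (real n * pi * (t + 1/2)))"
 define D where "D = (%t. real m * pi * cos (real m * pi * (t + 1/2)))"
 \<comment> \<open>Both coordinates are cut off, because a test function must vanish near all four
   sides. Only the i-th partial derivative is used, so the cut-off in the other coordinate is never
   differentiated.\<close>
 define \<phi> where "\<phi> = (%N (w::real^2). (S (w$i) * cutoff N (w$i)) * (C (w$j) * cutoff N (w$j)))"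
 define \<gamma> where "\<gamma> = (%N (w::real^2). (D (w$i) * cutoff N (w$i) + S (w$i) * dcutoff N (w$i)) * (C (w$j) * cutoff N (w$j)))"
 have bnds: "\<bar>S t\<bar> <= 1" "\<bar>C t\<bar> <= 1" "\<bar>D t\<bar> <= real m * pi" for t
  by (auto simp: S_def C_def D_def abs_mult intro: mult_left_le)
 have cb: "\<bar>cutoff N t\<bar> <= 1" for N t using cutoff_nonneg cutoff_le_1 by (simp add: abs_of_nonneg)
 have ck: "C_k k (\<phi> N)" for k N
 proof -
  have "C_k k (%w. S (w$i))" "C_k k (%w. C (w$j))"
   using C_k_sin[of k "real m * pi" i "real m * pi / 2"] C_k_cos[of k "real n * pi" j "real n * pi / 2"]
   by (simp_all add: S_def C_def algebra_simps)
  then show ?thesis unfolding \<phi>_def by (intro C_k_mult C_k_cutoff)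
 qed
 have test: "test_function osq (\<phi> N)" if "N \<ge> 1" for N
 proof -
  define K where "K = cbox (vector [-1/2 + 1/N, -1/2 + 1/N]) (vector [1/2 - 1/N, 1/2 - 1/N] :: real^2)"
  have "\<bar>t\<bar> <= 1/2 - 1/N" if "cutoff N t \<noteq> 0" for t
   using cutoff_support[OF that] \<open>N \<ge> 1\<close> by (simp add: field_simps)
  then have *: "\<bar>w$k\<bar> <= 1/2 - 1/N" if "\<phi> N w \<noteq> 0" for w k
   using that ij exhaust_2[of k] exhaust_2[of i] exhaust_2[of j] by (auto simp: \<phi>_def)
  have "w \<in> K" if "\<phi> N w \<noteq> 0" for w
   using *[OF that, of 1] *[OF that, of 2]
   by (auto simp: K_def mem_box UNIV_Basis2 inner_axis)
  then have sub: "closure {w. \<phi> N w \<noteq> 0} \<subseteq> K"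
   by (intro closure_minimal) (auto simp: K_def)
  moreover have "K \<subseteq> osq"
  proof
   fix w assume "w \<in> K"
   then have "-1/2 + 1/N <= w$1" "w$1 <= 1/2 - 1/N" "-1/2 + 1/N <= w$2" "w$2 <= 1/2 - 1/N"
    by (auto simp: K_def mem_box UNIV_Basis2 inner_axis)
   moreover have "1 / real N > 0" using \<open>N \<ge> 1\<close> by simp
   ultimately show "w \<in> osq" unfolding mem_osq by linarith
  qed
  moreover have "compact (closure {w. \<phi> N w \<noteq> 0})"
   using sub compact_cbox by (metis K_def bounded_cbox bounded_subset closed_closure compact_eq_bounded_closed)
  ultimately show ?thesis using ck by (auto simp: test_function_def)
 qed
 have axij: "axis i (1::real) $ j = 0" using ij by (simp add: axis_def)
 have grad: "gradient (\<phi> N) w $ i = \<gamma> N w" for N w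
 proof -
  have co: "((%w::real^2. f (w$k)) has_derivative (%h. f' (w$k) * h$k)) (at w)"
   if "!!t. (f has_real_derivative f' t) (at t)" for f f' k and w :: "real^2"
   using that[of "w$k", THEN has_field_derivative_imp_has_derivative]
   by (rule has_derivative_compose[rotated]) (rule has_derivative_nth)
  have "((%t. S t * cutoff N t) has_real_derivative D t * cutoff N t + S t * dcutoff N t) (at t)" for t
   unfolding S_def D_def by (rule derivative_eq_intros DERIV_cutoff refl)+ simp
  moreover have "((%t. C t * cutoff N t) has_real_derivative (- real n * pi * sin (real n * pi * (t + 1/2))) * cutoff N t + C t * dcutoff N t) (at t)" for t
   unfolding C_def by (rule derivative_eq_intros DERIV_cutoff refl)+ simp
  ultimately have "(\<phi> N has_derivative (%h. (S (w$i) * cutoff N (w$i)) *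
    (((- real n * pi * sin (real n * pi * (w$j + 1/2))) * cutoff N (w$j) + C (w$j) * dcutoff N (w$j)) * h$j)
    + ((D (w$i) * cutoff N (w$i) + S (w$i) * dcutoff N (w$i)) * h$i) * (C (w$j) * cutoff N (w$j)))) (at w)"
   unfolding \<phi>_def by (intro has_derivative_mult co)
  from fun_cong[OF frechet_derivative_at[OF this], of "axis i 1"] show ?thesis
   using axij by (simp add: gradient_def \<gamma>_def)
 qed
 interpret finite_measure "lebesgue_on osq" by (rule lebesgue_on_osq_finite)
 note uL = H1_D(1)[OF H] and GL = H1_D(2)[OF H, of i]
 have one: "(%x. 1) \<in> L2 (lebesgue_on osq)" by (simp add: L2_def)
 have uint: "integrable (lebesgue_on osq) u" and Gint: "integrable (lebesgue_on osq) (%x. G x $ i)"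
  using L2_mult_integrable[OF uL one] L2_mult_integrable[OF GL one] by auto
 have meas: "f \<in> borel_measurable (lebesgue_on osq)" if "contU f" for f :: "real^2 => real"
  by (rule continuous_imp_measurable_on_sets_lebesgue) (use sets_osq in \<open>auto intro: continuous_on_subset[OF that]\<close>)
 have ctp: "contU (\<phi> N)" for N using C_k_imp_continuous[OF ck] .
 have ctg: "(%w. \<gamma> N w) \<in> borel_measurable (lebesgue_on osq)" for N
 proof (rule meas)
  have cc: "contU (%w::real^2. f (w$k))" if "contU f" for f :: "real => real" and k
   by (rule continuous_on_compose2[OF that]) (auto intro: continuous_vec_nth)
  have "contU (cutoff N)"
   by (meson DERIV_cutoff DERIV_isCont continuous_at_imp_continuous_on)
  moreover have "contU (dcutoff N)"
   unfolding dcutoff_def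
   by (intro continuous_intros continuous_on_compose2[OF continuous_flat]) auto
  ultimately show "contU (\<gamma> N)"
   unfolding \<gamma>_def S_def C_def D_def
   by (intro continuous_intros cc[where f="cutoff N"] cc[where f="dcutoff N"])
 qed
 have lim1: "(%N. LINT w|lebesgue_on osq. u w * \<gamma> N w) \<longlonglongrightarrow> (LINT w|lebesgue_on osq. u w * (D (w$i) * C (w$j)))"
 \<comment> \<open>25 = 1 + 24: the differentiated sine contributes at most m pi, and the sine times
   the derivative of the cut-off at most 24 m pi.\<close>
 proof (rule integral_dominated_convergence[where w = "%w. \<bar>u w\<bar> * (25 * real m * pi)"])
  show "AE w in lebesgue_on osq. (%N. u w * \<gamma> N w) \<longlonglongrightarrow> u w * (D (w$i) * C (w$j))"
  proof (rule AE_I2)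
   fix w assume "w \<in> space (lebesgue_on osq)"
   then have w: "\<bar>w$k\<bar> < 1/2" for k using exhaust_2[of k] by (auto simp: mem_osq)
   have "(%N. u w * \<gamma> N w) \<longlonglongrightarrow> u w * ((D (w$i) * 1 + 0) * (C (w$j) * 1))"
    unfolding \<gamma>_def S_def using w by (intro tendsto_intros cutoff_tendsto sin_dcutoff_tendsto)
   then show "(%N. u w * \<gamma> N w) \<longlonglongrightarrow> u w * (D (w$i) * C (w$j))" by simp
  qed
  fix N show "AE w in lebesgue_on osq. norm (u w * \<gamma> N w) <= \<bar>u w\<bar> * (25 * real m * pi)"
  proof (rule AE_I2)
   fix w assume "w \<in> space (lebesgue_on osq)"
   then have w: "\<bar>w$k\<bar> < 1/2" for k using exhaust_2[of k] by (auto simp: mem_osq)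
   have "\<bar>D (w$i) * cutoff N (w$i)\<bar> <= real m * pi * 1"
    unfolding abs_mult by (intro mult_mono bnds cb) auto
   then have "\<bar>D (w$i) * cutoff N (w$i) + S (w$i) * dcutoff N (w$i)\<bar> <= 25 * real m * pi"
    using sin_dcutoff_le[OF w, of m i N] unfolding S_def by linarith
   moreover have "\<bar>C (w$j) * cutoff N (w$j)\<bar> <= 1 * 1"
    unfolding abs_mult by (intro mult_mono bnds cb) auto
   ultimately have "\<bar>\<gamma> N w\<bar> <= (25 * real m * pi) * 1"
    unfolding \<gamma>_def abs_mult by (intro mult_mono) auto
   then show "norm (u w * \<gamma> N w) <= \<bar>u w\<bar> * (25 * real m * pi)"
    by (simp add: abs_mult mult_left_mono)
  qed
 next
  show "(%w. u w * (D (w $ i) * C (w $ j))) \<in> borel_measurable (lebesgue_on osq)"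
   by (intro borel_measurable_times L2_measurable[OF uL] meas) (auto simp: D_def C_def intro!: continuous_intros)
  show "integrable (lebesgue_on osq) (%w. \<bar>u w\<bar> * (25 * real m * pi))" using uint by auto
 qed (intro borel_measurable_times L2_measurable[OF uL] ctg)
 have lim2: "(%N. LINT w|lebesgue_on osq. G w $ i * \<phi> N w) \<longlonglongrightarrow> (LINT w|lebesgue_on osq. G w $ i * (S (w$i) * C (w$j)))"
 proof (rule integral_dominated_convergence[where w = "%w. \<bar>G w $ i\<bar>"])
  show "AE w in lebesgue_on osq. (%N. G w $ i * \<phi> N w) \<longlonglongrightarrow> G w $ i * (S (w$i) * C (w$j))"
  proof (rule AE_I2)
   fix w assume "w \<in> space (lebesgue_on osq)"
   then have w: "\<bar>w$k\<bar> < 1/2" for k using exhaust_2[of k] by (auto simp: mem_osq)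
   have "(%N. G w $ i * \<phi> N w) \<longlonglongrightarrow> G w $ i * ((S (w$i) * 1) * (C (w$j) * 1))"
    unfolding \<phi>_def using w by (intro tendsto_intros cutoff_tendsto)
   then show "(%N. G w $ i * \<phi> N w) \<longlonglongrightarrow> G w $ i * (S (w$i) * C (w$j))" by simp
  qed
  fix N show "AE w in lebesgue_on osq. norm (G w $ i * \<phi> N w) <= \<bar>G w $ i\<bar>"
  proof (rule AE_I2)
   fix w assume "w \<in> space (lebesgue_on osq)"
   have "\<bar>\<phi> N w\<bar> <= (1 * 1) * (1 * 1)"
    unfolding \<phi>_def abs_mult by (intro mult_mono bnds cb) auto
   then show "norm (G w $ i * \<phi> N w) <= \<bar>G w $ i\<bar>"
    by (simp add: abs_mult mult_left_le)
  qed
 next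
  show "(%w. G w $ i * (S (w $ i) * C (w $ j))) \<in> borel_measurable (lebesgue_on osq)"
   by (intro borel_measurable_times L2_measurable[OF GL] meas) (auto simp: S_def C_def intro!: continuous_intros)
  show "integrable (lebesgue_on osq) (%w. \<bar>G w $ i\<bar>)" using Gint by auto
 qed (intro borel_measurable_times L2_measurable[OF GL] meas ctp)
 have "\<forall>\<^sub>F N in sequentially. (LINT w|lebesgue_on osq. u w * \<gamma> N w) = - (LINT w|lebesgue_on osq. G w $ i * \<phi> N w)"
  using eventually_ge_at_top[of 1]
  by eventually_elim (use H1_D(4)[OF H test, of _ i] grad in simp)
 then have "(%N. - (LINT w|lebesgue_on osq. G w $ i * \<phi> N w)) \<longlonglongrightarrow> (LINT w|lebesgue_on osq. u w * (D (w$i) * C (w$j)))"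
  by (rule Lim_transform_eventually[OF lim1])
 from LIMSEQ_unique[OF this tendsto_minus[OF lim2]] show ?thesis
  by (simp add: D_def C_def S_def mult.assoc)
qed

section \<open>Orthogonality of the cosine and sine modes\<close>

lemma I1_FTC:
 assumes "!!t. (F has_real_derivative f t) (at t)"
 shows "I1 f = F (1/2) - F (-1/2)"
proof -
 have "(f has_integral F (1/2) - F (-1/2)) {-1/2..1/2}"
  by (rule fundamental_theorem_of_calculus)
   (use assms in \<open>auto intro: has_field_derivative_at_within simp flip: has_real_derivative_iff_has_vector_derivative\<close>)
 then show ?thesis by (rule integral_unique)
qed

lemma I1_cos_int: 
 assumes "k \<noteq> 0"
 shows "I1 (%t. cos (of_int k * pi * (t + 1/2))) = 0"
proof -
 have "((%t. sin (of_int k * pi * (t + 1/2)) / (of_int k * pi)) has_real_derivative cos (of_int k * pi * (t + 1/2))) (at t)" for t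
  using assms by (auto intro!: derivative_eq_intros)
 from I1_FTC[OF this] show ?thesis by (auto simp: sin_zero_iff_int2)
qed

lemma I1_integrable: "contU f ==> f integrable_on {-1/2..1/2::real}" for f :: "real => real"
 by (meson continuous_on_subset integrable_continuous_interval subset_UNIV)

lemma I1_cos_cos:
 "I1 (%t. cos (real m * pi * (t + 1/2)) * cos (real n * pi * (t + 1/2)))
  = (if m = n then (if m = 0 then 1 else 1/2) else 0)"
 and I1_sin_sin: "m > 0 ==> I1 (%t. sin (real m * pi * (t + 1/2)) * sin (real n * pi * (t + 1/2)))
  = (if m = n then 1/2 else 0)"
proof -
 define A where "A = (%t. cos (of_int (int m - int n) * pi * (t + 1/2)))"
 define B where "B = (%t. cos (of_int (int m + int n) * pi * (t + 1/2)))"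
 have At: "A t = cos (real m * pi * (t + 1/2) - real n * pi * (t + 1/2))"
  and Bt: "B t = cos (real m * pi * (t + 1/2) + real n * pi * (t + 1/2))" for t
  by (simp_all add: A_def B_def algebra_simps)
 have cont: "contU A" "contU B" unfolding A_def B_def by (intro continuous_intros)+
 have AB: "I1 (%t. c * A t + d * B t) = c * I1 A + d * I1 B" for c d
 proof -
  have "(%t. c * A t) integrable_on {-1/2..1/2}" "(%t. d * B t) integrable_on {-1/2..1/2}"
   by (intro I1_integrable continuous_intros cont)+
  then show ?thesis by (simp only: integral_add integral_mult_right)
 qed
 have IA: "I1 A = (if m = n then 1 else 0)"
  using I1_cos_int[of "int m - int n"] by (auto simp: A_def)
 have IB: "I1 B = (if m = 0 \<and> n = 0 then 1 else 0)"
  using I1_cos_int[of "int m + int n"] by (auto simp: B_def)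
 have "(%t. cos (real m * pi * (t + 1/2)) * cos (real n * pi * (t + 1/2))) = (%t. 1/2 * A t + 1/2 * B t)"
  by (simp only: fun_eq_iff At Bt cos_times_cos) (simp add: add_divide_distrib)
 then show "I1 (%t. cos (real m * pi * (t + 1/2)) * cos (real n * pi * (t + 1/2)))
  = (if m = n then (if m = 0 then 1 else 1/2) else 0)"
  by (simp only: AB IA IB) auto
 have "(%t. sin (real m * pi * (t + 1/2)) * sin (real n * pi * (t + 1/2))) = (%t. 1/2 * A t + (-1/2) * B t)"
  by (simp only: fun_eq_iff At Bt sin_times_sin) (simp add: diff_divide_distrib)
 then show "I1 (%t. sin (real m * pi * (t + 1/2)) * sin (real n * pi * (t + 1/2)))
  = (if m = n then 1/2 else 0)" if "m > 0"
  using that by (simp only: AB IA IB) auto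
qed

lemma measurable_osq: "contU f ==> f \<in> borel_measurable (lebesgue_on osq)" for f :: "real^2 => real"
 by (rule continuous_imp_measurable_on_sets_lebesgue) (use sets_osq in \<open>auto intro: continuous_on_subset\<close>)

lemma L2_osq_bounded:
 assumes "contU f"
 shows "f \<in> L2 (lebesgue_on osq)" 
proof -
 have "compact (f ` square)"
  unfolding square_def using assms by (meson compact_cbox compact_continuous_image continuous_on_subset subset_UNIV)
 then obtain B where "!!w. w \<in> square ==> \<bar>f w\<bar> <= B"
  using compact_imp_bounded[of "f ` square"] unfolding bounded_iff by auto
 then show ?thesis
  using osq_subset by (intro L2_bounded[OF measurable_osq[OF assms] lebesgue_on_osq_finite]) auto
qed

lemma continuous_fn_nth: "contU f ==> contU (%w::real^'n. f (w $ k))" for f :: "real => real"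
 by (rule continuous_on_compose2[of UNIV f]) (auto intro: continuous_vec_nth)

lemma continuous_cmode: "contU (cmode m n)"
 unfolding cmode_def[abs_def] by (intro continuous_intros)

lemma integral_osq_product:
 assumes "contU f" "contU g"
 shows "(LINT w|lebesgue_on osq. f (w$1) * g (w$2)) = I1 f * I1 g"
 using integral_square_product[OF assms] assms
 by (subst integral_osq) (auto intro!: continuous_on_mult continuous_fn_nth)

text \<open>The squared L2 norm of \<open>cmode m n\<close> on the unit square.\<close>

definition nu :: "nat => nat => real" where
 "nu m n = (if m = 0 then 1 else 1/2) * (if n = 0 then 1 else 1/2)"

lemma nu_pos: "nu m n > 0" by (simp add: nu_def)

lemma cmode_orth:
 "(LINT w|lebesgue_on osq. cmode m n w * cmode m' n' w) = (if m = m' \<and> n = n' then nu m n else 0)"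
proof -
 have "(LINT w|lebesgue_on osq. cmode m n w * cmode m' n' w)
  = (LINT w|lebesgue_on osq. (cos (real m * pi * (w$1 + 1/2)) * cos (real m' * pi * (w$1 + 1/2)))
    * (cos (real n * pi * (w$2 + 1/2)) * cos (real n' * pi * (w$2 + 1/2))))"
  by (simp add: cmode_def mult_ac)
 also have "\<dots> = I1 (%t. cos (real m * pi * (t + 1/2)) * cos (real m' * pi * (t + 1/2)))
   * I1 (%t. cos (real n * pi * (t + 1/2)) * cos (real n' * pi * (t + 1/2)))"
  by (rule integral_osq_product) (intro continuous_intros)+
 also have "\<dots> = (if m = m' \<and> n = n' then nu m n else 0)"
  unfolding I1_cos_cos by (auto simp: nu_def)
 finally show ?thesis .
qed

text \<open>Up to the factor -m pi or -n pi, the i-th partial derivative of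
  \<open>cmode m n\<close>.\<close>

definition smode :: "2 => nat => nat => real^2 => real" where
 "smode i m n w = (if i = 1 then sin (real m * pi * (w $ 1 + 1/2)) * cos (real n * pi * (w $ 2 + 1/2))
   else cos (real m * pi * (w $ 1 + 1/2)) * sin (real n * pi * (w $ 2 + 1/2)))"

lemma continuous_smode: "contU (smode i m n)"
 unfolding smode_def[abs_def] by (cases "i = 1") (auto intro!: continuous_intros)

lemma smode_orth1:
 assumes "m > 0"
 shows "(LINT w|lebesgue_on osq. smode 1 m n w * smode 1 m' n' w) = (if m = m' \<and> n = n' then nu m n else 0)"
proof -
 have "(LINT w|lebesgue_on osq. smode 1 m n w * smode 1 m' n' w)
  = (LINT w|lebesgue_on osq. (sin (real m * pi * (w$1 + 1/2)) * sin (real m' * pi * (w$1 + 1/2)))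
    * (cos (real n * pi * (w$2 + 1/2)) * cos (real n' * pi * (w$2 + 1/2))))"
  by (simp add: smode_def mult_ac)
 also have "\<dots> = I1 (%t. sin (real m * pi * (t + 1/2)) * sin (real m' * pi * (t + 1/2)))
   * I1 (%t. cos (real n * pi * (t + 1/2)) * cos (real n' * pi * (t + 1/2)))"
  by (rule integral_osq_product) (intro continuous_intros)+
 also have "\<dots> = (if m = m' \<and> n = n' then nu m n else 0)"
  unfolding I1_cos_cos I1_sin_sin[OF assms] using assms by (auto simp: nu_def)
 finally show ?thesis .
qed

lemma smode_orth2:
 assumes "n > 0"
 shows "(LINT w|lebesgue_on osq. smode 2 m n w * smode 2 m' n' w) = (if m = m' \<and> n = n' then nu m n else 0)"
proof -
 have "(LINT w|lebesgue_on osq. smode 2 m n w * smode 2 m' n' w)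
  = (LINT w|lebesgue_on osq. (cos (real m * pi * (w$1 + 1/2)) * cos (real m' * pi * (w$1 + 1/2)))
    * (sin (real n * pi * (w$2 + 1/2)) * sin (real n' * pi * (w$2 + 1/2))))"
  by (simp add: smode_def mult_ac)
 also have "\<dots> = I1 (%t. cos (real m * pi * (t + 1/2)) * cos (real m' * pi * (t + 1/2)))
   * I1 (%t. sin (real n * pi * (t + 1/2)) * sin (real n' * pi * (t + 1/2)))"
  by (rule integral_osq_product) (intro continuous_intros)+
 also have "\<dots> = (if m = m' \<and> n = n' then nu m n else 0)"
  unfolding I1_cos_cos I1_sin_sin[OF assms] using assms by (auto simp: nu_def)
 finally show ?thesis .
qed

section \<open>Bessel's inequality and density of cosine polynomials\<close>

lemma orthogonal_expansion:
 fixes e :: "'k => 'a => real"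
 assumes "finite F" "u \<in> L2 M" "!!k. k \<in> F ==> e k \<in> L2 M"
  and "!!k l. k \<in> F ==> l \<in> F ==> (LINT x|M. e k x * e l x) = (if k = l then \<nu> k else 0)"
 shows "(LINT x|M. (u x - (\<Sum>k\<in>F. a k * e k x))\<^sup>2)
  = (LINT x|M. (u x)\<^sup>2) - 2 * (\<Sum>k\<in>F. a k * (LINT x|M. u x * e k x)) + (\<Sum>k\<in>F. (a k)\<^sup>2 * \<nu> k)"
 using assms
proof (induction F)
 case (insert j F)
 define v where "v = (%x. u x - (\<Sum>k\<in>F. a k * e k x))"
 have sL: "(%x. \<Sum>k\<in>F. a k * e k x) \<in> L2 M"
  using insert by (intro L2_sum L2_cmult) auto
 have vL: "v \<in> L2 M" unfolding v_def using insert sL by (intro L2_diff) auto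
 have ej: "e j \<in> L2 M" using insert by simp
 have "(LINT x|M. v x * e j x) = (LINT x|M. u x * e j x - (\<Sum>k\<in>F. a k * (e k x * e j x)))"
  by (rule lint_cong0) (simp_all add: v_def left_diff_distrib sum_distrib_right mult.assoc)
 also have "\<dots> = (LINT x|M. u x * e j x) - (LINT x|M. (\<Sum>k\<in>F. a k * (e k x * e j x)))"
  using insert by (intro Bochner_Integration.integral_diff Bochner_Integration.integrable_sum integrable_mult_right L2_mult_integrable) auto
 also have "(LINT x|M. (\<Sum>k\<in>F. a k * (e k x * e j x))) = (\<Sum>k\<in>F. a k * (LINT x|M. e k x * e j x))"
  using insert by (subst Bochner_Integration.integral_sum) (auto intro!: integrable_mult_right L2_mult_integrable)
 also have "\<dots> = 0" using insert by (intro sum.neutral) auto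
 finally have vj: "(LINT x|M. v x * e j x) = (LINT x|M. u x * e j x)" by simp
 have jj: "(LINT x|M. (e j x)\<^sup>2) = \<nu> j" using insert.prems(3)[of j j] by (simp add: power2_eq_square)
 have "(LINT x|M. (u x - (\<Sum>k\<in>insert j F. a k * e k x))\<^sup>2) = (LINT x|M. (v x + (- a j) * e j x)\<^sup>2)"
  using insert by (simp add: v_def algebra_simps)
 also have "\<dots> = (LINT x|M. (v x)\<^sup>2) - 2 * a j * (LINT x|M. u x * e j x) + (a j)^2 * \<nu> j"
  unfolding integral_square_expand[OF vL ej] vj jj by simp
 also have "(LINT x|M. (v x)\<^sup>2) = (LINT x|M. (u x)\<^sup>2) - 2 * (\<Sum>k\<in>F. a k * (LINT x|M. u x * e k x)) + (\<Sum>k\<in>F. (a k)\<^sup>2 * \<nu> k)"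
  unfolding v_def using insert by (intro insert.IH) auto
 finally show ?case using insert by (simp add: algebra_simps)
qed simp

text \<open>With c the inner product of u with a mode, completing the square c^2/nu - 2ac + a^2 nu =
  (c - a nu)^2/nu gives both parts; the second says that the Fourier sum is the best
  approximation.\<close>

lemma Bessel:
 fixes e :: "'k => 'a => real"
 assumes "finite F" "u \<in> L2 M" "!!k. k \<in> F ==> e k \<in> L2 M"
  and "!!k l. k \<in> F ==> l \<in> F ==> (LINT x|M. e k x * e l x) = (if k = l then \<nu> k else 0)"
  and pos: "!!k. k \<in> F ==> \<nu> k > 0"
 shows "(\<Sum>k\<in>F. (LINT x|M. u x * e k x)\<^sup>2 / \<nu> k) <= (LINT x|M. (u x)\<^sup>2)"
  and "(LINT x|M. (u x)\<^sup>2) - (\<Sum>k\<in>F. (LINT x|M. u x * e k x)\<^sup>2 / \<nu> k) <= (LINT x|M. (u x - (\<Sum>k\<in>F. a k * e k x))\<^sup>2)"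
proof -
 define c where "c = (%k. LINT x|M. u x * e k x)"
 have E: "(LINT x|M. (u x - (\<Sum>k\<in>F. a k * e k x))\<^sup>2)
  = (LINT x|M. (u x)\<^sup>2) - 2 * (\<Sum>k\<in>F. a k * c k) + (\<Sum>k\<in>F. (a k)\<^sup>2 * \<nu> k)" for a
  unfolding c_def by (rule orthogonal_expansion) (use assms in auto)
 have le: "(LINT x|M. (u x)\<^sup>2) - (\<Sum>k\<in>F. (c k)\<^sup>2 / \<nu> k) <= (LINT x|M. (u x - (\<Sum>k\<in>F. a k * e k x))\<^sup>2)" for a
 proof -
  have "2 * (a k * c k) - (a k)\<^sup>2 * \<nu> k <= (c k)\<^sup>2 / \<nu> k" if "k \<in> F" for k
  proof -
   have "(c k)^2 / \<nu> k - 2 * (a k * c k) + (a k)^2 * \<nu> k = (c k - a k * \<nu> k)^2 / \<nu> k"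
    using pos[OF that] by (simp add: power2_eq_square field_simps)
   also have "\<dots> \<ge> 0" using pos[OF that] by simp
   finally show ?thesis by simp
  qed
  then have "(\<Sum>k\<in>F. 2 * (a k * c k) - (a k)\<^sup>2 * \<nu> k) <= (\<Sum>k\<in>F. (c k)\<^sup>2 / \<nu> k)" by (rule sum_mono)
  then have "2 * (\<Sum>k\<in>F. a k * c k) - (\<Sum>k\<in>F. (a k)\<^sup>2 * \<nu> k) <= (\<Sum>k\<in>F. (c k)\<^sup>2 / \<nu> k)"
   by (simp add: sum_subtractf sum_distrib_left[symmetric])
  then show ?thesis using E[of a] by linarith
 qed
 show "(LINT x|M. (u x)\<^sup>2) - (\<Sum>k\<in>F. (LINT x|M. u x * e k x)\<^sup>2 / \<nu> k) <= (LINT x|M. (u x - (\<Sum>k\<in>F. a k * e k x))\<^sup>2)"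
  using le[of a] by (simp add: c_def)
 have "0 <= (LINT x|M. (u x - (\<Sum>k\<in>F. (c k / \<nu> k) * e k x))\<^sup>2)" by simp
 also have "\<dots> = (LINT x|M. (u x)\<^sup>2) - 2 * (\<Sum>k\<in>F. c k / \<nu> k * c k) + (\<Sum>k\<in>F. (c k / \<nu> k)\<^sup>2 * \<nu> k)"
  by (rule E)
 also have "(\<Sum>k\<in>F. (c k / \<nu> k)\<^sup>2 * \<nu> k) = (\<Sum>k\<in>F. c k / \<nu> k * c k)"
  using pos by (intro sum.cong) (auto simp: power2_eq_square field_simps dest: less_imp_neq)
 finally show "(\<Sum>k\<in>F. (LINT x|M. u x * e k x)\<^sup>2 / \<nu> k) <= (LINT x|M. (u x)\<^sup>2)"
  by (simp add: c_def power2_eq_square)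
qed

text \<open>Finite linear combinations of cosine modes. The product formula makes them an algebra,
  to which Stone-Weierstrass applies.\<close>

inductive trigp :: "(real^2 => real) => bool" where
 trigp_mode: "trigp (%w. c * cmode m n w)"
| trigp_add: "trigp f ==> trigp g ==> trigp (%w. f w + g w)"

lemma trigp_repr:
 assumes "trigp f"
 shows "\<exists>F a. finite F \<and> f = (%w. \<Sum>k\<in>F. a k * cmode (fst k) (snd k) w)"
 using assms
proof induction
 case (trigp_mode c m n)
 show ?case by (rule exI[of _ "{(m, n)}"], rule exI[of _ "%_. c"]) simp
next
 case (trigp_add f g)
 then obtain F a F' a' where *: "finite F" "f = (%w. \<Sum>k\<in>F. a k * cmode (fst k) (snd k) w)"
  "finite F'" "g = (%w. \<Sum>k\<in>F'. a' k * cmode (fst k) (snd k) w)" by blast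
 have "(\<Sum>k\<in>F. a k * cmode (fst k) (snd k) w) = (\<Sum>k\<in>F\<union>F'. (if k \<in> F then a k else 0) * cmode (fst k) (snd k) w)"
  "(\<Sum>k\<in>F'. a' k * cmode (fst k) (snd k) w) = (\<Sum>k\<in>F\<union>F'. (if k \<in> F' then a' k else 0) * cmode (fst k) (snd k) w)" for w
  using * by (auto intro!: sum.mono_neutral_cong_left)
 then show ?case
  using * by (intro exI[of _ "F \<union> F'"] exI[of _ "%k. (if k \<in> F then a k else 0) + (if k \<in> F' then a' k else 0)"])
   (simp add: distrib_right sum.distrib)
qed

text \<open>The index difference is taken in absolute value because modes are indexed by natural
  numbers; the cosine is even.\<close>

lemma cos_prod_nat:
 "cos (real m * s) * cos (real m' * s) = (cos (real (m + m') * s) + cos (real (nat \<bar>int m - int m'\<bar>) * s)) / 2"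
proof -
 have "cos (real (nat \<bar>int m - int m'\<bar>) * s) = cos (real m * s - real m' * s)"
 proof (cases "m \<ge> m'")
  case True
  then show ?thesis by (simp add: algebra_simps)
 next
  case False
  then have "real (nat \<bar>int m - int m'\<bar>) * s = - (real m * s - real m' * s)" by (simp add: algebra_simps)
  then show ?thesis by (simp only: cos_minus)
 qed
 then show ?thesis unfolding cos_times_cos by (simp add: algebra_simps)
qed

lemma trigp_mult: "trigp f ==> trigp g ==> trigp (%w. f w * g w)"
proof (induction arbitrary: g rule: trigp.induct)
 case (trigp_mode c m n)
 from trigp_mode show ?case
 proof (induction rule: trigp.induct)
  case (trigp_mode c' m' n')
  define d :: "nat => nat => nat" where "d = (%m m'. nat \<bar>int m - int m'\<bar>)"
  have "c * cmode m n w * (c' * cmode m' n' w) =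
    (c * c' / 4) * cmode (m + m') (n + n') w + ((c * c' / 4) * cmode (m + m') (d n n') w
     + ((c * c' / 4) * cmode (d m m') (n + n') w + (c * c' / 4) * cmode (d m m') (d n n') w))" for w
  proof -
   define X where "X = (%m. cos (real m * (pi * (w $ 1 + 1/2))))"
   define Y where "Y = (%n. cos (real n * (pi * (w $ 2 + 1/2))))"
   have cm: "cmode m n w = X m * Y n" for m n by (simp add: cmode_def X_def Y_def mult.assoc)
   have XX: "X m * X m' = (X (m + m') + X (d m m')) / 2" and YY: "Y n * Y n' = (Y (n + n') + Y (d n n')) / 2"
    unfolding X_def Y_def d_def by (rule cos_prod_nat)+
   have "c * (X m * Y n) * (c' * (X m' * Y n')) = c * c' * (X m * X m') * (Y n * Y n')" by simp
   then show ?thesis unfolding cm XX YY by (simp add: field_simps)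
  qed
  then show ?case by (simp only:) (intro trigp.intros)
 next
  case (trigp_add f g)
  then show ?case by (simp add: distrib_left trigp.trigp_add)
 qed
next
 case (trigp_add f f')
 then show ?case by (simp add: distrib_right trigp.trigp_add)
qed

lemma trigp_continuous: "trigp f ==> contU f"
 by (induction rule: trigp.induct) (auto intro!: continuous_intros continuous_cmode)

text \<open>\<open>cmode 1 0\<close> and \<open>cmode 0 1\<close> separate the points of the square,
  since the cosine is injective on [0, pi].\<close>

lemma trigp_uniform:
 assumes "continuous_on square f" "e > 0"
 shows "\<exists>g. trigp g \<and> (\<forall>x\<in>square. \<bar>f x - g x\<bar> < e)"
proof -
 have cosinj: "x = y" if "\<bar>x\<bar> <= 1/2" "\<bar>y\<bar> <= 1/2" "cos (pi * (x + 1/2)) = cos (pi * (y + 1/2))" for x y :: real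
 proof -
  have "0 <= pi * (x + 1/2)" "pi * (x + 1/2) <= pi * 1" "0 <= pi * (y + 1/2)" "pi * (y + 1/2) <= pi * 1"
   using that by (intro mult_nonneg_nonneg mult_left_mono; auto)+
  then have "pi * (x + 1/2) = pi * (y + 1/2)" using cos_inj_pi[OF _ _ _ _ that(3)] by simp
  then show ?thesis by simp
 qed
 interpret function_ring_on "Collect trigp" square
 proof
  show "compact square" by (simp add: square_def)
  show "f \<in> Collect trigp ==> continuous_on square f" for f
   using trigp_continuous continuous_on_subset by blast
  show "(%_. c) \<in> Collect trigp" for c
   using trigp_mode[of c 0 0] by (simp add: cmode_def)
  fix x y :: "real^2" assume xy: "x \<in> square" "y \<in> square" "x \<noteq> y"
  show "\<exists>f\<in>Collect trigp. f x \<noteq> f y"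
  proof (rule ccontr)
   assume "\<not> ?thesis"
   then have "cmode 1 0 x = cmode 1 0 y" "cmode 0 1 x = cmode 0 1 y"
    using trigp_mode[of 1 1 0] trigp_mode[of 1 0 1] by auto
   then have "x $ 1 = y $ 1" "x $ 2 = y $ 2"
    using xy by (auto simp: cmode_def mem_square intro!: cosinj)
   then show False using xy by (simp add: vec_eq_iff forall_2)
  qed
 qed (auto intro: trigp_add trigp_mult)
 show ?thesis using Stone_Weierstrass_basic[OF assms] by auto
qed

abbreviation "Mosq \<equiv> lebesgue_on osq"

definition trig_dense :: "(real^2 => real) => bool" where
 "trig_dense u \<longleftrightarrow> (\<forall>e>0. \<exists>g. trigp g \<and> (LINT w|Mosq. (u w - g w)\<^sup>2) < e)"

lemma L2_trigp: "trigp g ==> g \<in> L2 Mosq"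
 by (intro L2_osq_bounded trigp_continuous)

lemma trig_dense_limit:
 assumes "u \<in> L2 Mosq" "!!e. e > 0 ==> \<exists>v \<in> L2 Mosq. trig_dense v \<and> (LINT w|Mosq. (u w - v w)\<^sup>2) < e"
 shows "trig_dense u"
 unfolding trig_dense_def
proof (intro allI impI)
 fix e :: real assume "e > 0"
 then obtain v where v: "v \<in> L2 Mosq" "trig_dense v" "(LINT w|Mosq. (u w - v w)\<^sup>2) < e / 4"
  using assms(2)[of "e/4"] by auto
 obtain g where g: "trigp g" "(LINT w|Mosq. (v w - g w)\<^sup>2) < e / 4"
  using v(2) \<open>e > 0\<close> unfolding trig_dense_def by (meson zero_less_divide_iff zero_less_numeral)
 have "(LINT w|Mosq. ((u w - v w) + (v w - g w))\<^sup>2) <= 2 * (LINT w|Mosq. (u w - v w)\<^sup>2) + 2 * (LINT w|Mosq. (v w - g w)\<^sup>2)"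
  using assms(1) v L2_trigp[OF g(1)] by (intro L2_sum_le L2_diff)
 also have "\<dots> < e" using v g by simp
 finally show "\<exists>g. trigp g \<and> (LINT w|Mosq. (u w - g w)\<^sup>2) < e" using g by auto
qed

lemma measure_osq: "measure Mosq (space Mosq) = 1"
proof -
 have "measure Mosq (space Mosq) = (LINT w|Mosq. cmode 0 0 w * cmode 0 0 w)" by (simp add: cmode_def)
 then show ?thesis unfolding cmode_orth by (simp add: nu_def)
qed

lemma trig_dense_continuous:
 assumes f: "contU f"
 shows "trig_dense f"
 unfolding trig_dense_def
proof (intro allI impI)
 interpret finite_measure Mosq by (rule lebesgue_on_osq_finite)
 fix e :: real assume "e > 0"
 then obtain g where g: "trigp g" "!!x. x \<in> square ==> \<bar>f x - g x\<bar> < sqrt (e / 2)"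
  using trigp_uniform[of f "sqrt (e/2)"] continuous_on_subset[OF f] by auto
 have "(LINT w|Mosq. (f w - g w)\<^sup>2) <= (LINT w|Mosq. e / 2)"
 proof (rule integral_mono)
  show "integrable Mosq (%w. (f w - g w)\<^sup>2)"
   by (intro L2_integrable L2_diff L2_osq_bounded f trigp_continuous g)
  fix w assume "w \<in> space Mosq"
  then have "\<bar>f w - g w\<bar> <= sqrt (e / 2)" using g(2)[of w] osq_subset by auto
  from power_mono[OF this abs_ge_zero, of 2] show "(f w - g w)^2 <= e / 2" using \<open>e > 0\<close> by simp
 qed simp
 also have "\<dots> = e / 2" using measure_osq by simp
 finally show "\<exists>g. trigp g \<and> (LINT w|Mosq. (f w - g w)\<^sup>2) < e" using g \<open>e > 0\<close> by force
qed

text \<open>A Urysohn function between a closed subset and an open superset differs from the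
  indicator only on a set of measure below e, and there by at most 1.\<close>

lemma trig_dense_indicator:
 assumes "A \<in> sets Mosq"
 shows "trig_dense (indicator A)"
proof (rule trig_dense_limit)
 interpret finite_measure Mosq by (rule lebesgue_on_osq_finite)
 have AL: "A \<in> sets lebesgue" "A \<subseteq> osq" using assms sets_osq(1) by (auto simp: sets_restrict_space)
 show ind: "indicator A \<in> L2 Mosq"
  by (rule L2_bounded[of _ _ 1]) (use assms lebesgue_on_osq_finite in \<open>auto simp: indicator_def\<close>)
 fix e :: real assume "e > 0"
 obtain U where U: "open U" "A \<subseteq> U" "(U - A) \<in> lmeasurable" "emeasure lebesgue (U - A) < ennreal (e/2)"
  using sets_lebesgue_outer_open[OF AL(1), of "e/2"] \<open>e > 0\<close> by auto
 obtain C where C: "closed C" "C \<subseteq> A" "(A - C) \<in> lmeasurable" "emeasure lebesgue (A - C) < ennreal (e/2)"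
  using sets_lebesgue_inner_closed[OF AL(1), of "e/2"] \<open>e > 0\<close> by auto
 obtain f :: "real^2 => real" where f: "contU f" "!!x. f x \<in> closed_segment 1 0"
   "!!x. x \<in> C ==> f x = 1" "!!x. x \<in> - U ==> f x = 0"
  using Urysohn[of C "- U" 1 0] C U by (auto simp: closed_Compl)
 have f01: "0 <= f x" "f x <= 1" for x using f(2)[of x] by (auto simp: closed_segment_eq_real_ivl)
 define D where "D = (U - A) \<union> (A - C)"
 have D: "D \<in> lmeasurable" unfolding D_def using U C by blast
 have "measure lebesgue D < e"
 proof -
  have "measure lebesgue (U - A) < e/2" "measure lebesgue (A - C) < e/2"
   using U C \<open>e > 0\<close> by (auto simp: emeasure_eq_measure2 ennreal_less_iff)
  moreover have "measure lebesgue D <= measure lebesgue (U - A) + measure lebesgue (A - C)"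
   unfolding D_def using U C by (intro measure_Un_le) auto
  ultimately show ?thesis by simp
 qed
 have "(LINT w|Mosq. (indicator A w - f w)\<^sup>2) <= (LINT w|Mosq. indicator D w)"
 proof (rule integral_mono)
  show "integrable Mosq (%w. (indicator A w - f w)\<^sup>2)"
   by (intro L2_integrable L2_diff[OF ind L2_osq_bounded[OF f(1)]])
  show "integrable Mosq (indicator D :: _ => real)"
   by (rule integrable_const_bound[of _ 1]) (use D sets_osq(1) in \<open>auto simp: indicator_def borel_measurable_indicator_iff sets_restrict_space_iff intro!: borel_measurable_if_D measurable_restrict_space1\<close>)
  fix w
  show "(indicator A w - f w)^2 <= (indicator D w :: real)"
   using f01[of w] f(3,4)[of w] U(2) C(2) by (auto simp: indicator_def D_def power_le_one abs_square_le_1)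
 qed
 also have "\<dots> = (LINT w|lebesgue. indicator osq w *\<^sub>R (indicator D w :: real))"
  by (rule integral_restrict_space) (use sets_osq in auto)
 also have "(%w. indicator osq w *\<^sub>R (indicator D w :: real)) = indicator (D \<inter> osq)"
  by (auto simp: indicator_def)
 also have "(LINT w|lebesgue. (indicator (D \<inter> osq) w :: real)) = measure lebesgue (D \<inter> osq)"
  using Bochner_Integration.integral_indicator[of lebesgue "D \<inter> osq"]
  by (simp only: space_completion space_lborel space_borel Int_UNIV_right)
 also have "\<dots> <= measure lebesgue D"
  using D sets_osq(1) by (intro measure_mono_fmeasurable) auto
 also have "\<dots> < e" by fact
 finally show "\<exists>v\<in>L2 Mosq. trig_dense v \<and> (LINT w|Mosq. (indicator A w - v w)\<^sup>2) < e"
  using f L2_osq_bounded trig_dense_continuous by blast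
qed

lemma trig_dense_add:
 assumes "f \<in> L2 Mosq" "g \<in> L2 Mosq" "trig_dense f" "trig_dense g"
 shows "trig_dense (%w. f w + g w)"
 unfolding trig_dense_def
proof (intro allI impI)
 fix e :: real assume "e > 0"
 obtain f' where f': "trigp f'" "(LINT w|Mosq. (f w - f' w)\<^sup>2) < e / 4"
  using assms(3) \<open>e > 0\<close> unfolding trig_dense_def by (meson zero_less_divide_iff zero_less_numeral)
 obtain g' where g': "trigp g'" "(LINT w|Mosq. (g w - g' w)\<^sup>2) < e / 4"
  using assms(4) \<open>e > 0\<close> unfolding trig_dense_def by (meson zero_less_divide_iff zero_less_numeral)
 have "(LINT w|Mosq. ((f w - f' w) + (g w - g' w))\<^sup>2) <= 2 * (LINT w|Mosq. (f w - f' w)\<^sup>2) + 2 * (LINT w|Mosq. (g w - g' w)\<^sup>2)"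
  using assms L2_trigp[OF f'(1)] L2_trigp[OF g'(1)] by (intro L2_sum_le L2_diff)
 also have "\<dots> < e" using f' g' by simp
 finally have "(LINT w|Mosq. (f w + g w - (f' w + g' w))\<^sup>2) < e" by (simp add: algebra_simps)
 then show "\<exists>h. trigp h \<and> (LINT w|Mosq. (f w + g w - h w)\<^sup>2) < e"
  using trigp_add[OF f'(1) g'(1)] by blast
qed

lemma trigp_cmult: "trigp g ==> trigp (%w. c * g w)"
 using trigp_mult[OF trigp_mode[of c 0 0], of g] by (simp add: cmode_def)

lemma trig_dense_cmult:
 assumes "f \<in> L2 Mosq" "trig_dense f"
 shows "trig_dense (%w. c * f w)"
 unfolding trig_dense_def
proof (intro allI impI)
 fix e :: real assume "e > 0"
 have p: "e / (c^2 + 1) > 0" using \<open>e > 0\<close> by (simp add: add_nonneg_pos)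
 then obtain f' where f': "trigp f'" "(LINT w|Mosq. (f w - f' w)\<^sup>2) < e / (c^2 + 1)"
  using assms(2) unfolding trig_dense_def by blast
 have "(LINT w|Mosq. (c * f w - c * f' w)\<^sup>2) = c^2 * (LINT w|Mosq. (f w - f' w)\<^sup>2)"
  by (simp flip: right_diff_distrib add: power_mult_distrib)
 also have "\<dots> <= c\<^sup>2 * (e / (c^2 + 1))" using f' by (intro mult_left_mono) auto
 also have "\<dots> < e" using \<open>e > 0\<close> by (simp add: field_simps add_pos_nonneg)
 finally show "\<exists>h. trigp h \<and> (LINT w|Mosq. (c * f w - h w)\<^sup>2) < e"
  using trigp_cmult[OF f'(1)] by blast
qed

lemma trig_dense_nonneg:
 assumes "u \<in> L2 Mosq" "!!w. u w \<ge> 0"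
 shows "trig_dense u"
proof -
 \<comment> \<open>Square integrability is a premise inside the induction formula, because the
   induction runs over all nonnegative measurable functions; in each case nonnegativity passes it on
   to the pieces.\<close>
 have "integrable Mosq (%w. (u w)\<^sup>2) --> trig_dense u" if "u \<in> borel_measurable Mosq" "!!w. u w \<ge> 0" for u
  using that
 proof (induction u rule: borel_measurable_induct_real)
  case (set A)
  then show ?case using trig_dense_indicator by blast
 next
  case (mult u c)
  show ?case
  proof
   assume i: "integrable Mosq (%x. (c * u x)\<^sup>2)"
   show "trig_dense (%x. c * u x)"
   proof (cases "c = 0")
    case True
    then show ?thesis using trig_dense_continuous[of "%_. 0"] by simp
   next
    case False
    then have "integrable Mosq (%x. (u x)\<^sup>2)" using i by (simp add: power_mult_distrib)
    then show ?thesis using mult by (intro trig_dense_cmult) (auto simp: L2_def)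
   qed
  qed
 next
  case (add u v)
  show ?case
  proof
   assume i: "integrable Mosq (%x. (v x + u x)\<^sup>2)"
   have *: "(a::real)^2 <= (b + a)\<^sup>2" "b^2 <= (b + a)\<^sup>2" if "a \<ge> 0" "b \<ge> 0" for a b
    using that by (auto intro!: power_mono)
   have "integrable Mosq (%x. (u x)\<^sup>2)" "integrable Mosq (%x. (v x)\<^sup>2)"
    using add * by (auto intro!: Bochner_Integration.integrable_bound[OF i])
   then show "trig_dense (%x. v x + u x)"
    using add by (intro trig_dense_add) (auto simp: L2_def)
  qed
 next
  case (seq U)
  show ?case
  proof
   assume i: "integrable Mosq (%x. (u x)\<^sup>2)"
   have um: "u \<in> borel_measurable Mosq"
    by (rule borel_measurable_LIMSEQ_real[of _ U]) (use seq in auto)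
   have le: "U n x <= u x" if "x \<in> space Mosq" for n x
    using seq.hyps(3) by (intro LIMSEQ_le_const[OF seq.hyps(4)[OF that]]) (auto simp: incseq_def le_fun_def)
   have i': "U n \<in> L2 Mosq" for n
    using seq le by (intro L2_I Bochner_Integration.integrable_bound[OF i]) (auto intro!: power_mono)
   have lim: "(%n. LINT x|Mosq. (u x - U n x)\<^sup>2) \<longlonglongrightarrow> (LINT x|Mosq. 0)"
   proof (rule integral_dominated_convergence[where w = "%x. (u x)\<^sup>2"])
    show "AE x in Mosq. (%n. (u x - U n x)\<^sup>2) \<longlonglongrightarrow> 0"
    proof (rule AE_I2)
     fix x assume "x \<in> space Mosq"
     then have "(%n. (u x - U n x)\<^sup>2) \<longlonglongrightarrow> (u x - u x)\<^sup>2" by (intro tendsto_intros seq)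
     then show "(%n. (u x - U n x)\<^sup>2) \<longlonglongrightarrow> 0" by simp
    qed
    show "AE x in Mosq. norm ((u x - U n x)^2) <= (u x)\<^sup>2" for n
     using seq.hyps(2) le by (auto intro!: AE_I2 power_mono)
   qed (use i um seq in auto)
   show "trig_dense u"
   proof (rule trig_dense_limit)
    fix e :: real assume "e > 0"
    have "\<forall>\<^sub>F n in sequentially. (LINT x|Mosq. (u x - U n x)\<^sup>2) < e"
     using order_tendstoD(2)[OF lim, of e] \<open>e > 0\<close> by simp
    then obtain n where "(LINT x|Mosq. (u x - U n x)\<^sup>2) < e"
     by (meson eventually_sequentially order_refl)
    then show "\<exists>v\<in>L2 Mosq. trig_dense v \<and> (LINT w|Mosq. (u w - v w)\<^sup>2) < e"
     using i' seq L2_integrable by blast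
   qed (use i um in \<open>auto simp: L2_def\<close>)
  qed
 qed
 then show ?thesis using assms by (auto simp: L2_def)
qed

lemma trig_dense_L2:
 assumes u: "u \<in> L2 Mosq"
 shows "trig_dense u"
proof -
 have m: "u \<in> borel_measurable Mosq" using u by (rule L2_measurable)
 have "(%w. max (u w) 0) \<in> L2 Mosq" "(%w. max (- u w) 0) \<in> L2 Mosq"
  using m by (auto intro!: L2_I Bochner_Integration.integrable_bound[OF L2_integrable[OF u]] simp: max_def)
 then have "trig_dense (%w. max (u w) 0 + (-1) * max (- u w) 0)"
  by (intro trig_dense_add trig_dense_cmult trig_dense_nonneg L2_cmult) auto
 moreover have "(%w. max (u w) 0 + (-1) * max (- u w) 0) = u" by (auto simp: max_def)
 ultimately show ?thesis by simp
qed

text \<open>For \<open>N = 1\<close> this is the sharp Poincare inequality of the unit square; the whole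
 family is Rellich's theorem in quantitative form.\<close>

theorem square_spectral_estimate:
 assumes H: "H1 osq u G" and N: "N \<ge> 1"
 shows "(LINT w|Mosq. (u w)\<^sup>2) <=
  (\<Sum>k\<in>{..<N}\<times>{..<N}. (LINT w|Mosq. u w * cmode (fst k) (snd k) w)\<^sup>2 / nu (fst k) (snd k))
  + (LINT w|Mosq. (norm (G w))\<^sup>2) / (pi^2 * (real N)^2)"
proof (rule field_le_epsilon)
 fix \<epsilon> :: real assume "\<epsilon> > 0"
 define c where "c = (%k. LINT w|Mosq. u w * cmode (fst k) (snd k) w)"
 define \<nu> where "\<nu> = (%k. nu (fst k) (snd k))"
 have nup: "\<nu> k > 0" for k by (simp add: \<nu>_def nu_pos)
 have uL: "u \<in> L2 Mosq" and GL: "!!i. (%w. G w $ i) \<in> L2 Mosq" using H1_D[OF H] by auto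
 obtain g where g: "trigp g" "(LINT w|Mosq. (u w - g w)\<^sup>2) < \<epsilon>"
  using trig_dense_L2[OF uL] \<open>\<epsilon> > 0\<close> unfolding trig_dense_def by blast
 obtain F0 a0 where F0: "finite F0" "g = (%w. \<Sum>k\<in>F0. a0 k * cmode (fst k) (snd k) w)"
  using trigp_repr[OF g(1)] by blast
 define B where "B = {..<N}\<times>{..<N}"
 \<comment> \<open>F contains both the modes of the approximant g and the block B, so that
   approximation error and tail are read off one finite sum.\<close>
 define F where "F = F0 \<union> B"
 have finF: "finite F" "B \<subseteq> F" using F0 by (auto simp: F_def B_def)
 define a where "a = (%k. if k \<in> F0 then a0 k else 0)"
 have g': "g = (%w. \<Sum>k\<in>F. a k * cmode (fst k) (snd k) w)"
  using F0 finF by (auto simp: F_def a_def fun_eq_iff intro!: sum.mono_neutral_cong_left)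
 have cL: "cmode m n \<in> L2 Mosq" "smode i m n \<in> L2 Mosq" for i m n
  by (intro L2_osq_bounded continuous_cmode continuous_smode)+
 have 1: "(LINT w|Mosq. (u w)\<^sup>2) - (\<Sum>k\<in>F. (c k)\<^sup>2 / \<nu> k) <= \<epsilon>"
 proof -
  have "(LINT w|Mosq. (u w)\<^sup>2) - (\<Sum>k\<in>F. (c k)\<^sup>2 / \<nu> k) <= (LINT w|Mosq. (u w - (\<Sum>k\<in>F. a k * cmode (fst k) (snd k) w))\<^sup>2)"
   unfolding c_def by (rule Bessel(2)) (use finF uL cL nup in \<open>auto simp: cmode_orth \<nu>_def prod_eq_iff\<close>)
  then show ?thesis using g unfolding g' by simp
 qed
 \<comment> \<open>By Green's formula the coefficients of the gradient with respect to
   \<open>smode\<close> are, up to sign, those of u times the frequency; Bessel's inequality for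
   both components then bounds the frequency-weighted sum.\<close>
 have G1: "real m * pi * c (m, n) = - (LINT w|Mosq. G w $ 1 * smode 1 m n w)"
  and G2: "real n * pi * c (m, n) = - (LINT w|Mosq. G w $ 2 * smode 2 m n w)" for m n
 proof -
  have "real m * pi * c (m, n) = (LINT w|Mosq. u w * (real m * pi * (cos (real m * pi * (w $ 1 + 1/2)) * cos (real n * pi * (w $ 2 + 1/2)))))"
   unfolding c_def by (subst Bochner_Integration.integral_mult_right_zero[symmetric]) (simp add: cmode_def mult_ac)
  then show "real m * pi * c (m, n) = - (LINT w|Mosq. G w $ 1 * smode 1 m n w)"
   using square_Green[OF H, of 1 2 m n] by (simp add: smode_def)
  have "real n * pi * c (m, n) = (LINT w|Mosq. u w * (real n * pi * (cos (real n * pi * (w $ 2 + 1/2)) * cos (real m * pi * (w $ 1 + 1/2)))))"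
   unfolding c_def by (subst Bochner_Integration.integral_mult_right_zero[symmetric]) (simp add: cmode_def mult_ac)
  then show "real n * pi * c (m, n) = - (LINT w|Mosq. G w $ 2 * smode 2 m n w)"
   using square_Green[OF H, of 2 1 n m] by (simp add: smode_def mult.commute)
 qed
 have B1: "(\<Sum>k\<in>F. (real (fst k) * pi * c k)\<^sup>2 / \<nu> k) <= (LINT w|Mosq. (G w $ 1)\<^sup>2)"
 proof -
  have "(\<Sum>k\<in>F. (real (fst k) * pi * c k)\<^sup>2 / \<nu> k) = (\<Sum>k\<in>{k\<in>F. fst k > 0}. (real (fst k) * pi * c k)\<^sup>2 / \<nu> k)"
   using finF by (intro sum.mono_neutral_right) auto
  also have "\<dots> = (\<Sum>k\<in>{k\<in>F. fst k > 0}. (LINT w|Mosq. G w $ 1 * smode 1 (fst k) (snd k) w)\<^sup>2 / \<nu> k)"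
   by (rule sum.cong) (use G1 in \<open>auto simp: power2_eq_square\<close>)
  also have "\<dots> <= (LINT w|Mosq. (G w $ 1)\<^sup>2)"
   by (rule Bessel(1)) (use finF GL cL nup in \<open>auto simp: smode_orth1 \<nu>_def prod_eq_iff\<close>)
  finally show ?thesis .
 qed
 have B2: "(\<Sum>k\<in>F. (real (snd k) * pi * c k)\<^sup>2 / \<nu> k) <= (LINT w|Mosq. (G w $ 2)\<^sup>2)"
 proof -
  have "(\<Sum>k\<in>F. (real (snd k) * pi * c k)\<^sup>2 / \<nu> k) = (\<Sum>k\<in>{k\<in>F. snd k > 0}. (real (snd k) * pi * c k)\<^sup>2 / \<nu> k)"
   using finF by (intro sum.mono_neutral_right) auto
  also have "\<dots> = (\<Sum>k\<in>{k\<in>F. snd k > 0}. (LINT w|Mosq. G w $ 2 * smode 2 (fst k) (snd k) w)\<^sup>2 / \<nu> k)"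
   by (rule sum.cong) (use G2 in \<open>auto simp: power2_eq_square\<close>)
  also have "\<dots> <= (LINT w|Mosq. (G w $ 2)\<^sup>2)"
   by (rule Bessel(1)) (use finF GL cL nup in \<open>auto simp: smode_orth2 \<nu>_def prod_eq_iff\<close>)
  finally show ?thesis .
 qed
 \<comment> \<open>Outside the block one index is at least N, so each coefficient comes with a
   squared frequency of at least pi^2 N^2.\<close>
 have "(\<Sum>k\<in>F-B. (c k)\<^sup>2 / \<nu> k) * (pi^2 * (real N)^2) <= (\<Sum>k\<in>F-B. (real (fst k) * pi * c k)\<^sup>2 / \<nu> k + (real (snd k) * pi * c k)^2 / \<nu> k)"
  unfolding sum_distrib_right
 proof (rule sum_mono)
  fix k assume "k \<in> F - B"
  then have "fst k \<ge> N \<or> snd k \<ge> N" by (cases k) (auto simp: B_def)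
  then have "(real N)^2 <= (real (fst k))\<^sup>2 + (real (snd k))^2"
  proof
   assume "fst k \<ge> N"
   then have "(real N)^2 <= (real (fst k))\<^sup>2" by (intro power_mono) auto
   then show ?thesis by (simp add: add_increasing2)
  next
   assume "snd k \<ge> N"
   then have "(real N)^2 <= (real (snd k))\<^sup>2" by (intro power_mono) auto
   then show ?thesis by (simp add: add_increasing)
  qed
  then have "((c k)^2 / \<nu> k * pi^2) * (real N)^2 <= ((c k)^2 / \<nu> k * pi^2) * ((real (fst k))^2 + (real (snd k))^2)"
   using nup[of k] by (intro mult_left_mono) auto
  then show "(c k)^2 / \<nu> k * (pi^2 * (real N)^2) <= (real (fst k) * pi * c k)\<^sup>2 / \<nu> k + (real (snd k) * pi * c k)^2 / \<nu> k"
   by (simp add: algebra_simps power_mult_distrib add_divide_distrib)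
 qed
 also have "\<dots> <= (\<Sum>k\<in>F. (real (fst k) * pi * c k)\<^sup>2 / \<nu> k + (real (snd k) * pi * c k)^2 / \<nu> k)"
  using finF nup by (intro sum_mono2) (auto intro!: add_nonneg_nonneg divide_nonneg_pos)
 also have "\<dots> <= (LINT w|Mosq. (norm (G w))\<^sup>2)"
  unfolding integral_norm_sq[OF GL] sum.distrib using B1 B2 by simp
 finally have "(\<Sum>k\<in>F-B. (c k)\<^sup>2 / \<nu> k) <= (LINT w|Mosq. (norm (G w))\<^sup>2) / (pi^2 * (real N)^2)"
  using N by (simp add: pos_le_divide_eq)
 moreover have "(\<Sum>k\<in>F. (c k)\<^sup>2 / \<nu> k) = (\<Sum>k\<in>F-B. (c k)\<^sup>2 / \<nu> k) + (\<Sum>k\<in>B. (c k)\<^sup>2 / \<nu> k)"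
  using finF by (simp add: sum.subset_diff)
 ultimately show "(LINT w|Mosq. (u w)\<^sup>2) <=
  (\<Sum>k\<in>{..<N}\<times>{..<N}. (LINT w|Mosq. u w * cmode (fst k) (snd k) w)\<^sup>2 / nu (fst k) (snd k))
  + (LINT w|Mosq. (norm (G w))\<^sup>2) / (pi^2 * (real N)^2) + \<epsilon>"
  using 1 by (simp add: c_def \<nu>_def B_def)
qed

section \<open>The direct method on bounded domains\<close>

lemma bounded_family_convergent_subsequence:
 fixes a :: "nat => nat => real"
 assumes bd: "!!k. \<exists>C. \<forall>n. \<bar>a n k\<bar> <= C"
 shows "\<exists>r. strict_mono r \<and> (\<forall>k. convergent (%n. a (r n) k))"
proof -
 interpret subseqs "%k s. convergent (%n. a (s n) k)"
 proof
  fix k and s :: "nat => nat"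
  obtain C where C: "\<forall>n. \<bar>a n k\<bar> <= C" using bd by blast
  then have "bounded (range (%n. a (s n) k))" by (auto simp: bounded_iff)
  from bounded_imp_convergent_subsequence[OF this] obtain l r where "strict_mono r" "((%n. a (s n) k) \<circ> r) \<longlonglongrightarrow> l"
   by blast
  then show "\<exists>r'. strict_mono r' \<and> convergent (%n. a ((s \<circ> r') n) k)"
   by (auto simp: o_def convergent_def)
 qed
 have "convergent (%n. a (diagseq n) k)" for k
 proof -
  \<comment> \<open>The shift by \<open>Suc k\<close> is needed because only the tail of the
    diagonal sequence is a subsequence of the k-th one.\<close>
  have "convergent (%n. a ((diagseq \<circ> (+) (Suc k)) n) k)"
  proof (rule diagseq_holds)
   fix k and r s :: "nat => nat" assume "strict_mono r" "convergent (%n. a (s n) k)"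
   then show "convergent (%n. a ((s \<circ> r) n) k)"
    using convergent_subseq_convergent[of "%n. a (s n) k" r] by (simp add: o_def)
  qed
  then have "convergent (%n. a (diagseq (n + Suc k)) k)" by (simp add: o_def add.commute)
  then show ?thesis by (simp only: convergent_ignore_initial_segment[of "%n. a (diagseq n) k"])
 qed
 then show ?thesis using subseq_diagseq by blast
qed

text \<open>A quantitative form of the compactness of the embedding of \<open>H\<^sup>1(\<Omega>)\<close> into \<open>L\<^sup>2(\<Omega>)\<close>.\<close>

definition rellich :: "(real^2) set => bool" where
 "rellich \<Omega> \<longleftrightarrow> (\<exists>C>0. \<exists>e :: nat \<times> nat => real^2 => real. (\<forall>k. e k \<in> L2 (lebesgue_on \<Omega>)) \<and>
   (LINT x|lebesgue_on \<Omega>. e (0, 0) x) \<noteq> 0 \<and>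
   (\<forall>N\<ge>1. \<forall>u G. H1 \<Omega> u G --> (LINT x|lebesgue_on \<Omega>. (u x)\<^sup>2) <=
    C * ((\<Sum>k\<in>{..<N}\<times>{..<N}. (LINT x|lebesgue_on \<Omega>. u x * e k x)\<^sup>2)
       + (LINT x|lebesgue_on \<Omega>. (norm (G x))\<^sup>2) / (real N)^2)))"

locale bounded_domain =
 fixes \<Omega> :: "(real^2) set"
 assumes bounded: "bounded \<Omega>" and open_dom: "open \<Omega>" and rellich: "rellich \<Omega>"
begin

abbreviation "M \<equiv> lebesgue_on \<Omega>"

abbreviation nrm :: "(real^2 => real) => real" where
 "nrm u \<equiv> (LINT x|M. (u x)\<^sup>2)"

abbreviation dir :: "(real^2 => real^2) => (real^2 => real^2) => real" where
 "dir F G \<equiv> (LINT x|M. F x \<bullet> G x)"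

lemma sets_dom: "\<Omega> \<in> sets lebesgue"
 using open_dom by auto

lemma fin: "finite_measure M"
 by (rule finite_measure_lebesgue_on_bounded[OF bounded sets_dom])

lemma one_L2: "(%x. c) \<in> L2 M"
proof -
 interpret finite_measure M by (rule fin)
 show ?thesis by (simp add: L2_def)
qed

lemma L2_test:
 assumes "test_function \<Omega> \<phi>"
 shows "\<phi> \<in> L2 M" "(%x. gradient \<phi> x $ i) \<in> L2 M"
proof -
 obtain G K where G: "contU G" "compact K" "!!x. x \<notin> K ==> \<phi> x = 0" "!!x. gradient \<phi> x = G x" "contU \<phi>"
  using assms by (rule test_functionE) blast
 have *: "f \<in> L2 M" if f: "contU f" for f :: "real^2 => real"
 proof -
  have "bounded (closure \<Omega>)" using bounded by (rule bounded_closure)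
  then have "compact (f ` closure \<Omega>)"
   using f by (meson closed_closure compact_continuous_image compact_eq_bounded_closed continuous_on_subset subset_UNIV)
  then obtain B where "!!w. w \<in> closure \<Omega> ==> \<bar>f w\<bar> <= B"
   using compact_imp_bounded[of "f ` closure \<Omega>"] unfolding bounded_iff by auto
  then show ?thesis
   using closure_subset[of \<Omega>]
   by (intro L2_bounded[OF _ fin, of _ B] continuous_imp_measurable_on_sets_lebesgue[OF continuous_on_subset[OF f]] sets_dom) auto
 qed
 show "\<phi> \<in> L2 M" using G by (intro *)
 show "(%x. gradient \<phi> x $ i) \<in> L2 M" using G by (intro *) (auto intro!: continuous_intros)
qed

lemma inner2: "(x::real^2) \<bullet> y = x$1 * y$1 + x$2 * y$2"
 by (simp add: inner_vec_def sum_2)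

lemma H1_iff:
 "H1 \<Omega> u G \<longleftrightarrow> u \<in> L2 M \<and> (\<forall>i. (%x. G x $ i) \<in> L2 M) \<and>
  (\<forall>\<phi>. test_function \<Omega> \<phi> --> (\<forall>i. (LINT x|M. u x * gradient \<phi> x $ i) = - (LINT x|M. G x $ i * \<phi> x)))"
  (is "_ \<longleftrightarrow> ?R")
proof
 assume "H1 \<Omega> u G"
 then show ?R using H1_D by blast
next
 assume R: ?R
 have m: "G \<in> borel_measurable M"
  unfolding borel_measurable_euclidean_space[of G] UNIV_Basis2 using R L2_measurable by (auto simp: inner_axis)
 have "integrable M (%x. (norm (G x))\<^sup>2)"
  unfolding norm_vec2_sq using R by (intro lint_integrable_add L2_integrable) auto
 then show "H1 \<Omega> u G" using R m L2_measurable L2_integrable unfolding H1_def by blast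
qed

lemma H1_lin:
 assumes u: "H1 \<Omega> u G" and v: "H1 \<Omega> v F"
 shows "H1 \<Omega> (%x. u x + t * v x) (%x. G x + t *\<^sub>R F x)"
 unfolding H1_iff
proof (intro conjI allI impI)
 show "(%x. u x + t * v x) \<in> L2 M" by (intro L2_add L2_cmult H1_D(1)[OF u] H1_D(1)[OF v])
 show "(%x. (G x + t *\<^sub>R F x) $ i) \<in> L2 M" for i
  using L2_add[OF H1_D(2)[OF u, of i] L2_cmult[OF H1_D(2)[OF v, of i], of t]] by simp
 fix \<phi> i assume \<phi>: "test_function \<Omega> \<phi>"
 note p = L2_mult_integrable[OF H1_D(1)[OF u] L2_test(2)[OF \<phi>, of i]] L2_mult_integrable[OF H1_D(1)[OF v] L2_test(2)[OF \<phi>, of i]]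
  L2_mult_integrable[OF H1_D(2)[OF u, of i] L2_test(1)[OF \<phi>]] L2_mult_integrable[OF H1_D(2)[OF v, of i] L2_test(1)[OF \<phi>]]
 have "(LINT x|M. (u x + t * v x) * gradient \<phi> x $ i) = (LINT x|M. u x * gradient \<phi> x $ i) + t * (LINT x|M. v x * gradient \<phi> x $ i)"
  using p by (simp add: distrib_right mult.assoc)
 also have "\<dots> = - ((LINT x|M. G x $ i * \<phi> x) + t * (LINT x|M. F x $ i * \<phi> x))"
  using H1_D(4)[OF u \<phi>, of i] H1_D(4)[OF v \<phi>, of i] by simp
 also have "(LINT x|M. G x $ i * \<phi> x) + t * (LINT x|M. F x $ i * \<phi> x) = (LINT x|M. (G x + t *\<^sub>R F x) $ i * \<phi> x)"
  using p by (simp add: distrib_right mult.assoc)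
 finally show "(LINT x|M. (u x + t * v x) * gradient \<phi> x $ i) = - (LINT x|M. (G x + t *\<^sub>R F x) $ i * \<phi> x)" .
qed

text \<open>Partial derivatives of test functions integrate to zero, so the zero field satisfies the
  weak-gradient identity.\<close>

lemma H1_const: "H1 \<Omega> (%x. c) (%x. 0)"
 unfolding H1_iff
proof (intro conjI allI impI)
 fix \<phi> i assume \<phi>: "test_function \<Omega> \<phi>"
 obtain G K where G: "!!x. (\<phi> has_derivative (%h. G x \<bullet> h)) (at x)" "contU G"
  "compact K" "K \<subseteq> \<Omega>" "!!x. x \<notin> K ==> \<phi> x = 0" "!!x. gradient \<phi> x = G x" "contU \<phi>"
  using \<phi> by (rule test_functionE) blast
 have "G x $ i = 0" if "x \<notin> \<Omega>" for x
 proof -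
  have "x \<notin> K" using that G by auto
  have "((%x. 0) has_derivative (%h. G x \<bullet> h)) (at x)"
   by (rule has_derivative_transform_within_open[OF G(1), of "- K"])
     (use G \<open>x \<notin> K\<close> in \<open>auto simp: compact_imp_closed open_Compl\<close>)
  then have "(%h. G x \<bullet> h) = (%h. 0)" using has_derivative_const has_derivative_unique by blast
  then show ?thesis by (metis inner_eq_zero_iff zero_index)
 qed
 then have "(LINT x|M. G x $ i) = (LINT x|lebesgue. G x $ i)"
  using sets_dom by (subst integral_restrict_space) (auto simp: indicator_def intro!: lint_cong0)
 also have "\<dots> = (LINT x|lborel. G x $ i)"
  by (intro integral_completion) (use G in \<open>auto intro!: borel_measurable_continuous_onI continuous_intros\<close>)
 also have "\<dots> = 0" using integral_derivative_eq_0[OF G(1,2,3,5)] .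
 finally show "(LINT x|M. c * gradient \<phi> x $ i) = - (LINT x|M. 0 $ i * \<phi> x)" by (simp add: G)
qed (auto simp: one_L2)

lemma dir_integrable: "H1 \<Omega> u G ==> H1 \<Omega> v F ==> integrable M (%x. G x \<bullet> F x)"
 unfolding inner2 by (intro lint_integrable_add L2_mult_integrable) (auto dest: H1_D(2))

lemma dir_expand:
 assumes u: "H1 \<Omega> u G" and v: "H1 \<Omega> v F"
 shows "dir (%x. G x + t *\<^sub>R F x) (%x. G x + t *\<^sub>R F x) = dir G G + 2 * t * dir G F + t^2 * dir F F"
proof -
 have "(%x. (G x + t *\<^sub>R F x) \<bullet> (G x + t *\<^sub>R F x)) = (%x. G x \<bullet> G x + 2 * t * (G x \<bullet> F x) + t^2 * (F x \<bullet> F x))"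
  by (auto simp: inner_add_left inner_add_right inner_commute power2_eq_square algebra_simps)
 then show ?thesis using dir_integrable u v by simp
qed

lemma dir_nonneg: "dir G G \<ge> 0" by simp

lemma dir_norm: "dir G G = (LINT x|M. (norm (G x))\<^sup>2)"
 by (simp add: power2_norm_eq_inner)

text \<open>For a fixed test function the weak-gradient identity is linear in u and in its gradient,
  hence stable under L2 limits of u and of each component.\<close>

lemma H1_closed:
 assumes H: "!!n. H1 \<Omega> (U n) (\<Gamma> n)"
  and cu: "!!e. e > 0 ==> \<exists>N. \<forall>m\<ge>N. \<forall>n\<ge>N. nrm (%x. U m x - U n x) < e"
  and cg: "!!e. e > 0 ==> \<exists>N. \<forall>m\<ge>N. \<forall>n\<ge>N. dir (%x. \<Gamma> m x - \<Gamma> n x) (%x. \<Gamma> m x - \<Gamma> n x) < e"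
 obtains u G where "H1 \<Omega> u G" "(%n. nrm (%x. U n x - u x)) \<longlonglongrightarrow> 0" "(%n. dir (\<Gamma> n) (\<Gamma> n)) \<longlonglongrightarrow> dir G G"
proof -
 obtain u where u: "u \<in> L2 M" "(%n. nrm (%x. U n x - u x)) \<longlonglongrightarrow> 0"
  by (rule L2_complete[OF fin H1_D(1)[OF H] cu]) auto
 have "\<exists>g. g \<in> L2 M \<and> (%n. LINT x|M. (\<Gamma> n x $ i - g x)\<^sup>2) \<longlonglongrightarrow> 0" for i
 proof -
  have "\<exists>N. \<forall>m\<ge>N. \<forall>n\<ge>N. (LINT x|M. (\<Gamma> m x $ i - \<Gamma> n x $ i)\<^sup>2) < e" if e0: "e > 0" for e
  proof -
   obtain N where N: "\<forall>m\<ge>N. \<forall>n\<ge>N. dir (%x. \<Gamma> m x - \<Gamma> n x) (%x. \<Gamma> m x - \<Gamma> n x) < e"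
    using cg[OF e0] by blast
   have "(LINT x|M. (\<Gamma> m x $ i - \<Gamma> n x $ i)\<^sup>2) <= dir (%x. \<Gamma> m x - \<Gamma> n x) (%x. \<Gamma> m x - \<Gamma> n x)" for m n
   proof (rule integral_mono)
    show "integrable M (%x. (\<Gamma> m x $ i - \<Gamma> n x $ i)\<^sup>2)"
     by (intro L2_integrable L2_diff H1_D(2)[OF H])
    have "H1 \<Omega> (%x. U m x + (-1) * U n x) (%x. \<Gamma> m x + (-1) *\<^sub>R \<Gamma> n x)" by (rule H1_lin[OF H H])
    from dir_integrable[OF this this] show "integrable M (%x. (\<Gamma> m x - \<Gamma> n x) \<bullet> (\<Gamma> m x - \<Gamma> n x))" by simp
    show "(\<Gamma> m x $ i - \<Gamma> n x $ i)^2 <= (\<Gamma> m x - \<Gamma> n x) \<bullet> (\<Gamma> m x - \<Gamma> n x)" for x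
     using power_mono[OF component_le_norm_cart[of "\<Gamma> m x - \<Gamma> n x" i] abs_ge_zero, of 2]
     by (simp add: power2_norm_eq_inner)
   qed
   then show ?thesis using N by (meson le_less_trans)
  qed
  from L2_complete[OF fin H1_D(2)[OF H, of _ i] this] show ?thesis by blast
 qed
 then have "\<exists>g. \<forall>i. g i \<in> L2 M \<and> (%n. LINT x|M. (\<Gamma> n x $ i - g i x)\<^sup>2) \<longlonglongrightarrow> 0"
  by (intro choice allI)
 then obtain g where g: "!!i. g i \<in> L2 M" "!!i. (%n. LINT x|M. (\<Gamma> n x $ i - g i x)\<^sup>2) \<longlonglongrightarrow> 0"
  by blast
 define G :: "real^2 => real^2" where "G = (%x. \<chi> i. g i x)"
 have "H1 \<Omega> u G"
  unfolding H1_iff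
 proof (intro conjI allI impI)
  show "u \<in> L2 M" by (rule u)
  show "(%x. G x $ i) \<in> L2 M" for i using g by (simp add: G_def)
  fix \<phi> i assume \<phi>: "test_function \<Omega> \<phi>"
  have "(%n. LINT x|M. U n x * gradient \<phi> x $ i) \<longlonglongrightarrow> (LINT x|M. u x * gradient \<phi> x $ i)"
   by (rule L2_product_tendsto[OF u(1) H1_D(1)[OF H] u(2) L2_test(2)[OF \<phi>]])
  moreover have "(%n. - (LINT x|M. \<Gamma> n x $ i * \<phi> x)) \<longlonglongrightarrow> - (LINT x|M. g i x * \<phi> x)"
   by (intro tendsto_minus L2_product_tendsto[OF g(1) H1_D(2)[OF H] g(2) L2_test(1)[OF \<phi>]])
  moreover have "(LINT x|M. U n x * gradient \<phi> x $ i) = - (LINT x|M. \<Gamma> n x $ i * \<phi> x)" for n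
   using H1_D(4)[OF H \<phi>] .
  ultimately show "(LINT x|M. u x * gradient \<phi> x $ i) = - (LINT x|M. G x $ i * \<phi> x)"
   using LIMSEQ_unique by (simp add: G_def)
 qed
 moreover have "(%n. dir (\<Gamma> n) (\<Gamma> n)) \<longlonglongrightarrow> dir G G"
 proof -
  have "(%n. (LINT x|M. (\<Gamma> n x $ 1)\<^sup>2) + (LINT x|M. (\<Gamma> n x $ 2)\<^sup>2)) \<longlonglongrightarrow> (LINT x|M. (g 1 x)\<^sup>2) + (LINT x|M. (g 2 x)\<^sup>2)"
   by (intro tendsto_add L2_norm_tendsto[OF g(1) H1_D(2)[OF H] g(2)])
  moreover have "dir (\<Gamma> n) (\<Gamma> n) = (LINT x|M. (\<Gamma> n x $ 1)\<^sup>2) + (LINT x|M. (\<Gamma> n x $ 2)\<^sup>2)" for n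
   unfolding dir_norm by (rule integral_norm_sq) (rule H1_D(2)[OF H])
  moreover have "dir G G = (LINT x|M. (g 1 x)\<^sup>2) + (LINT x|M. (g 2 x)\<^sup>2)"
   unfolding dir_norm by (subst integral_norm_sq) (auto simp: G_def g)
  ultimately show ?thesis by simp
 qed
 ultimately show ?thesis using that u by blast
qed

text \<open>A diagonal sequence makes every coefficient converge. The gradient term in
  \<open>rellich\<close> is uniformly small for large N, and only finitely many coefficients
  remain.\<close>

lemma Rellich_subsequence:
 assumes H: "!!n. H1 \<Omega> (U n) (\<Gamma> n)" and bu: "!!n. nrm (U n) <= B" and bg: "!!n. dir (\<Gamma> n) (\<Gamma> n) <= B"
 obtains r where "strict_mono (r :: nat => nat)"
  "!!e. e > 0 ==> \<exists>N. \<forall>m\<ge>N. \<forall>n\<ge>N. nrm (%x. U (r m) x - U (r n) x) < e"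
proof -
 obtain C e where C: "C > 0" and e: "!!k. e k \<in> L2 M" and est: "!!N u G. N \<ge> 1 ==> H1 \<Omega> u G ==>
   nrm u <= C * ((\<Sum>k\<in>{..<N}\<times>{..<N}. (LINT x|M. u x * e k x)\<^sup>2) + (LINT x|M. (norm (G x))\<^sup>2) / (real N)^2)"
  using rellich unfolding rellich_def by blast
 have B: "B \<ge> 0" using dir_nonneg[of "\<Gamma> 0"] bg[of 0] by linarith
 define a where "a = (%n k. LINT x|M. U n x * e (prod_decode k) x)"
 have "\<exists>C. \<forall>n. \<bar>a n k\<bar> <= C" for k
 proof (intro exI allI)
  fix n
  have "(a n k)^2 <= nrm (U n) * nrm (e (prod_decode k))"
   unfolding a_def by (rule L2_Cauchy_Schwarz[OF H1_D(1)[OF H] e])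
  also have "\<dots> <= B * nrm (e (prod_decode k))" by (intro mult_right_mono bu) simp
  finally show "\<bar>a n k\<bar> <= sqrt (B * nrm (e (prod_decode k)))"
   using real_le_rsqrt by (metis power2_abs)
 qed
 from bounded_family_convergent_subsequence[of a, OF this] obtain r where r: "strict_mono r" "!!k. convergent (%n. a (r n) k)"
  by blast
 have conv: "convergent (%n. LINT x|M. U (r n) x * e k x)" for k
  using r(2)[of "prod_encode k"] by (simp add: a_def)
 show ?thesis
 proof (rule that[OF r(1)])
  fix \<epsilon> :: real assume "\<epsilon> > 0"
  \<comment> \<open>N is fixed before the indices: the gradient of a difference has squared norm at
    most 4B, so the remainder is below half of the tolerance for all pairs at once.\<close>
  obtain N :: nat where N: "N \<ge> 1" "C * (4 * B / (real N)^2) < \<epsilon> / 2"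
  proof -
   have "(%N. C * (4 * B) * (inverse (real (Suc N)) * inverse (real (Suc N)))) \<longlonglongrightarrow> C * (4 * B) * (0 * 0)"
    by (intro tendsto_intros LIMSEQ_inverse_real_of_nat)
   then have ev: "\<forall>\<^sub>F N in sequentially. C * (4 * B) * (inverse (real (Suc N)) * inverse (real (Suc N))) < \<epsilon> / 2"
    using \<open>\<epsilon> > 0\<close> by (intro order_tendstoD(2)) auto
   then obtain N where "C * (4 * B) * (inverse (real (Suc N)) * inverse (real (Suc N))) < \<epsilon> / 2"
    using eventually_happens[OF ev] by auto
   moreover have "C * (4 * B / (real (Suc N))^2) = C * (4 * B) * (inverse (real (Suc N)) * inverse (real (Suc N)))"
    by (simp only: power2_eq_square divide_inverse inverse_mult_distrib mult.assoc)
   ultimately show ?thesis by (intro that[of "Suc N"]) simp_all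
  qed
  define b where "b = (%n k. LINT x|M. U (r n) x * e k x)"
  define D where "D = real N * real N"
  have D: "D > 0" using N by (simp add: D_def)
  have "\<forall>k\<in>{..<N}\<times>{..<N}. \<exists>n0. \<forall>m\<ge>n0. \<forall>n\<ge>n0. \<bar>b m k - b n k\<bar> < sqrt (\<epsilon> / (2 * C * D))"
  proof
   fix k :: "nat \<times> nat"
   have "Cauchy (%n. b n k)" using conv[of k] by (simp add: b_def Cauchy_convergent_iff)
   moreover have "sqrt (\<epsilon> / (2 * C * D)) > 0" using \<open>\<epsilon> > 0\<close> C D by simp
   ultimately show "\<exists>n0. \<forall>m\<ge>n0. \<forall>n\<ge>n0. \<bar>b m k - b n k\<bar> < sqrt (\<epsilon> / (2 * C * D))"
    unfolding Cauchy_def dist_real_def by blast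
  qed
  then obtain n0 where n0: "!!k m n. k \<in> {..<N}\<times>{..<N} ==> m \<ge> n0 k ==> n \<ge> n0 k ==> \<bar>b m k - b n k\<bar> < sqrt (\<epsilon> / (2 * C * D))"
   by metis
  define n1 where "n1 = Max (n0 ` ({..<N}\<times>{..<N}))"
  have n1: "n0 k <= n1" if "k \<in> {..<N}\<times>{..<N}" for k
   unfolding n1_def using that by (intro Max_ge) auto
  have "nrm (%x. U (r m) x - U (r n) x) < \<epsilon>" if mn: "m \<ge> n1" "n \<ge> n1" for m n
  proof -
   have h: "H1 \<Omega> (%x. U (r m) x + (-1) * U (r n) x) (%x. \<Gamma> (r m) x + (-1) *\<^sub>R \<Gamma> (r n) x)" by (rule H1_lin[OF H H])
   have bd: "(LINT x|M. (U (r m) x - U (r n) x) * e k x) = b m k - b n k" for k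
    using L2_mult_integrable[OF H1_D(1)[OF H] e[of k]] by (simp add: b_def left_diff_distrib)
   have g: "(LINT x|M. (norm (\<Gamma> (r m) x - \<Gamma> (r n) x))\<^sup>2) <= 4 * B"
   proof -
    have "(LINT x|M. (norm (\<Gamma> (r m) x - \<Gamma> (r n) x))\<^sup>2) <= (LINT x|M. 2 * (\<Gamma> (r m) x \<bullet> \<Gamma> (r m) x) + 2 * (\<Gamma> (r n) x \<bullet> \<Gamma> (r n) x))"
    proof (rule integral_mono)
     show "integrable M (%x. (norm (\<Gamma> (r m) x - \<Gamma> (r n) x))\<^sup>2)" using H1_D(3)[OF h] by simp
     show "integrable M (%x. 2 * (\<Gamma> (r m) x \<bullet> \<Gamma> (r m) x) + 2 * (\<Gamma> (r n) x \<bullet> \<Gamma> (r n) x))"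
      using dir_integrable[OF H H] by auto
     show "(norm (\<Gamma> (r m) x - \<Gamma> (r n) x))^2 <= 2 * (\<Gamma> (r m) x \<bullet> \<Gamma> (r m) x) + 2 * (\<Gamma> (r n) x \<bullet> \<Gamma> (r n) x)" for x
     proof -
      have "0 <= (\<Gamma> (r m) x + \<Gamma> (r n) x) \<bullet> (\<Gamma> (r m) x + \<Gamma> (r n) x)" by simp
      then show ?thesis by (simp add: power2_norm_eq_inner inner_add_left inner_add_right inner_diff_left inner_diff_right inner_commute)
     qed
    qed
    also have "\<dots> = 2 * dir (\<Gamma> (r m)) (\<Gamma> (r m)) + 2 * dir (\<Gamma> (r n)) (\<Gamma> (r n))"
     using dir_integrable[OF H H] by simp
    also have "\<dots> <= 4 * B" using bg[of "r m"] bg[of "r n"] by simp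
    finally show ?thesis .
   qed
   have "(\<Sum>k\<in>{..<N}\<times>{..<N}. (b m k - b n k)\<^sup>2) <= (\<Sum>k\<in>{..<N}\<times>{..<N}. \<epsilon> / (2 * C * D))"
   proof (rule sum_mono)
    fix k assume k: "k \<in> {..<N}\<times>{..<N}"
    have "\<bar>b m k - b n k\<bar> <= sqrt (\<epsilon> / (2 * C * D))" using n0[OF k, of m n] n1[OF k] mn by simp
    from power_mono[OF this abs_ge_zero, of 2] show "(b m k - b n k)^2 <= \<epsilon> / (2 * C * D)"
     using \<open>\<epsilon> > 0\<close> C D by simp
   qed
   also have "\<dots> = \<epsilon> / (2 * C)" using N(1) by (simp add: D_def)
   finally have s: "(\<Sum>k\<in>{..<N}\<times>{..<N}. (b m k - b n k)\<^sup>2) <= \<epsilon> / (2 * C)" .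
   have "nrm (%x. U (r m) x - U (r n) x) <= C * ((\<Sum>k\<in>{..<N}\<times>{..<N}. (b m k - b n k)\<^sup>2) + (LINT x|M. (norm (\<Gamma> (r m) x - \<Gamma> (r n) x))\<^sup>2) / (real N)^2)"
    using est[OF N(1) h] by (simp add: bd)
   also have "\<dots> <= C * (\<epsilon> / (2 * C) + 4 * B / (real N)^2)"
    using s g C by (intro mult_left_mono add_mono divide_right_mono) auto
   also have "\<dots> < \<epsilon>" using N(2) C by (simp add: distrib_left)
   finally show ?thesis .
  qed
  then show "\<exists>N. \<forall>m\<ge>N. \<forall>n\<ge>N. nrm (%x. U (r m) x - U (r n) x) < \<epsilon>" by blast
 qed
qed

lemma integral_L2_one: "u \<in> L2 M ==> integrable M u"
 using L2_mult_integrable[OF _ one_L2[of 1], of u] by simp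

text \<open>For N = 1 the estimate in \<open>rellich\<close> contains a single coefficient. Since
  \<open>e (0, 0)\<close> has nonzero integral, subtracting a suitable constant makes it vanish;
  then u equals that constant almost everywhere, and the mean forces it to be 0.\<close>

lemma zero_gradient_imp_const:
 assumes H: "H1 \<Omega> u G" and G: "dir G G = 0" and u: "(LINT x|M. u x) = 0"
 shows "nrm u = 0"
proof -
 obtain C e where C: "C > 0" and e: "!!k. e k \<in> L2 M" "(LINT x|M. e (0,0) x) \<noteq> 0" and est: "!!N u G. N \<ge> 1 ==> H1 \<Omega> u G ==>
   nrm u <= C * ((\<Sum>k\<in>{..<N}\<times>{..<N}. (LINT x|M. u x * e k x)\<^sup>2) + (LINT x|M. (norm (G x))\<^sup>2) / (real N)^2)"
  using rellich unfolding rellich_def by blast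
 define c where "c = (LINT x|M. u x * e (0,0) x) / (LINT x|M. e (0,0) x)"
 have h: "H1 \<Omega> (%x. u x + (- c) * 1) (%x. G x + (- c) *\<^sub>R 0)" by (rule H1_lin[OF H H1_const])
 have "(LINT x|M. (u x + (- c) * 1) * e (0,0) x) = (LINT x|M. u x * e (0,0) x) - c * (LINT x|M. e (0,0) x)"
  using L2_mult_integrable[OF H1_D(1)[OF H] e(1)] integral_L2_one[OF e(1)] by (simp add: left_diff_distrib)
 also have "\<dots> = 0" using e(2) by (simp add: c_def)
 finally have z: "(LINT x|M. (u x + (- c) * 1) * e (0,0) x) = 0" .
 have one: "{..<1::nat} \<times> {..<1::nat} = {(0,0)}" by auto
 have "nrm (%x. u x + (- c) * 1) <= C * (0 + dir G G)"
  using est[of 1, OF _ h] unfolding one by (simp add: z[simplified] dir_norm)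
 then have "nrm (%x. u x + (- c) * 1) <= 0" using G by simp
 moreover have "nrm (%x. u x + (- c) * 1) = nrm u + c^2 * (LINT x|M. 1)"
  using integral_square_expand[OF H1_D(1)[OF H] one_L2[of 1], of "- c"] u by simp
 ultimately have "nrm u + c^2 * (LINT x|M. 1) <= 0" by simp
 moreover have "c^2 * (LINT x|M. 1) \<ge> 0" by simp
 moreover have "nrm u \<ge> 0" by simp
 ultimately show ?thesis by linarith
qed

text \<open>The direct method: a minimizing sequence of the Rayleigh quotient on mean-zero functions
 converges in \<open>L\<^sup>2\<close> along a subsequence, and by the parallelogram identity also in \<open>H\<^sup>1\<close>.\<close>

theorem exists_eigenvalue_le_Rayleigh:
 assumes f: "H1 \<Omega> f F" and f0: "(LINT x|M. f x) = 0" and fne: "nrm f > 0"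
 obtains \<mu> where "neumann_eigenvalue \<Omega> \<mu>" "\<mu> > 0" "\<mu> * nrm f <= dir F F"
proof -
 define Q where "Q = {dir G G | u G. H1 \<Omega> u G \<and> (LINT x|M. u x) = 0 \<and> nrm u = 1}"
 define \<mu> where "\<mu> = Inf Q"
 have Q0: "x \<ge> 0" if "x \<in> Q" for x using that by (auto simp: Q_def)
 have scale: "H1 \<Omega> (%x. t * u x) (%x. t *\<^sub>R G x)" if "H1 \<Omega> u G" for t u G
  using H1_lin[OF H1_const[of 0] that, of t] by simp
 have unit: "dir G G / nrm u \<in> Q" if u: "H1 \<Omega> u G" "(LINT x|M. u x) = 0" "nrm u > 0" for u G
 proof -
  define t where "t = 1 / sqrt (nrm u)"
  have t2: "t^2 = 1 / nrm u" using u(3) by (simp add: t_def power_divide)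
  have "dir (%x. t *\<^sub>R G x) (%x. t *\<^sub>R G x) = t^2 * dir G G"
   by (simp add: power2_eq_square mult.assoc)
  then have "dir G G / nrm u = dir (%x. t *\<^sub>R G x) (%x. t *\<^sub>R G x)" using t2 by simp
  moreover have "nrm (%x. t * u x) = 1" using t2 u(3) by (simp add: power_mult_distrib)
  moreover have "(LINT x|M. t * u x) = 0" using u(2) by simp
  ultimately show ?thesis using scale[OF u(1), of t] unfolding Q_def
   by (intro CollectI exI[of _ "%x. t * u x"] exI[of _ "%x. t *\<^sub>R G x"] conjI)
 qed
 have bdd: "bdd_below Q" using Q0 by (rule bdd_belowI)
 have Qne: "Q \<noteq> {}" using unit[OF f f0 fne] by fast
 have mu_le: "\<mu> * nrm u <= dir G G" if "H1 \<Omega> u G" "(LINT x|M. u x) = 0" for u G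
 proof (cases "nrm u > 0")
  case True
  from cInf_lower[OF unit[OF that True] bdd] show ?thesis
   using True by (simp add: \<mu>_def pos_le_divide_eq)
 next
  case False
  then have "nrm u = 0" by (simp add: not_less antisym)
  then show ?thesis by simp
 qed
 have mu0: "\<mu> \<ge> 0" unfolding \<mu>_def using Qne Q0 by (intro cInf_greatest)
 have "\<exists>p. H1 \<Omega> (fst p) (snd p) \<and> (LINT x|M. fst p x) = 0 \<and> nrm (fst p) = 1
   \<and> dir (snd p) (snd p) < \<mu> + inverse (real (Suc n))" for n
 proof -
  have "Inf Q < \<mu> + inverse (real (Suc n))" by (simp add: \<mu>_def)
  from cInf_lessD[OF Qne this] obtain u G where "H1 \<Omega> u G" "(LINT x|M. u x) = 0" "nrm u = 1"
   "dir G G < \<mu> + inverse (real (Suc n))" by (auto simp: Q_def)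
  then show ?thesis by (intro exI[of _ "(u, G)"]) simp
 qed
 then have "\<exists>p. \<forall>n. H1 \<Omega> (fst (p n)) (snd (p n)) \<and> (LINT x|M. fst (p n) x) = 0 \<and> nrm (fst (p n)) = 1
   \<and> dir (snd (p n)) (snd (p n)) < \<mu> + inverse (real (Suc n))"
  by (intro choice allI)
 then obtain p where p: "\<forall>n. H1 \<Omega> (fst (p n)) (snd (p n)) \<and> (LINT x|M. fst (p n) x) = 0 \<and> nrm (fst (p n)) = 1
   \<and> dir (snd (p n)) (snd (p n)) < \<mu> + inverse (real (Suc n))" by blast
 define U where "U = (%n. fst (p n))"
 define \<Gamma> where "\<Gamma> = (%n. snd (p n))"
 have U: "!!n. H1 \<Omega> (U n) (\<Gamma> n)" "!!n. (LINT x|M. U n x) = 0" "!!n. nrm (U n) = 1"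
   "!!n. dir (\<Gamma> n) (\<Gamma> n) < \<mu> + inverse (real (Suc n))"
  using p unfolding U_def \<Gamma>_def by blast+
 have "inverse (real (Suc n)) <= 1" for n by (simp add: inverse_le_1_iff)
 then have "dir (\<Gamma> n) (\<Gamma> n) <= \<mu> + 1" for n using U(4)[of n] by (meson add_left_mono less_imp_le order_trans)
 note dle = this
 have nle: "nrm (U n) <= \<mu> + 1" for n using U(3)[of n] mu0 by simp
 obtain r :: "nat => nat" where r: "strict_mono r"
  and ru: "!!e. e > 0 ==> \<exists>N. \<forall>m\<ge>N. \<forall>n\<ge>N. nrm (%x. U (r m) x - U (r n) x) < e"
  by (rule Rellich_subsequence[where U = U and \<Gamma> = \<Gamma>, OF U(1) nle dle]) blast
 have rn: "dir (\<Gamma> (r n)) (\<Gamma> (r n)) <= \<mu> + inverse (real (Suc n))" for n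
 proof -
  have "inverse (real (Suc (r n))) <= inverse (real (Suc n))"
   using seq_suble[OF r, of n] by (intro le_imp_inverse_le) auto
  then show ?thesis using U(4)[of "r n"] by linarith
 qed
 \<comment> \<open>Parallelogram identity: the sum of two members of the minimizing sequence again
   has mean zero, so its energy is at least \<open>\<mu>\<close> times its squared norm; little
   energy is left for the difference.\<close>
 have par: "dir (%x. \<Gamma> (r m) x - \<Gamma> (r n) x) (%x. \<Gamma> (r m) x - \<Gamma> (r n) x)
  <= 2 * inverse (real (Suc m)) + 2 * inverse (real (Suc n)) + \<mu> * nrm (%x. U (r m) x - U (r n) x)" for m n
 proof -
  note h = U(1)[of "r m"] U(1)[of "r n"]
  have e1: "dir (%x. \<Gamma> (r m) x - \<Gamma> (r n) x) (%x. \<Gamma> (r m) x - \<Gamma> (r n) x)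
   = dir (\<Gamma> (r m)) (\<Gamma> (r m)) - 2 * dir (\<Gamma> (r m)) (\<Gamma> (r n)) + dir (\<Gamma> (r n)) (\<Gamma> (r n))"
   using dir_expand[OF h, of "-1"] by simp
  have e2: "nrm (%x. U (r m) x - U (r n) x) = 2 - 2 * (LINT x|M. U (r m) x * U (r n) x)"
   using integral_square_expand[OF H1_D(1)[OF h(1)] H1_D(1)[OF h(2)], of "-1"] U(3) by simp
  have m0: "(LINT x|M. U (r m) x + 1 * U (r n) x) = 0"
   using U(2) integral_L2_one[OF H1_D(1)[OF U(1)]] by simp
  from mu_le[OF H1_lin[OF h, of 1] m0]
  have "\<mu> * (2 + 2 * (LINT x|M. U (r m) x * U (r n) x)) <= dir (\<Gamma> (r m)) (\<Gamma> (r m)) + 2 * dir (\<Gamma> (r m)) (\<Gamma> (r n)) + dir (\<Gamma> (r n)) (\<Gamma> (r n))"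
   unfolding dir_expand[OF h] integral_square_expand[OF H1_D(1)[OF h(1)] H1_D(1)[OF h(2)]] U(3) by simp
  then have "\<mu> * (2 + (2 - nrm (%x. U (r m) x - U (r n) x))) <= dir (\<Gamma> (r m)) (\<Gamma> (r m)) + 2 * dir (\<Gamma> (r m)) (\<Gamma> (r n)) + dir (\<Gamma> (r n)) (\<Gamma> (r n))"
   unfolding e2 by simp
  then show ?thesis unfolding e1 using rn[of m] rn[of n] by (simp add: algebra_simps)
 qed
 have rg: "\<exists>N. \<forall>m\<ge>N. \<forall>n\<ge>N. dir (%x. \<Gamma> (r m) x - \<Gamma> (r n) x) (%x. \<Gamma> (r m) x - \<Gamma> (r n) x) < e" if e0: "e > 0" for e
 proof -
  obtain N1 where N1: "\<forall>m\<ge>N1. \<forall>n\<ge>N1. nrm (%x. U (r m) x - U (r n) x) < e / (2 * (\<mu> + 1))"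
  proof -
   have "e / (2 * (\<mu> + 1)) > 0" using e0 mu0 by (intro divide_pos_pos) auto
   from ru[OF this] show ?thesis using that by blast
  qed
  obtain N2 where N2: "inverse (real (Suc N2)) < e / 8"
   using reals_Archimedean[of "e/8"] e0 by auto
  show ?thesis
  proof (intro exI[of _ "max N1 N2"] allI impI)
   fix m n assume mn: "m \<ge> max N1 N2" "n \<ge> max N1 N2"
   have "inverse (real (Suc k)) <= inverse (real (Suc N2))" if "k \<ge> N2" for k
    using that by (intro le_imp_inverse_le) auto
   then have i: "inverse (real (Suc m)) < e / 8" "inverse (real (Suc n)) < e / 8"
    using mn N2 by (meson le_less_trans max.bounded_iff)+
   have "nrm (%x. U (r m) x - U (r n) x) < e / (2 * (\<mu> + 1))" using N1 mn by auto
   then have "\<mu> * nrm (%x. U (r m) x - U (r n) x) <= \<mu> * (e / (2 * (\<mu> + 1)))"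
    using mu0 by (intro mult_left_mono) auto
   also have "\<dots> <= e / 2"
   proof -
    have "\<mu> * e <= (\<mu> + 1) * e" using e0 by (intro mult_right_mono) auto
    then show ?thesis using mu0 by (simp add: pos_divide_le_eq) (simp add: algebra_simps)
   qed
   finally show "dir (%x. \<Gamma> (r m) x - \<Gamma> (r n) x) (%x. \<Gamma> (r m) x - \<Gamma> (r n) x) < e"
    using par[of m n] i by linarith
  qed
 qed
 obtain u G where uG: "H1 \<Omega> u G" "(%n. nrm (%x. U (r n) x - u x)) \<longlonglongrightarrow> 0"
   "(%n. dir (\<Gamma> (r n)) (\<Gamma> (r n))) \<longlonglongrightarrow> dir G G"
  by (rule H1_closed[of "%n. U (r n)" "%n. \<Gamma> (r n)"]) (use U(1) ru rg in auto)
 note uL = H1_D(1)[OF uG(1)]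
 have n1: "nrm u = 1"
  using L2_norm_tendsto[OF uL H1_D(1)[OF U(1)] uG(2)] U(3) LIMSEQ_unique[OF _ tendsto_const] by simp
 have m0: "(LINT x|M. u x) = 0"
 proof -
  have "(%n. LINT x|M. U (r n) x * 1) \<longlonglongrightarrow> (LINT x|M. u x * 1)"
   by (rule L2_product_tendsto[OF uL H1_D(1)[OF U(1)] uG(2) one_L2])
  then show ?thesis using U(2) LIMSEQ_unique[OF _ tendsto_const] by simp
 qed
 have dG: "dir G G = \<mu>"
 proof (rule antisym)
  have "(%n. \<mu> + inverse (real (Suc n))) \<longlonglongrightarrow> \<mu> + 0" by (intro tendsto_intros LIMSEQ_inverse_real_of_nat)
  from LIMSEQ_le[OF uG(3) this] show "dir G G <= \<mu>" using rn by auto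
  show "\<mu> <= dir G G" using mu_le[OF uG(1) m0] n1 by simp
 qed
 have mupos: "\<mu> > 0"
 proof (rule ccontr)
  assume "\<not> ?thesis"
  then have "dir G G = 0" using mu0 dG by simp
  from zero_gradient_imp_const[OF uG(1) this m0] n1 show False by simp
 qed
 \<comment> \<open>First variation: a quadratic in t that is nonnegative and has no constant term
   has no linear term either.\<close>
 have weak0: "dir G F' = \<mu> * (LINT x|M. u x * v x)" if v: "H1 \<Omega> v F'" "(LINT x|M. v x) = 0" for v F'
 proof -
  define b where "b = dir G F' - \<mu> * (LINT x|M. u x * v x)"
  define c where "c = dir F' F' - \<mu> * nrm v"
  have "0 <= 0 + 2 * t * b + t^2 * c" for t
  proof -
   have "(LINT x|M. u x + t * v x) = 0"
    using m0 v(2) integral_L2_one[OF uL] integral_L2_one[OF H1_D(1)[OF v(1)]] by simp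
   from mu_le[OF H1_lin[OF uG(1) v(1)] this] show ?thesis
    unfolding dir_expand[OF uG(1) v(1)] integral_square_expand[OF uL H1_D(1)[OF v(1)]] n1 dG
    by (simp add: b_def c_def algebra_simps)
  qed
  moreover have "c \<ge> 0" using mu_le[OF v] by (simp add: c_def)
  ultimately have "b^2 <= 0 * c" by (rule quadratic_nonneg_discriminant)
  then show ?thesis by (simp add: b_def)
 qed
 have "neumann_eigenvalue \<Omega> \<mu>"
  unfolding neumann_eigenvalue_def
 proof (intro exI[of _ u] exI[of _ G] conjI allI impI)
  show "\<not> (AE x in M. u x = 0)"
  proof
   assume "AE x in M. u x = 0"
   then have "nrm u = (LINT x|M. 0)"
    using L2_measurable[OF uL] by (intro integral_cong_AE) auto
   then show False using n1 by simp
  qed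
  fix v F' assume v: "H1 \<Omega> v F'"
  define V where "V = (LINT x|M. (1::real))"
  define c where "c = (LINT x|M. v x) / V"
  have "V \<noteq> 0"
  proof
   assume "V = 0"
   have "(LINT x|M. (u x)\<^sup>2 * 1)^2 \<ge> 0" by simp
   have "(LINT x|M. f x * 1)^2 \<ge> 0" by simp
   have "AE x in M. (1::real) = 0"
    using \<open>V = 0\<close> one_L2[of 1] integral_nonneg_eq_0_iff_AE[of M "%_. 1::real"]
    by (auto simp: V_def L2_def)
   then have "AE x in M. u x = 0" by auto
   then have "nrm u = (LINT x|M. 0)"
    using L2_measurable[OF uL] by (intro integral_cong_AE) auto
   then show False using n1 by simp
  qed
  \<comment> \<open>A constant shift of v changes neither side of the weak equation, as constants
    have zero gradient and u has mean zero; so the case of mean zero suffices.\<close>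
  have h: "H1 \<Omega> (%x. v x + (- c) * 1) (%x. F' x + (- c) *\<^sub>R 0)" by (rule H1_lin[OF v H1_const])
  have "(LINT x|M. v x + (- c) * 1) = (LINT x|M. v x) - c * V"
   using integral_L2_one[OF H1_D(1)[OF v]] integral_L2_one[OF one_L2[of 1]] integral_L2_one[OF one_L2[of c]]
   by (simp add: V_def)
  also have "\<dots> = 0" using \<open>V \<noteq> 0\<close> by (simp add: c_def)
  finally have "(LINT x|M. v x + (- c) * 1) = 0" .
  from weak0[OF h this] have "dir G F' = \<mu> * (LINT x|M. u x * (v x - c))" by simp
  also have "(LINT x|M. u x * (v x - c)) = (LINT x|M. u x * v x) - c * (LINT x|M. u x)"
   using L2_mult_integrable[OF uL H1_D(1)[OF v]] integral_L2_one[OF uL]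
   by (simp add: right_diff_distrib)
  finally show "dir G F' = \<mu> * (LINT x|M. u x * v x)" using m0 by simp
 qed (rule uG)
 then show ?thesis using that mupos mu_le[OF f f0] by blast
qed

text \<open>Testing an eigenfunction with itself gives a nonnegative eigenvalue. Boundedness is what
  places the infimum in \<open>mu1\<close> below each of its elements.\<close>

lemma mu1_bdd: "bdd_below {\<mu>. neumann_eigenvalue \<Omega> \<mu> \<and> \<mu> \<noteq> 0}"
proof (rule bdd_belowI[of _ 0])
 fix \<mu> assume "\<mu> \<in> {\<mu>. neumann_eigenvalue \<Omega> \<mu> \<and> \<mu> \<noteq> 0}"
 then obtain u G where u: "H1 \<Omega> u G" "\<not> (AE x in M. u x = 0)"
  "dir G G = \<mu> * (LINT x|M. u x * u x)" unfolding neumann_eigenvalue_def by blast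
 have "nrm u \<noteq> 0"
  using u(2) integral_nonneg_eq_0_iff_AE[OF L2_integrable[OF H1_D(1)[OF u(1)]]] by auto
 then have "nrm u > 0" by (simp add: less_le)
 moreover have "0 <= \<mu> * nrm u" using u(3) dir_nonneg[of G] by (simp add: power2_eq_square)
 ultimately show "0 <= \<mu>" by (simp add: zero_le_mult_iff)
qed

theorem mu1_le_Rayleigh:
 assumes "H1 \<Omega> f F" "(LINT x|M. f x) = 0" "nrm f > 0"
 shows "mu1 \<Omega> * nrm f <= dir F F"
proof -
 obtain \<mu> where \<mu>: "neumann_eigenvalue \<Omega> \<mu>" "\<mu> > 0" "\<mu> * nrm f <= dir F F"
  using exists_eigenvalue_le_Rayleigh[OF assms] .
 have "mu1 \<Omega> <= \<mu>" unfolding mu1_def using \<mu> by (intro cInf_lower mu1_bdd) auto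
 then have "mu1 \<Omega> * nrm f <= \<mu> * nrm f" using assms(3) by (intro mult_right_mono) auto
 then show ?thesis using \<mu>(3) by simp
qed

end

section \<open>Geometry of the quadrilaterals\<close>

lemma vector4_nth [simp]:
 "(vector [x1, x2, x3, x4] :: 'a::zero^4) $ 1 = x1" "(vector [x1, x2, x3, x4] :: 'a^4) $ 2 = x2"
 "(vector [x1, x2, x3, x4] :: 'a^4) $ 3 = x3" "(vector [x1, x2, x3, x4] :: 'a^4) $ 4 = x4"
 unfolding vector_def by auto

lemma add_type4: "(1::4) + 1 = 2" "(2::4) + 1 = 3" "(3::4) + 1 = 4" "(4::4) + 1 = 1"
  "(1::4) + 2 = 3" "(2::4) + 2 = 4" "(3::4) + 2 = 1" "(4::4) + 2 = 2"
 by simp_all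

lemma cross_zero: "cross x 0 = 0" and cross_scale: "cross x (t *\<^sub>R y) = t * cross x y"
 and cross_add: "cross x (y + z) = cross x y + cross x z"
 by (simp_all add: cross_def algebra_simps)

text \<open>The radius 1/8 exceeds \<open>rho_sharp\<close> and keeps the Jacobian between 1/4 and 2
  on the square; all estimates of \<open>mu1\<close> are made for this radius.\<close>

locale quad_map =
 fixes p :: "real^4"
 assumes small: "norm p <= 1/8"
begin

definition A :: real where "A = 1 - (p$1)\<^sup>2 - (p$4)\<^sup>2"
definition j1 :: real where "j1 = 2 * p$3 * (1 - p$1) - 2 * p$2 * p$4"
definition j2 :: real where "j2 = - 2 * p$2 * (1 + p$1) + 2 * p$3 * p$4"
text \<open>The Jacobian determinant of \<open>Phi p\<close>. Its uv-terms cancel, which leaves an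
  affine function.\<close>

definition J :: "real^2 => real" where "J w = A + j1 * w$1 + j2 * w$2"

text \<open>The columns of the derivative of \<open>Phi p\<close>; as the map is affine in each
  variable separately, \<open>Pu\<close> depends only on v and \<open>Pv\<close> only on u.\<close>

definition Pu :: "real => real^2" where "Pu v = vector [1 - p$1 - 2 * p$2 * v, - p$4 + 2 * p$3 * v]"
definition Pv :: "real => real^2" where "Pv u = vector [- p$4 - 2 * p$2 * u, 1 + p$1 + 2 * p$3 * u]"

lemma Phi_nth: "Phi p w $ 1 = w$1 - p$1 * w$1 - p$4 * w$2 - 2 * p$2 * w$1 * w$2"
 "Phi p w $ 2 = w$2 - p$4 * w$1 + p$1 * w$2 + 2 * p$3 * w$1 * w$2"
 by (simp_all add: Phi_def Let_def)

lemma p_le: "\<bar>p $ i\<bar> <= 1/8"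
 using component_le_norm_cart[of p i] small by linarith

lemma mult_le: "\<bar>x\<bar> <= c ==> \<bar>y\<bar> <= d ==> \<bar>x * y\<bar> <= c * (d::real)"
 by (simp add: abs_mult) (intro mult_mono, auto)

lemma J_bounds: 
 assumes "\<bar>w$1\<bar> <= 1/2" "\<bar>w$2\<bar> <= 1/2"
 shows "1/4 <= J w" "J w <= 2"
proof -
 have 1: "\<bar>p$i * p$j\<bar> <= 1/8 * (1/8)" for i j by (rule mult_le[OF p_le p_le])
 have e1: "j1 = 2 * p$3 - 2 * (p$3 * p$1) - 2 * (p$2 * p$4)" and e2: "j2 = - 2 * p$2 - 2 * (p$2 * p$1) + 2 * (p$3 * p$4)"
  and e3: "A = 1 - p$1 * p$1 - p$4 * p$4"
  by (simp_all add: j1_def j2_def A_def algebra_simps power2_eq_square)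
 have a: "1 - 1/32 <= A" "A <= 1" using 1[of 1 1] 1[of 4 4] e3 zero_le_square[of "p$1"] zero_le_square[of "p$4"] by (simp_all add: abs_le_iff)
 have b: "\<bar>j1\<bar> <= 5/16" using 1[of 3 1] 1[of 2 4] p_le[of 3] unfolding e1 abs_le_iff by linarith
 have c: "\<bar>j2\<bar> <= 5/16" using 1[of 2 1] 1[of 3 4] p_le[of 2] unfolding e2 abs_le_iff by linarith
 have "\<bar>j1 * w$1\<bar> <= 5/16 * (1/2)" "\<bar>j2 * w$2\<bar> <= 5/16 * (1/2)"
  using mult_le[OF b assms(1)] mult_le[OF c assms(2)] .
 then show "1/4 <= J w" "J w <= 2" unfolding J_def using a by (simp_all add: abs_le_iff)
qed

lemma J_pos: "w \<in> square ==> J w > 0"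
 using J_bounds(1)[of w] by (simp add: mem_square)

lemma cross_Pu_Pv: "cross (Pu v) (Pv u) = J (vector [u, v])"
 by (simp add: cross_def Pu_def Pv_def J_def A_def j1_def j2_def algebra_simps power2_eq_square)

text \<open>For a map that is affine in each variable separately, the mean value formula with
  derivatives at midpoints is exact.\<close>

lemma Phi_diff: "Phi p w - Phi p w' = (w$1 - w'$1) *\<^sub>R Pu ((w$2 + w'$2) / 2) + (w$2 - w'$2) *\<^sub>R Pv ((w$1 + w'$1) / 2)"
 by (simp add: vec_eq_iff forall_2 Phi_nth Pu_def Pv_def) (simp add: algebra_simps)

text \<open>In \<open>Phi_diff\<close> the two vectors are independent, because their cross product
  is the positive Jacobian at the midpoint; so both coefficients vanish.\<close>

lemma inj_Phi: "inj_on (Phi p) square"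
proof (rule inj_onI)
 fix w w' assume w: "w \<in> square" "w' \<in> square" "Phi p w = Phi p w'"
 define U V where "U = Pu ((w$2 + w'$2) / 2)" and "V = Pv ((w$1 + w'$1) / 2)"
 have z: "(w$1 - w'$1) *\<^sub>R U + (w$2 - w'$2) *\<^sub>R V = 0" using Phi_diff[of w w'] w(3) by (simp add: U_def V_def)
 have "\<bar>(w$1 + w'$1) / 2\<bar> <= 1/2" "\<bar>(w$2 + w'$2) / 2\<bar> <= 1/2" using w by (auto simp: mem_square)
 then have pos: "cross U V > 0"
  unfolding U_def V_def cross_Pu_Pv by (intro J_pos) (auto simp: mem_square)
 have c1: "cross U ((w$1 - w'$1) *\<^sub>R U + (w$2 - w'$2) *\<^sub>R V) = (w$2 - w'$2) * cross U V"
  by (simp add: cross_def algebra_simps)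
 have c2: "cross V ((w$1 - w'$1) *\<^sub>R U + (w$2 - w'$2) *\<^sub>R V) = - (w$1 - w'$1) * cross U V"
  by (simp add: cross_def algebra_simps)
 from c1 c2 have "w$2 - w'$2 = 0" "w$1 - w'$1 = 0" using pos unfolding z cross_zero by auto
 then show "w = w'" by (simp add: vec_eq_iff forall_2)
qed

lemma vertex_eq: "vertex p 1 = Phi p (vector [-1/2, -1/2])" "vertex p 2 = Phi p (vector [1/2, -1/2])"
 "vertex p 3 = Phi p (vector [1/2, 1/2])" "vertex p 4 = Phi p (vector [-1/2, 1/2])"
 by (simp_all add: vertex_def vertex0_def)

text \<open>Twice the signed area of the triangle spanned by the i-th edge and x: an affine
  function, positive to the left of the oriented edge.\<close>

definition edge :: "4 => real^2 => real" where
 "edge i x = cross (vertex p (i + 1) - vertex p i) (x - vertex p i)"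

text \<open>Pulled back to the square, the function of an edge is the distance to the corresponding
  side times a Jacobian value; its sign locates the images of the interior and of the
  boundary.\<close>

lemma edge_Phi:
 "edge 1 (Phi p w) = (1/2 + w$2) * J (vector [w$1, -1/2])"
 "edge 2 (Phi p w) = (1/2 - w$1) * J (vector [1/2, w$2])"
 "edge 3 (Phi p w) = (1/2 - w$2) * J (vector [w$1, 1/2])"
 "edge 4 (Phi p w) = (1/2 + w$1) * J (vector [-1/2, w$2])"
 unfolding edge_def add_type4 vertex_eq cross_def vector_minus_component Phi_nth vector_2 J_def A_def j1_def j2_def
 by algebra+

lemma corner_eq: "corner p i = edge i (vertex p (i + 2))"
 by (simp add: corner_def edge_def)

text \<open>By \<open>edge_Phi\<close> every corner quantity is the Jacobian at a vertex of the
  square, hence positive.\<close>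

lemma admissible_p: "p \<in> admissible"
proof -
 have "corner p i \<ge> 0" for i
 proof -
  have s: "0 <= J (vector [x, y])" if "\<bar>x\<bar> <= 1/2" "\<bar>y\<bar> <= 1/2" for x y
   using J_pos[of "vector [x, y]"] that by (auto simp: mem_square)
  show ?thesis
   using exhaust_4[of i] unfolding corner_eq
   by (elim disjE) (simp_all only: add_type4 vertex_eq edge_Phi vector_2, auto intro!: s)
 qed
 then show ?thesis by (simp add: admissible_def)
qed

text \<open>Shown below to be the image of the open square and the interior of
  \<open>quad p\<close>. The description by half-planes makes convexity immediate.\<close>

definition \<Omega> :: "(real^2) set" where "\<Omega> = {x. \<forall>i. edge i x > 0}"

lemma edge_affine: "edge i ((1 - t) *\<^sub>R x + t *\<^sub>R y) = (1 - t) * edge i x + t * edge i y"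
 by (simp add: edge_def cross_def algebra_simps)

lemma convex_dom: "convex \<Omega>"
proof (rule convexI)
 fix x y and s t :: real assume xy: "x \<in> \<Omega>" "y \<in> \<Omega>" "0 <= s" "0 <= t" "s + t = 1"
 have "edge i (s *\<^sub>R x + t *\<^sub>R y) > 0" for i
 proof -
  have "edge i (s *\<^sub>R x + t *\<^sub>R y) = s * edge i x + t * edge i y"
   using edge_affine[of i t x y] xy(5) by (simp add: eq_diff_eq[symmetric])
  moreover have "edge i x > 0" "edge i y > 0" using xy by (auto simp: \<Omega>_def)
  ultimately show ?thesis using xy(3-5)
   by (cases "s = 0") (auto intro: add_pos_nonneg)
 qed
 then show "s *\<^sub>R x + t *\<^sub>R y \<in> \<Omega>" by (simp add: \<Omega>_def)
qed

lemma open_dom: "open \<Omega>"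
proof -
 have "\<Omega> = (\<Inter>i. {x. edge i x > 0})" by (auto simp: \<Omega>_def)
 moreover have "open {x. edge i x > 0}" for i
  unfolding edge_def cross_def by (intro open_Collect_less continuous_intros)
 ultimately show ?thesis by (auto intro!: open_INT)
qed

lemma continuous_Phi: "continuous_on S (Phi p)"
 unfolding continuous_on_componentwise[of S "Phi p"] UNIV_Basis2
 by (auto simp: inner_axis Phi_nth intro!: continuous_intros)

lemma Phi_osq_subset: "Phi p ` osq \<subseteq> \<Omega>"
proof
 fix x assume "x \<in> Phi p ` osq"
 then obtain w where w: "w \<in> osq" "x = Phi p w" by blast
 have "edge i x > 0" for i
  using exhaust_4[of i] w unfolding w(2)
  by (elim disjE) (simp_all only: edge_Phi, auto simp: mem_osq mem_square intro!: mult_pos_pos J_pos)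
 then show "x \<in> \<Omega>" by (simp add: \<Omega>_def)
qed

lemma Phi_boundary: "w \<in> square ==> w \<notin> osq ==> Phi p w \<notin> \<Omega>"
proof -
 assume w: "w \<in> square" "w \<notin> osq"
 then have "w$2 = -1/2 \<or> w$1 = 1/2 \<or> w$2 = 1/2 \<or> w$1 = -1/2"
  by (auto simp: mem_osq mem_square)
 then have "\<exists>i. edge i (Phi p w) = 0"
  by (elim disjE) (auto intro: exI[of _ 1] exI[of _ 2] exI[of _ 3] exI[of _ 4] simp: edge_Phi)
 then show "Phi p w \<notin> \<Omega>" by (auto simp: \<Omega>_def) (metis less_irrefl)
qed

text \<open>The image is open by invariance of domain, and closed relative to the target because it
  is the part of a compact image lying there; the target is convex, hence connected.\<close>

lemma Phi_osq: "Phi p ` osq = \<Omega>"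
proof -
 have op: "open (Phi p ` osq)"
  by (rule invariance_of_domain[OF continuous_Phi open_osq inj_on_subset[OF inj_Phi osq_subset]])
 have eq: "Phi p ` osq = Phi p ` square \<inter> \<Omega>"
  using Phi_osq_subset Phi_boundary osq_subset by blast
 have cl: "closed (Phi p ` square)"
  by (intro compact_imp_closed compact_continuous_image continuous_Phi) (simp add: square_def)
 have "connected \<Omega>" using convex_dom by (rule convex_connected)
 moreover have "openin (top_of_set \<Omega>) (Phi p ` osq)"
  using op Phi_osq_subset by (simp add: openin_open_eq open_dom)
 moreover have "closedin (top_of_set \<Omega>) (Phi p ` osq)"
  unfolding eq by (subst Int_commute) (intro closedin_closed_Int cl)
 moreover have "0 \<in> osq" by (simp add: mem_osq)
 ultimately show ?thesis unfolding connected_clopen by blast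
qed

lemma closure_osq: "closure osq = square"
 unfolding osq_def square_def by (rule closure_box) (metis mem_osq osq_def abs_zero empty_iff half_gt_zero zero_index zero_less_one)

lemma closure_dom: "closure \<Omega> = Phi p ` square"
proof
 have "closed (Phi p ` square)"
  by (intro compact_imp_closed compact_continuous_image continuous_Phi) (simp add: square_def)
 then show "closure \<Omega> \<subseteq> Phi p ` square"
  using Phi_osq osq_subset by (intro closure_minimal) auto
 have "Phi p ` closure osq \<subseteq> closure \<Omega>"
  by (rule image_closure_subset[OF continuous_Phi]) (use Phi_osq closure_subset in auto)
 then show "Phi p ` square \<subseteq> closure \<Omega>" by (simp add: closure_osq)
qed

lemma bounded_dom: "bounded \<Omega>"
proof -
 have "compact (Phi p ` square)"
  by (intro compact_continuous_image continuous_Phi) (simp add: square_def)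
 then show ?thesis
  using closure_subset[of \<Omega>] by (metis bounded_subset closure_dom compact_imp_bounded)
qed

lemma Phi_edge:
 "Phi p (vector [s - 1/2, -1/2]) = (1 - s) *\<^sub>R vertex p 1 + s *\<^sub>R vertex p 2"
 "Phi p (vector [1/2, s - 1/2]) = (1 - s) *\<^sub>R vertex p 2 + s *\<^sub>R vertex p 3"
 "Phi p (vector [1/2 - s, 1/2]) = (1 - s) *\<^sub>R vertex p 3 + s *\<^sub>R vertex p 4"
 "Phi p (vector [-1/2, 1/2 - s]) = (1 - s) *\<^sub>R vertex p 4 + s *\<^sub>R vertex p 1"
 by (simp_all add: vertex_eq vec_eq_iff forall_2 Phi_nth algebra_simps)

lemma polygon_eq: "(\<Union>i. closed_segment (vertex p i) (vertex p (i + 1))) = Phi p ` (square - osq)" (is "?L = ?R")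
proof
 show "?L \<subseteq> ?R"
 proof
  fix x assume "x \<in> ?L"
  then obtain i s where s: "0 <= s" "s <= 1" "x = (1 - s) *\<^sub>R vertex p i + s *\<^sub>R vertex p (i + 1)"
   by (auto simp: closed_segment_def)
  have hs: "\<bar>s - 1/2\<bar> <= 1/2" "\<bar>1/2 - s\<bar> <= 1/2" using s unfolding abs_le_iff by auto
  consider "i = 1" | "i = 2" | "i = 3" | "i = 4" using exhaust_4[of i] by blast
  then show "x \<in> ?R"
  proof cases
   case 1
   have "x = Phi p (vector [s - 1/2, -1/2])" unfolding s(3) 1 add_type4 Phi_edge ..
   moreover have "vector [s - 1/2, -1/2] \<in> square - osq" using hs by (simp add: mem_square mem_osq)
   ultimately show ?thesis by blast
  next
   case 2
   have "x = Phi p (vector [1/2, s - 1/2])" unfolding s(3) 2 add_type4 Phi_edge ..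
   moreover have "vector [1/2, s - 1/2] \<in> square - osq" using hs by (simp add: mem_square mem_osq)
   ultimately show ?thesis by blast
  next
   case 3
   have "x = Phi p (vector [1/2 - s, 1/2])" unfolding s(3) 3 add_type4 Phi_edge ..
   moreover have "vector [1/2 - s, 1/2] \<in> square - osq" using hs by (simp add: mem_square mem_osq)
   ultimately show ?thesis by blast
  next
   case 4
   have "x = Phi p (vector [-1/2, 1/2 - s])" unfolding s(3) 4 add_type4 Phi_edge ..
   moreover have "vector [-1/2, 1/2 - s] \<in> square - osq" using hs by (simp add: mem_square mem_osq)
   ultimately show ?thesis by blast
  qed
 qed
 show "?R \<subseteq> ?L"
 proof
  fix x assume "x \<in> ?R"
  then obtain w where w: "w \<in> square" "w \<notin> osq" "x = Phi p w" by blast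
  have seg: "(1 - s) *\<^sub>R vertex p i + s *\<^sub>R vertex p (i + 1) \<in> ?L" if "0 <= s" "s <= 1" for s i
   using that by (auto simp: closed_segment_def)
  have "w$2 = -1/2 \<or> w$1 = 1/2 \<or> w$2 = 1/2 \<or> w$1 = -1/2"
   using w by (auto simp: mem_osq mem_square)
  then consider "w$2 = -1/2" | "w$1 = 1/2" | "w$2 = 1/2" | "w$1 = -1/2" by blast
  note cases = this
  have wb: "0 <= w$i + 1/2" "w$i + 1/2 <= 1" "0 <= 1/2 - w$i" "1/2 - w$i <= 1" for i
   using w(1) exhaust_2[of i] by (auto simp: mem_square abs_le_iff)
  from cases show "x \<in> ?L"
  proof cases
   case 1
   then have wv: "w = vector [w$1 + 1/2 - 1/2, -1/2]" by (simp add: vec_eq_iff forall_2)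
   have "x = (1 - (w$1 + 1/2)) *\<^sub>R vertex p 1 + (w$1 + 1/2) *\<^sub>R vertex p (1 + 1)"
    unfolding add_type4 Phi_edge[symmetric] w(3) using wv by (rule arg_cong)
   then show ?thesis using seg[of "w$1 + 1/2" 1] wb by (simp only:)
  next
   case 2
   then have wv: "w = vector [1/2, w$2 + 1/2 - 1/2]" by (simp add: vec_eq_iff forall_2)
   have "x = (1 - (w$2 + 1/2)) *\<^sub>R vertex p 2 + (w$2 + 1/2) *\<^sub>R vertex p (2 + 1)"
    unfolding add_type4 Phi_edge[symmetric] w(3) using wv by (rule arg_cong)
   then show ?thesis using seg[of "w$2 + 1/2" 2] wb by (simp only:)
  next
   case 3
   then have wv: "w = vector [1/2 - (1/2 - w$1), 1/2]" by (simp add: vec_eq_iff forall_2)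
   have "x = (1 - (1/2 - w$1)) *\<^sub>R vertex p 3 + (1/2 - w$1) *\<^sub>R vertex p (3 + 1)"
    unfolding add_type4 Phi_edge[symmetric] w(3) using wv by (rule arg_cong)
   then show ?thesis using seg[of "1/2 - w$1" 3] wb by (simp only:)
  next
   case 4
   then have wv: "w = vector [-1/2, 1/2 - (1/2 - w$2)]" by (simp add: vec_eq_iff forall_2)
   have "x = (1 - (1/2 - w$2)) *\<^sub>R vertex p 4 + (1/2 - w$2) *\<^sub>R vertex p (4 + 1)"
    unfolding add_type4 Phi_edge[symmetric] w(3) using wv by (rule arg_cong)
   then show ?thesis using seg[of "1/2 - w$2" 4] wb by (simp only:)
  qed
 qed
qed

lemma polygon_frontier: "Phi p ` (square - osq) = frontier \<Omega>"
proof -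
 have "frontier \<Omega> = Phi p ` square - Phi p ` osq"
  unfolding frontier_def closure_dom by (simp add: interior_open open_dom Phi_osq)
 also have "\<dots> = Phi p ` (square - osq)"
  using inj_Phi osq_subset by (simp add: inj_on_image_set_diff)
 finally show ?thesis ..
qed

text \<open>The polygon is the frontier of a bounded open convex set, and the inside of such a
  frontier is the set itself; this resolves the topological definition of
  \<open>quad\<close>.\<close>

theorem quad_eq: "quad p = Phi p ` square"
proof -
 have "quad p = frontier \<Omega> \<union> inside (frontier \<Omega>)"
  by (simp add: quad_def Let_def polygon_eq polygon_frontier)
 also have "inside (frontier \<Omega>) = \<Omega>"
  using inside_frontier_eq_interior[OF bounded_dom convex_dom] by (simp add: interior_open open_dom)
 also have "frontier \<Omega> \<union> \<Omega> = closure \<Omega>" unfolding closure_Un_frontier[of \<Omega>] by (rule Un_commute)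
 finally show ?thesis by (simp add: closure_dom)
qed

theorem interior_quad: "interior (quad p) = \<Omega>"
 unfolding quad_eq closure_dom[symmetric] by (simp add: convex_dom convex_interior_closure interior_open open_dom)

section \<open>Change of variables and area\<close>

definition DPhi :: "real^2 => real^2 => real^2" where
 "DPhi w h = h$1 *\<^sub>R Pu (w$2) + h$2 *\<^sub>R Pv (w$1)"

lemma DPhi_nth: "DPhi w h $ i = h$1 * Pu (w$2) $ i + h$2 * Pv (w$1) $ i"
 by (simp add: DPhi_def)

lemma has_derivative_Phi: "(Phi p has_derivative DPhi w) (at w within S)"
proof -
 have "((%w. Phi p w $ i) has_derivative (%h. DPhi w h $ i)) (at w within S)" for i
  using exhaust_2[of i]
  by (elim disjE; simp add: Phi_nth DPhi_nth Pu_def Pv_def)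
    (auto intro!: derivative_eq_intros simp: algebra_simps)
 then show ?thesis by (subst has_derivative_componentwise_within) (auto simp: UNIV_Basis2 inner_axis)
qed

lemma det_DPhi: "det (matrix (DPhi w)) = J w"
proof -
 have "J w = cross (Pu (w$2)) (Pv (w$1))" unfolding cross_Pu_Pv by (simp add: J_def)
 then show ?thesis
  by (simp add: det_2 matrix_def DPhi_nth axis_def cross_def)
qed

lemma Jac_eq: "Jac p w = J w"
 unfolding Jac_def frechet_derivative_at[OF has_derivative_Phi, symmetric] by (rule det_DPhi)

text \<open>Integrability is part of the conclusion and \<open>F\<close> is arbitrary, so the
  formula applies before measurability of a pullback is known.\<close>

lemma change_of_variables:
 fixes F :: "real^2 => real"
 shows "integrable (lebesgue_on \<Omega>) F \<longleftrightarrow> integrable (lebesgue_on osq) (%w. F (Phi p w) * J w)" (is "?I1 = ?I2")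
  and "(LINT x|lebesgue_on \<Omega>. F x) = (LINT w|lebesgue_on osq. F (Phi p w) * J w)"
proof -
 have sO: "osq \<in> sets lebesgue" "\<Omega> \<in> sets lebesgue" using sets_osq open_dom by auto
 \<comment> \<open>The change-of-variables theorem speaks of functions with values in a Cartesian
   power, hence the passage through \<open>real^1\<close>.\<close>
 define f :: "real^2 => real^1" where "f = (%x. vec (F x))"
 have cov: "(%w. \<bar>det (matrix (DPhi w))\<bar> *\<^sub>R f (Phi p w)) absolutely_integrable_on osq \<and>
      integral osq (%w. \<bar>det (matrix (DPhi w))\<bar> *\<^sub>R f (Phi p w)) = b
   \<longleftrightarrow> f absolutely_integrable_on \<Omega> \<and> integral \<Omega> f = b" for b
  using has_absolute_integral_change_of_variables[OF sO(1) has_derivative_Phi inj_on_subset[OF inj_Phi osq_subset], of f b]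
  unfolding Phi_osq .
 have int_iff: "g absolutely_integrable_on X \<longleftrightarrow> integrable (lebesgue_on X) (%x. g x $ 1)" if "X \<in> sets lebesgue" for g :: "real^2 => real^1" and X
 proof -
  have "g absolutely_integrable_on X \<longleftrightarrow> (%x. g x $ 1) absolutely_integrable_on X"
   by (subst absolutely_integrable_componentwise_iff) (simp add: Basis_vec_def UNIV_1 inner_axis)
  also have "\<dots> \<longleftrightarrow> integrable (lebesgue_on X) (%x. g x $ 1)"
   using that by (simp add: integrable_restrict_space set_integrable_def)
  finally show ?thesis .
 qed
 have "integrable (lebesgue_on osq) (%w. (\<bar>det (matrix (DPhi w))\<bar> *\<^sub>R f (Phi p w)) $ 1) \<longleftrightarrow> ?I2"
  by (rule Bochner_Integration.integrable_cong) (use J_pos osq_subset in \<open>auto simp: f_def det_DPhi mult.commute abs_of_pos\<close>)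
 then have i: "(%w. \<bar>det (matrix (DPhi w))\<bar> *\<^sub>R f (Phi p w)) absolutely_integrable_on osq \<longleftrightarrow> ?I2"
  "f absolutely_integrable_on \<Omega> \<longleftrightarrow> ?I1"
  unfolding int_iff[OF sO(1)] int_iff[OF sO(2)] by (simp_all add: f_def)
 show I: "?I1 = ?I2" using cov i by blast
 show "(LINT x|lebesgue_on \<Omega>. F x) = (LINT w|lebesgue_on osq. F (Phi p w) * J w)"
 proof (cases ?I1)
  case True
  then have T2: ?I2 using I by simp
  have "integral osq (%w. \<bar>det (matrix (DPhi w))\<bar> *\<^sub>R f (Phi p w)) = integral \<Omega> f"
   using cov[of "integral \<Omega> f"] i True by simp
  then have e: "integral osq (%w. \<bar>det (matrix (DPhi w))\<bar> *\<^sub>R f (Phi p w)) $ 1 = integral \<Omega> f $ 1" by simp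
  have fi: "f integrable_on \<Omega>" "(%w. \<bar>det (matrix (DPhi w))\<bar> *\<^sub>R f (Phi p w)) integrable_on osq"
   using i True T2 absolutely_integrable_on_def by blast+
  have "integral \<Omega> f $ 1 = integral \<Omega> F"
   using integral_component_eq_cart[OF fi(1), of 1] by (simp add: f_def)
  moreover have "integral osq (%w. \<bar>det (matrix (DPhi w))\<bar> *\<^sub>R f (Phi p w)) $ 1 = integral osq (%w. F (Phi p w) * J w)"
  proof -
   have "integral osq (%w. (\<bar>det (matrix (DPhi w))\<bar> *\<^sub>R f (Phi p w)) $ 1) = integral osq (%w. F (Phi p w) * J w)"
    by (rule Henstock_Kurzweil_Integration.integral_cong) (use J_pos osq_subset in \<open>auto simp: f_def det_DPhi mult.commute abs_of_pos\<close>)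
   then show ?thesis using integral_component_eq_cart[OF fi(2), of 1] by simp
  qed
  ultimately show ?thesis
   using e by (simp add: lebesgue_integral_eq_integral[OF True sO(2)] lebesgue_integral_eq_integral[OF T2 sO(1)])
 next
  \<comment> \<open>Integrability fails on both sides together, and both integrals are then 0 by
    default.\<close>
  case False
  then show ?thesis using I by (simp add: not_integrable_integral_eq)
 qed
qed

lemma continuous_J: "continuous_on S J"
 unfolding J_def[abs_def] by (intro continuous_intros)

text \<open>The linear terms of the Jacobian integrate to zero over the symmetric square, which
  leaves its value at the origin.\<close>

theorem area_eq: "area p = A"
proof -
 have "finite_measure (lebesgue_on osq)" by (rule lebesgue_on_osq_finite)
 have cid: "contU (%x::real. x)" "contU (%x::real. 1::real)" by (auto intro: continuous_intros)
 have I1x: "I1 (%x. x) = 0" "I1 (%x. 1) = 1"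
 proof -
  have "((%x::real. x) has_integral ((1/2)^2 / 2 - (-1/2)\<^sup>2 / 2)) {-1/2..1/2}"
   by (rule fundamental_theorem_of_calculus) (auto intro!: derivative_eq_intros simp flip: has_real_derivative_iff_has_vector_derivative)
  from integral_unique[OF this] show "I1 (%x. x) = 0" by (simp add: power2_eq_square)
 qed simp
 have "area p = measure lebesgue (closure \<Omega>)" by (simp add: area_def quad_eq closure_dom)
 also have "\<dots> = measure lebesgue \<Omega>"
  by (rule measure_closure[OF bounded_dom negligible_convex_frontier[OF convex_dom]])
 also have "\<dots> = (LINT x|lebesgue_on \<Omega>. 1)" using open_dom by (simp add: measure_restrict_space)
 also have "\<dots> = (LINT w|lebesgue_on osq. 1 * J w)" by (rule change_of_variables(2))
 also have "\<dots> = (LINT w|lebesgue_on square. J w)"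
  using integral_osq[OF continuous_J] by simp
 also have "\<dots> = (LINT w|lebesgue_on square. (A * (1 * 1) + j1 * (w$1 * 1)) + j2 * (1 * w$2))"
  by (simp add: J_def)
 also have "\<dots> = A * (LINT w|lebesgue_on square. 1 * 1) + j1 * (LINT w|lebesgue_on square. w$1 * 1) + j2 * (LINT w|lebesgue_on square. 1 * w$2)"
 proof -
  have "integrable (lebesgue_on square) f" if "contU f" for f :: "real^2 => real"
   unfolding square_def by (rule continuous_imp_integrable[OF continuous_on_subset[OF that]]) simp
  then have "integrable (lebesgue_on square) (%w. w $ i)" "integrable (lebesgue_on square) (%w. c::real)" for i c
   by (auto intro: continuous_intros)
  then show ?thesis by simp
 qed
 also have "\<dots> = A"
  using integral_square_product[OF cid(2) cid(2)] integral_square_product[OF cid(1) cid(2)] integral_square_product[OF cid(2) cid(1)]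
  by (simp only: I1x)
 finally show ?thesis .
qed

end

lemma quad_0: "quad 0 = square"
proof -
 interpret quad_map 0 by unfold_locales simp
 have "Phi 0 w = w" for w by (simp add: vec_eq_iff forall_2 Phi_nth)
 then show ?thesis using quad_eq by simp
qed

section \<open>Pulling back to the square\<close>

text \<open>\<open>C_k\<close> asserts a gradient afresh for every k; uniqueness of the derivative
  shows that one pair of partial derivatives serves all k.\<close>

lemma smooth_partials:
 assumes "!!k. C_k k F"
 obtains F1 F2 where "!!x. (F has_derivative (%h. F1 x * h$1 + F2 x * h$2)) (at x)"
  "!!k. C_k k F1" "!!k. C_k k F2"
proof -
 obtain F1 F2 where F: "!!x. (F has_derivative (%h. F1 x * h$1 + F2 x * h$2)) (at x)"
  using assms[of "Suc 0"] by (rule C_k_SucE) blast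
 have "C_k k F1 \<and> C_k k F2" for k
 proof -
  obtain g1 g2 where g: "!!x. (F has_derivative (%h. g1 x * h$1 + g2 x * h$2)) (at x)" "C_k k g1" "C_k k g2"
   using assms[of "Suc k"] by (rule C_k_SucE) blast
  have "F1 x = g1 x \<and> F2 x = g2 x" for x
  proof -
   have e: "(%h::real^2. F1 x * h$1 + F2 x * h$2) = (%h. g1 x * h$1 + g2 x * h$2)"
    using has_derivative_unique[OF F g(1)] .
   show ?thesis using fun_cong[OF e, of "vector [1, 0]"] fun_cong[OF e, of "vector [0, 1]"] by simp
  qed
  then have "F1 = g1" "F2 = g2" by auto
  then show ?thesis using g by simp
 qed
 then show ?thesis using that F by blast
qed

lemma derivative_zero_outside:
 assumes F: "(F has_derivative (%h. a * h$1 + b * h$2)) (at (x::real^2))" and K: "closed K" "!!x. x \<notin> K ==> F x = (0::real)" "x \<notin> K"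
 shows "a = 0" "b = 0"
proof -
 have "((%x. 0) has_derivative (%h. a * h$1 + b * h$2)) (at x)"
  by (rule has_derivative_transform_within_open[OF F, of "- K"]) (use K in auto)
 then have e: "(%h::real^2. a * h$1 + b * h$2) = (%h. 0)" using has_derivative_const has_derivative_unique by blast
 show "a = 0" "b = 0" using fun_cong[OF e, of "vector [1, 0]"] fun_cong[OF e, of "vector [0, 1]"] by simp_all
qed

lemma L2_continuous:
 assumes bd: "bounded \<Omega>" and sO: "\<Omega> \<in> sets lebesgue" and h: "contU (h :: real^2 => real)"
 shows "h \<in> L2 (lebesgue_on \<Omega>)"
proof -
 have "compact (h ` closure \<Omega>)"
  using h bd by (meson closed_closure bounded_closure compact_continuous_image compact_eq_bounded_closed continuous_on_subset subset_UNIV)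
 then obtain B where "!!w. w \<in> closure \<Omega> ==> \<bar>h w\<bar> <= B"
  using compact_imp_bounded[of "h ` closure \<Omega>"] unfolding bounded_iff by auto
 then show ?thesis
  using closure_subset[of \<Omega>]
  by (intro L2_bounded[OF _ finite_measure_lebesgue_on_bounded[OF bd sO], of _ B]
    continuous_imp_measurable_on_sets_lebesgue[OF continuous_on_subset[OF h]] sO) auto
qed

lemma test_function_L2:
 assumes "bounded \<Omega>" "\<Omega> \<in> sets lebesgue" "test_function \<Omega> \<phi>"
 shows "\<phi> \<in> L2 (lebesgue_on \<Omega>)" "(%x. gradient \<phi> x $ i) \<in> L2 (lebesgue_on \<Omega>)"
proof -
 obtain G K where G: "contU G" "compact K" "!!x. x \<notin> K ==> \<phi> x = 0" "!!x. gradient \<phi> x = G x" "contU \<phi>"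
  using assms(3) by (rule test_functionE) blast
 show "\<phi> \<in> L2 (lebesgue_on \<Omega>)" by (rule L2_continuous[OF assms(1,2) G(5)])
 show "(%x. gradient \<phi> x $ i) \<in> L2 (lebesgue_on \<Omega>)"
  unfolding G(4) by (rule L2_continuous[OF assms(1,2)]) (intro continuous_intros G)
qed

lemma H1_I:
 assumes "u \<in> L2 (lebesgue_on \<Omega>)" "!!i. (%x. G x $ i) \<in> L2 (lebesgue_on \<Omega>)"
  "!!\<phi> i. test_function \<Omega> \<phi> ==> (LINT x|lebesgue_on \<Omega>. u x * gradient \<phi> x $ i) = - (LINT x|lebesgue_on \<Omega>. G x $ i * \<phi> x)"
 shows "H1 \<Omega> u G"
proof -
 have m: "G \<in> borel_measurable (lebesgue_on \<Omega>)"
  unfolding borel_measurable_euclidean_space[of G] UNIV_Basis2 using assms(2) L2_measurable by (auto simp: inner_axis)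
 have "integrable (lebesgue_on \<Omega>) (%x. (norm (G x))\<^sup>2)"
  unfolding norm_vec2_sq by (intro lint_integrable_add L2_integrable assms)
 then show ?thesis using assms m L2_measurable L2_integrable unfolding H1_def by blast
qed

text \<open>The product of f with a test function, extended by zero, is C1 with compact support; its
  partial derivatives integrate to zero, and this is the required integration by parts.\<close>

lemma H1_C1:
 assumes op: "open \<Omega>" and f: "!!x. x \<in> \<Omega> ==> (f has_derivative (%h. G x \<bullet> h)) (at x)"
  and G: "continuous_on \<Omega> G" and L: "f \<in> L2 (lebesgue_on \<Omega>)" "!!i. (%x. G x $ i) \<in> L2 (lebesgue_on \<Omega>)"
  and bd: "bounded \<Omega>"
 shows "H1 \<Omega> f G"
proof -
 have sO: "\<Omega> \<in> sets lebesgue" using op by auto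
 have "(LINT x|lebesgue_on \<Omega>. f x * gradient \<phi> x $ i) = - (LINT x|lebesgue_on \<Omega>. G x $ i * \<phi> x)"
  if \<phi>: "test_function \<Omega> \<phi>" for \<phi> i
 proof -
  obtain P K where P: "!!x. (\<phi> has_derivative (%h. P x \<bullet> h)) (at x)" "contU P"
   "compact K" "K \<subseteq> \<Omega>" "!!x. x \<notin> K ==> \<phi> x = 0" "!!x. gradient \<phi> x = P x" "contU \<phi>"
   using \<phi> by (rule test_functionE) blast
  have Kcl: "closed K" using P(3) compact_imp_closed by blast
  have P0: "P x = 0" if "x \<notin> K" for x
   using derivative_zero_outside[OF P(1)[of x, unfolded has_derivative_vec2_iff] Kcl P(5) that]
   by (simp add: vec_eq_iff forall_2)
  define \<psi> where "\<psi> = (%x. if x \<in> \<Omega> then f x * \<phi> x else 0)"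
  define Q where "Q = (%x. if x \<in> \<Omega> then f x *\<^sub>R P x + \<phi> x *\<^sub>R G x else 0)"
  \<comment> \<open>The domain and the complement of the support are two open sets covering the
    plane; differentiability and continuity of the extension are checked on each.\<close>
  have cover: "x \<in> \<Omega> \<or> x \<in> - K" for x using P(4) by blast
  have d: "(\<psi> has_derivative (%h. Q x \<bullet> h)) (at x)" for x
  proof (cases "x \<in> \<Omega>")
   case True
   have "((%x. f x * \<phi> x) has_derivative (%h. Q x \<bullet> h)) (at x)"
    using has_derivative_mult[OF f[OF True] P(1)[of x]] True
    by (simp add: Q_def inner_add_left mult.commute)
   then show ?thesis
    by (rule has_derivative_transform_within_open[OF _ op True]) (simp add: \<psi>_def)
  next
   case False
   then have x: "x \<in> - K" using cover by blast
   have "((%x. 0) has_derivative (%h. Q x \<bullet> h)) (at x)" using False by (simp add: Q_def)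
   then show ?thesis
    by (rule has_derivative_transform_within_open[of _ _ _ _ "- K"])
      (use x Kcl P(5) in \<open>auto simp: \<psi>_def\<close>)
  qed
  have "isCont Q x" for x
  proof (cases "x \<in> \<Omega>")
   case True
   have "continuous_on \<Omega> f" using f has_derivative_continuous continuous_at_imp_continuous_on by blast
   then have "continuous_on \<Omega> (%x. f x *\<^sub>R P x + \<phi> x *\<^sub>R G x)"
    using P(2,7) G by (intro continuous_intros) (auto intro: continuous_on_subset)
   then have "continuous_on \<Omega> Q" by (rule continuous_on_eq) (simp add: Q_def)
   then show ?thesis using op True continuous_on_eq_continuous_at by blast
  next
   case False
   then have x: "x \<in> - K" using cover by blast
   have "continuous_on (- K) Q"
    by (rule continuous_on_eq[of _ "%x. 0"]) (auto simp: Q_def P(5) P0)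
   then show ?thesis using x Kcl continuous_on_eq_continuous_at by blast
  qed
  then have Qc: "contU Q" by (simp add: continuous_at_imp_continuous_on)
  have "(LINT x|lborel. Q x $ i) = 0"
   by (rule integral_derivative_eq_0[OF d Qc P(3)]) (simp add: \<psi>_def P(5))
  moreover have "(LINT x|lborel. Q x $ i) = (LINT x|lebesgue. Q x $ i)"
   by (rule integral_completion[symmetric]) (use Qc in \<open>auto intro!: borel_measurable_continuous_onI continuous_intros\<close>)
  moreover have "(LINT x|lebesgue. Q x $ i) = (LINT x|lebesgue_on \<Omega>. f x * P x $ i + G x $ i * \<phi> x)"
   using sO by (subst integral_restrict_space) (auto simp: Q_def indicator_def algebra_simps intro!: lint_cong0)
  moreover have "integrable (lebesgue_on \<Omega>) (%x. f x * P x $ i)" "integrable (lebesgue_on \<Omega>) (%x. G x $ i * \<phi> x)"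
   using test_function_L2[OF bd sO \<phi>] L P(6) by (auto intro: L2_mult_integrable)
  ultimately show ?thesis by (simp add: P(6))
 qed
 then show ?thesis using L by (intro H1_I)
qed

section \<open>The inverse map and the transport of test functions\<close>

context quad_map begin

definition \<Psi> :: "real^2 => real^2" where "\<Psi> = inv_into osq (Phi p)"

lemma inj_osq: "inj_on (Phi p) osq"
 by (rule inj_on_subset[OF inj_Phi osq_subset])

lemma Psi_Phi: "w \<in> osq ==> \<Psi> (Phi p w) = w"
 by (simp add: \<Psi>_def inv_into_f_f[OF inj_osq])

lemma Phi_Psi: "x \<in> \<Omega> ==> Phi p (\<Psi> x) = x" and Psi_in: "x \<in> \<Omega> ==> \<Psi> x \<in> osq"
 unfolding \<Psi>_def Phi_osq[symmetric] by (auto intro: f_inv_into_f inv_into_into)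

lemma Phi_in: "w \<in> osq ==> Phi p w \<in> \<Omega>"
 using Phi_osq by blast

text \<open>Cramer's rule for the inverse of the matrix with columns \<open>Pu\<close> and
  \<open>Pv\<close>.\<close>

definition DPsi :: "real^2 => real^2 => real^2" where
 "DPsi w h = vector [(h$1 * Pv (w$1) $ 2 - h$2 * Pv (w$1) $ 1) / J w, (Pu (w$2) $ 1 * h$2 - Pu (w$2) $ 2 * h$1) / J w]"

lemma J_cross: "J w = Pu (w$2) $ 1 * Pv (w$1) $ 2 - Pu (w$2) $ 2 * Pv (w$1) $ 1"
 using cross_Pu_Pv[of "w$2" "w$1"] by (simp add: cross_def J_def)

lemma J_osq: "w \<in> osq ==> J w > 0"
 using J_pos osq_subset by blast

lemma has_derivative_Psi:
 assumes x: "x \<in> \<Omega>"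
 shows "(\<Psi> has_derivative DPsi (\<Psi> x)) (at x)"
proof -
 define w where "w = \<Psi> x"
 have w: "w \<in> osq" "Phi p w = x" using x by (auto simp: w_def Psi_in Phi_Psi)
 have Jp: "J w > 0" using w J_osq by blast
 have "DPhi w (DPsi w h) = h" for h
 proof -
  have "DPhi w (DPsi w h) $ 1 = h$1 * J w / J w" "DPhi w (DPsi w h) $ 2 = h$2 * J w / J w"
   unfolding J_cross[of w] by (simp_all add: DPhi_nth DPsi_def J_cross[of w] add_divide_distrib[symmetric] algebra_simps)
  then show ?thesis using Jp by (simp add: vec_eq_iff forall_2)
 qed
 then have "DPhi w \<circ> DPsi w = id" by auto
 from has_derivative_inverse_strong[OF open_osq w(1) continuous_Phi _ has_derivative_Phi this]
 show ?thesis using Psi_Phi by (simp add: w(2)) (simp add: w_def)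
qed

lemma continuous_Psi: "continuous_on \<Omega> \<Psi>"
 using has_derivative_Psi has_derivative_continuous continuous_at_imp_continuous_on by blast

lemma has_derivative_J: "(J has_derivative (%h. j1 * h$1 + j2 * h$2)) (at w within S)"
 unfolding J_def[abs_def] by (auto intro!: derivative_eq_intros)

text \<open>Transport to the quadrilateral, extended by zero. The power of \<open>J\<close> in the
  denominator is a parameter because differentiation raises it: each partial derivative of
  \<open>ext n F\<close> is \<open>ext (n + 2)\<close> of a smooth numerator, \<open>ext1\<close> or
  \<open>ext2\<close>, and so the induction on the order of smoothness closes.\<close>

definition ext :: "nat => (real^2 => real) => real^2 => real" where
 "ext n F x = (if x \<in> \<Omega> then F (\<Psi> x) / J (\<Psi> x) ^ n else 0)"

lemma C_k_J: "C_k k J"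
 unfolding J_def[abs_def] by (intro C_k_add C_k_cmult C_k_nth C_k_const)

lemma C_k_Pu: "C_k k (%w. Pu (w$2) $ i)" and C_k_Pv: "C_k k (%w. Pv (w$1) $ i)"
 using exhaust_2[of i] by (auto simp: Pu_def Pv_def intro!: C_k_add C_k_diff C_k_cmult C_k_nth C_k_const)

definition ext1 :: "nat => (real^2 => real) => (real^2 => real) => (real^2 => real) => real^2 => real" where
 "ext1 n F F1 F2 w = (F1 w * J w - real n * F w * j1) * Pv (w$1) $ 2 - (F2 w * J w - real n * F w * j2) * Pu (w$2) $ 2"

definition ext2 :: "nat => (real^2 => real) => (real^2 => real) => (real^2 => real) => real^2 => real" where
 "ext2 n F F1 F2 w = (F2 w * J w - real n * F w * j2) * Pu (w$2) $ 1 - (F1 w * J w - real n * F w * j1) * Pv (w$1) $ 1"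

lemma has_derivative_quotient_Psi:
 assumes F: "(F has_derivative (%h. F1 (\<Psi> x) * h$1 + F2 (\<Psi> x) * h$2)) (at (\<Psi> x))" and x: "x \<in> \<Omega>"
 shows "((%x. F (\<Psi> x) / J (\<Psi> x) ^ n) has_derivative
   (%h. ext1 n F F1 F2 (\<Psi> x) / J (\<Psi> x) ^ (n + 2) * h$1 + ext2 n F F1 F2 (\<Psi> x) / J (\<Psi> x) ^ (n + 2) * h$2)) (at x)"
proof -
 define w where "w = \<Psi> x"
 have Jp: "J w > 0" using Psi_in[OF x] J_osq w_def by blast
 have "((%w. F w / J w ^ n) has_derivative (%h. (F1 w * J w - real n * F w * j1) / J w ^ (n + 1) * h$1
   + (F2 w * J w - real n * F w * j2) / J w ^ (n + 1) * h$2)) (at w)"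
 proof (cases n)
  case 0
  then show ?thesis using F Jp by (simp add: w_def)
 next
  case (Suc m)
  have pw: "((%w. J w ^ n) has_derivative (%h. real n * (j1 * h$1 + j2 * h$2) * J w ^ (n - 1))) (at w)"
   by (rule has_derivative_power[OF has_derivative_J])
  have "((%w. F w / J w ^ n) has_derivative (%h. ((F1 w * h$1 + F2 w * h$2) * J w ^ n
    - F w * (real n * (j1 * h$1 + j2 * h$2) * J w ^ (n - 1))) / (J w ^ n * J w ^ n))) (at w)"
   by (rule has_derivative_divide'[OF F[folded w_def] pw]) (use Jp in simp)
  moreover have "((F1 w * h$1 + F2 w * h$2) * J w ^ n
    - F w * (real n * (j1 * h$1 + j2 * h$2) * J w ^ (n - 1))) / (J w ^ n * J w ^ n)
   = (F1 w * J w - real n * F w * j1) / J w ^ (n + 1) * h$1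
   + (F2 w * J w - real n * F w * j2) / J w ^ (n + 1) * h$2" for h :: "real^2"
   using Jp by (simp add: Suc field_simps)
  ultimately show ?thesis by simp
 qed
 from has_derivative_compose[OF has_derivative_Psi[OF x] this[unfolded w_def]]
 show ?thesis
  unfolding w_def[symmetric] DPsi_def vector_2
  by (rule has_derivative_eq_rhs) (use Jp in \<open>simp add: fun_eq_iff ext1_def ext2_def field_simps\<close>)
qed

lemma ext_has_derivative:
 assumes F: "!!x. (F has_derivative (%h. F1 x * h$1 + F2 x * h$2)) (at x)"
  and K: "compact K" "K \<subseteq> osq" "!!w. w \<notin> K ==> F w = 0"
 shows "(ext n F has_derivative (%h. ext (n + 2) (ext1 n F F1 F2) x * h$1 + ext (n + 2) (ext2 n F F1 F2) x * h$2)) (at x)"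
proof (cases "x \<in> \<Omega>")
 case True
 show ?thesis
  by (rule has_derivative_transform_within_open[OF _ open_dom True, of "%x. F (\<Psi> x) / J (\<Psi> x) ^ n"])
   (use has_derivative_quotient_Psi[where F = F and ?F1.0 = F1 and ?F2.0 = F2, OF F True] True in \<open>simp_all add: ext_def\<close>)
next
 case False
 have cl: "closed (Phi p ` K)"
  by (intro compact_imp_closed compact_continuous_image continuous_Phi K)
 have "Phi p ` K \<subseteq> \<Omega>" using K(2) Phi_osq by blast
 then have x: "x \<in> - Phi p ` K" using False by blast
 have "((%x. 0) has_derivative (%h. ext (n + 2) (ext1 n F F1 F2) x * h$1 + ext (n + 2) (ext2 n F F1 F2) x * h$2)) (at x)"
  using False by (simp add: ext_def)
 then show ?thesis
 proof (rule has_derivative_transform_within_open[of _ _ _ _ "- Phi p ` K"])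
  fix y assume "y \<in> - Phi p ` K"
  then have "\<Psi> y \<notin> K" if "y \<in> \<Omega>" using Phi_Psi[OF that] by (metis ComplD imageI)
  then show "0 = ext n F y" by (simp add: ext_def K(3))
 qed (use x cl in auto)
qed

lemma C_k_ext:
 assumes "!!k. C_k k F" and K: "compact K" "K \<subseteq> osq" "!!w. w \<notin> K ==> F w = 0"
 shows "C_k k (ext n F)"
 using assms
proof (induction k arbitrary: n F)
 case (0 n F)
 obtain F1 F2 where F: "!!x. (F has_derivative (%h. F1 x * h$1 + F2 x * h$2)) (at x)"
  "!!k. C_k k F1" "!!k. C_k k F2"
  by (rule smooth_partials[OF 0(1)]) (rule that)
 have "isCont (ext n F) x" for x
  by (rule has_derivative_continuous[OF ext_has_derivative[OF F(1) K(1,2) 0(4)]])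
 then show ?case by (simp add: continuous_at_imp_continuous_on)
next
 case (Suc k n F)
 obtain F1 F2 where F: "!!x. (F has_derivative (%h. F1 x * h$1 + F2 x * h$2)) (at x)"
  "!!k. C_k k F1" "!!k. C_k k F2"
  by (rule smooth_partials[OF Suc.prems(1)]) (rule that)
 have z: "F1 w = 0" "F2 w = 0" if "w \<notin> K" for w
  using derivative_zero_outside[OF F(1) compact_imp_closed[OF K(1)] Suc.prems(4) that] by auto
 show ?case
 proof (rule C_k_SucI[OF ext_has_derivative[OF F(1) K(1,2) Suc.prems(4)]])
  have c: "C_k k (ext1 n F F1 F2)" "C_k k (ext2 n F F1 F2)" for k
   unfolding ext1_def[abs_def] ext2_def[abs_def]
   by (intro C_k_diff C_k_mult C_k_J C_k_Pu C_k_Pv C_k_const F Suc.prems(1))+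
  show "C_k k (ext (n + 2) (ext1 n F F1 F2))"
   by (rule Suc.IH[OF c(1) K(1,2)]) (simp add: ext1_def z Suc.prems(4))
  show "C_k k (ext (n + 2) (ext2 n F F1 F2))"
   by (rule Suc.IH[OF c(2) K(1,2)]) (simp add: ext2_def z Suc.prems(4))
 qed
qed

lemma test_function_ext:
 assumes F: "!!k. C_k k F" and K: "compact K" "K \<subseteq> osq" "!!w. w \<notin> K ==> F w = 0"
 shows "test_function \<Omega> (ext n F)"
proof -
 have cp: "compact (Phi p ` K)" by (intro compact_continuous_image continuous_Phi K)
 have "x \<in> Phi p ` K" if "ext n F x \<noteq> 0" for x
 proof -
  have "x \<in> \<Omega>" "\<Psi> x \<in> K" using that K(3) by (auto simp: ext_def split: if_splits)
  then show ?thesis using Phi_Psi by (metis imageI)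
 qed
 then have "closure {x. ext n F x \<noteq> 0} \<subseteq> Phi p ` K"
  by (intro closure_minimal compact_imp_closed cp) auto
 moreover have "Phi p ` K \<subseteq> \<Omega>" using K(2) Phi_osq by blast
 moreover have "compact (closure {x. ext n F x \<noteq> 0})"
  using cp calculation(1) by (meson bounded_subset closed_closure compact_eq_bounded_closed)
 ultimately show ?thesis using C_k_ext[OF F K] by (auto simp: test_function_def)
qed

lemma gradient_ext:
 assumes F: "!!x. (F has_derivative (%h. F1 x * h$1 + F2 x * h$2)) (at x)"
  and K: "compact K" "K \<subseteq> osq" "!!w. w \<notin> K ==> F w = 0"
 shows "gradient (ext n F) x $ 1 = ext (n + 2) (ext1 n F F1 F2) x" "gradient (ext n F) x $ 2 = ext (n + 2) (ext2 n F F1 F2) x"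
 unfolding gradient_def using frechet_derivative_at[OF ext_has_derivative[OF F K], symmetric]
 by (simp_all add: axis_def)

lemma ext_Phi: "w \<in> osq ==> ext n F (Phi p w) = F w / J w ^ n"
 by (simp add: ext_def Phi_in Psi_Phi)

abbreviation "M\<Omega> \<equiv> lebesgue_on \<Omega>"

lemma fin_dom: "finite_measure M\<Omega>"
 using finite_measure_lebesgue_on_bounded[OF bounded_dom] open_dom by auto

lemma J_inverse_measurable: "(%w. inverse (J w)) \<in> borel_measurable Mosq"
 using measurable_osq[OF continuous_J] by measurable

text \<open>Composition does not preserve Lebesgue measurability in general. Here it is read off
  from the integrable function u(Phi) J of the change of variables, divided by J; square
  integrability uses J >= 1/4.\<close>

lemma pullback_L2:
 assumes "u \<in> L2 M\<Omega>"
 shows "(%w. u (Phi p w)) \<in> L2 Mosq"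
proof -
 interpret fin: finite_measure M\<Omega> by (rule fin_dom)
 have "integrable M\<Omega> (%x. u x * 1)"
  using assms by (rule L2_mult_integrable) (simp add: L2_def)
 then have "integrable Mosq (%w. (u (Phi p w) * 1) * J w)" unfolding change_of_variables(1) .
 then have "(%w. u (Phi p w) * 1 * J w * inverse (J w)) \<in> borel_measurable Mosq"
  by (intro borel_measurable_times[OF _ J_inverse_measurable] borel_measurable_integrable)
 then have m: "(%w. u (Phi p w)) \<in> borel_measurable Mosq"
  by (rule measurable_cong[THEN iffD1, rotated]) (use J_osq in force)
 have "integrable Mosq (%w. (u (Phi p w))\<^sup>2 * J w)"
  using L2_integrable[OF assms] unfolding change_of_variables(1) .
 then have "integrable Mosq (%w. 4 * ((u (Phi p w))^2 * J w))" by simp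
 then have "integrable Mosq (%w. (u (Phi p w))\<^sup>2)"
 proof (rule Bochner_Integration.integrable_bound)
  show "AE w in Mosq. norm ((u (Phi p w))^2) <= norm (4 * ((u (Phi p w))^2 * J w))"
  proof (rule AE_I2)
   fix w assume "w \<in> space Mosq"
   then have "1/4 <= J w" by (intro J_bounds) (auto simp: mem_osq)
   then have "(u (Phi p w))^2 * 1 <= (u (Phi p w))\<^sup>2 * (4 * J w)" by (intro mult_left_mono) auto
   then show "norm ((u (Phi p w))^2) <= norm (4 * ((u (Phi p w))^2 * J w))" by (simp add: mult_ac)
  qed
 qed (use m in measurable)
 then show ?thesis using m by (rule L2_I[rotated])
qed

text \<open>The gradient of u composed with \<open>Phi p\<close> by the chain rule: the transposed
  derivative applied to G.\<close>

definition pullG :: "(real^2 => real^2) => real^2 => real^2" where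
 "pullG G w = vector [G (Phi p w) \<bullet> Pu (w$2), G (Phi p w) \<bullet> Pv (w$1)]"

lemma Pu_bound: "\<bar>t\<bar> <= 1/2 ==> \<bar>Pu t $ i\<bar> <= 3/2" and Pv_bound: "\<bar>t\<bar> <= 1/2 ==> \<bar>Pv t $ i\<bar> <= 3/2"
proof -
 assume t: "\<bar>t\<bar> <= 1/2"
 have "\<bar>p $ k * t\<bar> <= 1/8 * (1/2)" for k by (rule mult_le[OF p_le t])
 note * = this[of 2] this[of 3] p_le[of 1] p_le[of 4]
 show "\<bar>Pu t $ i\<bar> <= 3/2" using exhaust_2[of i] *
  by (elim disjE; simp only: Pu_def vector_2 abs_le_iff mult.assoc) linarith+
 show "\<bar>Pv t $ i\<bar> <= 3/2" using exhaust_2[of i] *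
  by (elim disjE; simp only: Pv_def vector_2 abs_le_iff mult.assoc) linarith+
qed

lemma pullG_nth: "pullG G w $ 1 = G (Phi p w) $ 1 * Pu (w$2) $ 1 + G (Phi p w) $ 2 * Pu (w$2) $ 2"
 "pullG G w $ 2 = G (Phi p w) $ 1 * Pv (w$1) $ 1 + G (Phi p w) $ 2 * Pv (w$1) $ 2"
 by (simp_all add: pullG_def inner_vec_def sum_2)

lemma pullG_L2:
 assumes "!!i. (%x. G x $ i) \<in> L2 M\<Omega>"
 shows "(%w. pullG G w $ i) \<in> L2 Mosq"
proof -
 have b: "\<bar>Pu (w$2) $ l\<bar> <= 3/2" "\<bar>Pv (w$1) $ l\<bar> <= 3/2" if "w \<in> space Mosq" for w l
 proof -
  have "\<bar>w$1\<bar> <= 1/2" "\<bar>w$2\<bar> <= 1/2" using that by (auto simp: mem_osq)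
  then show "\<bar>Pu (w$2) $ l\<bar> <= 3/2" "\<bar>Pv (w$1) $ l\<bar> <= 3/2" using Pu_bound Pv_bound by blast+
 qed
 have u: "(%w. G (Phi p w) $ k * Pu (w$2) $ l) \<in> L2 Mosq" for k l
  by (rule L2_mult_bounded[OF pullback_L2[OF assms] measurable_osq[OF C_k_imp_continuous[OF C_k_Pu[of 0]]] b(1)])
 have v: "(%w. G (Phi p w) $ k * Pv (w$1) $ l) \<in> L2 Mosq" for k l
  by (rule L2_mult_bounded[OF pullback_L2[OF assms] measurable_osq[OF C_k_imp_continuous[OF C_k_Pv[of 0]]] b(2)])
 show ?thesis using exhaust_2[of i] by (elim disjE; simp only: pullG_nth) (intro L2_add u v)+
qed

text \<open>Test functions on the square are transported by the Piola transform, under which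
 the divergence becomes \<open>\<partial>\<^sub>i\<phi> / J\<close>.\<close>

lemma pullback_H1:
 assumes H: "H1 \<Omega> u G"
 shows "H1 osq (%w. u (Phi p w)) (pullG G)"
proof (rule H1_I)
 note uL = H1_D(1)[OF H] and GL = H1_D(2)[OF H]
 show "(%w. u (Phi p w)) \<in> L2 Mosq" by (rule pullback_L2[OF uL])
 show "(%w. pullG G w $ i) \<in> L2 Mosq" for i by (rule pullG_L2[OF GL])
 fix \<phi> and i :: 2 assume \<phi>: "test_function osq \<phi>"
 \<comment> \<open>\<open>R\<close> is the i-th column of the derivative of \<open>Phi p\<close>;
   multiplied by the test function and divided by J it is the Piola transform of the field with i-th
   component phi.\<close>
 define R where "R = (%(w::real^2) (k::2). if i = 1 then Pu (w$2) $ k else Pv (w$1) $ k)"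
 have ck: "C_k k \<phi>" for k using \<phi> by (simp add: test_function_def)
 obtain P K where P: "!!x. (\<phi> has_derivative (%h. P x \<bullet> h)) (at x)" "compact K" "K \<subseteq> osq" "!!x. x \<notin> K ==> \<phi> x = 0" "!!x. gradient \<phi> x = P x"
  using \<phi> by (rule test_functionE) blast
 define Y where "Y = (%k w. R w k * \<phi> w)"
 have ckY: "C_k n (Y k)" for n k
  unfolding Y_def R_def by (cases "i = 1") (simp_all add: C_k_mult C_k_Pu C_k_Pv ck)
 have Y0: "Y k w = 0" if "w \<notin> K" for k w using P(4)[OF that] by (simp add: Y_def)
 define Yu where "Yu = (%k w. R w k * P w $ 1 + (if i = 1 then 0 else if k = 1 then - 2 * p$2 else 2 * p$3) * \<phi> w)"
 define Yv where "Yv = (%k w. R w k * P w $ 2 + (if i = 1 then if k = 1 then - 2 * p$2 else 2 * p$3 else 0) * \<phi> w)"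
 have dY: "(Y k has_derivative (%h. Yu k w * h$1 + Yv k w * h$2)) (at w)" for k w
 proof -
  have "((%w. R w k) has_derivative (%h. (if i = 1 then 0 else if k = 1 then - 2 * p$2 else 2 * p$3) * h$1
    + (if i = 1 then if k = 1 then - 2 * p$2 else 2 * p$3 else 0) * h$2)) (at w)"
   using exhaust_2[of k] by (cases "i = 1"; elim disjE; simp add: R_def Pu_def Pv_def)
    (auto intro!: derivative_eq_intros)
  from has_derivative_mult[OF this P(1)[of w]] show ?thesis
   unfolding Y_def by (rule has_derivative_eq_rhs) (simp add: fun_eq_iff Yu_def Yv_def inner_vec_def sum_2 algebra_simps)
 qed
 have test: "test_function \<Omega> (ext 1 (Y k))" for k
  by (rule test_function_ext[OF ckY P(2,3) Y0])
 have L: "ext 1 (Y k) \<in> L2 M\<Omega>" "(%x. gradient (ext 1 (Y k)) x $ l) \<in> L2 M\<Omega>" for k l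
  using test_function_L2[OF bounded_dom _ test] open_dom by auto
 have int: "integrable M\<Omega> (%x. u x * gradient (ext 1 (Y k)) x $ k)" "integrable M\<Omega> (%x. G x $ k * ext 1 (Y k) x)" for k
  by (intro L2_mult_integrable uL GL L)+
 have weak: "(LINT x|M\<Omega>. u x * gradient (ext 1 (Y k)) x $ k) = - (LINT x|M\<Omega>. G x $ k * ext 1 (Y k) x)" for k
  by (rule H1_D(4)[OF H test])
 \<comment> \<open>The weak identities for both components are added, so that u meets only the
   divergence of the transported field.\<close>
 have "(LINT x|M\<Omega>. u x * gradient (ext 1 (Y 1)) x $ 1 + u x * gradient (ext 1 (Y 2)) x $ 2)
  = - (LINT x|M\<Omega>. G x $ 1 * ext 1 (Y 1) x + G x $ 2 * ext 1 (Y 2) x)"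
  using weak[of 1] weak[of 2] int[of 1] int[of 2] by simp
 then have e0: "(LINT w|Mosq. (u (Phi p w) * gradient (ext 1 (Y 1)) (Phi p w) $ 1 + u (Phi p w) * gradient (ext 1 (Y 2)) (Phi p w) $ 2) * J w)
  = - (LINT w|Mosq. (G (Phi p w) $ 1 * ext 1 (Y 1) (Phi p w) + G (Phi p w) $ 2 * ext 1 (Y 2) (Phi p w)) * J w)"
  unfolding change_of_variables(2) .
 have e1: "(u (Phi p w) * gradient (ext 1 (Y 1)) (Phi p w) $ 1 + u (Phi p w) * gradient (ext 1 (Y 2)) (Phi p w) $ 2) * J w
   = u (Phi p w) * gradient \<phi> w $ i" if w: "w \<in> osq" for w
 proof -
  have Jn: "J w \<noteq> 0" using J_osq[OF w] by simp
  define E where "E = ext1 1 (Y 1) (Yu 1) (Yv 1) w + ext2 1 (Y 2) (Yu 2) (Yv 2) w"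
  \<comment> \<open>Piola's identity: the derivatives of the columns and of J cancel, and only the
    partial derivative of the test function survives.\<close>
  have key: "E = P w $ i * J w ^ 2"
  proof -
   define x1 x2 y1 y2 where "x1 = Pu (w$2) $ 1" and "x2 = Pu (w$2) $ 2" and "y1 = Pv (w$1) $ 1" and "y2 = Pv (w$1) $ 2"
   have e: "J w = x1 * y2 - x2 * y1" "j1 = 2 * p$2 * x2 + 2 * p$3 * x1" "j2 = - 2 * p$2 * y2 - 2 * p$3 * y1"
    unfolding J_cross[of w] x1_def x2_def y1_def y2_def j1_def j2_def by (simp_all add: Pu_def Pv_def algebra_simps)
   show ?thesis
    using exhaust_2[of i]
    by (elim disjE; simp only: E_def ext1_def ext2_def Y_def Yu_def Yv_def R_def x1_def[symmetric] x2_def[symmetric] y1_def[symmetric] y2_def[symmetric])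
     (simp_all add: e power2_eq_square algebra_simps)
  qed
  have "(u (Phi p w) * gradient (ext 1 (Y 1)) (Phi p w) $ 1 + u (Phi p w) * gradient (ext 1 (Y 2)) (Phi p w) $ 2) * J w
   = u (Phi p w) * (E / J w ^ 3) * J w"
  proof -
   have "gradient (ext 1 (Y 1)) x $ 1 = ext (1 + 2) (ext1 1 (Y 1) (Yu 1) (Yv 1)) x"
    "gradient (ext 1 (Y 2)) x $ 2 = ext (1 + 2) (ext2 1 (Y 2) (Yu 2) (Yv 2)) x" for x
    using gradient_ext(1)[where F = "Y 1" and ?F1.0 = "Yu 1" and ?F2.0 = "Yv 1" and n = 1, OF dY P(2,3) Y0]
     gradient_ext(2)[where F = "Y 2" and ?F1.0 = "Yu 2" and ?F2.0 = "Yv 2" and n = 1, OF dY P(2,3) Y0] by blast+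
   then show ?thesis unfolding E_def by (simp add: ext_Phi[OF w] add_divide_distrib distrib_left eval_nat_numeral)
  qed
  also have "\<dots> = u (Phi p w) * gradient \<phi> w $ i"
   unfolding key P(5) using Jn by (simp add: power2_eq_square power3_eq_cube)
  finally show ?thesis .
 qed
 have e2: "(G (Phi p w) $ 1 * ext 1 (Y 1) (Phi p w) + G (Phi p w) $ 2 * ext 1 (Y 2) (Phi p w)) * J w
   = pullG G w $ i * \<phi> w" if w: "w \<in> osq" for w
 proof -
  have Jn: "J w \<noteq> 0" using J_osq[OF w] by simp
  have "(G (Phi p w) $ 1 * ext 1 (Y 1) (Phi p w) + G (Phi p w) $ 2 * ext 1 (Y 2) (Phi p w)) * J w
   = G (Phi p w) $ 1 * (R w 1 * \<phi> w) + G (Phi p w) $ 2 * (R w 2 * \<phi> w)"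
   using Jn by (simp add: ext_Phi[OF w] Y_def field_simps)
  also have "\<dots> = pullG G w $ i * \<phi> w"
   using exhaust_2[of i] by (auto simp: R_def pullG_nth algebra_simps)
  finally show ?thesis .
 qed
 have "(LINT w|Mosq. (u (Phi p w) * gradient (ext 1 (Y 1)) (Phi p w) $ 1 + u (Phi p w) * gradient (ext 1 (Y 2)) (Phi p w) $ 2) * J w)
   = (LINT w|Mosq. u (Phi p w) * gradient \<phi> w $ i)"
  by (rule lint_cong0[OF refl e1]) simp
 moreover have "(LINT w|Mosq. (G (Phi p w) $ 1 * ext 1 (Y 1) (Phi p w) + G (Phi p w) $ 2 * ext 1 (Y 2) (Phi p w)) * J w)
   = (LINT w|Mosq. pullG G w $ i * \<phi> w)"
  by (rule lint_cong0[OF refl e2]) simp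
 ultimately show "(LINT w|Mosq. u (Phi p w) * gradient \<phi> w $ i) = - (LINT w|Mosq. pullG G w $ i * \<phi> w)"
  using e0 by simp
qed

text \<open>Every entry of the derivative is at most 3/2 in modulus, so each of its two columns has
  squared norm at most 9/2.\<close>

lemma pullG_norm:
 assumes "w \<in> osq"
 shows "(norm (pullG G w))^2 <= 9 * (norm (G (Phi p w)))^2"
proof -
 have w: "\<bar>w$1\<bar> <= 1/2" "\<bar>w$2\<bar> <= 1/2" using assms by (auto simp: mem_osq)
 have sq: "(Pu (w$2) $ i)^2 <= 9/4" "(Pv (w$1) $ i)^2 <= 9/4" for i
  using power_mono[OF Pu_bound[OF w(2)] abs_ge_zero, of i 2] power_mono[OF Pv_bound[OF w(1)] abs_ge_zero, of i 2]
  by (simp_all add: power2_eq_square)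
 have pG: "pullG G w $ 1 = G (Phi p w) \<bullet> Pu (w$2)" "pullG G w $ 2 = G (Phi p w) \<bullet> Pv (w$1)"
  by (simp_all add: pullG_def)
 have CS: "(g \<bullet> h)^2 <= (norm g)\<^sup>2 * (9/2)" if "(h$1)^2 <= 9/4" "(h$2)^2 <= 9/4" for g h :: "real^2"
 proof -
  have "(g \<bullet> h)^2 <= (norm g)\<^sup>2 * (norm h)^2"
   using Cauchy_Schwarz_ineq[of g h] by (simp add: power2_norm_eq_inner)
  also have "\<dots> <= (norm g)\<^sup>2 * (9/2)" using that by (intro mult_left_mono) (auto simp: norm_vec2_sq)
  finally show ?thesis .
 qed
 show ?thesis
  unfolding norm_vec2_sq[of "pullG G w"] pG
  using CS[OF sq(1)[of 1] sq(1)[of 2], of "G (Phi p w)"] CS[OF sq(2)[of 1] sq(2)[of 2], of "G (Phi p w)"] by linarith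
qed

lemma rellich_dom: "rellich \<Omega>"
 unfolding rellich_def
proof (intro exI conjI allI impI)
 \<comment> \<open>The factor 1/J cancels the Jacobian of the change of variables, so the
   coefficients on the quadrilateral are the cosine coefficients of the pulled-back
   function.\<close>
 define e where "e = (%k x. cmode (fst k) (snd k) (\<Psi> x) / J (\<Psi> x))"
 have eL: "e k \<in> L2 M\<Omega>" for k
 proof (rule L2_bounded[OF _ fin_dom])
  have "continuous_on \<Omega> (e k)"
   unfolding e_def
   by (intro continuous_on_divide continuous_on_compose2[OF continuous_cmode continuous_Psi]
     continuous_on_compose2[OF continuous_J continuous_Psi]) (use Psi_in J_osq in force)+
  then show "e k \<in> borel_measurable M\<Omega>"
   by (rule continuous_imp_measurable_on_sets_lebesgue) (use open_dom in auto)
  fix x assume "x \<in> space M\<Omega>"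
  then have x: "\<Psi> x \<in> osq" using Psi_in by simp
  then have J: "1/4 <= J (\<Psi> x)" by (intro J_bounds) (auto simp: mem_osq)
  have "\<bar>cmode m n w\<bar> <= 1 * 1" for m n w
   unfolding cmode_def abs_mult by (intro mult_mono abs_cos_le_one) auto
  then have "\<bar>e k x\<bar> <= 1 / J (\<Psi> x)" using J by (simp add: e_def divide_right_mono)
  also have "\<dots> <= 4" using J by (simp add: pos_divide_le_eq)
  finally show "\<bar>e k x\<bar> <= 4" .
 qed
 show "e k \<in> L2 M\<Omega>" for k by (rule eL)
 \<comment> \<open>8 is 2 times 4: J <= 2 enters through the norm, and 4 bounds both 1/nu and
   36/pi^2. The 36 is the 9 of \<open>pullG_norm\<close> times 4, from J >= 1/4.\<close>
 show "(8::real) > 0" by simp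
 have ce: "(LINT x|M\<Omega>. u x * e k x) = (LINT w|Mosq. u (Phi p w) * cmode (fst k) (snd k) w)" for u k
  unfolding change_of_variables(2)
  by (rule lint_cong0) (use J_osq in \<open>force simp: e_def Psi_Phi\<close>)+
 have "(LINT x|M\<Omega>. e (0, 0) x) = (LINT w|Mosq. cmode 0 0 w * cmode 0 0 w)"
  using ce[of "%_. 1" "(0, 0)"] by (simp add: cmode_def)
 then show "(LINT x|M\<Omega>. e (0, 0) x) \<noteq> 0" unfolding cmode_orth by (simp add: nu_def)
 fix N :: nat and u G assume N: "N \<ge> 1" and H: "H1 \<Omega> u G"
 define U where "U = (%w. u (Phi p w))"
 note hU = pullback_H1[OF H, folded U_def]
 define S where "S = (\<Sum>k\<in>{..<N}\<times>{..<N}. (LINT x|M\<Omega>. u x * e k x)\<^sup>2)"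
 define D where "D = (LINT x|M\<Omega>. (norm (G x))\<^sup>2)"
 have UL: "integrable Mosq (%w. (U w)\<^sup>2)" by (rule L2_integrable[OF H1_D(1)[OF hU]])
 have 1: "(LINT x|M\<Omega>. (u x)\<^sup>2) <= 2 * (LINT w|Mosq. (U w)\<^sup>2)"
 proof -
  have "(LINT x|M\<Omega>. (u x)\<^sup>2) = (LINT w|Mosq. (U w)\<^sup>2 * J w)" unfolding change_of_variables(2) U_def ..
  also have "\<dots> <= (LINT w|Mosq. (U w)\<^sup>2 * 2)"
  proof (rule integral_mono)
   show "integrable Mosq (%w. (U w)\<^sup>2 * J w)"
    using L2_integrable[OF H1_D(1)[OF H]] unfolding change_of_variables(1) U_def .
   show "(U w)^2 * J w <= (U w)\<^sup>2 * 2" if "w \<in> space Mosq" for w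
    using that by (intro mult_left_mono J_bounds) (auto simp: mem_osq)
  qed (use UL in simp)
  finally show ?thesis by simp
 qed
 have 2: "(\<Sum>k\<in>{..<N}\<times>{..<N}. (LINT w|Mosq. U w * cmode (fst k) (snd k) w)\<^sup>2 / nu (fst k) (snd k)) <= 4 * S"
  unfolding S_def sum_distrib_left
 proof (rule sum_mono)
  fix k assume "k \<in> {..<N} \<times> {..<N}"
  have "1 / nu m n <= 4" for m n by (simp add: nu_def)
  from mult_left_mono[OF this zero_le_power2]
  show "(LINT w|Mosq. U w * cmode (fst k) (snd k) w)^2 / nu (fst k) (snd k) <= 4 * (LINT x|M\<Omega>. u x * e k x)^2"
   unfolding ce U_def by (simp add: mult.commute)
 qed
 have 3: "(LINT w|Mosq. (norm (pullG G w))\<^sup>2) <= 36 * D"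
 proof -
  have i: "integrable Mosq (%w. (norm (G (Phi p w)))\<^sup>2 * J w)"
   using H1_D(3)[OF H] unfolding change_of_variables(1) .
  have "(LINT w|Mosq. (norm (pullG G w))\<^sup>2) <= (LINT w|Mosq. 36 * ((norm (G (Phi p w)))^2 * J w))"
  proof (rule integral_mono)
   show "integrable Mosq (%w. (norm (pullG G w))\<^sup>2)" by (rule H1_D(3)[OF hU])
   fix w assume w: "w \<in> space Mosq"
   then have "1/4 <= J w" by (intro J_bounds) (auto simp: mem_osq)
   then have "9 * (norm (G (Phi p w)))^2 * 1 <= 9 * (norm (G (Phi p w)))^2 * (4 * J w)" by (intro mult_left_mono) auto
   then have "9 * (norm (G (Phi p w)))^2 <= 36 * ((norm (G (Phi p w)))^2 * J w)" by (simp add: mult_ac)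
   moreover have "w \<in> osq" using w by simp
   ultimately show "(norm (pullG G w))^2 <= 36 * ((norm (G (Phi p w)))^2 * J w)"
    using pullG_norm[of w G] by linarith
  qed (use i in simp)
  also have "\<dots> = 36 * (LINT w|Mosq. (norm (G (Phi p w)))\<^sup>2 * J w)" by simp
  finally show ?thesis unfolding D_def change_of_variables(2) .
 qed
 have "(LINT w|Mosq. (U w)\<^sup>2) <= 4 * S + 36 * D / (pi^2 * (real N)^2)"
  using square_spectral_estimate[OF hU N] 2 3 divide_right_mono[OF 3, of "pi^2 * (real N)^2"] by simp
 also have "36 * D / (pi^2 * (real N)^2) = 36 / pi^2 * (D / (real N)^2)" by simp
 also have "\<dots> <= 4 * (D / (real N)^2)"
 proof (rule mult_right_mono)
  have "3\<^sup>2 <= pi\<^sup>2" using pi_gt3 by (intro power_mono) auto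
  then show "36 / pi^2 <= 4" by (simp add: pos_divide_le_eq)
 qed (simp add: D_def)
 finally show "(LINT x|M\<Omega>. (u x)\<^sup>2) <= 8 * (S + D / (real N)^2)" using 1 by simp
qed

sublocale dom: bounded_domain \<Omega>
 by unfold_locales (rule bounded_dom open_dom rellich_dom)+

text \<open>The inverse transposed derivative applied to (F1, F2), that is, the gradient of F
  composed with the inverse map.\<close>

definition pushG :: "(real^2 => real) => (real^2 => real) => real^2 => real^2" where
 "pushG F1 F2 w = vector [(F1 w * Pv (w$1) $ 2 - F2 w * Pu (w$2) $ 2) / J w, (F2 w * Pu (w$2) $ 1 - F1 w * Pv (w$1) $ 1) / J w]"

lemma H1_push:
 assumes F: "!!x. (F has_derivative (%h. F1 x * h$1 + F2 x * h$2)) (at x)"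
  and cont: "contU F1" "contU F2"
 shows "H1 \<Omega> (%x. F (\<Psi> x)) (%x. pushG F1 F2 (\<Psi> x))"
proof (rule H1_C1[OF open_dom _ _ _ _ bounded_dom])
 show "((%x. F (\<Psi> x)) has_derivative (%h. pushG F1 F2 (\<Psi> x) \<bullet> h)) (at x)" if x: "x \<in> \<Omega>" for x
 proof -
  have "J (\<Psi> x) > 0" using x Psi_in J_osq by blast
  then have "(%h. pushG F1 F2 (\<Psi> x) \<bullet> h) = (%h. ext1 0 F F1 F2 (\<Psi> x) / J (\<Psi> x) ^ (0 + 2) * h$1 + ext2 0 F F1 F2 (\<Psi> x) / J (\<Psi> x) ^ (0 + 2) * h$2)"
   unfolding has_derivative_vec2_iff pushG_def vector_2 ext1_def ext2_def
   by (simp add: fun_eq_iff power2_eq_square field_simps)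
  then show ?thesis
   using has_derivative_quotient_Psi[where F = F and ?F1.0 = F1 and ?F2.0 = F2 and n = 0, OF F x] by simp
 qed
 have Jn: "J w \<noteq> 0" if "w \<in> square" for w using J_pos[OF that] by simp
 have cPu: "continuous_on square (%w. Pu (w$2) $ k)" and cPv: "continuous_on square (%w. Pv (w$1) $ k)" for k
  using C_k_imp_continuous[OF C_k_Pu[of 0]] C_k_imp_continuous[OF C_k_Pv[of 0]] continuous_on_subset subset_UNIV by blast+
 have cF12: "continuous_on square F1" "continuous_on square F2"
  using cont continuous_on_subset subset_UNIV by blast+
 have "continuous_on square (%w. (F1 w * Pv (w$1) $ 2 - F2 w * Pu (w$2) $ 2) / J w)"
  "continuous_on square (%w. (F2 w * Pu (w$2) $ 1 - F1 w * Pv (w$1) $ 1) / J w)"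
  by (intro continuous_on_divide continuous_on_diff continuous_on_mult cPu cPv cF12 continuous_J; use Jn in blast)+
 then have "continuous_on square (%w. pushG F1 F2 w $ 1)" "continuous_on square (%w. pushG F1 F2 w $ 2)"
  by (simp_all only: pushG_def vector_2)
 then have c: "continuous_on square (%w. pushG F1 F2 w $ i)" for i
  using exhaust_2[of i] by (elim disjE) (simp_all only:)
 have sub: "\<Psi> ` \<Omega> \<subseteq> square" using Psi_in osq_subset by blast
 have cF: "contU F"
  by (intro continuous_at_imp_continuous_on ballI has_derivative_continuous[OF F])
 have L: "(%x. f (\<Psi> x)) \<in> L2 M\<Omega>" if f: "continuous_on square f" for f :: "real^2 => real"
 proof -
  have "compact (f ` square)" using f by (intro compact_continuous_image) (auto simp: square_def)
  then obtain B where B: "!!w. w \<in> square ==> \<bar>f w\<bar> <= B"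
   using compact_imp_bounded[of "f ` square"] unfolding bounded_iff by auto
  show ?thesis
  proof (rule L2_bounded[OF _ fin_dom])
   show "(%x. f (\<Psi> x)) \<in> borel_measurable M\<Omega>"
    by (rule continuous_imp_measurable_on_sets_lebesgue[OF continuous_on_compose2[OF f continuous_Psi sub]]) (use open_dom in auto)
   show "\<bar>f (\<Psi> x)\<bar> <= B" if "x \<in> space M\<Omega>" for x using B sub that by auto
  qed
 qed
 show "(%x. F (\<Psi> x)) \<in> L2 M\<Omega>" by (rule L[OF continuous_on_subset[OF cF]]) simp
 show "(%x. pushG F1 F2 (\<Psi> x) $ i) \<in> L2 M\<Omega>" for i by (rule L[OF c])
 show "continuous_on \<Omega> (%x. pushG F1 F2 (\<Psi> x))"
  by (subst continuous_on_componentwise)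
   (auto simp: UNIV_Basis2 inner_axis intro!: continuous_on_compose2[OF c continuous_Psi sub])
qed

text \<open>The mean m/A is subtracted and the Rayleigh quotient pulled back. The factor J of the
  change of variables cancels one of the two in the denominator of the squared norm of
  \<open>pushG\<close>.\<close>

theorem mu1_le_pullback:
 assumes F: "!!x. (F has_derivative (%h. F1 x * h$1 + F2 x * h$2)) (at x)"
  and cont: "contU F1" "contU F2"
 defines "m \<equiv> (LINT w|Mosq. F w * J w)"
 defines "N \<equiv> (LINT w|Mosq. (F w)\<^sup>2 * J w) - m\<^sup>2 / A"
 defines "D \<equiv> (LINT w|Mosq. ((F1 w * Pv (w$1) $ 2 - F2 w * Pu (w$2) $ 2)^2 + (F2 w * Pu (w$2) $ 1 - F1 w * Pv (w$1) $ 1)^2) / J w)"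
 assumes N: "N > 0"
 shows "mu1 \<Omega> * N <= D"
proof -
 define f where "f = (%x. F (\<Psi> x))"
 define g where "g = (%x. pushG F1 F2 (\<Psi> x))"
 have h: "H1 \<Omega> f g" unfolding f_def g_def by (rule H1_push[OF F cont])
 have ch: "(LINT x|M\<Omega>. \<phi> (\<Psi> x)) = (LINT w|Mosq. \<phi> w * J w)" for \<phi> :: "real^2 => real"
  unfolding change_of_variables(2) by (rule lint_cong0) (auto simp: Psi_Phi)
 have Apos: "A > 0" using J_bounds(1)[of 0] by (simp add: J_def)
 have vol: "(LINT x|M\<Omega>. (1::real)) = A"
 proof -
  have "(LINT x|M\<Omega>. (1::real)) = measure lebesgue \<Omega>" using open_dom by (simp add: measure_restrict_space)
  also have "\<dots> = measure lebesgue (closure \<Omega>)"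
   by (rule measure_closure[symmetric, OF bounded_dom negligible_convex_frontier[OF convex_dom]])
  finally show ?thesis using area_eq by (simp add: area_def quad_eq closure_dom)
 qed
 have mf: "(LINT x|M\<Omega>. f x) = m" unfolding f_def m_def by (rule ch)
 have nf: "(LINT x|M\<Omega>. (f x)\<^sup>2) = (LINT w|Mosq. (F w)\<^sup>2 * J w)" unfolding f_def by (rule ch)
 define c where "c = m / A"
 have h': "H1 \<Omega> (%x. f x + (- c) * 1) (%x. g x + (- c) *\<^sub>R 0)" by (rule dom.H1_lin[OF h dom.H1_const])
 have mean: "(LINT x|M\<Omega>. f x + (- c) * 1) = 0"
  using dom.integral_L2_one[OF H1_D(1)[OF h]] dom.integral_L2_one[OF dom.one_L2[of c]] mf vol Apos
  by (simp add: c_def)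
 have nrm: "(LINT x|M\<Omega>. (f x + (- c) * 1)\<^sup>2) = N"
  unfolding integral_square_expand[OF H1_D(1)[OF h] dom.one_L2[of 1]] using Apos mf vol
  by (simp add: N_def nf c_def) (simp add: power2_eq_square field_simps)
 have dirg: "(LINT x|M\<Omega>. (g x + (- c) *\<^sub>R 0) \<bullet> (g x + (- c) *\<^sub>R 0)) = D"
 proof -
  have "(LINT x|M\<Omega>. (g x + (- c) *\<^sub>R 0) \<bullet> (g x + (- c) *\<^sub>R 0)) = (LINT w|Mosq. (pushG F1 F2 w \<bullet> pushG F1 F2 w) * J w)"
   unfolding g_def using ch[of "%w. pushG F1 F2 w \<bullet> pushG F1 F2 w"] by simp
  also have "\<dots> = D"
   unfolding D_def
  proof (rule lint_cong0)
   fix w assume "w \<in> space Mosq"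
   then have "J w > 0" using J_osq by simp
   then show "(pushG F1 F2 w \<bullet> pushG F1 F2 w) * J w = ((F1 w * Pv (w$1) $ 2 - F2 w * Pu (w$2) $ 2)^2 + (F2 w * Pu (w$2) $ 1 - F1 w * Pv (w$1) $ 1)^2) / J w"
    by (simp add: pushG_def inner_vec_def sum_2 power2_eq_square add_divide_distrib[symmetric])
  qed simp
  finally show ?thesis .
 qed
 show ?thesis using dom.mu1_le_Rayleigh[OF h' mean] N unfolding nrm dirg by simp
qed

end

text \<open>Testing with constants shows that an eigenfunction of a nonzero eigenvalue has mean
  zero; the spectral estimate with N = 1 then bounds the eigenvalue from below.\<close>

theorem mu1_square_ge: "pi^2 <= mu1 osq"
proof -
 interpret quad_map 0 by unfold_locales simp
 have P0: "Phi 0 w = w" for w by (simp add: vec_eq_iff forall_2 Phi_nth)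
 have dom: "\<Omega> = osq" using Phi_osq by (simp add: P0)
 have rng: "\<mu> \<ge> pi\<^sup>2" if \<mu>: "neumann_eigenvalue osq \<mu>" "\<mu> \<noteq> 0" for \<mu>
 proof -
  obtain u G where u: "H1 osq u G" "\<not> (AE x in Mosq. u x = 0)"
   and w: "!!v F. H1 osq v F ==> (LINT x|Mosq. G x \<bullet> F x) = \<mu> * (LINT x|Mosq. u x * v x)"
   using \<mu>(1) unfolding neumann_eigenvalue_def by blast
  have "(LINT x|Mosq. u x) = 0" using w[OF dom.H1_const[of 1, unfolded dom]] \<mu>(2) by simp
  moreover have "{..<1::nat} \<times> {..<1::nat} = {(0,0)}" by auto
  ultimately have le: "(LINT x|Mosq. (u x)\<^sup>2) <= (LINT x|Mosq. (norm (G x))\<^sup>2) / pi^2"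
   using square_spectral_estimate[OF u(1), of 1] by (simp add: cmode_def)
  have "(LINT x|Mosq. (norm (G x))\<^sup>2) = \<mu> * (LINT x|Mosq. (u x)\<^sup>2)"
   using w[OF u(1)] unfolding power2_norm_eq_inner by (simp add: power2_eq_square)
  then have "pi^2 * (LINT x|Mosq. (u x)\<^sup>2) <= \<mu> * (LINT x|Mosq. (u x)\<^sup>2)"
   using le by (simp add: pos_le_divide_eq mult.commute)
  moreover have "(LINT x|Mosq. (u x)\<^sup>2) > 0"
  proof -
   have "(LINT x|Mosq. (u x)\<^sup>2) \<noteq> 0"
    using u(2) integral_nonneg_eq_0_iff_AE[OF L2_integrable[OF H1_D(1)[OF u(1)]]] by auto
   then show ?thesis by (simp add: less_le)
  qed
  ultimately show ?thesis by simp
 qed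
 \<comment> \<open>An infimum over the empty set would carry no information; the first coordinate
   serves as a trial function to produce some positive eigenvalue.\<close>
 define F where "F = (%w::real^2. w$1)"
 have Fd: "(F has_derivative (%h. 1 * h$1 + 0 * h$2)) (at x)" for x
  unfolding F_def by (auto intro!: derivative_eq_intros)
 have h: "H1 osq (%x. F (\<Psi> x)) (%x. pushG (%_. 1) (%_. 0) (\<Psi> x))"
  using H1_push[OF Fd] by (simp add: dom)
 have Psi0: "\<Psi> x = x" if "x \<in> osq" for x using Psi_Phi[OF that] by (simp add: P0)
 have I: "I1 (%x. x) = 0" "I1 (%x. 1) = 1" "I1 (%x. x\<^sup>2) = 1/12"
 proof -
  show "I1 (%x. x) = 0"
   using I1_FTC[of "%x. x\<^sup>2 / 2" "%x. x"] by (auto intro!: derivative_eq_intros simp: power2_eq_square)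
  show "I1 (%x. x\<^sup>2) = 1/12"
  proof -
   have "((%x. x^3 / 3) has_real_derivative x\<^sup>2) (at x)" for x :: real
    by (auto intro!: derivative_eq_intros)
   from I1_FTC[OF this] show ?thesis by (simp add: power3_eq_cube)
  qed
 qed simp
 have c: "contU (%x::real. x)" "contU (%x::real. x\<^sup>2)" "contU (%x::real. 1::real)"
  by (auto intro!: continuous_intros)
 have "(LINT x|Mosq. F (\<Psi> x)) = (LINT x|Mosq. x$1 * 1)"
  by (rule lint_cong0) (auto simp: Psi0 F_def)
 also have "\<dots> = 0" using integral_osq_product[OF c(1,3)] I by simp
 finally have m: "(LINT x|Mosq. F (\<Psi> x)) = 0" .
 have "(LINT x|Mosq. (F (\<Psi> x))\<^sup>2) = (LINT x|Mosq. (x$1)\<^sup>2 * 1)"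
  by (rule lint_cong0) (auto simp: Psi0 F_def)
 also have "\<dots> = 1/12" using integral_osq_product[OF c(2,3)] unfolding I by simp
 finally have n: "(LINT x|Mosq. (F (\<Psi> x))\<^sup>2) > 0" by simp
 obtain \<mu> where "neumann_eigenvalue osq \<mu>" "\<mu> > 0"
  using dom.exists_eigenvalue_le_Rayleigh[unfolded dom, OF h m n] by blast
 then have "{\<mu>. neumann_eigenvalue osq \<mu> \<and> \<mu> \<noteq> 0} \<noteq> {}" by auto
 then show ?thesis unfolding mu1_def using rng by (intro cInf_greatest) auto
qed

section \<open>The trial function inequality\<close>

lemma I1_add: "contU f ==> contU g ==> I1 (%x. f x + g x) = I1 f + I1 g"
 by (intro Henstock_Kurzweil_Integration.integral_add I1_integrable)

lemma I1_cmult: "I1 (%x. c * f x) = c * I1 f"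
 by simp

lemma I1_odd:
 assumes "!!x. f (- x) = - f x"
 shows "I1 f = 0"
proof -
 have "I1 (%x. f (- x)) = I1 f" using Henstock_Kurzweil_Integration.integral_reflect_real[of "1/2" "-1/2" f] by simp
 moreover have "I1 (%x. f (- x)) = - I1 f" unfolding assms by simp
 ultimately show ?thesis by linarith
qed

lemma I1_mono:
 assumes "contU f" "contU g" "!!x. \<bar>x\<bar> <= 1/2 ==> f x <= g x"
 shows "I1 f <= I1 g"
proof (rule Henstock_Kurzweil_Integration.integral_le[OF I1_integrable I1_integrable])
 fix x :: real assume "x \<in> {-1/2..1/2}"
 then show "f x <= g x" by (intro assms(3)) (auto simp: abs_le_iff)
qed fact+

lemma I1_power: "I1 (%x. 1) = 1" "I1 (%x. x) = 0" "I1 (%x. x\<^sup>2) = 1/12" "I1 (%x. x^3) = 0" "I1 (%x. x^4) = 1/80"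
proof -
 have "((%x. x^3 / 3) has_real_derivative x\<^sup>2) (at x)" for x :: real
  by (auto intro!: derivative_eq_intros)
 from I1_FTC[OF this] show "I1 (%x. x\<^sup>2) = 1/12" by (simp add: power3_eq_cube)
 have "((%x. x^5 / 5) has_real_derivative x^4) (at x)" for x :: real
  by (auto intro!: derivative_eq_intros)
 from I1_FTC[OF this] show "I1 (%x. x^4) = 1/80" by (simp add: eval_nat_numeral)
 show "I1 (%x. x) = 0" "I1 (%x. x^3) = 0" by (rule I1_odd; simp)+
qed simp

lemma integral_osq_product_ij:
 assumes "contU f" "contU g" "i \<noteq> (j::2)"
 shows "(LINT w|Mosq. f (w$i) * g (w$j)) = I1 f * I1 g"
proof (cases "i = 1")
 case True
 then have "j = 2" using assms(3) exhaust_2[of j] by auto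
 then show ?thesis using integral_osq_product[OF assms(1,2)] True by simp
next
 case False
 then have "i = 2" "j = 1" using assms(3) exhaust_2[of i] exhaust_2[of j] by auto
 then show ?thesis using integral_osq_product[OF assms(2,1)] by (simp add: mult.commute)
qed

lemma integrable_osq: "contU f ==> integrable Mosq f" for f :: "real^2 => real"
proof -
 assume f: "contU f"
 have one: "(%x. 1) \<in> L2 Mosq" by (rule L2_osq_bounded) (intro continuous_intros)
 show "integrable Mosq f" using L2_mult_integrable[OF L2_osq_bounded[OF f] one] by simp
qed

lemma continuous_two: "contU f ==> contU g ==> contU (%w::real^2. f (w$i) * g (w$j))"
 for f g :: "real => real"
 by (intro continuous_on_mult continuous_fn_nth)

text \<open>Odd powers of the second variable integrate to 0; 1/12 and 1/80 are its second and
  fourth moments on [-1/2, 1/2].\<close>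

lemma integral_osq_poly:
 assumes C: "contU C0" "contU C1" "contU C2" "contU C3" "contU C4"
  and ij: "i \<noteq> (j::2)"
 shows "(LINT w|Mosq. C0 (w$i) * 1 + C1 (w$i) * w$j + C2 (w$i) * (w$j)^2 + C3 (w$i) * (w$j)^3 + C4 (w$i) * (w$j)^4)
  = I1 C0 + I1 C2 / 12 + I1 C4 / 80"
proof -
 have c: "contU (%x::real. 1::real)" "contU (%x::real. x)" "contU (%x::real. x\<^sup>2)" "contU (%x::real. x^3)" "contU (%x::real. x^4)"
  by (intro continuous_intros)+
 note p = integral_osq_product_ij[OF C(1) c(1) ij] integral_osq_product_ij[OF C(2) c(2) ij] integral_osq_product_ij[OF C(3) c(3) ij]
  integral_osq_product_ij[OF C(4) c(4) ij] integral_osq_product_ij[OF C(5) c(5) ij]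
 note q = integrable_osq[OF continuous_two[OF C(1) c(1), of i]] integrable_osq[OF continuous_two[OF C(2) c(2), of i j]]
  integrable_osq[OF continuous_two[OF C(3) c(3), of i j]] integrable_osq[OF continuous_two[OF C(4) c(4), of i j]] integrable_osq[OF continuous_two[OF C(5) c(5), of i j]]
 show ?thesis
  by (simp only: lint_add lint_integrable_add q p I1_power)
qed

section \<open>Trigonometric moments and the energy of the trial functions\<close>

abbreviation "cs2 u \<equiv> (cos (pi * u))\<^sup>2"
abbreviation "sn2 u \<equiv> (sin (pi * u))\<^sup>2"
abbreviation "sc u \<equiv> sin (pi * u) * cos (pi * u)"

text \<open>\<open>kap2\<close>, \<open>sig1\<close> and \<open>tau\<close> are evaluated in closed
  form. \<open>kap4\<close>, \<open>lam2\<close> and \<open>sig3\<close> are only bounded, since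
  they enter the decisive estimates at higher order in b and c.\<close>

definition kap2 :: real where "kap2 = I1 (%u. u\<^sup>2 * cs2 u)"
definition kap4 :: real where "kap4 = I1 (%u. u^4 * cs2 u)"
definition lam2 :: real where "lam2 = I1 (%u. u\<^sup>2 * sn2 u)"
definition sig1 :: real where "sig1 = I1 (%u. u * sc u)"
definition sig3 :: real where "sig3 = I1 (%u. u^3 * sc u)"
definition tau :: real where "tau = I1 (%u. u\<^sup>2 * cos (pi * u))"

lemma I1_trig: "I1 cs2 = 1/2" "I1 sn2 = 1/2" "I1 (%u. u * sin (pi * u)) = 2 / pi^2" "I1 (%u. cos (pi * u)) = 2 / pi"
 "pi^2 * kap2 = pi^2 / 24 - 1/4" "pi * sig1 = 1/4" "tau = 1 / (2 * pi) - 4 / pi^3"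
proof -
 have "((%u. u / 2 + sin (pi * u) * cos (pi * u) / (2 * pi)) has_real_derivative cs2 u) (at u)" for u
 proof -
  have "((%u. u / 2 + sin (pi * u) * cos (pi * u) / (2 * pi)) has_real_derivative 1/2 + (pi * cs2 u - pi * sn2 u) / (2 * pi)) (at u)"
   by (auto intro!: derivative_eq_intros simp: power2_eq_square field_simps)
  moreover have "1/2 + (pi * cs2 u - pi * sn2 u) / (2 * pi) = cs2 u" by (simp add: sin_squared_eq field_simps)
  ultimately show ?thesis by simp
 qed
 from I1_FTC[OF this] show 1: "I1 cs2 = 1/2" by simp
 have "sn2 = (%u. 1 + (-1) * cs2 u)" by (auto simp: fun_eq_iff sin_squared_eq)
 then have "I1 sn2 = I1 (%u. 1 + (-1) * cs2 u)" by simp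
 also have "\<dots> = I1 (%u. 1) + (-1) * I1 cs2"
  by (subst I1_add; (intro continuous_intros)?) simp
 finally show "I1 sn2 = 1/2" by (simp only: 1 I1_power; simp)
 have "((%u. sin (pi * u) / pi^2 - u * cos (pi * u) / pi) has_real_derivative u * sin (pi * u)) (at u)" for u
  by (auto intro!: derivative_eq_intros simp: power2_eq_square field_simps)
 from I1_FTC[OF this] show "I1 (%u. u * sin (pi * u)) = 2 / pi^2" by simp
 have "((%u. sin (pi * u) / pi) has_real_derivative cos (pi * u)) (at u)" for u
  by (auto intro!: derivative_eq_intros)
 from I1_FTC[OF this] show "I1 (%u. cos (pi * u)) = 2 / pi" by simp
 have "((%u. u^3 / 6 + u^2 * sc u / (2 * pi) + u * (cs2 u - sn2 u) / (4 * pi^2) - sc u / (4 * pi^3)) has_real_derivative u\<^sup>2 * cs2 u) (at u)" for u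
 proof -
  define s c where "s = sin (pi * u)" and "c = cos (pi * u)"
  have e: "s^2 = 1 - c\<^sup>2" unfolding s_def c_def by (rule sin_squared_eq)
  have "((%u. u^3 / 6 + u^2 * sc u / (2 * pi) + u * (cs2 u - sn2 u) / (4 * pi^2) - sc u / (4 * pi^3)) has_real_derivative
   u\<^sup>2 / 2 + (2 * u * (s * c) + u^2 * (pi * (c^2 - s\<^sup>2))) / (2 * pi) + ((c^2 - s\<^sup>2) - u * (4 * pi * s * c)) / (4 * pi^2) - pi * (c^2 - s\<^sup>2) / (4 * pi^3)) (at u)"
   by (auto intro!: derivative_eq_intros simp: s_def[symmetric] c_def[symmetric] power2_eq_square field_simps)
  moreover have "u^2 / 2 + (2 * u * (s * c) + u^2 * (pi * (c^2 - s\<^sup>2))) / (2 * pi) + ((c^2 - s\<^sup>2) - u * (4 * pi * s * c)) / (4 * pi^2) - pi * (c^2 - s\<^sup>2) / (4 * pi^3)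
    = u^2 * c^2"
   unfolding e by (simp add: field_simps eval_nat_numeral)
  ultimately show ?thesis by (simp only: c_def)
 qed
 note K = I1_FTC[OF this, folded kap2_def]
 have "kap2 = 1/24 - 1 / (4 * pi^2)"
  by (rule trans[OF K]) (simp add: eval_nat_numeral field_simps)
 then have "pi^2 * kap2 = pi^2 * (1/24 - 1 / (4 * pi^2))" by (simp only:)
 also have "\<dots> = pi^2 / 24 - 1/4" by (simp add: field_simps)
 finally show "pi^2 * kap2 = pi^2 / 24 - 1/4" .
 have "((%u. u * (sn2 u - cs2 u) / (4 * pi) + sc u / (4 * pi^2)) has_real_derivative u * sc u) (at u)" for u
  by (auto intro!: derivative_eq_intros simp: power2_eq_square field_simps)
 from I1_FTC[OF this] show "pi * sig1 = 1/4" unfolding sig1_def by (simp add: field_simps)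
 have "((%u. u\<^sup>2 * sin (pi * u) / pi + 2 * u * cos (pi * u) / pi^2 - 2 * sin (pi * u) / pi^3) has_real_derivative u\<^sup>2 * cos (pi * u)) (at u)" for u
  by (auto intro!: derivative_eq_intros simp: eval_nat_numeral field_simps)
 from I1_FTC[OF this] show "tau = 1 / (2 * pi) - 4 / pi^3" unfolding tau_def by (simp add: eval_nat_numeral)
qed

text \<open>u^2 <= 1/4 reduces each moment to one of lower degree; u sin(pi u) cos(pi u) is
  nonnegative on the interval.\<close>

lemma I1_trig_bounds: "0 <= kap4" "kap4 <= kap2 / 4" "0 <= lam2" "lam2 <= 1/8" "0 <= sig3" "sig3 <= sig1 / 4"
proof -
 have u: "u^2 <= 1/4" if "\<bar>u\<bar> <= 1/2" for u :: real
  using power_mono[OF that abs_ge_zero, of 2] by (simp add: power2_eq_square)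
 have z: "I1 (%_. 0) = 0" by simp
 have usc: "u * sc u \<ge> 0" if "\<bar>u\<bar> <= 1/2" for u
 proof -
  have "- (1/2) <= u" "u <= 1/2" using that by auto
  then have "pi * (- (1/2)) <= pi * u" "pi * u <= pi * (1/2)" by (intro mult_left_mono; simp)+
  then have b: "- (pi / 2) <= pi * u" "pi * u <= pi / 2" by auto
  then have "cos (pi * u) \<ge> 0" by (intro cos_ge_zero) auto
  moreover have "u * sin (pi * u) \<ge> 0"
  proof (cases "u \<ge> 0")
   case True
   then show ?thesis using b by (intro mult_nonneg_nonneg sin_ge_zero) auto
  next
   case False
   moreover have "- (pi * u) <= pi" using b(1) pi_gt_zero by linarith
   ultimately have "0 <= sin (- (pi * u))" by (intro sin_ge_zero) (auto simp: mult_nonneg_nonpos)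
   then show ?thesis using False by (simp add: mult_nonpos_nonpos)
  qed
  ultimately show ?thesis by (metis mult.assoc mult_nonneg_nonneg)
 qed
 have "I1 (%_. 0) <= kap4" unfolding kap4_def by (intro I1_mono continuous_intros) auto
 then show "0 <= kap4" by simp
 have "kap4 <= I1 (%x. 1/4 * (x^2 * cs2 x))" unfolding kap4_def
 proof (intro I1_mono continuous_intros)
  fix x :: real assume "\<bar>x\<bar> <= 1/2"
  have nn: "0 <= x\<^sup>2 * cs2 x" by simp
  from mult_right_mono[OF u[OF \<open>\<bar>x\<bar> <= 1/2\<close>] nn] show "x^4 * cs2 x <= 1/4 * (x^2 * cs2 x)"
   by (simp add: eval_nat_numeral mult.assoc)
 qed
 then show "kap4 <= kap2 / 4" unfolding kap2_def by (simp only: I1_cmult; simp)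
 have "I1 (%_. 0) <= lam2" unfolding lam2_def by (intro I1_mono continuous_intros) auto
 then show "0 <= lam2" by simp
 have "lam2 <= I1 (%x. 1/4 * sn2 x)" unfolding lam2_def
  by (intro I1_mono continuous_intros mult_right_mono u) auto
 then show "lam2 <= 1/8" by (simp only: I1_cmult I1_trig; simp)
 have "I1 (%_. 0) <= sig3" unfolding sig3_def
 proof (intro I1_mono continuous_intros)
  fix x :: real assume "\<bar>x\<bar> <= 1/2"
  from mult_nonneg_nonneg[OF zero_le_power2 usc[OF this], of x] show "0 <= x^3 * sc x"
   by (simp add: eval_nat_numeral mult.assoc)
 qed
 then show "0 <= sig3" by simp
 have "sig3 <= I1 (%x. 1/4 * (x * sc x))" unfolding sig3_def
 proof (intro I1_mono continuous_intros)
  fix x :: real assume x: "\<bar>x\<bar> <= 1/2"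
  from mult_right_mono[OF u[OF x] usc[OF x]] show "x^3 * sc x <= 1/4 * (x * sc x)"
   by (simp add: eval_nat_numeral mult.assoc)
 qed
 then show "sig3 <= sig1 / 4" unfolding sig1_def by (simp only: I1_cmult; simp)
qed

text \<open>Parity: the terms odd in u are collected in \<open>R\<close> and drop out.\<close>

lemma I1_trigpoly:
 "I1 (%u. cs2 u * (q0 + q1 * u + q2 * u^2 + q3 * u^3 + q4 * u^4) + sn2 u * (p0 + p1 * u + p2 * u^2)
   + sc u * (r0 + r1 * u + r2 * u^2 + r3 * u^3))
  = q0 / 2 + q2 * kap2 + q4 * kap4 + p0 / 2 + p2 * lam2 + r1 * sig1 + r3 * sig3"
proof -
 define R where "R = (%u. cs2 u * (q1 * u + q3 * u^3) + sn2 u * (p1 * u) + sc u * (r0 + r2 * u^2))"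
 have R: "I1 R = 0" by (rule I1_odd) (simp add: R_def algebra_simps)
 have Rc: "contU R" unfolding R_def by (intro continuous_intros)
 have "(%u. cs2 u * (q0 + q1 * u + q2 * u^2 + q3 * u^3 + q4 * u^4) + sn2 u * (p0 + p1 * u + p2 * u^2)
   + sc u * (r0 + r1 * u + r2 * u^2 + r3 * u^3))
  = (%u. ((((((q0 * cs2 u + q2 * (u^2 * cs2 u)) + q4 * (u^4 * cs2 u)) + p0 * sn2 u) + p2 * (u^2 * sn2 u)) + r1 * (u * sc u)) + r3 * (u^3 * sc u)) + R u)"
  by (auto simp: fun_eq_iff R_def algebra_simps)
 moreover have "I1 (%u. ((((((q0 * cs2 u + q2 * (u^2 * cs2 u)) + q4 * (u^4 * cs2 u)) + p0 * sn2 u) + p2 * (u^2 * sn2 u)) + r1 * (u * sc u)) + r3 * (u^3 * sc u)) + R u)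
  = (((((q0 * I1 cs2 + q2 * kap2) + q4 * kap4) + p0 * I1 sn2) + p2 * lam2) + r1 * sig1) + r3 * sig3 + I1 R"
  unfolding kap2_def kap4_def lam2_def sig1_def sig3_def
  by (subst I1_add I1_cmult; (intro continuous_intros Rc)?)+ simp
 ultimately show ?thesis by (simp only: I1_trig R)
qed

text \<open>The weighted Dirichlet form of \<open>sin (\<pi> u) (1 - h v)\<close> with the weight \<open>1 - z + 5/4 z\<^sup>2\<close>, \<open>z = \<alpha>u + \<beta>v\<close>.\<close>

definition Dform :: "real => real => real => real => real => real => real => real => real => real => real => real => real => real" where
 "Dform h \<alpha> \<beta> Y0 Y1 Y2 X0 X1 X2 W0 W1 W2 W3 =
  pi^2 * (Y0 * (1 + (5/4 * \<beta>\<^sup>2 + 2 * h * \<beta> + h^2) / 12 + h^2 * \<beta>\<^sup>2 / 64) / 2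
   + kap2 * (Y0 * (5/4 * \<alpha>\<^sup>2 * (1 + h^2 / 12)) - Y1 * (\<alpha> + 5 * h * \<alpha> * \<beta> / 12 + h^2 * \<alpha> / 12)
     + Y2 * (1 + (5/4 * \<beta>\<^sup>2 + 2 * h * \<beta> + h^2) / 12 + h^2 * \<beta>\<^sup>2 / 64))
   + kap4 * (Y2 * (5/4 * \<alpha>\<^sup>2 * (1 + h^2 / 12))))
  + h^2 * ((X0 + (5/4 * X0 * \<beta>\<^sup>2 - X1 * \<beta> + X2) / 12 + X2 * \<beta>\<^sup>2 / 64) / 2 + lam2 * (5/4 * \<alpha>\<^sup>2 * (X0 + X2 / 12)))
  + 2 * h * (pi * (sig1 * (W1 - \<alpha> * W0 + (5/4 * W1 * \<beta>\<^sup>2 - (W3 - h * W1) * \<beta> + 5/2 * \<alpha> * \<beta> * (W2 - h * W0) - h * (W3 - \<alpha> * W2)) / 12 - h * W3 * \<beta>\<^sup>2 / 64)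
    + sig3 * (5/4 * \<alpha>\<^sup>2 * (W1 - h * W3 / 12))))"

text \<open>The integrand has degree 4 in the variable outside the trigonometric factors.
  \<open>C0\<close> to \<open>C4\<close> are its coefficients as functions of the other variable,
  and the two families of moments evaluate it.\<close>

lemma integral_Dform:
 assumes ij: "i \<noteq> (j::2)"
 shows "(LINT w|Mosq. ((pi * cos (pi * w$i) * (1 - h * w$j))^2 * (Y0 + Y1 * w$i + Y2 * (w$i)^2)
    + (h * sin (pi * w$i))^2 * (X0 + X1 * w$j + X2 * (w$j)^2)
    - 2 * (pi * cos (pi * w$i) * (1 - h * w$j)) * (- h * sin (pi * w$i)) * (W0 + W1 * w$i + W2 * w$j + W3 * w$i * w$j))
    * (1 - (\<alpha> * w$i + \<beta> * w$j) + 5/4 * (\<alpha> * w$i + \<beta> * w$j)^2))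
  = Dform h \<alpha> \<beta> Y0 Y1 Y2 X0 X1 X2 W0 W1 W2 W3"
proof -
 define w0 where "w0 = (%u. 1 - \<alpha> * u + 5/4 * \<alpha>\<^sup>2 * u^2)"
 define w1 where "w1 = (%u. - \<beta> + 5/2 * \<alpha> * \<beta> * u)"
 define w2 where "w2 = 5/4 * \<beta>\<^sup>2"
 define y where "y = (%u. pi\<^sup>2 * (Y0 + Y1 * u + Y2 * u^2))"
 define P where "P = (%u. W0 + W1 * u)"
 define Q where "Q = (%u. W2 + W3 * u)"
 define C0 where "C0 = (%u. cs2 u * (y u * w0 u) + sn2 u * (h^2 * (X0 * w0 u)) + sc u * (2 * pi * h * (P u * w0 u)))"
 define C1 where "C1 = (%u. cs2 u * (y u * (w1 u - 2 * h * w0 u)) + sn2 u * (h^2 * (X0 * w1 u + X1 * w0 u))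
   + sc u * (2 * pi * h * (P u * w1 u + (Q u - h * P u) * w0 u)))"
 define C2 where "C2 = (%u. cs2 u * (y u * (w2 - 2 * h * w1 u + h^2 * w0 u)) + sn2 u * (h^2 * (X0 * w2 + X1 * w1 u + X2 * w0 u))
   + sc u * (2 * pi * h * (P u * w2 + (Q u - h * P u) * w1 u - h * Q u * w0 u)))"
 define C3 where "C3 = (%u. cs2 u * (y u * (- 2 * h * w2 + h^2 * w1 u)) + sn2 u * (h^2 * (X1 * w2 + X2 * w1 u))
   + sc u * (2 * pi * h * ((Q u - h * P u) * w2 - h * Q u * w1 u)))"
 define C4 where "C4 = (%u. cs2 u * (y u * (h^2 * w2)) + sn2 u * (h^2 * (X2 * w2)) + sc u * (2 * pi * h * (- h * Q u * w2)))"
 have cont: "contU C0" "contU C1" "contU C2" "contU C3" "contU C4"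
  unfolding C0_def C1_def C2_def C3_def C4_def y_def P_def Q_def w0_def w1_def w2_def by (intro continuous_intros)+
 have "(LINT w|Mosq. ((pi * cos (pi * w$i) * (1 - h * w$j))^2 * (Y0 + Y1 * w$i + Y2 * (w$i)^2)
    + (h * sin (pi * w$i))^2 * (X0 + X1 * w$j + X2 * (w$j)^2)
    - 2 * (pi * cos (pi * w$i) * (1 - h * w$j)) * (- h * sin (pi * w$i)) * (W0 + W1 * w$i + W2 * w$j + W3 * w$i * w$j))
    * (1 - (\<alpha> * w$i + \<beta> * w$j) + 5/4 * (\<alpha> * w$i + \<beta> * w$j)^2))
  = (LINT w|Mosq. C0 (w$i) * 1 + C1 (w$i) * w$j + C2 (w$i) * (w$j)^2 + C3 (w$i) * (w$j)^3 + C4 (w$i) * (w$j)^4)"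
 proof (rule lint_cong)
  fix w :: "real^2"
  define u v where "u = w$i" and "v = w$j"
  have W: "1 - (\<alpha> * u + \<beta> * v) + 5/4 * (\<alpha> * u + \<beta> * v)^2 = w0 u + w1 u * v + w2 * v^2"
   by (simp add: w0_def w1_def w2_def power2_eq_square algebra_simps)
  have E: "((pi * cos (pi * u) * (1 - h * v))^2 * (Y0 + Y1 * u + Y2 * u^2)
    + (h * sin (pi * u))^2 * (X0 + X1 * v + X2 * v^2)
    - 2 * (pi * cos (pi * u) * (1 - h * v)) * (- h * sin (pi * u)) * (W0 + W1 * u + W2 * v + W3 * u * v))
   = cs2 u * y u * (1 - h * v)^2 + sn2 u * h^2 * (X0 + X1 * v + X2 * v^2) + sc u * (2 * pi * h) * (1 - h * v) * (P u + Q u * v)"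
   by (simp add: y_def P_def Q_def power_mult_distrib) (simp add: algebra_simps)
  show "((pi * cos (pi * w$i) * (1 - h * w$j))^2 * (Y0 + Y1 * w$i + Y2 * (w$i)^2)
    + (h * sin (pi * w$i))^2 * (X0 + X1 * w$j + X2 * (w$j)^2)
    - 2 * (pi * cos (pi * w$i) * (1 - h * w$j)) * (- h * sin (pi * w$i)) * (W0 + W1 * w$i + W2 * w$j + W3 * w$i * w$j))
    * (1 - (\<alpha> * w$i + \<beta> * w$j) + 5/4 * (\<alpha> * w$i + \<beta> * w$j)^2)
   = C0 (w$i) * 1 + C1 (w$i) * w$j + C2 (w$i) * (w$j)^2 + C3 (w$i) * (w$j)^3 + C4 (w$i) * (w$j)^4"
   unfolding u_def[symmetric] v_def[symmetric] W E C0_def C1_def C2_def C3_def C4_def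
   by (simp add: algebra_simps power2_eq_square power3_eq_cube power4_eq_xxxx)
 qed
 also have "\<dots> = I1 C0 + I1 C2 / 12 + I1 C4 / 80" by (rule integral_osq_poly[OF cont ij])
 also have "\<dots> = I1 (%u. C0 u + 1/12 * C2 u + 1/80 * C4 u)"
  by (subst I1_add I1_cmult; (intro continuous_intros cont)?)+ simp
 also have "(%u. C0 u + 1/12 * C2 u + 1/80 * C4 u) = (%u. cs2 u * (pi^2 * Y0 * (1 + (5/4 * \<beta>\<^sup>2 + 2 * h * \<beta> + h^2) / 12 + h^2 * \<beta>\<^sup>2 / 64)
    + pi^2 * (Y1 * (1 + (5/4 * \<beta>\<^sup>2 + 2 * h * \<beta> + h^2) / 12 + h^2 * \<beta>\<^sup>2 / 64) - Y0 * (\<alpha> + 5 * h * \<alpha> * \<beta> / 12 + h^2 * \<alpha> / 12)) * u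
    + pi^2 * (Y0 * (5/4 * \<alpha>\<^sup>2 * (1 + h^2 / 12)) - Y1 * (\<alpha> + 5 * h * \<alpha> * \<beta> / 12 + h^2 * \<alpha> / 12)
     + Y2 * (1 + (5/4 * \<beta>\<^sup>2 + 2 * h * \<beta> + h^2) / 12 + h^2 * \<beta>\<^sup>2 / 64)) * u^2
    + pi^2 * (Y1 * (5/4 * \<alpha>\<^sup>2 * (1 + h^2 / 12)) - Y2 * (\<alpha> + 5 * h * \<alpha> * \<beta> / 12 + h^2 * \<alpha> / 12)) * u^3
    + pi^2 * Y2 * (5/4 * \<alpha>\<^sup>2 * (1 + h^2 / 12)) * u^4)
   + sn2 u * (h^2 * (X0 + (5/4 * X0 * \<beta>\<^sup>2 - X1 * \<beta> + X2) / 12 + X2 * \<beta>\<^sup>2 / 64)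
    + h^2 * (- \<alpha> * X0 + (5/2 * \<alpha> * \<beta> * X1 - \<alpha> * X2) / 12) * u
    + h^2 * (5/4 * \<alpha>\<^sup>2 * (X0 + X2 / 12)) * u^2)
   + sc u * (2 * pi * h * (W0 + (5/4 * W0 * \<beta>\<^sup>2 - (W2 - h * W0) * \<beta> - h * W2) / 12 - h * W2 * \<beta>\<^sup>2 / 64)
    + 2 * pi * h * (W1 - \<alpha> * W0 + (5/4 * W1 * \<beta>\<^sup>2 - (W3 - h * W1) * \<beta> + 5/2 * \<alpha> * \<beta> * (W2 - h * W0) - h * (W3 - \<alpha> * W2)) / 12 - h * W3 * \<beta>\<^sup>2 / 64) * u
    + 2 * pi * h * (5/4 * \<alpha>\<^sup>2 * W0 - \<alpha> * W1 + (5/2 * \<alpha> * \<beta> * (W3 - h * W1) - h * (5/4 * \<alpha>\<^sup>2 * W2 - \<alpha> * W3)) / 12) * u^2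
    + 2 * pi * h * (5/4 * \<alpha>\<^sup>2 * (W1 - h * W3 / 12)) * u^3))"
  unfolding C0_def C2_def C4_def y_def P_def Q_def w0_def w1_def w2_def
  by (rule ext) (simp add: algebra_simps power2_eq_square power3_eq_cube power4_eq_xxxx add_divide_distrib diff_divide_distrib)
 also have "I1 \<dots> = Dform h \<alpha> \<beta> Y0 Y1 Y2 X0 X1 X2 W0 W1 W2 W3"
  unfolding I1_trigpoly Dform_def by (simp add: algebra_simps add_divide_distrib diff_divide_distrib)
 finally show ?thesis .
qed

section \<open>Numerical bounds for the tilted trial functions\<close>

abbreviation "kk2 \<equiv> pi\<^sup>2 * kap2"
abbreviation "kk4 \<equiv> pi\<^sup>2 * kap4"
abbreviation "ss3 \<equiv> pi * sig3"

lemma pi_sq_bounds: "(9869/1000) <= pi\<^sup>2" "pi^2 <= (987/100)"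
proof -
 have b: "(31415/10000) <= pi" "pi <= (31416/10000)" using pi_approx by (simp_all)
 have "(31415/10000)^2 <= pi\<^sup>2" "pi^2 <= (31416/10000)\<^sup>2" using b by (intro power_mono; simp)+
 then show "(9869/1000) <= pi\<^sup>2" "pi^2 <= (987/100)" by (simp_all add: power2_eq_square)
qed

lemma kk_bounds: "(161/1000) <= kk2" "kk2 <= (1613/10000)" "0 <= kk4" "kk4 <= (404/10000)" "0 <= lam2" "lam2 <= 1/8" "0 <= ss3" "ss3 <= 1/16"
proof -
 show k: "(161/1000) <= kk2" "kk2 <= (1613/10000)" using I1_trig(5) pi_sq_bounds by linarith+
 show "0 <= kk4" using I1_trig_bounds(1) by simp
 have "kk4 <= pi\<^sup>2 * (kap2 / 4)" by (intro mult_left_mono I1_trig_bounds) simp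
 also have "\<dots> = kk2 / 4" by simp
 finally show "kk4 <= (404/10000)" using k(2) by linarith
 show "0 <= lam2" "lam2 <= 1/8" by (rule I1_trig_bounds)+
 show "0 <= ss3" using I1_trig_bounds(5) by simp
 have "ss3 <= pi * (sig1 / 4)" by (intro mult_left_mono I1_trig_bounds) simp
 then show "ss3 <= 1/16" using I1_trig(6) by simp
qed

lemma abs_mult_le: "\<bar>x\<bar> <= s ==> \<bar>y\<bar> <= t ==> \<bar>x * y\<bar> <= s * (t::real)"
 by (simp add: abs_mult) (intro mult_mono, auto)

lemma Dform_alt:
 "Dform h \<alpha> \<beta> Y0 Y1 Y2 X0 X1 X2 W0 W1 W2 W3 =
  pi^2 * (Y0 * (1 + (5/4 * \<beta>\<^sup>2 + 2 * h * \<beta> + h^2) / 12 + h^2 * \<beta>\<^sup>2 / 64) / 2)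
   + kk2 * (Y0 * (5/4 * \<alpha>\<^sup>2 * (1 + h^2 / 12)) - Y1 * (\<alpha> + 5 * h * \<alpha> * \<beta> / 12 + h^2 * \<alpha> / 12)
     + Y2 * (1 + (5/4 * \<beta>\<^sup>2 + 2 * h * \<beta> + h^2) / 12 + h^2 * \<beta>\<^sup>2 / 64))
   + kk4 * (Y2 * (5/4 * \<alpha>\<^sup>2 * (1 + h^2 / 12)))
  + h^2 * ((X0 + (5/4 * X0 * \<beta>\<^sup>2 - X1 * \<beta> + X2) / 12 + X2 * \<beta>\<^sup>2 / 64) / 2 + lam2 * (5/4 * \<alpha>\<^sup>2 * (X0 + X2 / 12)))
  + 2 * h * (1/4 * (W1 - \<alpha> * W0 + (5/4 * W1 * \<beta>\<^sup>2 - (W3 - h * W1) * \<beta> + 5/2 * \<alpha> * \<beta> * (W2 - h * W0) - h * (W3 - \<alpha> * W2)) / 12 - h * W3 * \<beta>\<^sup>2 / 64)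
    + ss3 * (5/4 * \<alpha>\<^sup>2 * (W1 - h * W3 / 12)))"
 unfolding Dform_def I1_trig(6)[symmetric] by (simp add: distrib_left mult.assoc)

text \<open>For fixed h, alpha and beta the form is linear in its ten coefficients, so the
  dependence on a and d can be split off.\<close>

lemma Dform_lin:
 "Dform h \<alpha> \<beta> (s * Y0 + t * Y0' + k * Y0'') (s * Y1 + t * Y1' + k * Y1'') (s * Y2 + t * Y2' + k * Y2'')
   (s * X0 + t * X0' + k * X0'') (s * X1 + t * X1' + k * X1'') (s * X2 + t * X2' + k * X2'')
   (s * W0 + t * W0' + k * W0'') (s * W1 + t * W1' + k * W1'') (s * W2 + t * W2' + k * W2'') (s * W3 + t * W3' + k * W3'')
  = s * Dform h \<alpha> \<beta> Y0 Y1 Y2 X0 X1 X2 W0 W1 W2 W3 + t * Dform h \<alpha> \<beta> Y0' Y1' Y2' X0' X1' X2' W0' W1' W2' W3'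
   + k * Dform h \<alpha> \<beta> Y0'' Y1'' Y2'' X0'' X1'' X2'' W0'' W1'' W2'' W3''"
 unfolding Dform_def by (simp add: algebra_simps add_divide_distrib diff_divide_distrib)

text \<open>This and the next two sums are the parts multiplying 1 + r2, -2 p$1 and -4 p$4 in the
  total energy of the trial functions with tilts 4b and -4c. The tilt 4b rounds the minimizer (1 +
  pi^2/3) b of the leading excess h^2/2 - (1 + pi^2/3) h b; likewise for c.\<close>

lemma Dform_T0:
 fixes b c :: real
 defines "x \<equiv> b\<^sup>2" and "y \<equiv> c\<^sup>2"
 shows "Dform (4*b) (2*c) (-2*b) 1 (4*c) (4*(x+y)) 1 (-4*b) (4*(x+y)) 0 (-2*b) (2*c) (4*(x+y))
  + Dform (-4*c) (-2*b) (2*c) 1 (-4*b) (4*(x+y)) 1 (4*c) (4*(x+y)) 0 (2*c) (-2*b) (4*(x+y))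
  = pi^2 + (5/24 * pi^2 + 4 + 5 * kk2) * (x + y) + (pi^2 / 2 + 1/3 + 5/3 * kk2 + 20 * kk4) * (x^2 + y^2)
   + (4/3 + 146/3 * kk2 + 40 * kk4 + 160 * lam2 - 160 * ss3) * (x * y)
   + (4 * kk2 + 160/3 * kk4 + 160/3 * lam2 - 320/3 * ss3) * (x * y * (x + y)) + 4 * kk2 * (x^3 + y^3)"
proof -
 define k2 k4 s3 P where "k2 = kk2" "k4 = kk4" "s3 = ss3" "P = pi^2"
 show ?thesis unfolding Dform_alt k2_k4_s3_P_def[symmetric] x_def y_def
  by (simp add: field_simps eval_nat_numeral)
qed

lemma Dform_T1:
 fixes b c :: real
 defines "x \<equiv> b\<^sup>2" and "y \<equiv> c\<^sup>2"
 shows "Dform (4*b) (2*c) (-2*b) (-1) (-4*c) (4*(x-y)) 1 (-4*b) (4*(x-y)) 0 (-2*b) (-2*c) (4*(x-y))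
  + Dform (-4*c) (-2*b) (2*c) 1 (-4*b) (4*(x-y)) (-1) (-4*c) (4*(x-y)) 0 (-2*c) (-2*b) (4*(x-y))
  = (4 + 5 * kk2 - 5/24 * pi^2) * (x - y) + (1/3 + 5/3 * kk2 + 20 * kk4 - pi\<^sup>2 / 2) * (x^2 - y\<^sup>2)
   + (160/3 * kk4 + 160/3 * lam2 - 320/3 * ss3 - 4 * kk2) * (x * y * (x - y)) + 4 * kk2 * (x^3 - y^3)"
proof -
 define k2 k4 s3 P where "k2 = kk2" "k4 = kk4" "s3 = ss3" "P = pi^2"
 show ?thesis unfolding Dform_alt k2_k4_s3_P_def[symmetric] x_def y_def
  by (simp add: field_simps eval_nat_numeral)
qed

lemma Dform_T2:
 fixes b c :: real
 defines "x \<equiv> b\<^sup>2" and "y \<equiv> c\<^sup>2"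
 shows "Dform (4*b) (2*c) (-2*b) 0 (-2*b) (-4*(b*c)) 0 (2*c) (-4*(b*c)) (1/2) c (-b) (-4*(b*c))
  + Dform (-4*c) (-2*b) (2*c) 0 (2*c) (-4*(b*c)) 0 (-2*b) (-4*(b*c)) (1/2) (-b) c (-4*(b*c))
  = (b * c) * ((9/2 - 29/3 * kk2 - 20 * kk4 + 40 * ss3) * (x + y) - 4 * kk2 * (x^2 + y^2)
   + (320/3 * ss3 - 160/3 * kk4 - 160/3 * lam2) * (x * y))"
proof -
 define k2 k4 s3 P where "k2 = kk2" "k4 = kk4" "s3 = ss3" "P = pi^2"
 show ?thesis unfolding Dform_alt k2_k4_s3_P_def[symmetric] x_def y_def
  by (simp add: field_simps eval_nat_numeral)
qed

text \<open>To first order in q the difference T0 - N has coefficient -9/8 pi^2 + 4 + 5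
  \<open>kk2\<close> + 16/pi^2, which is below -4.6. All other terms are of second order, and q <=
  1/62 keeps them under 0.6 q.\<close>

lemma T_bounds:
 fixes b c :: real
 defines "x \<equiv> b\<^sup>2" and "y \<equiv> c\<^sup>2"
 defines "q \<equiv> x + y"
 assumes q: "q <= 1/62"
 defines "T0 \<equiv> pi\<^sup>2 + (5/24 * pi^2 + 4 + 5 * kk2) * (x + y) + (pi^2 / 2 + 1/3 + 5/3 * kk2 + 20 * kk4) * (x^2 + y^2)
   + (4/3 + 146/3 * kk2 + 40 * kk4 + 160 * lam2 - 160 * ss3) * (x * y)
   + (4 * kk2 + 160/3 * kk4 + 160/3 * lam2 - 320/3 * ss3) * (x * y * (x + y)) + 4 * kk2 * (x^3 + y^3)"
 defines "T1 \<equiv> (4 + 5 * kk2 - 5/24 * pi^2) * (x - y) + (1/3 + 5/3 * kk2 + 20 * kk4 - pi\<^sup>2 / 2) * (x^2 - y\<^sup>2)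
   + (160/3 * kk4 + 160/3 * lam2 - 320/3 * ss3 - 4 * kk2) * (x * y * (x - y)) + 4 * kk2 * (x^3 - y^3)"
 defines "T2 \<equiv> (b * c) * ((9/2 - 29/3 * kk2 - 20 * kk4 + 40 * ss3) * (x + y) - 4 * kk2 * (x^2 + y^2)
   + (320/3 * ss3 - 160/3 * kk4 - 160/3 * lam2) * (x * y))"
 defines "N \<equiv> pi\<^sup>2 * (1 + 4/3 * q) - 16 / pi^2 * q"
 shows "T0 - N <= - 4 * q" "T0 + N <= 22" "\<bar>T1\<bar> <= 4 * q" "\<bar>T2\<bar> <= q"
proof -
 have x: "0 <= x" and y: "0 <= y" by (simp_all add: x_def y_def)
 then have q0: "0 <= q" by (simp add: q_def)
 have qq: "q * q <= q / 62" using mult_left_mono[OF q q0] by simp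
 have qqq: "q * (q * q) <= q / 62" using mult_left_mono[OF qq q0] qq q0 by simp
 have e: "x * x + 2 * (x * y) + y * y = q * q" by (simp add: q_def algebra_simps)
 have xy: "0 <= x * y" using x y by simp
 have dm: "0 <= (x - y) * (x - y)" by simp
 have xy4: "4 * (x * y) <= q * q" using e dm by (simp add: algebra_simps)
 have sq: "x^2 + y^2 <= q * q" "0 <= x\<^sup>2 + y^2" using e xy by (simp_all add: power2_eq_square)
 have m: "x * y <= q / 248" using xy4 qq by linarith
 have xyq: "x * y * (x + y) <= q / 248" "0 <= x * y * (x + y)"
 proof -
  have "x * y * q <= x * y * 1" using q by (intro mult_left_mono xy) simp
  then show "x * y * (x + y) <= q / 248" using m by (simp add: q_def)
  show "0 <= x * y * (x + y)" using x y by simp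
 qed
 have cu: "x^3 + y^3 <= q / 62" "0 <= x^3 + y^3"
 proof -
  have "x^3 + y^3 = q * (q * q) - 3 * (x * y * (x + y))" by (simp add: q_def algebra_simps eval_nat_numeral)
  then show "x^3 + y^3 <= q / 62" using qqq xyq(2) by linarith
  show "0 <= x^3 + y^3" using x y by simp
 qed
 note kb = kk_bounds pi_sq_bounds
 have ip: "(162/100) <= 16 / pi^2" "16 / pi^2 <= (163/100)" using pi_sq_bounds by (simp_all add: field_simps)
 have ub: "u * v <= C * V" if "u <= C" "v <= V" "0 <= v" "0 <= C" for u v C V :: real
  using that by (metis mult_left_mono mult_right_mono order_trans)
 have s: "x^2 + y^2 <= q / 62" using sq qq by linarith
 have A: "(pi^2 / 2 + 1/3 + 5/3 * kk2 + 20 * kk4) * (x^2 + y^2) <= (64/10) * (q/62)"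
  by (rule ub[OF _ s sq(2)]) (use kb in linarith)+
 have B: "(4/3 + 146/3 * kk2 + 40 * kk4 + 160 * lam2 - 160 * ss3) * (x * y) <= 31 * (q/248)"
  by (rule ub[OF _ m xy]) (use kb in linarith)+
 have C: "(4 * kk2 + 160/3 * kk4 + 160/3 * lam2 - 320/3 * ss3) * (x * y * (x + y)) <= 10 * (q/248)"
  by (rule ub[OF _ xyq]) (use kb in linarith)+
 have D: "4 * kk2 * (x^3 + y^3) <= (7/10) * (q / 62)" 
  by (rule ub[OF _ cu]) (use kb in linarith)+
 have "T0 - N = (5/24 * pi^2 + 4 + 5 * kk2 - 4/3 * pi^2 + 16 / pi^2) * q + ((pi^2 / 2 + 1/3 + 5/3 * kk2 + 20 * kk4) * (x^2 + y^2)
   + (4/3 + 146/3 * kk2 + 40 * kk4 + 160 * lam2 - 160 * ss3) * (x * y)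
   + (4 * kk2 + 160/3 * kk4 + 160/3 * lam2 - 320/3 * ss3) * (x * y * (x + y)) + 4 * kk2 * (x^3 + y^3))"
  unfolding T0_def N_def q_def[symmetric] by (simp add: distrib_right left_diff_distrib distrib_left)
 moreover have "(5/24 * pi^2 + 4 + 5 * kk2 - 4/3 * pi^2 + 16 / pi^2) * q <= (- (46/10)) * q"
  by (rule mult_right_mono[OF _ q0]) (use kb ip in linarith)
 ultimately show "T0 - N <= - 4 * q" using A B C D q0 by linarith
 have "T0 + N = 2 * pi^2 + (5/24 * pi^2 + 4 + 5 * kk2 + 4/3 * pi^2 - 16 / pi^2) * q + ((pi^2 / 2 + 1/3 + 5/3 * kk2 + 20 * kk4) * (x^2 + y^2)
   + (4/3 + 146/3 * kk2 + 40 * kk4 + 160 * lam2 - 160 * ss3) * (x * y)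
   + (4 * kk2 + 160/3 * kk4 + 160/3 * lam2 - 320/3 * ss3) * (x * y * (x + y)) + 4 * kk2 * (x^3 + y^3))"
  unfolding T0_def N_def q_def[symmetric] by (simp add: distrib_right left_diff_distrib distrib_left)
 moreover have "(5/24 * pi^2 + 4 + 5 * kk2 + 4/3 * pi^2 - 16 / pi^2) * q <= 21 * q"
  by (rule mult_right_mono[OF _ q0]) (use kb ip in linarith)
 ultimately show "T0 + N <= 22" using A B C D q q0 kb by linarith
 have d1: "\<bar>x - y\<bar> <= q" unfolding q_def using x y by (simp add: abs_le_iff)
 have d2: "\<bar>x\<^sup>2 - y\<^sup>2\<bar> <= q / 62" using s by (simp add: abs_le_iff) (smt (verit) zero_le_power2)
 have d3: "\<bar>x * y * (x - y)\<bar> <= q / 248"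
 proof -
  have "\<bar>x * y * (x - y)\<bar> = x * y * \<bar>x - y\<bar>" using x y by (simp add: abs_mult)
  also have "\<dots> <= x * y * (x + y)" using d1 unfolding q_def by (intro mult_left_mono xy)
  finally show ?thesis using xyq by linarith
 qed
 have d4: "\<bar>x^3 - y^3\<bar> <= q / 62" unfolding abs_le_iff using cu(1) zero_le_power[OF x, of 3] zero_le_power[OF y, of 3] by linarith
 have "\<bar>(4 + 5 * kk2 - 5/24 * pi^2) * (x - y)\<bar> <= (28/10) * q"
  by (rule abs_mult_le[OF _ d1]) (use kb in \<open>simp add: abs_le_iff\<close>)
 moreover have "\<bar>(1/3 + 5/3 * kk2 + 20 * kk4 - pi\<^sup>2 / 2) * (x^2 - y\<^sup>2)\<bar> <= 5 * (q / 62)"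
  by (rule abs_mult_le[OF _ d2]) (use kb in \<open>simp add: abs_le_iff\<close>)
 moreover have "\<bar>(160/3 * kk4 + 160/3 * lam2 - 320/3 * ss3 - 4 * kk2) * (x * y * (x - y))\<bar> <= 20 * (q / 248)"
  by (rule abs_mult_le[OF _ d3]) (use kb in \<open>simp add: abs_le_iff\<close>)
 moreover have "\<bar>4 * kk2 * (x^3 - y^3)\<bar> <= (7/10) * (q / 62)"
  by (rule abs_mult_le[OF _ d4]) (use kb in \<open>simp add: abs_le_iff\<close>)
 moreover have tri: "\<bar>t1 + t2 + t3 + t4\<bar> <= s1 + s2 + s3 + s4" if "\<bar>t1\<bar> <= s1" "\<bar>t2\<bar> <= s2" "\<bar>t3\<bar> <= s3" "\<bar>t4\<bar> <= s4"
  for t1 t2 t3 t4 s1 s2 s3 s4 :: real using that by linarith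
 ultimately have "\<bar>T1\<bar> <= 28/10 * q + 5 * (q / 62) + 20 * (q / 248) + 7/10 * (q / 62)" unfolding T1_def by (intro tri) simp_all
 then show "\<bar>T1\<bar> <= 4 * q" using q0 by linarith
 have bc: "\<bar>b * c\<bar> <= q"
 proof -
  have "2 * \<bar>b * c\<bar> <= q" using sum_squares_bound[of "\<bar>b\<bar>" "\<bar>c\<bar>"] by (simp add: q_def x_def y_def abs_mult)
  then show ?thesis using q0 by linarith
 qed
 have "\<bar>(9/2 - 29/3 * kk2 - 20 * kk4 + 40 * ss3) * (x + y)\<bar> <= 8 * q"
  by (rule abs_mult_le) (use kb q0 in \<open>simp_all add: abs_le_iff q_def\<close>)
 moreover have "\<bar>4 * kk2 * (x^2 + y^2)\<bar> <= (7/10) * (q / 62)"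
  by (rule abs_mult_le) (use kb s sq(2) in \<open>simp_all add: abs_le_iff\<close>)
 moreover have "\<bar>(320/3 * ss3 - 160/3 * kk4 - 160/3 * lam2) * (x * y)\<bar> <= 20 * (q / 248)"
  by (rule abs_mult_le) (use kb m xy in \<open>simp_all add: abs_le_iff\<close>)
 ultimately have "\<bar>(9/2 - 29/3 * kk2 - 20 * kk4 + 40 * ss3) * (x + y) - 4 * kk2 * (x^2 + y^2)
   + (320/3 * ss3 - 160/3 * kk4 - 160/3 * lam2) * (x * y)\<bar> <= 1" using q q0 by linarith
 from abs_mult_le[OF bc this] show "\<bar>T2\<bar> <= q" unfolding T2_def by simp
qed

text \<open>The form belongs to a symmetric traceless matrix with eigenvalues r and -r; it is the
  real part of (a - i d)(x + i y)^2.\<close>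

lemma quadratic_form_le:
 fixes a d x y r :: real
 assumes "r^2 = a^2 + d^2" "0 <= r"
 shows "\<bar>a * (x^2 - y\<^sup>2) + 2 * d * x * y\<bar> <= r * (x^2 + y^2)"
proof -
 have "(a * (x^2 - y\<^sup>2) + d * (2 * x * y))^2 + (a * (2 * x * y) - d * (x^2 - y\<^sup>2))^2 = (a^2 + d^2) * (x^2 + y^2)^2"
  by (simp add: algebra_simps power2_eq_square)
 then have "(a * (x^2 - y\<^sup>2) + d * (2 * x * y))^2 <= (r * (x^2 + y^2))\<^sup>2"
  using zero_le_power2[of "a * (2 * x * y) - d * (x^2 - y\<^sup>2)"] by (simp only: power_mult_distrib assms(1))
 then have "\<bar>a * (x^2 - y\<^sup>2) + d * (2 * x * y)\<bar> <= \<bar>r * (x^2 + y^2)\<bar>" by (simp only: abs_le_square_iff)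
 then show ?thesis using assms(2) by (simp add: mult.assoc mult.left_commute)
qed

lemma integral_trial:
 fixes h s t :: real
 assumes ij: "i \<noteq> (j::2)"
 shows "(LINT w|Mosq. (sin (pi * w$i) * (1 - h * w$j))\<^sup>2 * (1 + (s * w$i + t * w$j))) = (1 + h^2 / 12 - h * t / 6) / 2"
  and "(LINT w|Mosq. (sin (pi * w$i) * (1 - h * w$j)) * (1 + (s * w$i + t * w$j))) = s * (2 / pi^2)"
proof -
 define E1 E2 where "E1 = (%u::real. sn2 u * (t - 2 * h * (1 + s * u)))" and "E2 = (%u::real. sn2 u * ((h^2 - 2 * h * t) + (h^2 * s) * u))"
 define E0 E3 where "E0 = (%u::real. sn2 u * (1 + s * u))" and "E3 = (%u::real. sn2 u * (h^2 * t))"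
 have odd: "I1 (%u. sn2 u * (k + m * u)) = k / 2" for k m
  using I1_trigpoly[of 0 0 0 0 0 k m 0 0 0 0 0] by simp
 have "(LINT w|Mosq. (sin (pi * w$i) * (1 - h * w$j))\<^sup>2 * (1 + (s * w$i + t * w$j)))
  = (LINT w|Mosq. E0 (w$i) * 1 + E1 (w$i) * w$j + E2 (w$i) * (w$j)^2 + E3 (w$i) * (w$j)^3 + 0 * (w$j)^4)"
  by (rule lint_cong) (simp add: E0_def E1_def E2_def E3_def algebra_simps eval_nat_numeral)
 also have "\<dots> = I1 E0 + I1 E2 / 12 + I1 (%_. 0) / 80"
  by (rule integral_osq_poly[OF _ _ _ _ _ ij]) (auto simp: E0_def E1_def E2_def E3_def intro!: continuous_intros)
 also have "\<dots> = (1 + h^2 / 12 - h * t / 6) / 2" unfolding E0_def E2_def odd by (simp add: field_simps)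
 finally show "(LINT w|Mosq. (sin (pi * w$i) * (1 - h * w$j))\<^sup>2 * (1 + (s * w$i + t * w$j))) = (1 + h^2 / 12 - h * t / 6) / 2" .
 define G0 G1 G2 where "G0 = (%u::real. sin (pi * u) + s * (u * sin (pi * u)))" and "G1 = (%u::real. sin (pi * u) * (t - h * (1 + s * u)))"
  and "G2 = (%u::real. sin (pi * u) * (- h * t))"
 have "(LINT w|Mosq. (sin (pi * w$i) * (1 - h * w$j)) * (1 + (s * w$i + t * w$j)))
  = (LINT w|Mosq. G0 (w$i) * 1 + G1 (w$i) * w$j + G2 (w$i) * (w$j)^2 + 0 * (w$j)^3 + 0 * (w$j)^4)"
  by (rule lint_cong) (simp add: G0_def G1_def G2_def algebra_simps eval_nat_numeral)
 also have "\<dots> = I1 G0 + I1 G2 / 12 + I1 (%_. 0) / 80"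
  by (rule integral_osq_poly[OF _ _ _ _ _ ij]) (auto simp: G0_def G1_def G2_def intro!: continuous_intros)
 also have "I1 G0 = I1 (%u. sin (pi * u)) + s * I1 (%u. u * sin (pi * u))"
  unfolding G0_def by (subst I1_add; (intro continuous_intros)?) simp
 also have "I1 (%u. sin (pi * u)) = 0" by (rule I1_odd) simp
 also have "I1 G2 = 0" unfolding G2_def by (rule I1_odd) simp
 finally show "(LINT w|Mosq. (sin (pi * w$i) * (1 - h * w$j)) * (1 + (s * w$i + t * w$j))) = s * (2 / pi^2)"
  by (simp only: I1_trig; simp)
qed

text \<open>The mixed term in the energy of sin pi u + sin pi v or sin pi u - sin pi v. Writing tau
  = k/(2 pi) absorbs the remaining powers of pi into k.\<close>

lemma integral_cross:
 fixes \<alpha> \<beta> W0 W1 W2 W3 :: real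
 defines "k \<equiv> 1 - 8 / pi^2"
 shows "pi^2 * (LINT w|Mosq. cos (pi * w$1) * cos (pi * w$2) * (W0 + W1 * w$1 + W2 * w$2 + W3 * w$1 * w$2)
   * (1 - (\<alpha> * w$1 + \<beta> * w$2) + 5/4 * (\<alpha> * w$1 + \<beta> * w$2)^2))
  = W0 * (4 + 5/4 * (\<alpha>\<^sup>2 + \<beta>\<^sup>2) * k) - (W1 * \<alpha> + W2 * \<beta>) * k + 5/8 * W3 * \<alpha> * \<beta> * k^2"
proof -
 define w0 w1 where "w0 = (%u. 1 - \<alpha> * u + 5/4 * \<alpha>\<^sup>2 * u^2)" and "w1 = (%u. - \<beta> + 5/2 * \<alpha> * \<beta> * u)"
 define P Q where "P = (%u. W0 + W1 * u)" and "Q = (%u. W2 + W3 * u)"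
 define w2 where "w2 = 5/4 * \<beta>\<^sup>2"
 define k0 k1 k2 k3 where "k0 = (%u. cos (pi * u) * (P u * w0 u))" and "k1 = (%u. cos (pi * u) * (P u * w1 u + Q u * w0 u))"
  and "k2 = (%u. cos (pi * u) * (P u * w2 + Q u * w1 u))" and "k3 = (%u. cos (pi * u) * (Q u * w2))"
 define c0 c1 c2 c3 :: "real => real" where "c0 = (%v. cos (pi * v))" and "c1 = (%v. v * cos (pi * v))"
  and "c2 = (%v. v\<^sup>2 * cos (pi * v))" and "c3 = (%v. v^3 * cos (pi * v))"
 have ck: "contU k0" "contU k1" "contU k2" "contU k3"
  unfolding k0_def k1_def k2_def k3_def P_def Q_def w0_def w1_def by (intro continuous_intros)+
 have cc: "contU c0" "contU c1" "contU c2" "contU c3"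
  unfolding c0_def c1_def c2_def c3_def by (intro continuous_intros)+
 have I: "I1 (%u. cos (pi * u) * (q0 + q1 * u + q2 * u^2 + q3 * u^3)) = q0 * (2 / pi) + q2 * tau" for q0 q1 q2 q3
 proof -
  define R where "R = (%u. cos (pi * u) * (q1 * u + q3 * u^3))"
  have R: "I1 R = 0" by (rule I1_odd) (simp add: R_def algebra_simps)
  have Rc: "contU R" unfolding R_def by (intro continuous_intros)
  have "(%u. cos (pi * u) * (q0 + q1 * u + q2 * u^2 + q3 * u^3)) = (%u. q0 * cos (pi * u) + q2 * (u^2 * cos (pi * u)) + R u)"
   by (auto simp: fun_eq_iff R_def algebra_simps)
  moreover have "I1 (%u. q0 * cos (pi * u) + q2 * (u^2 * cos (pi * u)) + R u) = q0 * I1 (%u. cos (pi * u)) + q2 * tau + I1 R"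
   unfolding tau_def by (subst I1_add I1_cmult; (intro continuous_intros Rc)?)+ simp
  ultimately show ?thesis by (simp only: R I1_trig)
 qed
 have v0: "I1 c0 = 2 / pi" "I1 c1 = 0" "I1 c2 = tau" "I1 c3 = 0"
  using I[of 1 0 0 0] I[of 0 1 0 0] I[of 0 0 1 0] I[of 0 0 0 1] by (simp_all add: c0_def c1_def c2_def c3_def mult.commute)
 have "k0 = (%u. cos (pi * u) * (W0 + (W1 - \<alpha> * W0) * u + (5/4 * \<alpha>\<^sup>2 * W0 - \<alpha> * W1) * u^2 + (5/4 * \<alpha>\<^sup>2 * W1) * u^3))"
  by (rule ext) (simp add: k0_def P_def w0_def algebra_simps eval_nat_numeral)
 then have i0: "I1 k0 = W0 * (2 / pi) + (5/4 * \<alpha>\<^sup>2 * W0 - \<alpha> * W1) * tau" by (simp only: I)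
 have "k2 = (%u. cos (pi * u) * ((5/4 * \<beta>\<^sup>2 * W0 - \<beta> * W2) + (5/4 * \<beta>\<^sup>2 * W1 + 5/2 * \<alpha> * \<beta> * W2 - \<beta> * W3) * u + (5/2 * \<alpha> * \<beta> * W3) * u^2 + 0 * u^3))"
  by (rule ext) (simp add: k2_def P_def Q_def w2_def w1_def algebra_simps eval_nat_numeral add_divide_distrib)
 then have i2: "I1 k2 = (5/4 * \<beta>\<^sup>2 * W0 - \<beta> * W2) * (2 / pi) + (5/2 * \<alpha> * \<beta> * W3) * tau" by (simp only: I)
 have "(LINT w|Mosq. cos (pi * w$1) * cos (pi * w$2) * (W0 + W1 * w$1 + W2 * w$2 + W3 * w$1 * w$2)
   * (1 - (\<alpha> * w$1 + \<beta> * w$2) + 5/4 * (\<alpha> * w$1 + \<beta> * w$2)^2))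
  = (LINT w|Mosq. k0 (w$1) * c0 (w$2) + k1 (w$1) * c1 (w$2) + k2 (w$1) * c2 (w$2) + k3 (w$1) * c3 (w$2))"
  by (rule lint_cong)
   (simp add: k0_def k1_def k2_def k3_def c0_def c1_def c2_def c3_def P_def Q_def w0_def w1_def w2_def algebra_simps eval_nat_numeral add_divide_distrib diff_divide_distrib)
 also have "\<dots> = I1 k0 * I1 c0 + I1 k1 * I1 c1 + I1 k2 * I1 c2 + I1 k3 * I1 c3"
  by (simp only: lint_add lint_integrable_add integrable_osq continuous_two ck cc
   integral_osq_product)
 also have "\<dots> = W0 * (2/pi)^2 + 5/4 * (\<alpha>\<^sup>2 + \<beta>\<^sup>2) * W0 * (tau * (2/pi)) - (W1 * \<alpha> + W2 * \<beta>) * (tau * (2/pi)) + 5/2 * W3 * \<alpha> * \<beta> * tau^2"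
  unfolding i0 i2 v0 by (simp add: algebra_simps power2_eq_square add_divide_distrib diff_divide_distrib)
 finally have L: "(LINT w|Mosq. cos (pi * w$1) * cos (pi * w$2) * (W0 + W1 * w$1 + W2 * w$2 + W3 * w$1 * w$2)
   * (1 - (\<alpha> * w$1 + \<beta> * w$2) + 5/4 * (\<alpha> * w$1 + \<beta> * w$2)^2)) = \<dots>" .
 have t: "tau = k / (2 * pi)" by (simp add: I1_trig k_def field_simps eval_nat_numeral)
 show ?thesis unfolding L t by (simp add: field_simps eval_nat_numeral)
qed

section \<open>Rescaled parameters and the two cases\<close>

context quad_map begin

text \<open>The rescaled parameters for which J = A(1 + 2c u - 2b v).\<close>

definition b :: real where "b = (p$2 * (1 + p$1) - p$3 * p$4) / A"
definition c :: real where "c = (p$3 * (1 - p$1) - p$2 * p$4) / A"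
definition q :: real where "q = b^2 + c^2"
definition r2 :: real where "r2 = (p$1)^2 + (p$4)^2"

text \<open>The Y are the coefficients of the squared norm of \<open>Pv\<close> in u, the X those of
  the squared norm of \<open>Pu\<close> in v, and \<open>W0\<close> is the constant term of the
  inner product of \<open>Pu\<close> and \<open>Pv\<close>. The quadratic coefficient
  \<open>Y2\<close> is common to both norms, and X1/2, Y1/2, Y2 complete the inner product.\<close>

definition Y0 :: real where "Y0 = 1 + r2 + 2 * p$1"
definition X0 :: real where "X0 = 1 + r2 - 2 * p$1"
definition W0 :: real where "W0 = - 2 * p$4"
definition Y1 :: real where "Y1 = 4 * (p$2 * p$4 + p$3 * (1 + p$1))"
definition X1 :: real where "X1 = - 4 * (p$2 * (1 - p$1) + p$3 * p$4)"
definition Y2 :: real where "Y2 = 4 * ((p$2)^2 + (p$3)^2)"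

abbreviation "zz w \<equiv> 2 * c * w$1 + (- 2 * b) * (w::real^2)$2"
abbreviation "ww w \<equiv> 1 - zz w + 5/4 * (zz w)^2"

lemma A_r2: "A = 1 - r2" by (simp add: A_def r2_def)

lemma norm_sq: "r2 + (p$2)^2 + (p$3)^2 <= 1/64"
proof -
 have "(norm p)^2 <= (1/8)\<^sup>2" using small by (intro power_mono) auto
 moreover have "(norm p)^2 = (\<Sum>i\<in>UNIV. (p$i)\<^sup>2)" by (simp add: norm_vec_def L2_set_def sum_nonneg)
 ultimately show ?thesis by (simp add: r2_def sum_4 power2_eq_square)
qed

lemma r2_bounds: "0 <= r2" "r2 <= 1/64"
proof -
 show "0 <= r2" by (simp add: r2_def)
 show "r2 <= 1/64" using norm_sq zero_le_power2[of "p$2"] zero_le_power2[of "p$3"] by linarith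
qed

lemma A_pos: "A > 0" using r2_bounds by (simp add: A_r2)

text \<open>The matrix taking (p$2, p$3) to A(b, c) has determinant A, and its adjugate gives the
  inverse.\<close>

lemma p_bc: "p$2 = (1 - p$1) * b + p$4 * c" "p$3 = p$4 * b + (1 + p$1) * c"
proof -
 have "A * ((1 - p$1) * b + p$4 * c) = (1 - p$1) * (p$2 * (1 + p$1) - p$3 * p$4) + p$4 * (p$3 * (1 - p$1) - p$2 * p$4)"
  using A_pos by (simp add: b_def c_def field_simps)
 also have "\<dots> = A * p$2" by (simp add: A_def algebra_simps power2_eq_square)
 finally show "p$2 = (1 - p$1) * b + p$4 * c" using A_pos by simp
 have "A * (p$4 * b + (1 + p$1) * c) = p$4 * (p$2 * (1 + p$1) - p$3 * p$4) + (1 + p$1) * (p$3 * (1 - p$1) - p$2 * p$4)"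
  using A_pos by (simp add: b_def c_def field_simps)
 also have "\<dots> = A * p$3" by (simp add: A_def algebra_simps power2_eq_square)
 finally show "p$3 = p$4 * b + (1 + p$1) * c" using A_pos by simp
qed

lemma J_eq: "J w = A * (1 + zz w)"
proof -
 have A: "A * b = p$2 * (1 + p$1) - p$3 * p$4" "A * c = p$3 * (1 - p$1) - p$2 * p$4" using A_pos by (simp_all add: b_def c_def)
 have "j1 = 2 * (A * c)" "j2 = - 2 * (A * b)" unfolding A j1_def j2_def by (simp_all add: algebra_simps)
 then show ?thesis by (simp add: J_def algebra_simps)
qed

text \<open>The coefficients of 1 + r2, -2 p$1 and -4 p$4 depend on b and c alone; this form is what
  \<open>Dform_lin\<close> splits.\<close>

lemma Y1_bc: "Y1 = (1 + r2) * (4 * c) + (- 2 * p$1) * (- 4 * c) + (- 4 * p$4) * (- 2 * b)"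
 unfolding Y1_def p_bc by (simp add: r2_def algebra_simps power2_eq_square)

lemma X1_bc: "X1 = (1 + r2) * (- 4 * b) + (- 2 * p$1) * (- 4 * b) + (- 4 * p$4) * (2 * c)"
 unfolding X1_def p_bc by (simp add: r2_def algebra_simps power2_eq_square)

lemma Y2_bc: "Y2 = (1 + r2) * (4 * (b^2 + c^2)) + (- 2 * p$1) * (4 * (b^2 - c\<^sup>2)) + (- 4 * p$4) * (- 4 * (b * c))"
 unfolding Y2_def p_bc by (simp add: r2_def algebra_simps power2_eq_square)

definition r :: real where "r = sqrt r2"

lemma r: "r^2 = r2" "0 <= r" "r <= 1/8" "\<bar>p$1\<bar> <= r" "\<bar>p$4\<bar> <= r"
proof -
 show "r^2 = r2" "0 <= r" using r2_bounds by (simp_all add: r_def)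
 show "r <= 1/8" unfolding r_def using r2_bounds by (intro real_le_lsqrt) (simp_all add: power2_eq_square)
 show "\<bar>p$1\<bar> <= r" "\<bar>p$4\<bar> <= r" unfolding r_def by (intro real_le_rsqrt; simp add: r2_def)+
qed

lemma r_sq: "r^2 = (p$1)^2 + (p$4)^2" using r by (simp add: r2_def)

lemma q_nonneg: "0 <= q" by (simp add: q_def)

text \<open>(1 - r)^2 q is at most the squared length of (p$2, p$3), hence at most 1/64 - r^2. The
  quotient (1/64 - r^2)/(1 - r)^2 has maximum 1/63, at r = 1/64.\<close>

lemma q_le: "q <= 1/62"
proof -
 define s where "s = (p$2)^2 + (p$3)^2"
 have "A^2 * q = (A * b)^2 + (A * c)^2" by (simp add: q_def algebra_simps power_mult_distrib)
 also have "\<dots> = (p$2 * (1 + p$1) - p$3 * p$4)^2 + (p$3 * (1 - p$1) - p$2 * p$4)^2"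
  using A_pos by (simp add: b_def c_def)
 also have "\<dots> = (1 + r2) * s + 2 * (p$1 * ((p$2)^2 - (p$3)\<^sup>2) + 2 * (- p$4) * p$2 * p$3)"
  by (simp add: r2_def s_def algebra_simps power2_eq_square)
 also have "\<dots> <= (1 + r2) * s + 2 * (r * s)"
  using quadratic_form_le[of r "p$1" "- p$4" "p$2" "p$3"] r_sq r(2) unfolding s_def by simp
 also have "\<dots> = (1 + r)^2 * s" unfolding r(1)[symmetric] by (simp add: algebra_simps power2_eq_square)
 also have "A^2 * q = (1 + r)^2 * ((1 - r)^2 * q)" unfolding A_r2 r(1)[symmetric] by (simp add: algebra_simps power2_eq_square)
 finally have "(1 - r)^2 * q <= s" using r(2) by (simp add: mult_le_cancel_left_pos)
 also have "s <= 1/64 - r\<^sup>2" using norm_sq by (simp add: s_def r(1))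
 also have "\<dots> <= (1 - r)\<^sup>2 * (1/62)"
  using zero_le_power2[of "1/8 - 8 * r"] zero_le_power2[of "1 - r"] by (simp add: algebra_simps power2_eq_square)
 finally show ?thesis using r(3) by (subst (asm) mult_le_cancel_left_pos) auto
qed

lemma Y2_le: "0 <= Y2" "Y2 <= 51/10 * q"
proof -
 show "0 <= Y2" by (simp add: Y2_def)
 have "Y2 / 4 = (1 + r2) * q + 2 * ((- p$1) * (b^2 - c\<^sup>2) + 2 * p$4 * b * c)" unfolding Y2_bc by (simp add: q_def algebra_simps add_divide_distrib diff_divide_distrib)
 also have "\<dots> <= (1 + r2) * q + 2 * (r * q)"
  using quadratic_form_le[of r "- p$1" "p$4" b c] r_sq r(2) unfolding q_def by simp
 also have "\<dots> = (1 + r)^2 * q" unfolding r(1)[symmetric] by (simp add: algebra_simps power2_eq_square)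
 also have "\<dots> <= (1 + 1/8)\<^sup>2 * q" using r(2,3) q_nonneg by (intro mult_right_mono power_mono) auto
 finally show "Y2 <= 51/10 * q" using q_nonneg by (simp add: power2_eq_square)
qed

lemma numerator_eq:
 fixes w :: "real^2"
 shows
 "(F1 * Pv (w$1) $ 2 - F2 * Pu (w$2) $ 2)^2 + (F2 * Pu (w$2) $ 1 - F1 * Pv (w$1) $ 1)^2
  = F1^2 * (Y0 + Y1 * w$1 + Y2 * (w$1)^2) + F2^2 * (X0 + X1 * w$2 + Y2 * (w$2)^2)
   - 2 * F1 * F2 * (W0 + X1 / 2 * w$1 + Y1 / 2 * w$2 + Y2 * w$1 * w$2)"
 by (simp add: Pu_def Pv_def Y0_def Y1_def Y2_def X0_def X1_def W0_def r2_def)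
   (simp add: algebra_simps power2_eq_square add_divide_distrib diff_divide_distrib)

text \<open>(1 - z + 5/4 z^2)(1 + z) - 1 = z^2 (1 + 5z)/4 is nonnegative as soon as z >= -1/5, and
  the bound on q ensures this on the square. This is where 5/4 comes from.\<close>

lemma weight_bound: "w \<in> osq ==> A / J w <= ww w"
proof -
 assume w: "w \<in> osq"
 have wi: "\<bar>w$1\<bar> <= 1/2" "\<bar>w$2\<bar> <= 1/2" using w by (auto simp: mem_osq abs_le_iff)
 have "\<bar>2 * c * w$1\<bar> <= 2 * \<bar>c\<bar> * (1/2)" "\<bar>(- 2 * b) * w$2\<bar> <= 2 * \<bar>b\<bar> * (1/2)"
  by (rule mult_le; use wi in simp)+
 then have "\<bar>zz w\<bar> <= \<bar>b\<bar> + \<bar>c\<bar>" by linarith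
 moreover have "\<bar>b\<bar> + \<bar>c\<bar> <= 1/5"
 proof (rule power2_le_imp_le)
  have "(\<bar>b\<bar> + \<bar>c\<bar>)^2 <= 2 * q" using zero_le_power2[of "\<bar>b\<bar> - \<bar>c\<bar>"] unfolding q_def by (simp add: power2_eq_square algebra_simps)
  then show "(\<bar>b\<bar> + \<bar>c\<bar>)^2 <= (1/5)\<^sup>2" using q_le by (simp add: power2_eq_square)
 qed simp
 ultimately have z: "- 1/5 <= zz w" by (simp add: abs_le_iff)
 define z where "z = zz w"
 have z5: "- 1/5 <= z" using z by (simp add: z_def)
 have "z^2 * (1/4 + 5/4 * z) \<ge> 0" using z5 by (intro mult_nonneg_nonneg) auto
 then have "1 <= (1 - z + 5/4 * z^2) * (1 + z)" by (simp add: algebra_simps power2_eq_square)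
 then have "1 / (1 + z) <= 1 - z + 5/4 * z^2" using z5 by (simp add: divide_le_eq)
 moreover have "A / J w = 1 / (1 + z)" unfolding J_eq z_def[symmetric] using A_pos by simp
 ultimately show ?thesis by (simp add: z_def)
qed

text \<open>Stated under the negation of the goal, so that each trial function yields an inequality
  to be refuted. The polynomial weight replaces A/J, which makes the integrals explicit.\<close>

lemma trial_bound:
 assumes F: "!!x. (F has_derivative (%h. F1 x * h$1 + F2 x * h$2)) (at x)"
  and cont: "contU F1" "contU F2"
  and mu: "pi^2 <= A * mu1 \<Omega>"
  and I2: "(LINT w|Mosq. (F w)\<^sup>2 * (1 + zz w)) = n" and I1: "(LINT w|Mosq. F w * (1 + zz w)) = m"
 shows "pi^2 * ((1 - r2) * (n - m\<^sup>2)) <= (LINT w|Mosq. ((F1 w)^2 * (Y0 + Y1 * w$1 + Y2 * (w$1)^2) + (F2 w)^2 * (X0 + X1 * w$2 + Y2 * (w$2)^2)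
   - 2 * F1 w * F2 w * (W0 + X1 / 2 * w$1 + Y1 / 2 * w$2 + Y2 * w$1 * w$2)) * ww w)"
proof -
 define num where "num = (%w. (F1 w)\<^sup>2 * (Y0 + Y1 * w$1 + Y2 * (w$1)^2) + (F2 w)^2 * (X0 + X1 * w$2 + Y2 * (w$2)^2)
   - 2 * F1 w * F2 w * (W0 + X1 / 2 * w$1 + Y1 / 2 * w$2 + Y2 * w$1 * w$2))"
 have num: "(F1 w * Pv (w$1) $ 2 - F2 w * Pu (w$2) $ 2)^2 + (F2 w * Pu (w$2) $ 1 - F1 w * Pv (w$1) $ 1)^2 = num w" for w
  unfolding num_def by (rule numerator_eq)
 have nn: "0 <= num w" for w unfolding num[symmetric] by simp
 have int: "integrable Mosq (%w. num w * ww w)"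
  unfolding num_def by (intro integrable_osq continuous_intros cont)
 have wpos: "0 <= ww w" if "w \<in> osq" for w
  using weight_bound[OF that] J_osq[OF that] A_pos by (smt (verit) divide_pos_pos)
 have i2: "(LINT w|Mosq. (F w)\<^sup>2 * J w) = A * n"
 proof -
  have "(LINT w|Mosq. (F w)\<^sup>2 * J w) = (LINT w|Mosq. A * ((F w)^2 * (1 + zz w)))"
   by (rule lint_cong) (simp only: J_eq mult.left_commute)
  then show ?thesis by (simp only: I2 integral_mult_right_zero)
 qed
 have i1: "(LINT w|Mosq. F w * J w) = A * m"
 proof -
  have "(LINT w|Mosq. F w * J w) = (LINT w|Mosq. A * (F w * (1 + zz w)))"
   by (rule lint_cong) (simp only: J_eq mult.left_commute)
  then show ?thesis by (simp only: I1 integral_mult_right_zero)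
 qed
 define D where "D = (LINT w|Mosq. num w / J w)"
 have N: "(LINT w|Mosq. (F w)\<^sup>2 * J w) - (LINT w|Mosq. F w * J w)\<^sup>2 / A = A * (n - m\<^sup>2)"
  unfolding i1 i2 using A_pos by (simp add: field_simps power2_eq_square)
 have AD: "A * D <= (LINT w|Mosq. num w * ww w)"
 proof -
  have "A * D = (LINT w|Mosq. A * (num w / J w))" unfolding D_def by (simp only: integral_mult_right_zero)
  also have "\<dots> <= (LINT w|Mosq. num w * ww w)"
  proof (rule integral_mono'[OF int])
   fix w assume "w \<in> space Mosq"
   then have w: "w \<in> osq" by simp
   from mult_left_mono[OF weight_bound[OF w] nn[of w]] show "A * (num w / J w) <= num w * ww w" by (simp add: mult.commute)
   show "0 <= num w * ww w" by (rule mult_nonneg_nonneg[OF nn wpos[OF w]])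
  qed
  finally show ?thesis .
 qed
 have "pi^2 * ((1 - r2) * (n - m\<^sup>2)) <= (LINT w|Mosq. num w * ww w)"
 proof (cases "A * (n - m\<^sup>2) > 0")
  case True
  have "mu1 \<Omega> * (A * (n - m\<^sup>2)) <= D"
   using mu1_le_pullback[OF F cont] True unfolding N D_def num by blast
  then have "A * (mu1 \<Omega> * (A * (n - m\<^sup>2))) <= A * D" using A_pos by simp
  moreover have "pi^2 * (A * (n - m\<^sup>2)) <= A * mu1 \<Omega> * (A * (n - m\<^sup>2))" using True by (intro mult_right_mono mu) simp
  ultimately show "pi^2 * ((1 - r2) * (n - m\<^sup>2)) <= (LINT w|Mosq. num w * ww w)" using AD unfolding A_r2 by (simp add: mult.assoc)
 next
  \<comment> \<open>A trial function without positive variance makes the left side nonpositive,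
    while the integrand on the right is nonnegative.\<close>
  case False
  then have "pi^2 * (A * (n - m\<^sup>2)) <= 0" by (simp add: mult_nonneg_nonpos)
  moreover have "0 <= (LINT w|Mosq. num w * ww w)"
   by (rule integral_nonneg_AE, rule AE_I2, rule mult_nonneg_nonneg[OF nn wpos]) simp
  ultimately show "pi^2 * ((1 - r2) * (n - m\<^sup>2)) <= (LINT w|Mosq. num w * ww w)" unfolding A_r2 by linarith
 qed
 then show ?thesis unfolding num_def .
qed

abbreviation "D1 h \<equiv> Dform h (2 * c) (- 2 * b) Y0 Y1 Y2 X0 X1 Y2 W0 (X1 / 2) (Y1 / 2) Y2"
abbreviation "D2 h \<equiv> Dform h (- 2 * b) (2 * c) X0 X1 Y2 Y0 Y1 Y2 W0 (Y1 / 2) (X1 / 2) Y2"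

lemma deriv_sin1: "((%x::real^2. sin (pi * x$1) * (1 - h * x$2)) has_derivative
  (%k. pi * cos (pi * x$1) * (1 - h * x$2) * k$1 + (- h * sin (pi * x$1)) * k$2)) (at x)"
 by (auto intro!: derivative_eq_intros simp: algebra_simps)

lemma deriv_sin2: "((%x::real^2. sin (pi * x$2) * (1 - h * x$1)) has_derivative
  (%k. (- h * sin (pi * x$2)) * k$1 + pi * cos (pi * x$2) * (1 - h * x$1) * k$2)) (at x)"
 by (auto intro!: derivative_eq_intros simp: algebra_simps)

lemma ij12: "(1::2) \<noteq> 2" "(2::2) \<noteq> 1" by simp_all

lemma D1_bound:
 assumes "pi^2 <= A * mu1 \<Omega>"
 shows "pi^2 * ((1 - r2) * ((1 + h^2 / 12 - h * (- 2 * b) / 6) / 2 - (2 * c * (2 / pi^2))\<^sup>2)) <= D1 h"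
 using trial_bound[OF deriv_sin1 _ _ assms integral_trial[OF ij12(1)], of h]
 unfolding integral_Dform[OF ij12(1), symmetric] by (simp add: continuous_intros)

lemma D2_bound:
 assumes "pi^2 <= A * mu1 \<Omega>"
 shows "pi^2 * ((1 - r2) * ((1 + h^2 / 12 - h * (2 * c) / 6) / 2 - (- 2 * b * (2 / pi^2))\<^sup>2)) <= D2 h"
proof -
 have s: "zz w = (- 2 * b) * w$2 + 2 * c * w$1" for w :: "real^2" by simp
 have e: "((- h * sin (pi * w$2))^2 * (Y0 + Y1 * w$1 + Y2 * (w$1)^2) + (pi * cos (pi * w$2) * (1 - h * w$1))^2 * (X0 + X1 * w$2 + Y2 * (w$2)^2)
   - 2 * (- h * sin (pi * w$2)) * (pi * cos (pi * w$2) * (1 - h * w$1)) * (W0 + X1 / 2 * w$1 + Y1 / 2 * w$2 + Y2 * w$1 * w$2)) * ww w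
  = ((pi * cos (pi * w$2) * (1 - h * w$1))^2 * (X0 + X1 * w$2 + Y2 * (w$2)^2)
    + (h * sin (pi * w$2))^2 * (Y0 + Y1 * w$1 + Y2 * (w$1)^2)
    - 2 * (pi * cos (pi * w$2) * (1 - h * w$1)) * (- h * sin (pi * w$2)) * (W0 + Y1 / 2 * w$2 + X1 / 2 * w$1 + Y2 * w$2 * w$1))
    * (1 - ((- 2 * b) * w$2 + 2 * c * w$1) + 5/4 * ((- 2 * b) * w$2 + 2 * c * w$1)^2)" for w :: "real^2"
  unfolding s by (simp add: mult_ac add_ac)
 have t: "(LINT w|Mosq. (sin (pi * w$2) * (1 - h * w$1))\<^sup>2 * (1 + zz w)) = (1 + h^2 / 12 - h * (2 * c) / 6) / 2"
   "(LINT w|Mosq. (sin (pi * w$2) * (1 - h * w$1)) * (1 + zz w)) = (- 2 * b) * (2 / pi^2)"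
  unfolding s by (rule integral_trial[OF ij12(2)])+
 show ?thesis unfolding integral_Dform[OF ij12(2), symmetric] e[symmetric]
  by (rule trial_bound[OF deriv_sin2 _ _ assms t]) (intro continuous_intros)+
qed

text \<open>Adding the inequalities of the two tilted functions cancels the first-order effect of a,
  since Y0 + X0 = 2(1 + r2). There remain at most -4q from (b,c), 22q/9 from r2 <= q/9, and 3q/5
  from the mixed terms with a and d; the total is negative.\<close>

lemma case_A:
 assumes q0: "0 < q" and r: "9 * r2 <= q"
 shows "A * mu1 \<Omega> < pi\<^sup>2"
proof (rule ccontr)
 assume "\<not> A * mu1 \<Omega> < pi\<^sup>2"
 then have mu: "pi^2 <= A * mu1 \<Omega>" by simp
 define T0 where "T0 = Dform (4*b) (2*c) (-2*b) 1 (4*c) (4*(b^2+c^2)) 1 (-4*b) (4*(b^2+c^2)) 0 (-2*b) (2*c) (4*(b^2+c^2))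
  + Dform (-4*c) (-2*b) (2*c) 1 (-4*b) (4*(b^2+c^2)) 1 (4*c) (4*(b^2+c^2)) 0 (2*c) (-2*b) (4*(b^2+c^2))"
 define T1 where "T1 = Dform (4*b) (2*c) (-2*b) (-1) (-4*c) (4*(b^2-c\<^sup>2)) 1 (-4*b) (4*(b^2-c\<^sup>2)) 0 (-2*b) (-2*c) (4*(b^2-c\<^sup>2))
  + Dform (-4*c) (-2*b) (2*c) 1 (-4*b) (4*(b^2-c\<^sup>2)) (-1) (-4*c) (4*(b^2-c\<^sup>2)) 0 (-2*c) (-2*b) (4*(b^2-c\<^sup>2))"
 define T2 where "T2 = Dform (4*b) (2*c) (-2*b) 0 (-2*b) (-4*(b*c)) 0 (2*c) (-4*(b*c)) (1/2) c (-b) (-4*(b*c))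
  + Dform (-4*c) (-2*b) (2*c) 0 (2*c) (-4*(b*c)) 0 (-2*b) (-4*(b*c)) (1/2) (-b) c (-4*(b*c))"
 define N where "N = pi^2 * (1 + 4/3 * q) - 16 / pi^2 * q"
 have c0: "Y0 = (1 + r2) * 1 + (- 2 * p$1) * (- 1) + (- 4 * p$4) * 0" "X0 = (1 + r2) * 1 + (- 2 * p$1) * 1 + (- 4 * p$4) * 0"
  "W0 = (1 + r2) * 0 + (- 2 * p$1) * 0 + (- 4 * p$4) * (1/2)"
  "X1 / 2 = (1 + r2) * (- 2 * b) + (- 2 * p$1) * (- 2 * b) + (- 4 * p$4) * c"
  "Y1 / 2 = (1 + r2) * (2 * c) + (- 2 * p$1) * (- 2 * c) + (- 4 * p$4) * (- b)"
  by (simp_all add: Y0_def X0_def W0_def X1_bc Y1_bc algebra_simps add_divide_distrib diff_divide_distrib)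
 have T: "D1 (4*b) + D2 (-4*c) = (1 + r2) * T0 + (- 2 * p$1) * T1 + (- 4 * p$4) * T2"
 proof -
  have lin: "(s * e1 + t * e2 + k * e3) + (s * e4 + t * e5 + k * e6) = s * (e1 + e4) + t * (e2 + e5) + k * (e3 + e6)"
   for s t k e1 e2 e3 e4 e5 e6 :: real by (simp add: algebra_simps)
  show ?thesis unfolding T0_def T1_def T2_def
   by (simp only: c0, simp only: X1_bc Y1_bc Y2_bc, simp only: Dform_lin, rule lin)
 qed
 have n: "pi^2 * ((1 - r2) * ((1 + (4*b)^2 / 12 - 4*b * (- 2 * b) / 6) / 2 - (2 * c * (2 / pi^2))\<^sup>2))
   + pi^2 * ((1 - r2) * ((1 + (-4*c)^2 / 12 - (-4*c) * (2 * c) / 6) / 2 - (- 2 * b * (2 / pi^2))\<^sup>2)) = (1 - r2) * N"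
  by (simp add: N_def q_def field_simps power2_eq_square)
 have le: "(1 - r2) * N <= (1 + r2) * T0 + (- 2 * p$1) * T1 + (- 4 * p$4) * T2"
  unfolding n[symmetric] T[symmetric] by (intro add_mono D1_bound D2_bound mu)
 note B = T_bounds[of b c, folded Dform_T0 Dform_T1 Dform_T2, folded T0_def T1_def T2_def q_def, OF q_le, folded N_def]
 have a: "\<bar>p$1\<bar> <= 1/20" "\<bar>p$4\<bar> <= 1/20"
 proof -
  have "r2 <= (1/20)\<^sup>2" using r q_le by (simp add: power2_eq_square)
  then have "r <= 1/20" unfolding r_def by (intro real_le_lsqrt) auto
  then show "\<bar>p$1\<bar> <= 1/20" "\<bar>p$4\<bar> <= 1/20" using quad_map.r(4,5)[OF quad_map_axioms] by linarith+
 qed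
 have "\<bar>p$1 * T1\<bar> <= 1/20 * (4 * q)" "\<bar>p$4 * T2\<bar> <= 1/20 * q" by (rule mult_le[OF a(1) B(3)] mult_le[OF a(2) B(4)])+
 moreover have "r2 * (T0 + N) <= q / 9 * 22"
  using mult_left_mono[OF B(2) r2_bounds(1)] r by linarith
 moreover have "(1 + r2) * T0 + (- 2 * p$1) * T1 + (- 4 * p$4) * T2 - (1 - r2) * N
   = (T0 - N) + r2 * (T0 + N) - 2 * (p$1 * T1) - 4 * (p$4 * T2)" by (simp add: algebra_simps)
 ultimately show False using le B(1) q0 by linarith
qed

text \<open>Without tilt only the Z coefficients matter. The energy is compared with its leading
  value pi^2 Z0/2, at a cost linear in k.\<close>

lemma Dform0_bound:
 assumes q: "0 <= k" "k <= 1/62" and Y0: "0 <= Z0" "Z0 <= 81/64" and Z2: "0 <= Z2" "Z2 <= 51/10 * k"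
  and al: "\<alpha>\<^sup>2 <= 4 * k" and be: "\<beta>\<^sup>2 <= 4 * k" and m: "5/4 * \<alpha>\<^sup>2 * Z0 - Z1 * \<alpha> <= k"
 shows "Dform 0 \<alpha> \<beta> Z0 Z1 Z2 V0 V1 V2 U0 U1 U2 U3 <= pi\<^sup>2 / 2 * Z0 + 39/10 * k"
proof -
 define t1 where "t1 = pi^2 * (5/96 * (Z0 * \<beta>\<^sup>2))"
 define t2 where "t2 = kk2 * ((5/4 * \<alpha>\<^sup>2 * Z0 - Z1 * \<alpha>) + (Z2 + 5/48 * (Z2 * \<beta>\<^sup>2)))"
 define t3 where "t3 = kk4 * (5/4 * (Z2 * \<alpha>\<^sup>2))"
 define m1 where "m1 = k + (51/10 * k + 5/48 * ((51/10 * k) * (4 / 62)))"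
 have e: "Dform 0 \<alpha> \<beta> Z0 Z1 Z2 V0 V1 V2 U0 U1 U2 U3 = pi^2 / 2 * Z0 + t1 + t2 + t3"
  unfolding Dform_alt t1_def t2_def t3_def by (simp add: algebra_simps add_divide_distrib)
 have k1: "Z0 * \<beta>\<^sup>2 <= 81/64 * (4 * k)" by (rule mult_mono[OF Y0(2) be]) auto
 have k2: "Z2 * \<beta>\<^sup>2 <= (51/10 * k) * (4 / 62)" "Z2 * \<alpha>\<^sup>2 <= (51/10 * k) * (4 / 62)"
  by (rule mult_mono[OF Z2(2)]; use al be q in simp)+
 have "t1 <= 987/100 * (5/96 * (81/64 * (4 * k)))" unfolding t1_def
 proof (rule mult_mono[OF pi_sq_bounds(2)])
  show "5/96 * (Z0 * \<beta>\<^sup>2) <= 5/96 * (81/64 * (4 * k))" using k1 by linarith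
 qed (use Y0 in auto)
 moreover have "t2 <= kk2 * m1" unfolding t2_def m1_def
  by (rule mult_left_mono) (use kk_bounds k2(1) m Z2(2) in linarith)+
 moreover have "kk2 * m1 <= (1613/10000) * m1"
  by (rule mult_right_mono[OF kk_bounds(2)]) (use q in \<open>simp add: m1_def\<close>)
 moreover have "t3 <= (404/10000) * (5/4 * ((51/10 * k) * (4 / 62)))" unfolding t3_def
 proof (rule mult_mono[OF kk_bounds(4)])
  show "5/4 * (Z2 * \<alpha>\<^sup>2) <= 5/4 * ((51/10 * k) * (4 / 62))" using k2(2) by linarith
 qed (use Z2 in auto)
 moreover have "m1 <= 62/10 * k" using q(1) unfolding m1_def by linarith
 ultimately show ?thesis unfolding e using q(1) by linarith
qed

lemma al_be: "(2 * c)^2 <= 4 * q" "(- 2 * b)^2 <= 4 * q" by (simp_all add: q_def power_mult_distrib)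

lemma abs_bc: "\<bar>b * c\<bar> <= q / 2"
 using sum_squares_bound[of "\<bar>b\<bar>" "\<bar>c\<bar>"] by (simp add: q_def abs_mult)

lemma XY0: "0 <= Y0" "Y0 <= 81/64" "0 <= X0" "X0 <= 81/64"
 using r(3,4) r2_bounds unfolding Y0_def X0_def by (simp_all add: abs_le_iff)

lemma D1_0: "D1 0 <= pi\<^sup>2 / 2 * Y0 + 39/10 * q"
proof (rule Dform0_bound[OF q_nonneg q_le XY0(1,2) Y2_le al_be])
 have "5/4 * (2 * c)^2 * Y0 - Y1 * (2 * c) = - 3 * (c^2 * Y0) - 16 * (p$4 * (b * c))"
  unfolding Y1_bc Y0_def by (simp add: algebra_simps power2_eq_square)
 moreover have "0 <= c\<^sup>2 * Y0" using XY0 by simp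
 moreover have "\<bar>p$4 * (b * c)\<bar> <= 1/8 * (q / 2)" by (rule mult_le[OF p_le abs_bc])
 ultimately show "5/4 * (2 * c)^2 * Y0 - Y1 * (2 * c) <= q" by linarith
qed

lemma D2_0: "D2 0 <= pi\<^sup>2 / 2 * X0 + 39/10 * q"
proof (rule Dform0_bound[OF q_nonneg q_le XY0(3,4) Y2_le al_be(2,1)])
 have "5/4 * (- 2 * b)^2 * X0 - X1 * (- 2 * b) = - 3 * (b^2 * X0) - 16 * (p$4 * (b * c))"
  unfolding X1_bc X0_def by (simp add: algebra_simps power2_eq_square)
 moreover have "0 <= b\<^sup>2 * X0" using XY0 by simp
 moreover have "\<bar>p$4 * (b * c)\<bar> <= 1/8 * (q / 2)" by (rule mult_le[OF p_le abs_bc])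
 ultimately show "5/4 * (- 2 * b)^2 * X0 - X1 * (- 2 * b) <= q" by linarith
qed

text \<open>The trial functions do not have mean zero for the density 1 + z; the correction is
  quadratic in (b,c), with 4/pi^2 <= 41/100.\<close>

lemma mean_loss:
 assumes "s^2 <= t * q" "0 <= t"
 shows "pi^2 * ((1 - r2) * (n - (s * (2 / pi^2))\<^sup>2)) \<ge> pi\<^sup>2 * ((1 - r2) * n) - 41/100 * (t * q)"
proof -
 have "pi^2 * ((1 - r2) * (s * (2 / pi^2))^2) = (1 - r2) * (4 / pi^2) * s^2" by (simp add: field_simps power2_eq_square)
 also have "\<dots> <= 41/100 * (t * q)"
 proof (rule mult_mono[OF _ assms(1)])
  have "4 / pi^2 <= 41/100" using pi_sq_bounds by (simp add: field_simps)
  then have "(1 - r2) * (4 / pi^2) <= 1 * (41/100)" using r2_bounds by (intro mult_mono) auto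
  then show "(1 - r2) * (4 / pi^2) <= 41/100" by simp
 qed auto
 finally show ?thesis by (simp add: algebra_simps)
qed

text \<open>Here q <= 0.39 r, so the first-order effect of (a,d), of order r, outweighs all terms in
  q and r^2. If |a| is the larger of |a| and |d|, its sign selects sin pi u or sin pi v; otherwise
  the sum or difference of both is taken, with sign opposite to d.\<close>

lemma case_B:
 assumes q9: "q <= 9 * r2" and r0: "0 < r2"
 shows "A * mu1 \<Omega> < pi\<^sup>2"
proof (rule ccontr)
 assume "\<not> A * mu1 \<Omega> < pi\<^sup>2"
 then have mu: "pi^2 <= A * mu1 \<Omega>" by simp
 have rp: "0 < r" using r0 by (simp add: r_def)
 have rr: "r2 <= r / 8" using mult_left_mono[OF r(3) r(2)] unfolding r(1)[symmetric] by (simp add: power2_eq_square)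
 have qr: "q <= 39/100 * r"
 proof (rule power2_le_imp_le)
  have "q * q <= (9 * r2) * (1/62)" using q9 q_le q_nonneg r2_bounds by (intro mult_mono) auto
  moreover have "(39/100 * r)^2 = 1521/10000 * r2" unfolding r(1)[symmetric] by (simp add: power2_eq_square)
  ultimately show "q^2 <= (39/100 * r)\<^sup>2" using r2_bounds by (simp add: power2_eq_square)
 qed (use rp in simp)
 have Pr: "pi^2 * r2 <= 987/100 * (r / 8)" using pi_sq_bounds rr r2_bounds by (intro mult_mono) auto
 \<comment> \<open>Applied to the larger of |a| and |d|, which is at least r divided by the square
   root of 2.\<close>
 have seven: "7/10 * r <= \<bar>x\<bar>" if "r2 <= 2 * x^2" for x
 proof (rule power2_le_imp_le)
  have "(7/10 * r)^2 = 49/100 * r2" unfolding r(1)[symmetric] by (simp add: power2_eq_square)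
  then show "(7/10 * r)^2 <= \<bar>x\<bar>\<^sup>2" using that r2_bounds(1) by simp
 qed simp
 show False
 proof (cases "\<bar>p$4\<bar> <= \<bar>p$1\<bar>")
  case True
  then have "(p$4)^2 <= (p$1)\<^sup>2" by (simp only: abs_le_square_iff)
  then have a7: "7/10 * r <= \<bar>p$1\<bar>" by (intro seven) (simp add: r2_def)
  have aP: "pi^2 * \<bar>p$1\<bar> \<ge> 9869/1000 * (7/10 * r)" using a7 pi_sq_bounds rp by (intro mult_mono) auto
  show False
  proof (cases "p$1 <= 0")
   case True
   have "pi^2 * ((1 - r2) * (1/2)) - 41/100 * (4 * q) <= D1 0"
    using mean_loss[OF al_be(1), of "1/2"] D1_bound[OF mu, of 0] by simp
   then have "pi^2 * ((1 - r2) * (1/2)) - 41/100 * (4 * q) <= pi\<^sup>2 / 2 * Y0 + 39/10 * q" using D1_0 by linarith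
   then have "0 <= pi\<^sup>2 * r2 + pi^2 * p$1 + 6 * q" using q_nonneg by (simp add: Y0_def algebra_simps add_divide_distrib diff_divide_distrib)
   then show False using aP True Pr qr rp by simp
  next
   case False
   have "pi^2 * ((1 - r2) * (1/2)) - 41/100 * (4 * q) <= D2 0"
    using mean_loss[OF al_be(2), of "1/2"] D2_bound[OF mu, of 0] by simp
   then have "pi^2 * ((1 - r2) * (1/2)) - 41/100 * (4 * q) <= pi\<^sup>2 / 2 * X0 + 39/10 * q" using D2_0 by linarith
   then have "0 <= pi\<^sup>2 * r2 - pi\<^sup>2 * p$1 + 6 * q" using q_nonneg by (simp add: X0_def algebra_simps add_divide_distrib diff_divide_distrib)
   then show False using aP False Pr qr rp by simp
  qed
 next
  case False
  then have "(p$1)^2 <= (p$4)\<^sup>2" by (simp flip: abs_le_square_iff)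
  then have d7: "7/10 * r <= \<bar>p$4\<bar>" by (intro seven) (simp add: r2_def)
  \<comment> \<open>The mixed term enters the energy with factor -2 eps, and its leading value is 4
    \<open>W0\<close> = -8 p$4; this sign makes the contribution -16 |p$4|.\<close>
  define \<epsilon> where "\<epsilon> = - sgn (p$4)"
  have e2: "\<epsilon>\<^sup>2 = 1" and ed: "\<epsilon> * p$4 = - \<bar>p$4\<bar>" and ea: "\<bar>\<epsilon>\<bar> = 1" using d7 rp by (auto simp: \<epsilon>_def sgn_if abs_if)
  define C where "C = (LINT w|Mosq. cos (pi * w$1) * cos (pi * w$2) * (W0 + X1 / 2 * w$1 + Y1 / 2 * w$2 + Y2 * w$1 * w$2) * ww w)"
  have d: "((%x::real^2. sin (pi * x$1) + \<epsilon> * sin (pi * x$2)) has_derivative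
   (%k. pi * cos (pi * x$1) * k$1 + \<epsilon> * (pi * cos (pi * x$2)) * k$2)) (at x)" for x
   by (auto intro!: derivative_eq_intros simp: algebra_simps)
  have s: "zz w = (- 2 * b) * w$2 + 2 * c * w$1" for w :: "real^2" by simp
  have t1: "(LINT w|Mosq. (sin (pi * w$1))\<^sup>2 * (1 + zz w)) = 1/2" "(LINT w|Mosq. sin (pi * w$1) * (1 + zz w)) = 2 * c * (2 / pi^2)"
   using integral_trial[OF ij12(1), of 0 "2 * c" "- 2 * b"] by simp_all
  have t2: "(LINT w|Mosq. (sin (pi * w$2))\<^sup>2 * (1 + zz w)) = 1/2" "(LINT w|Mosq. sin (pi * w$2) * (1 + zz w)) = - 2 * b * (2 / pi^2)"
   unfolding s using integral_trial[OF ij12(2), of 0 "- 2 * b" "2 * c"] by simp_all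
  have t3: "(LINT w|Mosq. sin (pi * w$1) * sin (pi * w$2) * (1 + zz w)) = 0"
  proof -
   define g1 g2 :: "real => real" where "g1 = (%u. sin (pi * u))" and "g2 = (%u. u * sin (pi * u))"
   have cg: "contU g1" "contU g2" unfolding g1_def g2_def by (intro continuous_intros)+
   have z: "I1 g1 = 0" unfolding g1_def by (rule I1_odd) simp
   have "(LINT w|Mosq. sin (pi * w$1) * sin (pi * w$2) * (1 + zz w))
    = (LINT w|Mosq. g1 (w$1) * g1 (w$2) + 2 * c * (g2 (w$1) * g1 (w$2)) + (- 2 * b) * (g1 (w$1) * g2 (w$2)))"
    by (rule lint_cong) (simp add: g1_def g2_def algebra_simps)
   also have "\<dots> = I1 g1 * I1 g1 + 2 * c * (I1 g2 * I1 g1) + (- 2 * b) * (I1 g1 * I1 g2)"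
    by (simp only: lint_add lint_integrable_add integrable_mult_right integral_mult_right_zero
     integrable_osq continuous_two cg integral_osq_product)
   finally show ?thesis by (simp only: z; simp)
  qed
  have int: "integrable Mosq (%w. (sin (pi * w$1))\<^sup>2 * (1 + zz w))" "integrable Mosq (%w. (sin (pi * w$2))\<^sup>2 * (1 + zz w))"
   "integrable Mosq (%w. sin (pi * w$1) * sin (pi * w$2) * (1 + zz w))"
   "integrable Mosq (%w. sin (pi * w$1) * (1 + zz w))" "integrable Mosq (%w. sin (pi * w$2) * (1 + zz w))"
   by (intro integrable_osq continuous_intros)+
  have I2: "(LINT w|Mosq. (sin (pi * w$1) + \<epsilon> * sin (pi * w$2))\<^sup>2 * (1 + zz w)) = 1"
  proof -
   have "(LINT w|Mosq. (sin (pi * w$1) + \<epsilon> * sin (pi * w$2))\<^sup>2 * (1 + zz w))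
    = (LINT w|Mosq. (sin (pi * w$1))\<^sup>2 * (1 + zz w) + \<epsilon>\<^sup>2 * ((sin (pi * w$2))^2 * (1 + zz w)) + (2 * \<epsilon>) * (sin (pi * w$1) * sin (pi * w$2) * (1 + zz w)))"
    by (rule lint_cong) (simp add: power2_sum power_mult_distrib distrib_right distrib_left mult_ac)
   also have "\<dots> = 1/2 + \<epsilon>\<^sup>2 * (1/2) + (2 * \<epsilon>) * 0"
    by (simp only: lint_add lint_integrable_add integrable_mult_right integral_mult_right_zero int t1 t2 t3)
   finally show ?thesis by (simp add: e2)
  qed
  have I1: "(LINT w|Mosq. (sin (pi * w$1) + \<epsilon> * sin (pi * w$2)) * (1 + zz w)) = (2 * c - 2 * \<epsilon> * b) * (2 / pi^2)"
  proof -
   have "(LINT w|Mosq. (sin (pi * w$1) + \<epsilon> * sin (pi * w$2)) * (1 + zz w))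
    = (LINT w|Mosq. sin (pi * w$1) * (1 + zz w) + \<epsilon> * (sin (pi * w$2) * (1 + zz w)))"
    by (rule lint_cong) (simp only: distrib_right mult.assoc)
   also have "\<dots> = 2 * c * (2 / pi^2) + \<epsilon> * (- 2 * b * (2 / pi^2))"
    by (simp only: lint_add lint_integrable_add integrable_mult_right integral_mult_right_zero int t1 t2)
   finally show ?thesis by (simp add: algebra_simps)
  qed
  have ij: "integrable Mosq (%w. cos (pi * w$1) * cos (pi * w$2) * (W0 + X1 / 2 * w$1 + Y1 / 2 * w$2 + Y2 * w$1 * w$2) * ww w)"
   "integrable Mosq (%w. (pi * cos (pi * w$1))\<^sup>2 * (Y0 + Y1 * w$1 + Y2 * (w$1)^2) * ww w)"
   "integrable Mosq (%w. (pi * cos (pi * w$2))\<^sup>2 * (X0 + X1 * w$2 + Y2 * (w$2)^2) * ww w)"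
   by (intro integrable_osq continuous_intros)+
  have d1: "(LINT w|Mosq. (pi * cos (pi * w$1))\<^sup>2 * (Y0 + Y1 * w$1 + Y2 * (w$1)^2) * ww w) = D1 0"
   unfolding integral_Dform[OF ij12(1), symmetric] by simp
  have d2: "(LINT w|Mosq. (pi * cos (pi * w$2))\<^sup>2 * (X0 + X1 * w$2 + Y2 * (w$2)^2) * ww w) = D2 0"
   unfolding integral_Dform[OF ij12(2), symmetric] s by simp
  have "pi^2 * ((1 - r2) * (1 - ((2 * c - 2 * \<epsilon> * b) * (2 / pi^2))\<^sup>2)) <=
    (LINT w|Mosq. ((pi * cos (pi * w$1))^2 * (Y0 + Y1 * w$1 + Y2 * (w$1)^2) + (\<epsilon> * (pi * cos (pi * w$2)))^2 * (X0 + X1 * w$2 + Y2 * (w$2)^2)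
   - 2 * (pi * cos (pi * w$1)) * (\<epsilon> * (pi * cos (pi * w$2))) * (W0 + X1 / 2 * w$1 + Y1 / 2 * w$2 + Y2 * w$1 * w$2)) * ww w)"
   by (rule trial_bound[OF d _ _ mu I2 I1]) (intro continuous_intros)+
  also have "\<dots> = (LINT w|Mosq. (pi * cos (pi * w$1))\<^sup>2 * (Y0 + Y1 * w$1 + Y2 * (w$1)^2) * ww w
    + \<epsilon>\<^sup>2 * ((pi * cos (pi * w$2))^2 * (X0 + X1 * w$2 + Y2 * (w$2)^2) * ww w)
    + (- 2 * \<epsilon> * pi^2) * (cos (pi * w$1) * cos (pi * w$2) * (W0 + X1 / 2 * w$1 + Y1 / 2 * w$2 + Y2 * w$1 * w$2) * ww w))"
  proof (rule lint_cong)
   fix w :: "real^2"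
   have g: "((pi * U)^2 * Y + (\<epsilon> * (pi * V))^2 * X - 2 * (pi * U) * (\<epsilon> * (pi * V)) * W) * k
    = (pi * U)^2 * Y * k + \<epsilon>\<^sup>2 * ((pi * V)^2 * X * k) + (- 2 * \<epsilon> * pi^2) * (U * V * W * k)" for U V X Y W k
    by (simp add: algebra_simps power2_eq_square)
   show "((pi * cos (pi * w$1))^2 * (Y0 + Y1 * w$1 + Y2 * (w$1)^2) + (\<epsilon> * (pi * cos (pi * w$2)))^2 * (X0 + X1 * w$2 + Y2 * (w$2)^2)
     - 2 * (pi * cos (pi * w$1)) * (\<epsilon> * (pi * cos (pi * w$2))) * (W0 + X1 / 2 * w$1 + Y1 / 2 * w$2 + Y2 * w$1 * w$2)) * ww w
    = (pi * cos (pi * w$1))^2 * (Y0 + Y1 * w$1 + Y2 * (w$1)^2) * ww w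
    + \<epsilon>\<^sup>2 * ((pi * cos (pi * w$2))^2 * (X0 + X1 * w$2 + Y2 * (w$2)^2) * ww w)
    + (- 2 * \<epsilon> * pi^2) * (cos (pi * w$1) * cos (pi * w$2) * (W0 + X1 / 2 * w$1 + Y1 / 2 * w$2 + Y2 * w$1 * w$2) * ww w)"
    by (rule g)
  qed
  also have "\<dots> = D1 0 + \<epsilon>\<^sup>2 * D2 0 + (- 2 * \<epsilon> * pi^2) * C"
   unfolding C_def d1[symmetric] d2[symmetric]
   by (simp only: lint_add lint_integrable_add integrable_mult_right integral_mult_right_zero ij)
  finally have key: "pi^2 * ((1 - r2) * (1 - ((2 * c - 2 * \<epsilon> * b) * (2 / pi^2))\<^sup>2)) <= D1 0 + D2 0 - 2 * \<epsilon> * (pi^2 * C)"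
   by (simp add: e2 mult_ac)
  have m: "(2 * c - 2 * \<epsilon> * b)^2 <= 8 * q"
  proof -
   have "(2 * c - 2 * \<epsilon> * b)^2 + (2 * c + 2 * \<epsilon> * b)^2 = 8 * c^2 + 8 * \<epsilon>\<^sup>2 * b^2" by (simp add: algebra_simps power2_eq_square)
   moreover have "x <= z" if "x + y = z" "0 <= y" for x y z :: real using that by linarith
   ultimately have "(2 * c - 2 * \<epsilon> * b)^2 <= 8 * c^2 + 8 * \<epsilon>\<^sup>2 * b^2" using zero_le_power2 by blast
   also have "\<dots> = 8 * q" by (simp add: e2 q_def)
   finally show ?thesis .
  qed
  have key2: "pi^2 * ((1 - r2) * 1) - 41/100 * (8 * q) <= pi\<^sup>2 / 2 * Y0 + pi^2 / 2 * X0 + 78/10 * q - 2 * \<epsilon> * (pi^2 * C)"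
   using mean_loss[OF m, of 1] key D1_0 D2_0 by linarith
  define k where "k = 1 - 8 / pi^2"
  have k: "0 <= k" "k <= 19/100" using pi_sq_bounds by (simp_all add: k_def field_simps)
  have pC: "pi^2 * C = W0 * (4 + 5/4 * ((2 * c)^2 + (- 2 * b)^2) * k) - (X1 / 2 * (2 * c) + Y1 / 2 * (- 2 * b)) * k + 5/8 * Y2 * (2 * c) * (- 2 * b) * k^2"
   unfolding C_def k_def by (rule integral_cross)
  have "X1 / 2 * (2 * c) + Y1 / 2 * (- 2 * b) = - 8 * ((1 + r2) * (b * c)) - 8 * (p$4 * q)"
   unfolding X1_bc Y1_bc q_def by (simp add: algebra_simps power2_eq_square add_divide_distrib diff_divide_distrib)
  moreover have "\<bar>(1 + r2) * (b * c)\<bar> <= 65/64 * (q / 2)" by (rule mult_le[OF _ abs_bc]) (use r2_bounds in simp)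
  moreover have "\<bar>p$4 * q\<bar> <= 1/8 * q" by (rule mult_le[OF p_le]) (use q_nonneg in simp)
  ultimately have w1: "\<bar>X1 / 2 * (2 * c) + Y1 / 2 * (- 2 * b)\<bar> <= 51/10 * q" using q_nonneg by linarith
  have w2: "\<bar>(X1 / 2 * (2 * c) + Y1 / 2 * (- 2 * b)) * k\<bar> <= 51/10 * q * (19/100)" by (rule mult_le[OF w1]) (use k in simp)
  have "\<bar>(Y2 * k^2) * (b * c)\<bar> <= 1 * (q / 2)"
  proof (rule mult_le[OF _ abs_bc])
   have "Y2 * k^2 <= 1 * 1" using Y2_le q_le k by (intro mult_mono power_le_one) auto
   then show "\<bar>Y2 * k^2\<bar> <= 1" using Y2_le(1) by simp
  qed
  then have w3: "\<bar>5/8 * Y2 * (2 * c) * (- 2 * b) * k^2\<bar> <= 5/4 * q" by (simp add: mult_ac abs_mult)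
  have w0: "\<epsilon> * (W0 * (4 + 5/4 * ((2 * c)^2 + (- 2 * b)^2) * k)) \<ge> 8 * \<bar>p$4\<bar>"
  proof -
   have "\<epsilon> * (W0 * (4 + 5/4 * ((2 * c)^2 + (- 2 * b)^2) * k)) = 2 * \<bar>p$4\<bar> * (4 + 5/4 * ((2 * c)^2 + (- 2 * b)^2) * k)"
    using ed by (simp add: W0_def mult.assoc[symmetric] mult.commute[of \<epsilon>]) 
   also have "\<dots> \<ge> 2 * \<bar>p$4\<bar> * 4" using k by (intro mult_left_mono) auto
   finally show ?thesis by simp
  qed
  have w4: "\<bar>\<epsilon> * (- ((X1 / 2 * (2 * c) + Y1 / 2 * (- 2 * b)) * k) + 5/8 * Y2 * (2 * c) * (- 2 * b) * k^2)\<bar> <= 1 * (51/10 * q * (19/100) + 5/4 * q)"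
   by (rule mult_le) (use ea w2 w3 in linarith)+
  have "\<epsilon> * (pi^2 * C) = \<epsilon> * (W0 * (4 + 5/4 * ((2 * c)^2 + (- 2 * b)^2) * k)) + \<epsilon> * (- ((X1 / 2 * (2 * c) + Y1 / 2 * (- 2 * b)) * k) + 5/8 * Y2 * (2 * c) * (- 2 * b) * k^2)"
   unfolding pC by (simp add: distrib_left right_diff_distrib)
  moreover have "x \<ge> 8 * \<bar>p$4\<bar> - 23/10 * q" if "x = y + z" "8 * \<bar>p$4\<bar> <= y" "\<bar>z\<bar> <= 1 * (51/10 * q * (19/100) + 5/4 * q)" for x y z
  proof -
   have "1 * (51/10 * q * (19/100) + 5/4 * q) = 2219/1000 * q" by simp
   then show ?thesis using that q_nonneg by linarith
  qed
  ultimately have "\<epsilon> * (pi^2 * C) \<ge> 8 * \<bar>p$4\<bar> - 23/10 * q" using w0 w4 by blast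
  moreover have "pi^2 / 2 * Y0 + pi^2 / 2 * X0 = pi^2 + pi^2 * r2" by (simp add: Y0_def X0_def field_simps)
  moreover have "pi^2 * ((1 - r2) * 1) = pi^2 - pi\<^sup>2 * r2" by (simp add: algebra_simps)
  ultimately show False using key2 Pr qr d7 rp by linarith
 qed
qed

text \<open>If r2 = 0 and q = 0, then p = 0 by \<open>p_bc\<close>; for p nonzero one of the two
  cases therefore applies.\<close>

lemma area_mu1_less:
 assumes "p \<noteq> 0"
 shows "area p * mu1 (interior (quad p)) < pi\<^sup>2"
proof -
 have "A * mu1 \<Omega> < pi\<^sup>2"
 proof (cases "9 * r2 <= q \<and> 0 < q")
  case True
  then show ?thesis by (intro case_A) auto
 next
  case False
  have "0 < r2"
  proof (rule ccontr)
   assume "\<not> 0 < r2"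
   then have z: "r2 = 0" using r2_bounds by simp
   then have q: "q = 0" using False q_nonneg by auto
   have "p$1 = 0" "p$4 = 0" "b = 0" "c = 0" using z q by (simp_all add: r2_def q_def sum_power2_eq_zero_iff)
   then have "\<forall>i. p$i = 0" using p_bc by (simp add: forall_4)
   then show False using assms by (simp add: vec_eq_iff)
  qed
  then show ?thesis using False by (intro case_B) auto
 qed
 then show ?thesis by (simp add: area_eq interior_quad)
qed

end

theorem square_maximizes:
 assumes "p \<noteq> 0" "norm p <= 1/8"
 shows "area p * mu1 (interior (quad p)) < area 0 * mu1 (interior (quad 0))"
proof -
 interpret z: quad_map 0 by unfold_locales simp
 interpret quad_map p by unfold_locales fact
 have "area 0 = 1" unfolding z.area_eq by (simp add: z.A_def)
 moreover have "mu1 (interior (quad 0)) \<ge> pi\<^sup>2" unfolding quad_0 interior_square by (rule mu1_square_ge)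
 ultimately show ?thesis using area_mu1_less[OF assms(1)] by simp
qed

lemma rho_sharp_bounds: "\<bar>rho_sharp - 1245/10000\<bar> < 5/100000" 
proof -
 have b: "3.14159265 <= pi" "pi <= 3.14159266" using pi_approx by simp_all
 have "3.14159265 ^ 6 <= pi ^ 6" "pi ^ 6 <= 3.14159266 ^ 6" using b by (intro power_mono; simp)+
 moreover have "(961.389::real) <= 3.14159265 ^ 6" "3.14159266 ^ 6 <= (961.3893::real)" by (simp_all add: eval_nat_numeral)
 ultimately have p: "961.389 <= pi ^ 6" "pi ^ 6 <= 961.3893" by linarith+
 have "rho_sharp <= 3232 / (27 * 961.389)" "3232 / (27 * 961.3893) <= rho_sharp"
  unfolding rho_sharp_def using p by (intro divide_left_mono; simp)+
 then show ?thesis by (simp add: abs_less_iff)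
qed

section \<open>Derivatives of the Galerkin matrices\<close>

lemma integral_square_eq:
 fixes F :: "real^2 => real"
 assumes "contU F"
 shows "integral square F = (LINT w|Mosq. F w)"
proof -
 have "integrable (lebesgue_on square) F"
 proof -
  have "integrable lborel (%x. indicator square x *\<^sub>R F x)"
   using assms by (intro borel_integrable_compact) (auto simp: square_def intro: continuous_on_subset)
  then have "integrable lebesgue (%x. indicator square x *\<^sub>R F x)" by (subst integrable_completion) (auto intro: borel_measurable_integrable)
  then show ?thesis by (subst integrable_restrict_space) (auto simp: square_def)
 qed
 moreover have "square \<in> sets lebesgue" by (simp add: square_def)
 ultimately show ?thesis unfolding integral_osq[OF assms] by (rule lebesgue_integral_eq_integral[symmetric])
qed

lemma continuous_slice:
 assumes "contU (%(p, w). f p w)"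
 shows "contU (f p)"
proof -
 have "contU (%w. (p, w))" by (rule continuous_on_Pair[OF continuous_on_const continuous_on_id])
 from continuous_on_compose2[OF assms this] show ?thesis by simp
qed

text \<open>Differentiation under the integral sign; the partial derivatives are packed into bounded
  linear functionals, as \<open>leibniz_rule\<close> expects.\<close>

lemma leibniz_square:
 fixes h :: "real^4 => real^2 => real"
 assumes d: "!!p w. ((%p. h p w) has_derivative (%x. \<Sum>q\<in>UNIV. h' q p w * x$q)) (at p)"
  and c: "!!p. contU (h p)"
  and c': "!!q. contU (%(p, w). h' q p w)"
 shows "((%p. LINT w|Mosq. h p w) has_derivative (%x. \<Sum>q\<in>UNIV. (LINT w|Mosq. h' q p w) * x$q)) (at p)"
proof -
 define B :: "4 => (real^4) \<Rightarrow>\<^sub>L real" where "B = (%q. Blinfun (%x. x$q))"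
 have B: "blinfun_apply (B q) x = x$q" for q x
  unfolding B_def by (subst bounded_linear_Blinfun_apply) (auto intro: bounded_linear_vec_nth)
 define fx where "fx = (%p w. \<Sum>q\<in>UNIV. h' q p w *\<^sub>R B q)"
 have fxa: "blinfun_apply (fx p w) = (%x. \<Sum>q\<in>UNIV. h' q p w * x$q)" for p w
  by (rule ext) (simp add: fx_def blinfun.sum_left blinfun.scaleR_left B)
 have ch: "contU (h' q p)" for q p
  by (rule continuous_slice[OF c'])
 have cfx: "contU (%(p, w). fx p w)"
  unfolding fx_def split_def using c' by (intro continuous_intros) (simp add: split_def)
 have int: "fx p integrable_on square"
  unfolding square_def by (intro integrable_continuous continuous_on_subset[OF continuous_slice[OF cfx]]) simp
 have "((%p. integral square (h p)) has_derivative integral square (fx p)) (at p within UNIV)"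
  unfolding square_def
 proof (rule leibniz_rule)
  fix x :: "real^4" and t :: "real^2"
  show "((%x. h x t) has_derivative blinfun_apply (fx x t)) (at x within UNIV)" unfolding fxa using d by simp
  show "h x integrable_on cbox (vector [- 1 / 2, - 1 / 2]) (vector [1 / 2, 1 / 2])"
   by (intro integrable_continuous continuous_on_subset[OF c]) simp
 qed (auto intro: continuous_on_subset[OF cfx])
 moreover have "blinfun_apply (integral square (fx p)) x = (\<Sum>q\<in>UNIV. (LINT w|Mosq. h' q p w) * x$q)" for x
 proof -
  have "blinfun_apply (integral square (fx p)) x = integral square (%w. \<Sum>q\<in>UNIV. h' q p w * x$q)"
   by (subst blinfun_apply_integral[OF int]) (simp add: fxa)
  also have "\<dots> = (LINT w|Mosq. (\<Sum>q\<in>UNIV. h' q p w * x$q))"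
   by (rule integral_square_eq) (intro continuous_intros ch)
  also have "\<dots> = (\<Sum>q\<in>UNIV. LINT w|Mosq. h' q p w * x$q)"
   by (rule Bochner_Integration.integral_sum) (intro integrable_osq continuous_intros ch)
  finally show ?thesis by simp
 qed
 then have "blinfun_apply (integral square (fx p)) = (%x. \<Sum>q\<in>UNIV. (LINT w|Mosq. h' q p w) * x$q)" by (rule ext)
 ultimately show ?thesis by (simp only: integral_square_eq[OF c])
qed

section \<open>Partial derivatives in p of the integrands\<close>

definition Phi1 :: "4 => real^2 => real" where
 "Phi1 q w = (vector [- w$1, - 2 * w$1 * w$2, 0, - w$2] :: real^4) $ q"
definition Phi2 :: "4 => real^2 => real" where
 "Phi2 q w = (vector [w$2, 0, 2 * w$1 * w$2, - w$1] :: real^4) $ q"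
text \<open>The Jacobian as a polynomial in all p, so that it can be differentiated outside the
  locale; it equals \<open>Jac p\<close> for \<open>norm p <= 1/8\<close>.\<close>

definition JJ :: "real^4 => real^2 => real" where
 "JJ p w = 1 - (p$1)\<^sup>2 - (p$4)\<^sup>2 + (2 * p$3 * (1 - p$1) - 2 * p$2 * p$4) * w$1 + (- 2 * p$2 * (1 + p$1) + 2 * p$3 * p$4) * w$2"
definition JJ1 :: "4 => real^4 => real^2 => real" where
 "JJ1 q p w = (vector [- 2 * p$1 - 2 * p$3 * w$1 - 2 * p$2 * w$2, - 2 * p$4 * w$1 - 2 * (1 + p$1) * w$2,
   2 * (1 - p$1) * w$1 + 2 * p$4 * w$2, - 2 * p$4 - 2 * p$2 * w$1 + 2 * p$3 * w$2] :: real^4) $ q"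
definition JJ2 :: "4 => 4 => real^2 => real" where
 "JJ2 q r w = (vector [vector [- 2, - 2 * w$2, - 2 * w$1, 0], vector [- 2 * w$2, 0, 0, - 2 * w$1],
   vector [- 2 * w$1, 0, 0, 2 * w$2], vector [0, - 2 * w$1, 2 * w$2, - 2]] :: real^4^4) $ q $ r"

lemma JJ_eq: "norm p <= 1/8 ==> Jac p w = JJ p w"
proof -
 assume "norm p <= 1/8"
 then interpret quad_map p by unfold_locales
 show ?thesis unfolding Jac_eq by (simp add: J_def JJ_def A_def j1_def j2_def)
qed

lemma area_eq': "norm p <= 1/8 ==> area p = 1 - (p$1)\<^sup>2 - (p$4)\<^sup>2"
proof -
 assume "norm p <= 1/8"
 then interpret quad_map p by unfold_locales
 show ?thesis by (simp add: area_eq A_def)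
qed

lemma Phi_1: "Phi p w $ 1 = w$1 + (\<Sum>q\<in>UNIV. Phi1 q w * p$q)" and Phi_2: "Phi p w $ 2 = w$2 + (\<Sum>q\<in>UNIV. Phi2 q w * p$q)"
 by (simp_all add: Phi_def Let_def sum_4 Phi1_def Phi2_def)

abbreviation "csk k t \<equiv> cos (k * pi * (t + 1/2))"
abbreviation "snk k t \<equiv> - (k * pi * sin (k * pi * (t + 1/2)))"

text \<open>The indices are real because products of trial functions lead to sums and differences of
  indices.\<close>

definition psi :: "real => real => real^2 => real" where "psi k l x = csk k (x$1) * csk l (x$2)"
definition psi1 :: "real => real => real^2 => real" where "psi1 k l x = snk k (x$1) * csk l (x$2)"
definition psi2 :: "real => real => real^2 => real" where "psi2 k l x = csk k (x$1) * snk l (x$2)"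
definition psi12 :: "real => real => real^2 => real" where "psi12 k l x = snk k (x$1) * snk l (x$2)"

lemma csk_deriv: "((%p. csk k (f p)) has_derivative (%x. snk k (f p) * f' x)) (at p)"
 if "(f has_derivative f') (at p)" for f :: "'a::real_normed_vector => real"
 by (auto intro!: derivative_eq_intros that simp: algebra_simps)

lemma snk_deriv: "((%p. snk k (f p)) has_derivative (%x. (- (k * pi)\<^sup>2 * csk k (f p)) * f' x)) (at p)"
 if "(f has_derivative f') (at p)" for f :: "'a::real_normed_vector => real"
 by (auto intro!: derivative_eq_intros that simp: algebra_simps power2_eq_square)

text \<open>The derivative is given by its four partial derivatives as a function of the index, so
  that the calculus rules compute them explicitly.\<close>

definition grad4 :: "(real^4 => real) => (4 => real) => real^4 => bool" where
 "grad4 f f' p \<longleftrightarrow> (f has_derivative (%x. \<Sum>q\<in>UNIV. f' q * x$q)) (at p)"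

lemma grad4_add: "grad4 f f' p ==> grad4 g g' p ==> grad4 (%p. f p + g p) (%q. f' q + g' q) p"
 unfolding grad4_def by (drule (1) has_derivative_add) (simp add: sum.distrib distrib_right)

lemma grad4_mult: "grad4 f f' p ==> grad4 g g' p ==> grad4 (%p. f p * g p) (%q. f p * g' q + f' q * g p) p"
 unfolding grad4_def by (drule (1) has_derivative_mult) (simp add: sum.distrib distrib_left sum_distrib_left sum_distrib_right mult_ac)

lemma grad4_const: "grad4 (%p. k) (%q. 0) p"
 unfolding grad4_def by simp

lemma grad4_cmult: "grad4 f f' p ==> grad4 (%p. k * f p) (%q. k * f' q) p"
 using grad4_mult[OF grad4_const] by fastforce

lemma grad4_diff: "grad4 f f' p ==> grad4 g g' p ==> grad4 (%p. f p - g p) (%q. f' q - g' q) p"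
 unfolding grad4_def by (drule (1) has_derivative_diff) (simp add: sum_subtractf left_diff_distrib)

lemma grad4_inverse:
 assumes "grad4 f f' p" "f p \<noteq> 0"
 shows "grad4 (%p. inverse (f p)) (%q. - f' q / (f p)^2) p"
proof -
 have "(%x::real^4. - (inverse (f p) * (\<Sum>q\<in>UNIV. f' q * x$q) * inverse (f p))) = (%x. \<Sum>q\<in>UNIV. (- f' q / (f p)^2) * x$q)"
  by (rule ext) (simp add: sum_distrib_left sum_distrib_right sum_negf[symmetric] power2_eq_square divide_inverse mult_ac)
 then show ?thesis using Deriv.has_derivative_inverse[OF assms(2) assms(1)[unfolded grad4_def]] unfolding grad4_def by (simp only:)
qed

lemma grad4_csk: "grad4 f f' p ==> grad4 (%p. csk k (f p)) (%q. snk k (f p) * f' q) p"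
 unfolding grad4_def by (drule csk_deriv) (simp add: sum_distrib_left mult.assoc)

lemma grad4_snk: "grad4 f f' p ==> grad4 (%p. snk k (f p)) (%q. (- (k * pi)\<^sup>2 * csk k (f p)) * f' q) p"
 unfolding grad4_def by (drule snk_deriv[where k=k]) (simp add: sum_distrib_left mult.assoc)

lemma grad4_cong: "grad4 f f' p ==> (!!q. f' q = g' q) ==> grad4 f g' p"
 unfolding grad4_def by simp

lemma grad4_Phi: "grad4 (%p. Phi p w $ 1) (%q. Phi1 q w) p" "grad4 (%p. Phi p w $ 2) (%q. Phi2 q w) p"
 unfolding grad4_def Phi_1 Phi_2 by (auto intro!: derivative_eq_intros)

lemma all_4: "P 1 ==> P 2 ==> P 3 ==> P 4 ==> P (q::4)"
 using exhaust_4[of q] by auto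

lemma grad4_coord: "grad4 (%p. p$i) (%q. of_bool (q = i)) p"
proof -
 have "(%x::real^4. \<Sum>q\<in>UNIV. of_bool (q = i) * x$q) = (%x. x$i)"
 proof
  fix x :: "real^4"
  have "of_bool (q = i) * x$q = (if q = i then x$q else 0)" for q by simp
  then show "(\<Sum>q\<in>UNIV. of_bool (q = i) * x$q) = x$i" by (simp only:) simp
 qed
 then show ?thesis unfolding grad4_def by (simp add: bounded_linear_imp_has_derivative bounded_linear_vec_nth)
qed

lemma grad4_JJ: "grad4 (%p. JJ p w) (%q. JJ1 q p w) p" "grad4 (%p. JJ1 q p w) (%r. JJ2 q r w) p"
proof -
 note intros = grad4_add grad4_diff grad4_mult grad4_const grad4_coord
 have "JJ p w = 1 - p$1 * p$1 - p$4 * p$4 + (2 * p$3 * (1 - p$1) - 2 * p$2 * p$4) * w$1 + (- 2 * p$2 * (1 + p$1) + 2 * p$3 * p$4) * w$2" for p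
  by (simp add: JJ_def power2_eq_square)
 then have e: "(%p. JJ p w) = (%p. 1 - p$1 * p$1 - p$4 * p$4 + (2 * p$3 * (1 - p$1) - 2 * p$2 * p$4) * w$1 + (- 2 * p$2 * (1 + p$1) + 2 * p$3 * p$4) * w$2)"
  by (rule ext)
 show "grad4 (%p. JJ p w) (%q. JJ1 q p w) p" unfolding e
  by (rule grad4_cong, (rule intros)+) (rule all_4, simp_all add: JJ1_def algebra_simps)
 have "grad4 (%p. JJ1 1 p w) (%r. JJ2 1 r w) p"
  unfolding JJ1_def vector4_nth by (rule grad4_cong, (rule intros)+) (rule all_4, simp_all add: JJ2_def)
 moreover have "grad4 (%p. JJ1 2 p w) (%r. JJ2 2 r w) p"
  unfolding JJ1_def vector4_nth by (rule grad4_cong, (rule intros)+) (rule all_4, simp_all add: JJ2_def)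
 moreover have "grad4 (%p. JJ1 3 p w) (%r. JJ2 3 r w) p"
  unfolding JJ1_def vector4_nth by (rule grad4_cong, (rule intros)+) (rule all_4, simp_all add: JJ2_def)
 moreover have "grad4 (%p. JJ1 4 p w) (%r. JJ2 4 r w) p"
  unfolding JJ1_def vector4_nth by (rule grad4_cong, (rule intros)+) (rule all_4, simp_all add: JJ2_def)
 ultimately show "grad4 (%p. JJ1 q p w) (%r. JJ2 q r w) p" using exhaust_4[of q] by auto
qed

definition hh :: "real => real => real^4 => real^2 => real" where
 "hh k l p w = psi k l (Phi p w) * JJ p w"

definition hh1 :: "real => real => 4 => real^4 => real^2 => real" where
 "hh1 k l q p w = (psi1 k l (Phi p w) * Phi1 q w + psi2 k l (Phi p w) * Phi2 q w) * JJ p w + psi k l (Phi p w) * JJ1 q p w"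

definition hh2 :: "real => real => 4 => 4 => real^4 => real^2 => real" where
 "hh2 k l q r p w = (- (k * pi)\<^sup>2 * psi k l (Phi p w) * Phi1 q w * Phi1 r w + psi12 k l (Phi p w) * (Phi1 q w * Phi2 r w + Phi2 q w * Phi1 r w)
   - (l * pi)\<^sup>2 * psi k l (Phi p w) * Phi2 q w * Phi2 r w) * JJ p w
  + (psi1 k l (Phi p w) * Phi1 q w + psi2 k l (Phi p w) * Phi2 q w) * JJ1 r p w
  + (psi1 k l (Phi p w) * Phi1 r w + psi2 k l (Phi p w) * Phi2 r w) * JJ1 q p w + psi k l (Phi p w) * JJ2 q r w"

lemma grad4_hh: "grad4 (%p. hh k l p w) (%q. hh1 k l q p w) p"
 unfolding hh_def psi_def
 by (rule grad4_cong[OF grad4_mult[OF grad4_mult[OF grad4_csk[OF grad4_Phi(1)] grad4_csk[OF grad4_Phi(2)]] grad4_JJ(1)]])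
   (simp add: hh1_def psi_def psi1_def psi2_def algebra_simps)

lemma grad4_cmult_right: "grad4 f f' p ==> grad4 (%p. f p * k) (%q. f' q * k) p"
 using grad4_cmult[of f f' p k] by (simp add: mult.commute)

lemma grad4_hh1: "grad4 (%p. hh1 k l q p w) (%r. hh2 k l q r p w) p"
 unfolding hh1_def psi_def psi1_def psi2_def
 by (rule grad4_cong[OF grad4_add[OF grad4_mult[OF grad4_add[
   OF grad4_cmult_right[OF grad4_mult[OF grad4_snk[OF grad4_Phi(1)] grad4_csk[OF grad4_Phi(2)]]]
     grad4_cmult_right[OF grad4_mult[OF grad4_csk[OF grad4_Phi(1)] grad4_snk[OF grad4_Phi(2)]]]] grad4_JJ(1)]
   grad4_mult[OF grad4_mult[OF grad4_csk[OF grad4_Phi(1)] grad4_csk[OF grad4_Phi(2)]] grad4_JJ(2)]]])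
   (simp add: hh2_def psi_def psi1_def psi2_def psi12_def algebra_simps)

lemma continuous_vec4:
 fixes g1 :: "'a::topological_space => real"
 assumes "continuous_on S g1" "continuous_on S g2" "continuous_on S g3" "continuous_on S g4"
 shows "continuous_on S (%z. (vector [g1 z, g2 z, g3 z, g4 z] :: real^4) $ q)"
 using exhaust_4[of q] assms by auto

lemma continuous_hh: "contU (%(p, w). hh k l p w)" "contU (%(p, w). hh1 k l q p w)"
 "contU (%(p, w). hh2 k l q r p w)"
proof -
 have q: "contU (%z::(real^4) \<times> (real^2). Phi1 q (snd z))" "contU (%z::(real^4) \<times> (real^2). Phi2 q (snd z))"
   "contU (%z. JJ1 q (fst z) (snd z))" for q
  unfolding Phi1_def Phi2_def JJ1_def by (intro continuous_vec4 continuous_intros)+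
 have J: "contU (%z. JJ (fst z) (snd z))" unfolding JJ_def by (intro continuous_intros)
 have J2: "contU (%z::(real^4) \<times> (real^2). JJ2 q r (snd z))"
 proof -
  have "JJ2 q r = (%w. (vector [(vector [- 2, - 2 * w$2, - 2 * w$1, 0]::real^4) $ r, (vector [- 2 * w$2, 0, 0, - 2 * w$1]::real^4) $ r,
    (vector [- 2 * w$1, 0, 0, 2 * w$2]::real^4) $ r, (vector [0, - 2 * w$1, 2 * w$2, - 2]::real^4) $ r] :: real^4) $ q)"
   using exhaust_4[of q] unfolding JJ2_def by auto
  then show ?thesis by (simp only:) (intro continuous_vec4 continuous_intros)
 qed
 have P: "contU (%z::(real^4) \<times> (real^2). Phi (fst z) (snd z) $ 1)" "contU (%z::(real^4) \<times> (real^2). Phi (fst z) (snd z) $ 2)"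
  unfolding Phi_1 Phi_2 by (intro continuous_intros q)+
 have cs: "contU (%z. csk k (a z))" "contU (%z. snk k (a z))"
  if "contU a" for k and a :: "(real^4) \<times> (real^2) => real"
  using that by (intro continuous_intros; assumption)+
 have psi: "contU (%z. psi k l (Phi (fst z) (snd z)))" "contU (%z. psi1 k l (Phi (fst z) (snd z)))"
  "contU (%z. psi2 k l (Phi (fst z) (snd z)))" "contU (%z. psi12 k l (Phi (fst z) (snd z)))"
  unfolding psi_def psi1_def psi2_def psi12_def by (intro continuous_on_mult cs P)+
 note ops = continuous_on_mult continuous_on_add continuous_on_diff continuous_on_const psi J J2 q
 show "contU (%(p, w). hh k l p w)" "contU (%(p, w). hh1 k l q p w)" "contU (%(p, w). hh2 k l q r p w)"
  unfolding hh_def hh1_def hh2_def split_def by (intro ops)+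
qed

text \<open>The entries of both Galerkin matrices are built from these integrals and the area, so
  only this one family has to be differentiated under the integral.\<close>

definition CC :: "real => real => real^4 => real" where "CC k l p = (LINT w|Mosq. hh k l p w)"
definition CC1 :: "real => real => 4 => real^4 => real" where "CC1 k l q p = (LINT w|Mosq. hh1 k l q p w)"
definition CC2 :: "real => real => 4 => 4 => real^4 => real" where "CC2 k l q r p = (LINT w|Mosq. hh2 k l q r p w)"

lemma grad4_CC: "grad4 (CC k l) (%q. CC1 k l q p) p"
 unfolding grad4_def CC_def[abs_def] CC1_def
 by (rule leibniz_square) (use grad4_hh in \<open>simp_all add: grad4_def continuous_hh continuous_slice[OF continuous_hh(1)]\<close>)

lemma grad4_CC1: "grad4 (CC1 k l q) (%r. CC2 k l q r p) p"
 unfolding grad4_def CC1_def[abs_def] CC2_def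
 by (rule leibniz_square) (use grad4_hh1 in \<open>simp_all add: grad4_def continuous_hh continuous_slice[OF continuous_hh(2)]\<close>)

text \<open>One-dimensional moments into which the integrals \<open>CC\<close> and
  \<open>CC1\<close> factor at p = 0.\<close>

definition i0 :: "real => real" where "i0 k = I1 (%u. csk k u)"
definition i1 :: "real => real" where "i1 k = I1 (%u. u * csk k u)"
definition i2 :: "real => real" where "i2 k = I1 (%u. snk k u)"
definition i3 :: "real => real" where "i3 k = I1 (%u. u * snk k u)"

lemma moments_neg: "i0 (- k) = i0 k" "i1 (- k) = i1 k" "i2 (- k) = i2 k" "i3 (- k) = i3 k"
 unfolding i0_def i1_def i2_def i3_def by simp_all

lemma moments_0: "i0 0 = 1" "i1 0 = 0" "i2 0 = 0" "i3 0 = 0"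
 unfolding i0_def i1_def i2_def i3_def by (simp_all add: I1_power)

lemma I1_FTC': "(!!t. (F has_real_derivative f t) (at t)) ==> F (1/2) - F (-1/2) = v ==> I1 f = v"
 by (rule trans[OF I1_FTC])

lemma moments_nat:
 assumes n: "n > 0"
 shows "i0 (real n) = 0" "i1 (real n) = ((-1)^n - 1) / (real n * pi)^2" "i2 (real n) = (-1)^n - 1" "i3 (real n) = ((-1)^n + 1) / 2"
proof -
 define k where "k = real n * pi"
 have k0: "k \<noteq> 0" using n by (simp add: k_def)
 have b: "k * (1/2 + 1/2) = real n * pi" "k * (-1/2 + 1/2) = 0" by (simp_all add: k_def)
 note s = cos_npi sin_npi
 have S: "((%u. sin (k * (u + 1/2)) / k) has_real_derivative cos (k * (t + 1/2))) (at t)"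
  and C: "((%u. cos (k * (u + 1/2))) has_real_derivative - (k * sin (k * (t + 1/2)))) (at t)" for t
  using k0 by (auto intro!: derivative_eq_intros simp: field_simps)
 have C': "((%u. cos (k * (u + 1/2)) / k^2) has_real_derivative - (sin (k * (t + 1/2)) / k)) (at t)" for t
  using DERIV_cdivide[OF C[of t], of "k^2"] k0 by (simp add: power2_eq_square)
 show "i0 (real n) = 0" unfolding i0_def k_def[symmetric]
  by (rule I1_FTC'[OF S]) (simp only: b s sin_zero; simp)
 have "((%u. u * (sin (k * (u + 1/2)) / k) + cos (k * (u + 1/2)) / k^2) has_real_derivative t * cos (k * (t + 1/2))) (at t)" for t
  by (rule DERIV_cong[OF DERIV_add[OF DERIV_mult[OF DERIV_ident S] C']]) simp
 from I1_FTC'[OF this, of "((-1)^n - 1) / k^2"] show "i1 (real n) = ((-1)^n - 1) / (real n * pi)^2" unfolding i1_def k_def[symmetric]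
  by (simp only: b s sin_zero cos_zero; simp add: diff_divide_distrib)
 from I1_FTC'[OF C, of "(-1)^n - 1"] show "i2 (real n) = (-1)^n - 1" unfolding i2_def k_def[symmetric]
  by (simp only: b s cos_zero; simp)
 have "((%u. u * cos (k * (u + 1/2)) - sin (k * (u + 1/2)) / k) has_real_derivative t * - (k * sin (k * (t + 1/2)))) (at t)" for t
  by (rule DERIV_cong[OF DERIV_diff[OF DERIV_mult[OF DERIV_ident C] S]]) simp
 from I1_FTC'[OF this, of "((-1)^n + 1) / 2"] show "i3 (real n) = ((-1)^n + 1) / 2" unfolding i3_def k_def[symmetric]
  by (simp only: b s sin_zero cos_zero; simp add: field_simps)
qed

lemma moments_num: "i0 1 = 0" "i0 2 = 0" "i0 3 = 0" "i0 4 = 0"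
 "i1 1 = - 2 / pi^2" "i1 2 = 0" "i1 3 = - 2 / (9 * pi^2)" "i1 4 = 0"
 "i2 1 = - 2" "i2 2 = 0" "i2 3 = - 2" "i2 4 = 0" "i3 1 = 0" "i3 2 = 1" "i3 3 = 0" "i3 4 = 1"
 using moments_nat[of 1] moments_nat[of 2] moments_nat[of 3] moments_nat[of 4] by (simp_all add: power_mult_distrib)

lemmas moments = moments_0 moments_num moments_neg

lemma ij12': "(1::2) \<noteq> 2" "(2::2) \<noteq> 1" by simp_all

lemma Phi_0: "Phi 0 w = w" by (simp add: vec_eq_iff forall_2 Phi_def Let_def)
lemma JJ_0: "JJ 0 w = 1" by (simp add: JJ_def)

lemma integral_osq_2:
 assumes "contU f1" "contU g1" "contU h1" "contU h2"
 shows "(LINT w|Mosq. s * (f1 (w$1) * g1 (w$2)) + t * (h1 (w$1) * h2 (w$2))) = s * (I1 f1 * I1 g1) + t * (I1 h1 * I1 h2)"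
 by (simp only: lint_add lint_integrable_add integrable_mult_right integral_mult_right_zero
     integrable_osq continuous_two assms integral_osq_product)

lemma CC_0: "CC k l 0 = i0 k * i0 l"
 unfolding CC_def hh_def Phi_0 JJ_0 psi_def i0_def mult_1_right
 by (rule integral_osq_product) (intro continuous_intros)+

lemma CC1_0: "CC1 k l 1 0 = - i3 k * i0 l + i0 k * i3 l" "CC1 k l 2 0 = - 2 * (i3 k + i0 k) * i1 l"
 "CC1 k l 3 0 = 2 * i1 k * (i3 l + i0 l)" "CC1 k l 4 0 = - (i2 k * i1 l) - i1 k * i2 l"
proof -
 have c: "contU (%u. csk k u)" "contU (%u. snk k u)" "contU (%u. u * csk k u)" "contU (%u. u * snk k u)" for k
  by (intro continuous_intros)+
 note d = CC1_def hh1_def Phi_0 JJ_0 psi_def psi1_def psi2_def Phi1_def Phi2_def JJ1_def vector4_nth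
 have "CC1 k l 1 0 = (LINT w|Mosq. (-1) * ((w$1 * snk k (w$1)) * csk l (w$2)) + 1 * (csk k (w$1) * (w$2 * snk l (w$2))))"
  unfolding d by (rule lint_cong) (simp add: algebra_simps)
 then show "CC1 k l 1 0 = - i3 k * i0 l + i0 k * i3 l" by (simp only: integral_osq_2[OF c(4) c(1) c(1) c(4)] i0_def i1_def i2_def i3_def; simp)
 have "CC1 k l 2 0 = (LINT w|Mosq. (-2) * ((w$1 * snk k (w$1)) * (w$2 * csk l (w$2))) + (-2) * (csk k (w$1) * (w$2 * csk l (w$2))))"
  unfolding d by (rule lint_cong) (simp add: algebra_simps)
 then show "CC1 k l 2 0 = - 2 * (i3 k + i0 k) * i1 l" by (simp only: integral_osq_2[OF c(4) c(3) c(1) c(3)] i0_def i1_def i2_def i3_def; simp add: algebra_simps)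
 have "CC1 k l 3 0 = (LINT w|Mosq. 2 * ((w$1 * csk k (w$1)) * (w$2 * snk l (w$2))) + 2 * ((w$1 * csk k (w$1)) * csk l (w$2)))"
  unfolding d by (rule lint_cong) (simp add: algebra_simps)
 then show "CC1 k l 3 0 = 2 * i1 k * (i3 l + i0 l)" by (simp only: integral_osq_2[OF c(3) c(4) c(3) c(1)] i0_def i1_def i2_def i3_def; simp add: algebra_simps)
 have "CC1 k l 4 0 = (LINT w|Mosq. (-1) * (snk k (w$1) * (w$2 * csk l (w$2))) + (-1) * ((w$1 * csk k (w$1)) * snk l (w$2)))"
  unfolding d by (rule lint_cong) (simp add: algebra_simps)
 then show "CC1 k l 4 0 = - (i2 k * i1 l) - i1 k * i2 l" by (simp only: integral_osq_2[OF c(2) c(3) c(3) c(2)] i0_def i1_def i2_def i3_def; simp)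
qed

lemma I1_cs2_poly:
 "I1 (%u. csk 2 u * (a0 + a1 * u + a2 * u^2) + snk 2 u * (b0 + b1 * u + b2 * u^2)) = a2 / (2 * pi^2) + b1"
proof (rule I1_FTC'[where F="%u. (a0 + a1 * u + a2 * u^2 - b1 - 2 * b2 * u) * (sin (2 * pi * (u + 1/2)) / (2 * pi))
   + (a1 + 2 * a2 * u - 2 * b2) * (cos (2 * pi * (u + 1/2)) / (2 * pi)^2) - 2 * a2 * (sin (2 * pi * (u + 1/2)) / (2 * pi)^3)
   + (b0 + b1 * u + b2 * u^2) * cos (2 * pi * (u + 1/2))"])
 fix t
 define S C where "S = sin (2 * pi * (t + 1/2))" and "C = cos (2 * pi * (t + 1/2))"
 show "((%u. (a0 + a1 * u + a2 * u^2 - b1 - 2 * b2 * u) * (sin (2 * pi * (u + 1/2)) / (2 * pi))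
   + (a1 + 2 * a2 * u - 2 * b2) * (cos (2 * pi * (u + 1/2)) / (2 * pi)^2) - 2 * a2 * (sin (2 * pi * (u + 1/2)) / (2 * pi)^3)
   + (b0 + b1 * u + b2 * u^2) * cos (2 * pi * (u + 1/2)))
   has_real_derivative csk 2 t * (a0 + a1 * t + a2 * t^2) + snk 2 t * (b0 + b1 * t + b2 * t^2)) (at t)"
  by (auto intro!: derivative_eq_intros simp: S_def[symmetric] C_def[symmetric]) (simp add: field_simps eval_nat_numeral)
next
 have b: "2 * pi * (1/2 + 1/2) = 2 * pi" "2 * pi * (-1/2 + 1/2) = 0" by simp_all
 show "(a0 + a1 * (1/2) + a2 * (1/2)^2 - b1 - 2 * b2 * (1/2)) * (sin (2 * pi * (1/2 + 1/2)) / (2 * pi))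
   + (a1 + 2 * a2 * (1/2) - 2 * b2) * (cos (2 * pi * (1/2 + 1/2)) / (2 * pi)^2) - 2 * a2 * (sin (2 * pi * (1/2 + 1/2)) / (2 * pi)^3)
   + (b0 + b1 * (1/2) + b2 * (1/2)^2) * cos (2 * pi * (1/2 + 1/2))
   - ((a0 + a1 * (-1/2) + a2 * (-1/2)^2 - b1 - 2 * b2 * (-1/2)) * (sin (2 * pi * (-1/2 + 1/2)) / (2 * pi))
   + (a1 + 2 * a2 * (-1/2) - 2 * b2) * (cos (2 * pi * (-1/2 + 1/2)) / (2 * pi)^2) - 2 * a2 * (sin (2 * pi * (-1/2 + 1/2)) / (2 * pi)^3)
   + (b0 + b1 * (-1/2) + b2 * (-1/2)^2) * cos (2 * pi * (-1/2 + 1/2)))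
   = a2 / (2 * pi^2) + b1"
  unfolding b by (simp add: field_simps power2_eq_square)
qed

lemma integral_cs2:
 assumes ij: "i \<noteq> (j::2)"
 shows "(LINT w|Mosq. csk 2 (w$i) * ((s1 * w$i + s2 * w$j + s3 * (w$i * w$j)) * (t1 * w$i + t2 * w$j + t3 * (w$i * w$j)) * m + (e0 + e1 * w$i + e2 * w$j))
   + snk 2 (w$i) * ((s1 * w$i + s2 * w$j + s3 * (w$i * w$j)) * (y1 * w$i + y2 * w$j) + (t1 * w$i + t2 * w$j + t3 * (w$i * w$j)) * (x1 * w$i + x2 * w$j)))
  = m * (s1 * t1 + s3 * t3 / 12) / (2 * pi^2) + (s3 * y2 + t3 * x2) / 12"
proof -
 define C0 C1 C2 where "C0 = (%u. csk 2 u * (e0 + e1 * u + s1 * t1 * m * u^2) + snk 2 u * (0 + 0 * u + (s1 * y1 + t1 * x1) * u^2))"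
  and "C1 = (%u. csk 2 u * (e2 + (s1 * t2 + s2 * t1) * m * u + (s1 * t3 + s3 * t1) * m * u^2) + snk 2 u * (0 + (s1 * y2 + s2 * y1 + t1 * x2 + t2 * x1) * u + (s3 * y1 + t3 * x1) * u^2))"
  and "C2 = (%u. csk 2 u * (s2 * t2 * m + (s2 * t3 + s3 * t2) * m * u + s3 * t3 * m * u^2) + snk 2 u * ((s2 * y2 + t2 * x2) + (s3 * y2 + t3 * x2) * u + 0 * u^2))"
 have "(LINT w|Mosq. csk 2 (w$i) * ((s1 * w$i + s2 * w$j + s3 * (w$i * w$j)) * (t1 * w$i + t2 * w$j + t3 * (w$i * w$j)) * m + (e0 + e1 * w$i + e2 * w$j))
   + snk 2 (w$i) * ((s1 * w$i + s2 * w$j + s3 * (w$i * w$j)) * (y1 * w$i + y2 * w$j) + (t1 * w$i + t2 * w$j + t3 * (w$i * w$j)) * (x1 * w$i + x2 * w$j)))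
  = (LINT w|Mosq. C0 (w$i) * 1 + C1 (w$i) * w$j + C2 (w$i) * (w$j)^2 + 0 * (w$j)^3 + 0 * (w$j)^4)"
  by (rule lint_cong) (simp add: C0_def C1_def C2_def algebra_simps power2_eq_square)
 also have "\<dots> = I1 C0 + I1 C2 / 12 + I1 (%_. 0) / 80"
  by (rule integral_osq_poly[OF _ _ _ _ _ ij]) (auto simp: C0_def C1_def C2_def intro!: continuous_intros)
 also have "\<dots> = m * (s1 * t1 + s3 * t3 / 12) / (2 * pi^2) + (s3 * y2 + t3 * x2) / 12"
  unfolding C0_def C2_def I1_cs2_poly by (simp add: field_simps)
 finally show ?thesis .
qed

text \<open>Second derivatives are needed only for the indices (2,0) and (0,2): in the trace of M -
  K/pi^2 over the first two modes the integrals of index (0,0) cancel.\<close>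

lemma CC2_0: "CC2 2 0 q r 0 = (if q = 1 \<and> r = 1 then - 2 else 0)" "CC2 0 2 q r 0 = (if q = 1 \<and> r = 1 then - 2 else 0)"
proof -
 define s1 s2 s3 x1 x2 :: "4 => real" where "s1 q = (vector [-1,0,0,0]::real^4)$q" and "s2 q = (vector [0,0,0,-1]::real^4)$q" and "s3 q = (vector [0,-2,0,0]::real^4)$q"
  and "x1 q = (vector [0,0,2,0]::real^4)$q" and "x2 q = (vector [0,-2,0,0]::real^4)$q" for q
 define y1 y2 y3 :: "4 => real" where "y1 q = (vector [0,0,0,-1]::real^4)$q" and "y2 q = (vector [1,0,0,0]::real^4)$q" and "y3 q = (vector [0,0,2,0]::real^4)$q" for q
 define e0 e1 e2 :: "4 => 4 => real" where
  "e0 q r = (vector [vector [-2,0,0,0], 0, 0, vector [0,0,0,-2]]::real^4^4)$q$r" and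
  "e1 q r = (vector [vector [0,0,-2,0], vector [0,0,0,-2], vector [-2,0,0,0], vector [0,-2,0,0]]::real^4^4)$q$r" and
  "e2 q r = (vector [vector [0,-2,0,0], vector [-2,0,0,0], vector [0,0,0,2], vector [0,0,2,0]]::real^4^4)$q$r" for q r
 have P1: "Phi1 q w = s1 q * w$1 + s2 q * w$2 + s3 q * (w$1 * w$2)" for q w
  by (rule all_4[where q=q]) (simp_all add: Phi1_def s1_def s2_def s3_def)
 have P2: "Phi2 q w = y1 q * w$1 + y2 q * w$2 + y3 q * (w$1 * w$2)" for q w
  by (rule all_4[where q=q]) (simp_all add: Phi2_def y1_def y2_def y3_def)
 have J: "JJ1 q 0 w = x1 q * w$1 + x2 q * w$2" for q w
  by (rule all_4[where q=q]) (simp_all add: JJ1_def x1_def x2_def)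
 have J2: "JJ2 q r w = e0 q r + e1 q r * w$1 + e2 q r * w$2" for q r w
  by (rule all_4[where q=q]; rule all_4[where q=r]) (simp_all add: JJ2_def e0_def e1_def e2_def)
 have "CC2 2 0 q r 0 = (LINT w|Mosq. csk 2 (w$1) * ((s1 q * w$1 + s2 q * w$2 + s3 q * (w$1 * w$2)) * (s1 r * w$1 + s2 r * w$2 + s3 r * (w$1 * w$2)) * (- (2 * pi)\<^sup>2) + (e0 q r + e1 q r * w$1 + e2 q r * w$2))
   + snk 2 (w$1) * ((s1 q * w$1 + s2 q * w$2 + s3 q * (w$1 * w$2)) * (x1 r * w$1 + x2 r * w$2) + (s1 r * w$1 + s2 r * w$2 + s3 r * (w$1 * w$2)) * (x1 q * w$1 + x2 q * w$2)))"
  unfolding CC2_def hh2_def Phi_0 JJ_0 psi_def psi1_def psi2_def psi12_def P1[symmetric] J[symmetric] J2[symmetric]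
  by (rule lint_cong) (simp add: algebra_simps)
 also have "\<dots> = - 2 * s1 q * s1 r - s3 q * s3 r / 6 + (s3 q * x2 r + s3 r * x2 q) / 12"
  unfolding integral_cs2[OF ij12'(1)] by (simp add: field_simps power2_eq_square)
 also have "\<dots> = (if q = 1 \<and> r = 1 then - 2 else 0)"
  by (rule all_4[where q=q]; rule all_4[where q=r]) (simp_all add: s1_def s3_def x2_def)
 finally show "CC2 2 0 q r 0 = (if q = 1 \<and> r = 1 then - 2 else 0)" .
 have "CC2 0 2 q r 0 = (LINT w|Mosq. csk 2 (w$2) * ((y2 q * w$2 + y1 q * w$1 + y3 q * (w$2 * w$1)) * (y2 r * w$2 + y1 r * w$1 + y3 r * (w$2 * w$1)) * (- (2 * pi)\<^sup>2) + (e0 q r + e2 q r * w$2 + e1 q r * w$1))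
   + snk 2 (w$2) * ((y2 q * w$2 + y1 q * w$1 + y3 q * (w$2 * w$1)) * (x2 r * w$2 + x1 r * w$1) + (y2 r * w$2 + y1 r * w$1 + y3 r * (w$2 * w$1)) * (x2 q * w$2 + x1 q * w$1)))"
  unfolding CC2_def hh2_def Phi_0 JJ_0 psi_def psi1_def psi2_def psi12_def P2 J J2
  by (rule lint_cong) (simp add: algebra_simps)
 also have "\<dots> = - 2 * y2 q * y2 r - y3 q * y3 r / 6 + (y3 q * x1 r + y3 r * x1 q) / 12"
  unfolding integral_cs2[OF ij12'(2)] by (simp add: field_simps power2_eq_square)
 also have "\<dots> = (if q = 1 \<and> r = 1 then - 2 else 0)"
  by (rule all_4[where q=q]; rule all_4[where q=r]) (simp_all add: y2_def y3_def x1_def)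
 finally show "CC2 0 2 q r 0 = (if q = 1 \<and> r = 1 then - 2 else 0)" .
qed

section \<open>The Galerkin matrices and their derivatives at the square\<close>

lemma exhaust_5: "(i::5) = 1 \<or> i = 2 \<or> i = 3 \<or> i = 4 \<or> i = 5"
proof (induct i)
 case (of_int z)
 then have "z = 0 \<or> z = 1 \<or> z = 2 \<or> z = 3 \<or> z = 4" by auto
 then show ?case by auto
qed

lemma all_5: "P 1 ==> P 2 ==> P 3 ==> P 4 ==> P 5 ==> P (i::5)"
 using exhaust_5[of i] by auto

lemma UNIV_5: "(UNIV::5 set) = {1, 2, 3, 4, 5}"
 using exhaust_5 by auto

lemma neq_5 [simp]: "(1::5) \<noteq> 2" "(1::5) \<noteq> 3" "(1::5) \<noteq> 4" "(1::5) \<noteq> 5" "(2::5) \<noteq> 3" "(2::5) \<noteq> 4" "(2::5) \<noteq> 5"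
 "(3::5) \<noteq> 4" "(3::5) \<noteq> 5" "(4::5) \<noteq> 5" "(2::5) \<noteq> 1" "(3::5) \<noteq> 1" "(4::5) \<noteq> 1" "(5::5) \<noteq> 1" "(3::5) \<noteq> 2" "(4::5) \<noteq> 2" "(5::5) \<noteq> 2"
 "(4::5) \<noteq> 3" "(5::5) \<noteq> 3" "(5::5) \<noteq> 4"
 by simp_all

lemma sum_5: "sum f (UNIV::5 set) = f 1 + f 2 + f 3 + f 4 + f 5"
 unfolding UNIV_5 by (simp add: add.assoc)

lemma vector5_nth [simp]:
 "(vector [x1, x2, x3, x4, x5] :: 'a::zero^5) $ 1 = x1" "(vector [x1, x2, x3, x4, x5] :: 'a^5) $ 2 = x2"
 "(vector [x1, x2, x3, x4, x5] :: 'a^5) $ 3 = x3" "(vector [x1, x2, x3, x4, x5] :: 'a^5) $ 4 = x4" "(vector [x1, x2, x3, x4, x5] :: 'a^5) $ 5 = x5"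
 unfolding vector_def by auto

definition mi :: "5 => real" where "mi i = (vector [1, 0, 1, 2, 0] :: real^5) $ i"
definition ni :: "5 => real" where "ni i = (vector [0, 1, 1, 0, 2] :: real^5) $ i"

lemma mi_ni: "mi 1 = 1" "mi 2 = 0" "mi 3 = 1" "mi 4 = 2" "mi 5 = 0" "ni 1 = 0" "ni 2 = 1" "ni 3 = 1" "ni 4 = 0" "ni 5 = 2"
 by (simp_all add: mi_def ni_def)

text \<open>Products of two trial functions, and of their gradients, are linear combinations of the functions \<open>psi k l\<close>.\<close>

definition MP :: "(real => real => real) => 5 => 5 => real" where
 "MP C i j = (C (mi i - mi j) (ni i - ni j) + C (mi i - mi j) (ni i + ni j) + C (mi i + mi j) (ni i - ni j) + C (mi i + mi j) (ni i + ni j)) / 4"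

definition KP :: "(real => real => real) => 5 => 5 => real" where
 "KP C i j = pi^2 / 4 * (mi i * mi j * (C (mi i - mi j) (ni i - ni j) + C (mi i - mi j) (ni i + ni j) - C (mi i + mi j) (ni i - ni j) - C (mi i + mi j) (ni i + ni j))
  + ni i * ni j * (C (mi i - mi j) (ni i - ni j) - C (mi i - mi j) (ni i + ni j) + C (mi i + mi j) (ni i - ni j) - C (mi i + mi j) (ni i + ni j)))"

lemma trial_psi: "trial i x = psi (mi i) (ni i) x"
 by (simp add: trial_def psi_def mi_def ni_def Let_def)

lemma psi_has_derivative: "(psi k l has_derivative (%h. psi1 k l x * h$1 + psi2 k l x * h$2)) (at x)"
 unfolding psi_def[abs_def] psi1_def psi2_def
 by (auto intro!: derivative_eq_intros simp: algebra_simps)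

lemma gradient_trial: "gradient (trial i) x $ 1 = psi1 (mi i) (ni i) x" "gradient (trial i) x $ 2 = psi2 (mi i) (ni i) x"
proof -
 have "trial i = psi (mi i) (ni i)" by (rule ext) (rule trial_psi)
 then have "frechet_derivative (trial i) (at x) = (%h. psi1 (mi i) (ni i) x * h$1 + psi2 (mi i) (ni i) x * h$2)"
  using frechet_derivative_at[OF psi_has_derivative] by simp
 then show "gradient (trial i) x $ 1 = psi1 (mi i) (ni i) x" "gradient (trial i) x $ 2 = psi2 (mi i) (ni i) x"
  by (simp_all add: gradient_def axis_def)
qed

lemma csk_mult: "csk k t * csk k' t = (csk (k - k') t + csk (k + k') t) / 2"
 by (simp only: left_diff_distrib distrib_right cos_add cos_diff; simp)

lemma snk_mult: "snk k t * snk k' t = pi^2 * (k * k') * ((csk (k - k') t - csk (k + k') t) / 2)"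
 by (simp only: left_diff_distrib distrib_right cos_add cos_diff; simp add: power2_eq_square)

lemma psi_mult: "psi (mi i) (ni i) x * psi (mi j) (ni j) x = MP (%k l. psi k l x) i j"
proof -
 have alg: "((A + B) / 2) * ((C + D) / 2) = (A * C + A * D + B * C + B * D) / 4" for A B C D :: real by (simp add: field_simps)
 have "psi (mi i) (ni i) x * psi (mi j) (ni j) x = (csk (mi i) (x$1) * csk (mi j) (x$1)) * (csk (ni i) (x$2) * csk (ni j) (x$2))" by (simp add: psi_def)
 then show ?thesis unfolding csk_mult alg MP_def psi_def .
qed

lemma psi_grad_mult: "psi1 (mi i) (ni i) x * psi1 (mi j) (ni j) x + psi2 (mi i) (ni i) x * psi2 (mi j) (ni j) x = KP (%k l. psi k l x) i j"
proof -
 have alg: "(P * (k * k') * ((A - B) / 2)) * ((C + D) / 2) + ((A + B) / 2) * (P * (l * l') * ((C - D) / 2))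
  = P / 4 * (k * k' * (A * C + A * D - B * C - B * D) + l * l' * (A * C - A * D + B * C - B * D))" for A B C D P k k' l l' :: real
  by (simp add: field_simps)
 have "psi1 (mi i) (ni i) x * psi1 (mi j) (ni j) x + psi2 (mi i) (ni i) x * psi2 (mi j) (ni j) x
  = (snk (mi i) (x$1) * snk (mi j) (x$1)) * (csk (ni i) (x$2) * csk (ni j) (x$2)) + (csk (mi i) (x$1) * csk (mi j) (x$1)) * (snk (ni i) (x$2) * snk (ni j) (x$2))"
  by (simp add: psi1_def psi2_def)
 then show ?thesis unfolding csk_mult snk_mult alg KP_def psi_def .
qed

lemma MP_scale: "MP (%k l. C k l * t) i j = MP C i j * t" and KP_scale: "KP (%k l. C k l * t) i j = KP C i j * t"
 by (simp_all add: MP_def KP_def algebra_simps)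

lemma integrable_hh: "integrable Mosq (hh k l p)"
 by (rule integrable_osq[OF continuous_slice[OF continuous_hh(1)]])

lemma integral_MP: "(LINT w|Mosq. MP (%k l. hh k l p w) i j) = MP (%k l. CC k l p) i j"
 unfolding MP_def CC_def
 by (simp only: lint_add lint_integrable_add integral_divide_zero integrable_hh)

lemma integral_KP: "(LINT w|Mosq. KP (%k l. hh k l p w) i j) = KP (%k l. CC k l p) i j"
 unfolding KP_def CC_def
 by (simp only: lint_add lint_integrable_add Bochner_Integration.integral_diff Bochner_Integration.integrable_diff
   integral_mult_right_zero integrable_mult_right integrable_hh)

definition Kt :: "real^4 => 5 => 5 => real" where "Kt p i j = KP (%k l. CC k l p) i j"
definition K1 :: "4 => real^4 => 5 => 5 => real" where "K1 q p i j = KP (%k l. CC1 k l q p) i j"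
definition K2 :: "4 => 4 => real^4 => 5 => 5 => real" where "K2 q r p i j = KP (%k l. CC2 k l q r p) i j"
definition Mm :: "real^4 => 5 => real" where "Mm p i = CC (mi i) (ni i) p"
definition Mm1 :: "4 => real^4 => 5 => real" where "Mm1 q p i = CC1 (mi i) (ni i) q p"
definition Mm2 :: "4 => 4 => real^4 => 5 => real" where "Mm2 q r p i = CC2 (mi i) (ni i) q r p"
definition ar :: "real^4 => real" where "ar p = 1 - p$1 * p$1 - p$4 * p$4"
definition ar1 :: "4 => real^4 => real" where "ar1 q p = (vector [-2 * p$1, 0, 0, -2 * p$4] :: real^4) $ q"
definition ar2 :: "4 => 4 => real" where "ar2 q r = (if q = r \<and> (q = 1 \<or> q = 4) then - 2 else 0)"
definition Mt :: "real^4 => 5 => 5 => real" where "Mt p i j = MP (%k l. CC k l p) i j - inverse (ar p) * (Mm p i * Mm p j)"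
definition M1 :: "4 => real^4 => 5 => 5 => real" where
 "M1 q p i j = MP (%k l. CC1 k l q p) i j - (inverse (ar p) * (Mm p i * Mm1 q p j + Mm1 q p i * Mm p j)
   + (- ar1 q p * (inverse (ar p) * inverse (ar p))) * (Mm p i * Mm p j))"
text \<open>Second derivatives at p = 0 only, where the means \<open>Mm\<close> and the gradient
  \<open>ar1\<close> of the area vanish; of the mean correction just the products of first
  derivatives survive.\<close>

definition M2 :: "4 => 4 => 5 => 5 => real" where
 "M2 q r i j = MP (%k l. CC2 k l q r 0) i j - (Mm1 q 0 i * Mm1 r 0 j + Mm1 r 0 i * Mm1 q 0 j)"

lemma stiffness_eq: "norm p <= 1/8 ==> stiffness p $ i $ j = Kt p i j"
proof -
 assume p: "norm p <= 1/8"
 have e: "KP (%k l. hh k l p w) i j = (gradient (trial i) (Phi p w) \<bullet> gradient (trial j) (Phi p w)) * Jac p w" for w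
 proof -
  have "gradient (trial i) (Phi p w) \<bullet> gradient (trial j) (Phi p w) = KP (%k l. psi k l (Phi p w)) i j"
   by (simp add: inner_vec_def sum_2 gradient_trial psi_grad_mult[symmetric])
  then show ?thesis unfolding JJ_eq[OF p] hh_def KP_scale by simp
 qed
 have "contU (%w. KP (%k l. hh k l p w) i j)"
  unfolding KP_def by (intro continuous_on_mult continuous_on_add continuous_on_diff continuous_on_const continuous_slice[OF continuous_hh(1)])
 from integral_osq[OF this] show ?thesis unfolding stiffness_def Kt_def integral_KP[symmetric] by (simp add: e)
qed

lemma mass_eq: "norm p <= 1/8 ==> mass p $ i $ j = Mt p i j"
proof -
 assume p: "norm p <= 1/8"
 have e: "MP (%k l. hh k l p w) i j = trial i (Phi p w) * trial j (Phi p w) * Jac p w" for w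
  unfolding JJ_eq[OF p] trial_psi psi_mult hh_def MP_scale ..
 have e': "hh (mi i) (ni i) p = (%w. trial i (Phi p w) * Jac p w)" for i
  unfolding JJ_eq[OF p] trial_psi hh_def by (rule ext) simp
 have c: "contU (%w. MP (%k l. hh k l p w) i j)"
  unfolding MP_def by (intro continuous_on_divide continuous_on_add continuous_on_const continuous_slice[OF continuous_hh(1)]) auto
 have a: "area p = ar p" using area_eq'[OF p] by (simp add: ar_def power2_eq_square)
 show ?thesis unfolding mass_def Mt_def integral_MP[symmetric] unfolding integral_osq[OF c] unfolding Mm_def CC_def integral_osq[OF continuous_slice[OF continuous_hh(1)]]
  by (simp add: e e' a divide_inverse)
qed

lemma CC_neg: "CC (- k) l p = CC k l p" "CC k (- l) p = CC k l p"
 unfolding CC_def hh_def psi_def by simp_all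

lemma KM_sym: "Kt p i j = Kt p j i" "Mt p i j = Mt p j i"
proof -
 have d: "CC (mi j - mi i) l p = CC (mi i - mi j) l p" "CC k (ni j - ni i) p = CC k (ni i - ni j) p" for k l
  using CC_neg(1)[of "mi i - mi j" l p] CC_neg(2)[of k "ni i - ni j" p] by simp_all
 show "Kt p i j = Kt p j i" unfolding Kt_def KP_def d add.commute[of "mi j"] add.commute[of "ni j"] by (simp add: mult_ac)
 show "Mt p i j = Mt p j i" unfolding Mt_def MP_def d add.commute[of "mi j"] add.commute[of "ni j"] by (simp add: mult_ac)
qed

lemma grad4_MP:
 assumes "!!k l. grad4 (C k l) (%q. C1 k l q) p"
 shows "grad4 (%p. MP (%k l. C k l p) i j) (%q. MP (%k l. C1 k l q) i j) p"
 unfolding MP_def divide_inverse by (rule grad4_cmult_right grad4_add assms)+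

lemma grad4_KP:
 assumes "!!k l. grad4 (C k l) (%q. C1 k l q) p"
 shows "grad4 (%p. KP (%k l. C k l p) i j) (%q. KP (%k l. C1 k l q) i j) p"
 unfolding KP_def by (rule grad4_cmult grad4_add grad4_diff assms)+

lemma grad4_Kt: "grad4 (%p. Kt p i j) (%q. K1 q p i j) p" "grad4 (%p. K1 q p i j) (%r. K2 q r p i j) p"
 unfolding Kt_def K1_def K2_def by (rule grad4_KP[OF grad4_CC] grad4_KP[OF grad4_CC1])+

lemma grad4_Mm: "grad4 (%p. Mm p i) (%q. Mm1 q p i) p" "grad4 (%p. Mm1 q p i) (%r. Mm2 q r p i) p"
 unfolding Mm_def Mm1_def Mm2_def by (rule grad4_CC grad4_CC1)+

lemma grad4_ar: "grad4 ar (%q. ar1 q p) p" "grad4 (%p. ar1 q p) (%r. ar2 q r) p"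
proof -
 note intros = grad4_add grad4_diff grad4_mult grad4_const grad4_coord
 show "grad4 ar (%q. ar1 q p) p" unfolding ar_def[abs_def]
  by (rule grad4_cong, (rule intros)+) (rule all_4, simp_all add: ar1_def)
 have a1: "grad4 (%p. ar1 1 p) (%r. ar2 1 r) p"
  unfolding ar1_def vector4_nth by (rule grad4_cong, (rule intros)+, rule all_4, simp_all add: ar2_def)
 have a2: "grad4 (%p. ar1 2 p) (%r. ar2 2 r) p"
  unfolding ar1_def vector4_nth by (rule grad4_cong, (rule intros)+, rule all_4, simp_all add: ar2_def)
 have a3: "grad4 (%p. ar1 3 p) (%r. ar2 3 r) p"
  unfolding ar1_def vector4_nth by (rule grad4_cong, (rule intros)+, rule all_4, simp_all add: ar2_def)
 have a4: "grad4 (%p. ar1 4 p) (%r. ar2 4 r) p"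
  unfolding ar1_def vector4_nth by (rule grad4_cong, (rule intros)+, rule all_4, simp_all add: ar2_def)
 show "grad4 (%p. ar1 q p) (%r. ar2 q r) p" using exhaust_4[of q] a1 a2 a3 a4 by auto
qed

lemma ar_pos: "norm p <= 1/8 ==> ar p > 0"
proof -
 assume "norm p <= 1/8"
 then interpret quad_map p by unfold_locales
 show ?thesis using J_bounds(1)[of 0] by (simp add: J_def A_def ar_def power2_eq_square)
qed

lemma grad4_ar_inv: "norm p <= 1/8 ==> grad4 (%p. inverse (ar p)) (%q. - ar1 q p * (inverse (ar p) * inverse (ar p))) p"
 using ar_pos[of p] by (intro grad4_cong[OF grad4_inverse[OF grad4_ar(1)]]) (auto simp: power2_eq_square field_simps)

lemma grad4_Mt: "norm p <= 1/8 ==> grad4 (%p. Mt p i j) (%q. M1 q p i j) p"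
 unfolding Mt_def M1_def by (rule grad4_diff[OF grad4_MP[OF grad4_CC] grad4_mult[OF grad4_ar_inv grad4_mult[OF grad4_Mm(1) grad4_Mm(1)]]])

lemma KM_0: "Kt 0 i j = (if i = j then (vector [pi^2/2, pi^2/2, pi^2/2, 2 * pi^2, 2 * pi^2] :: real^5) $ i else 0)"
 "Mt 0 i j = (if i = j then (vector [1/2, 1/2, 1/4, 1/2, 1/2] :: real^5) $ i else 0)" "Mm 0 i = 0" "ar 0 = 1" "ar1 q 0 = 0"
proof -
 show "Kt 0 i j = (if i = j then (vector [pi^2/2, pi^2/2, pi^2/2, 2 * pi^2, 2 * pi^2] :: real^5) $ i else 0)"
  by (rule all_5[where i=i]; rule all_5[where i=j]) (simp_all add: Kt_def KP_def mi_ni CC_0 moments)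
 show m: "Mm 0 i = 0" for i by (rule all_5[where i=i]) (simp_all add: Mm_def mi_ni CC_0 moments)
 show "Mt 0 i j = (if i = j then (vector [1/2, 1/2, 1/4, 1/2, 1/2] :: real^5) $ i else 0)"
  by (rule all_5[where i=i]; rule all_5[where i=j]) (simp_all add: Mt_def m MP_def mi_ni CC_0 moments)
 show "ar 0 = 1" by (simp add: ar_def)
 show "ar1 q 0 = 0" by (rule all_4[where q=q]) (simp_all add: ar1_def)
qed

lemma grad4_minus: "grad4 f f' p ==> grad4 (%p. - f p) (%q. - f' q) p"
 using grad4_cmult[of f f' p "-1"] by simp

lemma grad4_M1_0: "grad4 (%p. M1 q p i j) (%r. M2 q r i j) 0"
proof -
 have z: "norm (0::real^4) <= 1/8" by simp
 note i = grad4_diff[OF grad4_MP[OF grad4_CC1] grad4_add[OF grad4_mult[OF grad4_ar_inv[OF z] grad4_add[OF grad4_mult[OF grad4_Mm(1) grad4_Mm(2)] grad4_mult[OF grad4_Mm(2) grad4_Mm(1)]]]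
   grad4_mult[OF grad4_mult[OF grad4_minus[OF grad4_ar(2)] grad4_mult[OF grad4_ar_inv[OF z] grad4_ar_inv[OF z]]] grad4_mult[OF grad4_Mm(1) grad4_Mm(1)]]]]
 show ?thesis unfolding M1_def
  by (rule grad4_cong[OF i]) (simp add: M2_def KM_0)
qed

lemma grad4_continuous: "(!!p. p \<in> U ==> grad4 f (f' p) p) ==> continuous_on U f"
 unfolding grad4_def by (meson continuous_at_imp_continuous_on has_derivative_continuous)

lemma continuous_K1: "continuous_on U (%p. K1 q p i j)"
 by (rule grad4_continuous[OF grad4_Kt(2)])

lemma continuous_M1: "continuous_on (cball 0 (1/8)) (%p. M1 q p i j)"
proof -
 let ?U = "cball (0::real^4) (1/8)"
 have c: "continuous_on ?U (%p. MP (%k l. CC1 k l q p) i j)" "continuous_on ?U (%p. Mm p i)" "continuous_on ?U (%p. Mm1 q p i)" "continuous_on ?U (%p. ar1 q p)" for i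
  by (rule grad4_continuous, rule grad4_MP[OF grad4_CC1] grad4_Mm grad4_ar)+
 have inv: "continuous_on ?U (%p. inverse (ar p))" by (rule grad4_continuous[OF grad4_ar_inv]) simp
 show ?thesis unfolding M1_def
  by (rule c inv continuous_on_diff continuous_on_add continuous_on_mult continuous_on_minus)+
qed

text \<open>First derivatives at p = 0 of M - K/pi^2. The number 1/pi^2 is the double eigenvalue of
  M x = nu K x there, and columns 1 and 2 belong to its eigenspace.\<close>

definition NN :: "4 => 5 => 5 => real" where "NN q i a = M1 q 0 i a - 1 / pi^2 * K1 q 0 i a"

lemma NN_1: "NN q i 1 = (vector [vector [-1,0,0,0,0], vector [0,0,4/pi^2,0,0], vector [0,0,0,4/(3*pi^2),-4/pi^2], vector [0,-8/pi^2,0,0,0]] :: real^5^4) $ q $ i"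
 by (rule all_4[where q=q]; rule all_5[where i=i])
   (simp_all add: NN_def M1_def K1_def KM_0 KP_def MP_def mi_ni CC1_0 moments field_simps)

lemma NN_2: "NN q i 2 = (vector [vector [0,1,0,0,0], vector [0,0,0,4/pi^2,-4/(3*pi^2)], vector [0,0,-4/pi^2,0,0], vector [-8/pi^2,0,0,0,0]] :: real^5^4) $ q $ i"
 by (rule all_4[where q=q]; rule all_5[where i=i])
   (simp_all add: NN_def M1_def K1_def KM_0 KP_def MP_def mi_ni CC1_0 moments field_simps)

lemma K1_0: "K1 q 0 1 1 = (if q = 1 then pi\<^sup>2/2 else 0)" "K1 q 0 2 2 = (if q = 1 then - (pi^2/2) else 0)" "K1 q 0 1 2 = 0" "K1 q 0 2 1 = 0"
 by (rule all_4[where q=q]; simp add: K1_def KP_def mi_ni CC1_0 moments)+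

lemma trace_second: "(M2 q r 1 1 - 1 / pi^2 * K2 q r 0 1 1) + (M2 q r 2 2 - 1 / pi^2 * K2 q r 0 2 2)
  = (if q = r then (vector [-4, -32 / pi^4, -32 / pi^4, 0] :: real^4) $ q else 0)"
proof -
 have "(M2 q r 1 1 - 1 / pi^2 * K2 q r 0 1 1) + (M2 q r 2 2 - 1 / pi^2 * K2 q r 0 2 2)
  = CC2 2 0 q r 0 + CC2 0 2 q r 0 - 2 * Mm1 q 0 1 * Mm1 r 0 1 - 2 * Mm1 q 0 2 * Mm1 r 0 2"
  by (simp add: M2_def K2_def MP_def KP_def mi_ni field_simps)
 also have "\<dots> = (if q = r then (vector [-4, -32 / pi^4, -32 / pi^4, 0] :: real^4) $ q else 0)"
  by (rule all_4[where q=q]; rule all_4[where q=r]) (simp_all add: CC2_0 Mm1_def mi_ni CC1_0 moments eval_nat_numeral)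
 finally show ?thesis .
qed

section \<open>The invariant subspace of the two smallest eigenvalues\<close>

text \<open>Continuous differentiability in the form required by the inverse function theorem, with
  the derivative as a bounded linear map.\<close>

definition C1on :: "'a::euclidean_space set => ('a => 'b::real_normed_vector) => bool" where
 "C1on U f \<longleftrightarrow> (\<exists>f'. (\<forall>x\<in>U. (f has_derivative blinfun_apply (f' x)) (at x)) \<and> continuous_on U f')"

lemma C1on_linear: "bounded_linear f ==> C1on U f"
 unfolding C1on_def
 by (rule exI[of _ "%_. Blinfun f"]) (simp add: bounded_linear_Blinfun_apply bounded_linear_imp_has_derivative)

lemma C1on_const: "C1on U (%x. c)"
 unfolding C1on_def by (rule exI[of _ "%_. 0"]) (auto intro!: derivative_eq_intros)

lemma C1on_add: "C1on U f ==> C1on U g ==> C1on U (%x. f x + g x)"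
proof -
 assume "C1on U f" "C1on U g"
 then obtain f' g' where f: "\<forall>x\<in>U. (f has_derivative blinfun_apply (f' x)) (at x)" "continuous_on U f'"
  and g: "\<forall>x\<in>U. (g has_derivative blinfun_apply (g' x)) (at x)" "continuous_on U g'" unfolding C1on_def by blast
 have "blinfun_apply (f' x + g' x) = (%h. f' x h + g' x h)" for x by (rule ext) (simp add: blinfun.add_left)
 then show ?thesis unfolding C1on_def using f g
  by (intro exI[of _ "%x. f' x + g' x"]) (auto intro!: continuous_intros has_derivative_add)
qed

lemma C1on_mult: "C1on U f ==> C1on U g ==> C1on U (%x. f x * (g x :: real))"
proof -
 assume "C1on U f" "C1on U g"
 then obtain f' g' where f: "\<forall>x\<in>U. (f has_derivative blinfun_apply (f' x)) (at x)" "continuous_on U f'"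
  and g: "\<forall>x\<in>U. (g has_derivative blinfun_apply (g' x)) (at x)" "continuous_on U g'" unfolding C1on_def by blast
 have c: "continuous_on U f" "continuous_on U g" using f(1) g(1)
  by (meson continuous_at_imp_continuous_on has_derivative_continuous)+
 have "blinfun_apply (f x *\<^sub>R g' x + g x *\<^sub>R f' x) = (%h. f x * g' x h + f' x h * g x)" for x
  by (rule ext) (simp add: blinfun.add_left blinfun.scaleR_left)
 then show ?thesis unfolding C1on_def using f g c
  by (intro exI[of _ "%x. f x *\<^sub>R g' x + g x *\<^sub>R f' x"]) (auto intro!: continuous_intros has_derivative_mult)
qed

lemma C1on_comp:
 assumes "bounded_linear L" "C1on U f"
 shows "C1on U (%x. L (f x))"
proof -
 obtain f' where f: "\<forall>x\<in>U. (f has_derivative blinfun_apply (f' x)) (at x)" "continuous_on U f'" using assms(2) unfolding C1on_def by blast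
 have "blinfun_apply (Blinfun L o\<^sub>L f' x) = (%h. L (f' x h))" for x
  by (rule ext) (simp add: bounded_linear_Blinfun_apply[OF assms(1)])
 then show ?thesis unfolding C1on_def using f
  by (intro exI[of _ "%x. Blinfun L o\<^sub>L f' x"]) (auto intro!: continuous_intros bounded_linear.has_derivative[OF assms(1)])
qed

lemma C1on_diff: "C1on U f ==> C1on U g ==> C1on U (%x. f x - g x)"
 using C1on_add[OF _ C1on_comp[OF bounded_linear_minus[OF bounded_linear_ident]], of U f g] by simp

lemma C1on_sum: "(!!i. i \<in> S ==> C1on U (f i)) ==> C1on U (%x. \<Sum>i\<in>S. f i x)"
 by (induct S rule: infinite_finite_induct) (auto intro: C1on_const C1on_add)

lemma C1on_fst_grad4:
 fixes f :: "real^4 => real"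
 assumes "!!p. p \<in> U ==> grad4 f (%q. f1 q p) p" "!!q. continuous_on U (f1 q)"
 shows "C1on (U \<times> UNIV) (%z::(real^4) \<times> 'b::euclidean_space. f (fst z))"
proof -
 define B :: "4 => ((real^4) \<times> 'b) \<Rightarrow>\<^sub>L real" where "B = (%q. Blinfun (%z. fst z $ q))"
 have bl: "bounded_linear (%z::(real^4) \<times> 'b. fst z $ q)" for q
  by (rule bounded_linear_compose[OF bounded_linear_vec_nth bounded_linear_fst])
 have B: "blinfun_apply (B q) x = fst x $ q" for q x
  unfolding B_def by (subst bounded_linear_Blinfun_apply) (rule bl, rule refl)
 have e: "blinfun_apply (\<Sum>q\<in>UNIV. f1 q (fst z) *\<^sub>R B q) = (%h. \<Sum>q\<in>UNIV. f1 q (fst z) * fst h $ q)" for z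
  by (rule ext) (simp add: blinfun.sum_left blinfun.scaleR_left B)
 have d: "((%z. f (fst z)) has_derivative (%h. \<Sum>q\<in>UNIV. f1 q (fst z) * fst h $ q)) (at z)" if "z \<in> U \<times> UNIV" for z :: "(real^4) \<times> 'b"
  using has_derivative_compose[OF has_derivative_fst[OF has_derivative_ident] assms(1)[of "fst z", unfolded grad4_def]] that by auto
 have c: "continuous_on (U \<times> UNIV) (%z::(real^4) \<times> 'b. f1 q (fst z))" for q
  by (rule continuous_on_compose2[OF assms(2)]) (auto intro: continuous_intros)
 show ?thesis unfolding C1on_def
  by (rule exI[of _ "%z. \<Sum>q\<in>UNIV. f1 q (fst z) *\<^sub>R B q"]) (use d c in \<open>auto simp: e intro!: continuous_intros\<close>)
qed

definition vv1 :: "real^5 => 5 => real" where "vv1 y j = (if j = 1 then 1 else if j = 2 then 0 else y$j)"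
definition vv2 :: "real^5 => 5 => real" where "vv2 y j = (if j = 1 then 0 else if j = 2 then 1 else y$j)"

text \<open>The columns of \<open>[I; X]\<close> are \<open>vv1 y\<^sub>1\<close> and \<open>vv2 y\<^sub>2\<close>, and those of \<open>B\<close> are stored in the first two
 components of \<open>y\<^sub>1\<close> and \<open>y\<^sub>2\<close>. The equation to be solved is \<open>M [I; X] = K [I; X] B\<close>.\<close>

definition Eq1 :: "5 => (real^4) \<times> (real^5) \<times> (real^5) => real" where
 "Eq1 i z = (\<Sum>j\<in>UNIV. Mt (fst z) i j * vv1 (fst (snd z)) j)
   - (\<Sum>j\<in>UNIV. Kt (fst z) i j * (fst (snd z) $ 1 * vv1 (fst (snd z)) j + fst (snd z) $ 2 * vv2 (snd (snd z)) j))"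
definition Eq2 :: "5 => (real^4) \<times> (real^5) \<times> (real^5) => real" where
 "Eq2 i z = (\<Sum>j\<in>UNIV. Mt (fst z) i j * vv2 (snd (snd z)) j)
   - (\<Sum>j\<in>UNIV. Kt (fst z) i j * (snd (snd z) $ 1 * vv1 (fst (snd z)) j + snd (snd z) $ 2 * vv2 (snd (snd z)) j))"

text \<open>The parameter p is carried along unchanged, so that inverting the map at (p, 0, 0)
  solves the equations for given p.\<close>

definition EF :: "(real^4) \<times> (real^5) \<times> (real^5) => (real^4) \<times> (real^5) \<times> (real^5)" where
 "EF z = (fst z, (\<chi> i. Eq1 i z), (\<chi> i. Eq2 i z))"

text \<open>At p = 0 the solution is X = 0 and B = I/pi^2.\<close>

definition z0 :: "(real^4) \<times> (real^5) \<times> (real^5)" where "z0 = (0, axis 1 (1/pi^2), axis 2 (1/pi^2))"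

abbreviation "kd \<equiv> (vector [pi^2/2, pi^2/2, pi^2/2, 2 * pi^2, 2 * pi^2] :: real^5)"
abbreviation "md \<equiv> (vector [1/2, 1/2, 1/4, 1/2, 1/2] :: real^5)"

lemma sum_KM_0: "(\<Sum>j\<in>UNIV. Mt 0 i j * f j) = md $ i * f i" "(\<Sum>j\<in>UNIV. Kt 0 i j * f j) = kd $ i * f i"
proof -
 have "Mt 0 i j * f j = (if i = j then md $ i * f i else 0)" "Kt 0 i j * f j = (if i = j then kd $ i * f i else 0)" for j
  by (simp_all add: KM_0)
 then show "(\<Sum>j\<in>UNIV. Mt 0 i j * f j) = md $ i * f i" "(\<Sum>j\<in>UNIV. Kt 0 i j * f j) = kd $ i * f i" by (simp_all only:) simp_all
qed

lemma EF_z0: "EF z0 = 0"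
proof -
 have "Eq1 i z0 = 0 \<and> Eq2 i z0 = 0" for i
  unfolding Eq1_def Eq2_def z0_def fst_conv snd_conv sum_KM_0
  by (rule all_5[where i=i]) (simp_all add: vv1_def vv2_def axis_def)
 then show ?thesis by (simp add: EF_def z0_def prod_eq_iff vec_eq_iff)
qed

lemma C1on_EF: "C1on (ball 0 (1/8) \<times> UNIV) EF"
proof -
 let ?U = "ball (0::real^4) (1/8) \<times> (UNIV :: ((real^5) \<times> (real^5)) set)"
 have K: "C1on ?U (%z. Kt (fst z) i j)" for i j
  by (rule C1on_fst_grad4[OF grad4_Kt(1) continuous_K1])
 have M: "C1on ?U (%z. Mt (fst z) i j)" for i j
  by (rule C1on_fst_grad4[OF grad4_Mt continuous_on_subset[OF continuous_M1 ball_subset_cball]]) simp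
 have bl: "bounded_linear (%z::(real^4) \<times> (real^5) \<times> (real^5). fst (snd z) $ j)" "bounded_linear (%z::(real^4) \<times> (real^5) \<times> (real^5). snd (snd z) $ j)" for j
  by (rule bounded_linear_compose[OF bounded_linear_vec_nth bounded_linear_compose[OF bounded_linear_fst bounded_linear_snd]]
    bounded_linear_compose[OF bounded_linear_vec_nth bounded_linear_compose[OF bounded_linear_snd bounded_linear_snd]])+
 note Y = C1on_linear[OF bl(1), of ?U] C1on_linear[OF bl(2), of ?U]
 have V: "C1on ?U (%z. vv1 (fst (snd z)) j)" "C1on ?U (%z. vv2 (snd (snd z)) j)" for j
  unfolding vv1_def vv2_def by (cases "j = 1"; cases "j = 2"; simp add: C1on_const Y)+
 have E: "C1on ?U (Eq1 i)" "C1on ?U (Eq2 i)" for i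
  unfolding Eq1_def Eq2_def by (intro C1on_diff C1on_sum C1on_mult C1on_add K M V Y)+
 have l1: "bounded_linear (%t::real. (0::real^4, t *\<^sub>R axis i (1::real) :: real^5, 0::real^5))" 
  and l2: "bounded_linear (%t::real. (0::real^4, 0::real^5, t *\<^sub>R axis i (1::real) :: real^5))" for i
  by (intro bounded_linear_Pair bounded_linear_zero bounded_linear_scaleR_left)+
 have l0: "bounded_linear (%z::(real^4) \<times> (real^5) \<times> (real^5). (fst z, 0::real^5, 0::real^5))"
  by (intro bounded_linear_Pair bounded_linear_zero bounded_linear_fst)
 have ax: "(\<Sum>i\<in>UNIV. f i *\<^sub>R axis i (1::real)) = (\<chi> i. f i)" for f :: "5 => real"
  by (simp add: vec_eq_iff axis_def if_distrib cong: if_cong)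
 have e: "EF = (%z. (fst z, 0, 0) + ((\<Sum>i\<in>UNIV. (0, Eq1 i z *\<^sub>R axis i 1, 0)) + (\<Sum>i\<in>UNIV. (0, 0, Eq2 i z *\<^sub>R axis i 1))))"
  by (rule ext) (simp add: EF_def prod_eq_iff fst_sum snd_sum ax)
 show ?thesis
  by (subst e) (intro C1on_add C1on_sum C1on_linear[OF l0] C1on_comp[OF l1 E(1)] C1on_comp[OF l2 E(2)])
qed

text \<open>The first component forces the p-direction to vanish. At p = 0 both matrices are
  diagonal, so the linearized equations decouple into one factor per component.\<close>

lemma EF_derivative_inj:
 assumes D: "(EF has_derivative D) (at z0)" and h: "D h = 0"
 shows "h = 0"
proof -
 obtain h0 k1 k2 where hh: "h = (h0, k1, k2)" by (metis prod.exhaust)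
 have "((%z. fst (EF z)) has_derivative (%h. fst (D h))) (at z0)" by (rule has_derivative_fst[OF D])
 moreover have "(%z. fst (EF z)) = fst" by (rule ext) (simp add: EF_def)
 ultimately have "(fst has_derivative (%h. fst (D h))) (at z0)" by simp
 moreover have "(fst has_derivative fst) (at z0)" by (rule has_derivative_fst[OF has_derivative_ident])
 ultimately have "(%h. fst (D h)) = fst" by (rule has_derivative_unique)
 then have "fst (D h) = fst h" by (rule fun_cong)
 then have h0: "h0 = 0" using h hh by simp
 have line: "((%t::real. z0 + t *\<^sub>R h) has_derivative (%s. s *\<^sub>R h)) (at 0)"
  by (auto intro!: derivative_eq_intros)
 have "((%t. EF (z0 + t *\<^sub>R h)) has_derivative (%s. D (s *\<^sub>R h))) (at 0)"
  using has_derivative_compose[OF line, of EF D] D by simp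
 moreover have "D (s *\<^sub>R h) = 0" for s using linear_scale[OF has_derivative_linear[OF D], of s h] h by simp
 ultimately have z: "((%t. EF (z0 + t *\<^sub>R h)) has_derivative (%s. 0)) (at 0)" by simp
 have e: "((%t. Eq1 i (z0 + t *\<^sub>R h)) has_real_derivative 0) (at 0)" "((%t. Eq2 i (z0 + t *\<^sub>R h)) has_real_derivative 0) (at 0)" for i
  using bounded_linear.has_derivative[OF bounded_linear_compose[OF bounded_linear_vec_nth[of i] bounded_linear_compose[OF bounded_linear_fst bounded_linear_snd]] z]
   bounded_linear.has_derivative[OF bounded_linear_compose[OF bounded_linear_vec_nth[of i] bounded_linear_compose[OF bounded_linear_snd bounded_linear_snd]] z]
  by (simp_all add: EF_def has_field_derivative_def lambda_zero)
 have f: "Eq1 i (z0 + t *\<^sub>R h) = md $ i * vv1 (axis 1 (1/pi^2) + t *\<^sub>R k1) i - kd $ i * ((1/pi^2 + t * k1$1) * vv1 (axis 1 (1/pi^2) + t *\<^sub>R k1) i + (t * k1$2) * vv2 (axis 2 (1/pi^2) + t *\<^sub>R k2) i)"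
  "Eq2 i (z0 + t *\<^sub>R h) = md $ i * vv2 (axis 2 (1/pi^2) + t *\<^sub>R k2) i - kd $ i * ((t * k2$1) * vv1 (axis 1 (1/pi^2) + t *\<^sub>R k1) i + (1/pi^2 + t * k2$2) * vv2 (axis 2 (1/pi^2) + t *\<^sub>R k2) i)" for i t
 proof -
  have z: "z0 + t *\<^sub>R h = (0, axis 1 (1/pi^2) + t *\<^sub>R k1, axis 2 (1/pi^2) + t *\<^sub>R k2)" by (simp add: hh h0 z0_def)
  show "Eq1 i (z0 + t *\<^sub>R h) = md $ i * vv1 (axis 1 (1/pi^2) + t *\<^sub>R k1) i - kd $ i * ((1/pi^2 + t * k1$1) * vv1 (axis 1 (1/pi^2) + t *\<^sub>R k1) i + (t * k1$2) * vv2 (axis 2 (1/pi^2) + t *\<^sub>R k2) i)"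
   "Eq2 i (z0 + t *\<^sub>R h) = md $ i * vv2 (axis 2 (1/pi^2) + t *\<^sub>R k2) i - kd $ i * ((t * k2$1) * vv1 (axis 1 (1/pi^2) + t *\<^sub>R k1) i + (1/pi^2 + t * k2$2) * vv2 (axis 2 (1/pi^2) + t *\<^sub>R k2) i)"
   unfolding z Eq1_def Eq2_def fst_conv snd_conv sum_KM_0 by (simp_all add: axis_def)
 qed
 \<comment> \<open>For i = 1, 2 the unknown is an entry of B and the factor is -pi^2/2. For i >= 3
   it is md - kd/pi^2, nonzero because those modes have the eigenvalues 2 pi^2 and 4 pi^2.\<close>
 define c where "c = (vector [- pi\<^sup>2/2, - pi\<^sup>2/2, -1/4, -3/2, -3/2] :: real^5)"
 have "((%t. Eq1 i (z0 + t *\<^sub>R h)) has_real_derivative c $ i * k1 $ i) (at 0) \<and> ((%t. Eq2 i (z0 + t *\<^sub>R h)) has_real_derivative c $ i * k2 $ i) (at 0)" for i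
  unfolding f by (rule all_5[where i=i]) (auto intro!: derivative_eq_intros simp: vv1_def vv2_def axis_def c_def field_simps)
 then have "c $ i * k1 $ i = 0 \<and> c $ i * k2 $ i = 0" for i using e[of i] DERIV_unique by blast
 moreover have "c $ i \<noteq> 0" for i by (rule all_5[where i=i]) (simp_all add: c_def)
 ultimately have "k1 = 0" "k2 = 0" by (simp_all add: vec_eq_iff)
 then show ?thesis by (simp add: hh h0 zero_prod_def)
qed

lemma grad4_ex:
 assumes "f differentiable at p"
 shows "\<exists>f'. grad4 f f' p"
proof -
 obtain D where D: "(f has_derivative D) (at p)" using assms unfolding differentiable_def by blast
 have "D = (%x. \<Sum>q\<in>UNIV. D (axis q 1) * x$q)"
 proof
  fix x :: "real^4"
  have "x = (\<Sum>q\<in>UNIV. x$q *\<^sub>R axis q 1)" by (simp add: vec_eq_iff axis_def if_distrib cong: if_cong)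
  then have "D x = D (\<Sum>q\<in>UNIV. x$q *\<^sub>R axis q 1)" by simp
  also have "\<dots> = (\<Sum>q\<in>UNIV. x$q *\<^sub>R D (axis q 1))"
   using has_derivative_linear[OF D] by (simp add: linear_sum linear_scale)
  finally show "D x = (\<Sum>q\<in>UNIV. D (axis q 1) * x$q)" by (simp add: mult.commute)
 qed
 then show ?thesis unfolding grad4_def using D by (intro exI[of _ "%q. D (axis q 1)"]) simp
qed

theorem invariant_subspace:
 obtains W y1 y2 where "open W" "0 \<in> W" "W \<subseteq> ball 0 (1/8)" "y1 0 = axis 1 (1/pi^2)" "y2 0 = axis 2 (1/pi^2)"
  "!!p i. p \<in> W ==> Eq1 i (p, y1 p, y2 p) = 0" "!!p i. p \<in> W ==> Eq2 i (p, y1 p, y2 p) = 0"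
  "!!p i. p \<in> W ==> \<exists>f'. grad4 (%p. y1 p $ i) f' p" "!!p i. p \<in> W ==> \<exists>f'. grad4 (%p. y2 p $ i) f' p"
proof -
 obtain F' where F: "!!x. x \<in> ball 0 (1/8) \<times> UNIV ==> (EF has_derivative blinfun_apply (F' x)) (at x)" and Fc: "continuous_on (ball 0 (1/8) \<times> UNIV) F'"
  using C1on_EF unfolding C1on_def by blast
 have z: "z0 \<in> ball 0 (1/8) \<times> UNIV" by (simp add: z0_def)
 have lin: "linear (blinfun_apply (F' z0))" by (rule bounded_linear.linear[OF blinfun.bounded_linear_right])
 have "inj (blinfun_apply (F' z0))" unfolding linear_injective_0[OF lin]
  using EF_derivative_inj[OF F[OF z]] by blast
 then obtain g where g: "linear g" "g \<circ> blinfun_apply (F' z0) = id" using linear_injective_left_inverse[OF lin] by blast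
 have "Blinfun g o\<^sub>L F' z0 = id_blinfun"
 proof (rule blinfun_eqI)
  fix i
  have "bounded_linear g" using g(1) by (simp add: linear_conv_bounded_linear)
  moreover have "g (blinfun_apply (F' z0) i) = i" using fun_cong[OF g(2), of i] by (simp only: comp_apply id_apply)
  ultimately show "blinfun_apply (Blinfun g o\<^sub>L F' z0) i = blinfun_apply id_blinfun i"
   by (simp only: blinfun_apply_blinfun_compose bounded_linear_Blinfun_apply blinfun_apply_id_blinfun)
 qed
 then obtain U' V g g' where IF: "open U'" "U' \<subseteq> ball 0 (1/8) \<times> UNIV" "z0 \<in> U'" "open V" "EF z0 \<in> V" "homeomorphism U' V EF g"
  "!!y. y \<in> V ==> (g has_derivative (g' y)) (at y)"
  using inverse_function_theorem[OF _ F Fc z] by (metis open_Times open_ball open_UNIV)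
 define P where "P = (%p::real^4. (p, 0::real^5, 0::real^5))"
 have cP: "contU P" unfolding P_def by (intro continuous_intros)
 define W where "W = P -` V"
 define y1 where "y1 = (%p. fst (snd (g (P p))))"
 define y2 where "y2 = (%p. snd (snd (g (P p))))"
 have E: "EF (g (P p)) = P p" if "p \<in> W" for p
  using IF(6) that unfolding homeomorphism_def W_def by auto
 have gU: "g (P p) \<in> U'" if "p \<in> W" for p
  using IF(6) that unfolding homeomorphism_def W_def by auto
 have gp: "g (P p) = (p, y1 p, y2 p)" if "p \<in> W" for p
 proof -
  have "fst (g (P p)) = p" using E[OF that] by (simp add: EF_def P_def)
  then show ?thesis by (simp add: y1_def y2_def prod_eq_iff)
 qed
 have g0: "g (P 0) = z0"
 proof -
  have "P 0 = EF z0" by (simp add: EF_z0 P_def zero_prod_def)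
  then show ?thesis using IF(3,6) unfolding homeomorphism_def by auto
 qed
 have W0: "0 \<in> W" using IF(5) by (simp add: W_def P_def EF_z0 zero_prod_def)
 have d: "(%p. g (P p)) differentiable at p" if "p \<in> W" for p
 proof -
  have "(P has_derivative (%h. (h, 0, 0))) (at p)" unfolding P_def by (intro has_derivative_Pair has_derivative_ident has_derivative_const)
  from has_derivative_compose[OF this IF(7)] that show ?thesis unfolding differentiable_def W_def by auto
 qed
 have bl: "bounded_linear (%z::(real^4) \<times> (real^5) \<times> (real^5). fst (snd z) $ j)" "bounded_linear (%z::(real^4) \<times> (real^5) \<times> (real^5). snd (snd z) $ j)" for j
  by (rule bounded_linear_compose[OF bounded_linear_vec_nth bounded_linear_compose[OF bounded_linear_fst bounded_linear_snd]]
    bounded_linear_compose[OF bounded_linear_vec_nth bounded_linear_compose[OF bounded_linear_snd bounded_linear_snd]])+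
 show ?thesis
 proof (rule that)
  show "open W" unfolding W_def by (rule open_vimage[OF IF(4) cP])
  show "0 \<in> W" by (rule W0)
  show "W \<subseteq> ball 0 (1/8)" using gU gp IF(2) by force
  show "y1 0 = axis 1 (1/pi^2)" "y2 0 = axis 2 (1/pi^2)" by (simp_all add: y1_def y2_def g0 z0_def)
  fix p i assume p: "p \<in> W"
  have "Eq1 i (g (P p)) = 0 \<and> Eq2 i (g (P p)) = 0" using E[OF p] by (auto simp: EF_def P_def vec_eq_iff)
  then show "Eq1 i (p, y1 p, y2 p) = 0" "Eq2 i (p, y1 p, y2 p) = 0" unfolding gp[OF p] by blast+
  obtain D where D: "((%p. g (P p)) has_derivative D) (at p)" using d[OF p] unfolding differentiable_def by blast
  show "\<exists>f'. grad4 (%p. y1 p $ i) f' p"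
   by (rule grad4_ex, unfold y1_def differentiable_def, rule exI, rule bounded_linear.has_derivative[OF bl(1) D])
  show "\<exists>f'. grad4 (%p. y2 p $ i) f' p"
   by (rule grad4_ex, unfold y2_def differentiable_def, rule exI, rule bounded_linear.has_derivative[OF bl(2) D])
 qed
qed

text \<open>The terms with the derivatives \<open>w\<close> of the basis vectors cancel in the trace because \<open>P B\<close> is symmetric, \<open>P = (v\<^sub>a \<bullet> K v\<^sub>b)\<close>.\<close>

lemma trace_derivative:
 fixes K M K' M' :: "real^'n^'n" and v1 v2 w1 w2 :: "real^'n"
 assumes symK: "!!x y. x \<bullet> (K *v y) = y \<bullet> (K *v x)" and symM: "!!x y. x \<bullet> (M *v y) = y \<bullet> (M *v x)"
  and e: "M *v v1 = K *v (\<beta>11 *\<^sub>R v1 + \<beta>21 *\<^sub>R v2)" "M *v v2 = K *v (\<beta>12 *\<^sub>R v1 + \<beta>22 *\<^sub>R v2)"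
  and d: "M' *v v1 + M *v w1 = K' *v (\<beta>11 *\<^sub>R v1 + \<beta>21 *\<^sub>R v2) + K *v (\<gamma>11 *\<^sub>R v1 + \<beta>11 *\<^sub>R w1 + (\<gamma>21 *\<^sub>R v2 + \<beta>21 *\<^sub>R w2))"
   "M' *v v2 + M *v w2 = K' *v (\<beta>12 *\<^sub>R v1 + \<beta>22 *\<^sub>R v2) + K *v (\<gamma>12 *\<^sub>R v1 + \<beta>12 *\<^sub>R w1 + (\<gamma>22 *\<^sub>R v2 + \<beta>22 *\<^sub>R w2))"
 defines "P11 \<equiv> v1 \<bullet> (K *v v1)" and "P12 \<equiv> v1 \<bullet> (K *v v2)" and "P22 \<equiv> v2 \<bullet> (K *v v2)"
 defines "R11 \<equiv> v1 \<bullet> (M' *v v1) - (\<beta>11 * (v1 \<bullet> (K' *v v1)) + \<beta>21 * (v1 \<bullet> (K' *v v2)))"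
  and "R21 \<equiv> v2 \<bullet> (M' *v v1) - (\<beta>11 * (v2 \<bullet> (K' *v v1)) + \<beta>21 * (v2 \<bullet> (K' *v v2)))"
  and "R12 \<equiv> v1 \<bullet> (M' *v v2) - (\<beta>12 * (v1 \<bullet> (K' *v v1)) + \<beta>22 * (v1 \<bullet> (K' *v v2)))"
  and "R22 \<equiv> v2 \<bullet> (M' *v v2) - (\<beta>12 * (v2 \<bullet> (K' *v v1)) + \<beta>22 * (v2 \<bullet> (K' *v v2)))"
 shows "(P11 * P22 - P12 * P12) * (\<gamma>11 + \<gamma>22) = P22 * R11 - P12 * (R21 + R12) + P11 * R22"
proof -
 define k11 k12 k21 k22 where "k11 = v1 \<bullet> (K *v w1)" and "k12 = v1 \<bullet> (K *v w2)" and "k21 = v2 \<bullet> (K *v w1)" and "k22 = v2 \<bullet> (K *v w2)"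
 note mv = matrix_vector_right_distrib matrix_vector_mult_scaleR inner_add_right inner_scaleR_right
 have P21: "v2 \<bullet> (K *v v1) = P12" unfolding P12_def by (rule symK)
 have m: "v1 \<bullet> (M *v w1) = \<beta>11 * k11 + \<beta>21 * k21" "v1 \<bullet> (M *v w2) = \<beta>11 * k12 + \<beta>21 * k22"
  "v2 \<bullet> (M *v w1) = \<beta>12 * k11 + \<beta>22 * k21" "v2 \<bullet> (M *v w2) = \<beta>12 * k12 + \<beta>22 * k22"
  unfolding symM[of v1] symM[of v2] e mv k11_def k12_def k21_def k22_def symK[of w1] symK[of w2] by simp_all
 have S: "\<beta>12 * P11 + \<beta>22 * P12 = \<beta>11 * P12 + \<beta>21 * P22"
  using symM[of v1 v2] unfolding e mv P21 by (simp add: P11_def P12_def P22_def)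
 have q: "R11 + (\<beta>11 * k11 + \<beta>21 * k21) = \<gamma>11 * P11 + \<beta>11 * k11 + (\<gamma>21 * P12 + \<beta>21 * k12)"
  "R21 + (\<beta>12 * k11 + \<beta>22 * k21) = \<gamma>11 * P12 + \<beta>11 * k21 + (\<gamma>21 * P22 + \<beta>21 * k22)"
  "R12 + (\<beta>11 * k12 + \<beta>21 * k22) = \<gamma>12 * P11 + \<beta>12 * k11 + (\<gamma>22 * P12 + \<beta>22 * k12)"
  "R22 + (\<beta>12 * k12 + \<beta>22 * k22) = \<gamma>12 * P12 + \<beta>12 * k21 + (\<gamma>22 * P22 + \<beta>22 * k22)"
  using arg_cong[OF d(1), of "%x. v1 \<bullet> x"] arg_cong[OF d(1), of "%x. v2 \<bullet> x"] arg_cong[OF d(2), of "%x. v1 \<bullet> x"] arg_cong[OF d(2), of "%x. v2 \<bullet> x"]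
  unfolding mv m P21 R11_def R21_def R12_def R22_def P11_def[symmetric] P12_def[symmetric] P22_def[symmetric]
   k11_def[symmetric] k12_def[symmetric] k21_def[symmetric] k22_def[symmetric]
  by linarith+
 \<comment> \<open>\<open>q\<close> pairs the differentiated equations with v1 and v2.
   \<open>S\<close> states that P B is symmetric, and with it all products involving w cancel in the
   combination on the right.\<close>
 show ?thesis using q S by algebra
qed

definition QF :: "('n::finite => 'n => real) => ('n => real) => ('n => real) => real" where
 "QF A a b = (\<Sum>i\<in>UNIV. \<Sum>j\<in>UNIV. a i * (A i j * b j))"

lemma inner_QF: "(\<chi> i. a i) \<bullet> ((\<chi> i j. A i j) *v (\<chi> j. b j)) = QF A a b"
 by (simp add: QF_def inner_vec_def matrix_vector_mult_def sum_distrib_left)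

lemma grad4_sum: "(!!i. i \<in> S ==> grad4 (f i) (f' i) p) ==> grad4 (%p. \<Sum>i\<in>S. f i p) (%q. \<Sum>i\<in>S. f' i q) p"
 by (induct S rule: infinite_finite_induct) (auto intro: grad4_const grad4_add)

lemma grad4_QF:
 assumes "!!i j. grad4 (%p. A p i j) (%q. A' q i j) p" "!!i. grad4 (%p. a p i) (%q. a' q i) p" "!!i. grad4 (%p. b p i) (%q. b' q i) p"
 shows "grad4 (%p. QF (A p) (a p) (b p)) (%q. QF (A p) (a p) (b' q) + QF (A' q) (a p) (b p) + QF (A p) (a' q) (b p)) p"
 unfolding QF_def
 by (rule grad4_cong[OF grad4_sum[OF grad4_sum[OF grad4_mult[OF assms(2) grad4_mult[OF assms(1,3)]]]]])
   (simp add: sum.distrib distrib_left)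

lemma sum_of_bool: "(\<Sum>i\<in>UNIV. of_bool (i = \<alpha>) * g i) = (g \<alpha> :: real)" "(\<Sum>i\<in>UNIV. g i * of_bool (i = \<alpha>)) = g \<alpha>" for \<alpha> :: "'n::finite"
proof -
 have "of_bool (i = \<alpha>) * g i = (if i = \<alpha> then g i else 0)" "g i * of_bool (i = \<alpha>) = (if i = \<alpha> then g i else 0)" for i by simp_all
 then show "(\<Sum>i\<in>UNIV. of_bool (i = \<alpha>) * g i) = g \<alpha>" "(\<Sum>i\<in>UNIV. g i * of_bool (i = \<alpha>)) = g \<alpha>" by (simp_all only:) simp_all
qed

lemma QF_axis: "QF A (%i. of_bool (i = \<alpha>)) b = (\<Sum>j\<in>UNIV. A \<alpha> j * b j)" "QF A a (%j. of_bool (j = \<beta>)) = (\<Sum>i\<in>UNIV. a i * A i \<beta>)"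
 unfolding QF_def by (simp_all only: sum_distrib_left[symmetric] sum_of_bool)

lemma grad4_unique: "grad4 f f' p ==> grad4 f g' p ==> f' q = g' q"
proof -
 assume "grad4 f f' p" "grad4 f g' p"
 then have "(%x::real^4. \<Sum>q\<in>UNIV. f' q * x$q) = (%x. \<Sum>q\<in>UNIV. g' q * x$q)" unfolding grad4_def by (rule has_derivative_unique)
 from fun_cong[OF this, of "axis q 1"] show ?thesis
  by (simp add: axis_def if_distrib cong: if_cong)
qed

lemma grad4_zero:
 assumes "open W" "p \<in> W" "!!x. x \<in> W ==> f x = 0" "grad4 f f' p"
 shows "f' q = 0"
proof -
 have "(f has_derivative (%x. 0)) (at p)"
  by (rule has_derivative_transform_within_open[of "%x. 0" _ _ _ W]) (use assms in auto)
 then have "grad4 f (%q. 0) p" by (simp add: grad4_def)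
 then show ?thesis using grad4_unique[OF assms(4)] by simp
qed

lemma K1_sym: "K1 q p i j = K1 q p j i"
 by (rule grad4_unique[OF grad4_Kt(1)]) (unfold KM_sym(1)[of _ i j], rule grad4_Kt(1))

lemma M1_sym: "norm p <= 1/8 ==> M1 q p i j = M1 q p j i"
 by (rule grad4_unique[OF grad4_Mt]) (assumption, unfold KM_sym(2)[of _ i j], rule grad4_Mt)

text \<open>As functions of p near 0, \<open>y1\<close> and \<open>y2\<close> hold the columns of B
  in components 1, 2 and those of X in components 3 to 5.\<close>

locale branch =
 fixes W and y1 y2 :: "real^4 => real^5"
 assumes openW: "open W" and W0: "0 \<in> W" and Wball: "W \<subseteq> ball 0 (1/8)"
  and y0: "y1 0 = axis 1 (1/pi^2)" "y2 0 = axis 2 (1/pi^2)"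
  and eq1: "!!p i. p \<in> W ==> Eq1 i (p, y1 p, y2 p) = 0" and eq2: "!!p i. p \<in> W ==> Eq2 i (p, y1 p, y2 p) = 0"
  and dy: "!!p i. p \<in> W ==> \<exists>f'. grad4 (%p. y1 p $ i) f' p" "!!p i. p \<in> W ==> \<exists>f'. grad4 (%p. y2 p $ i) f' p"
begin

definition "Y1 q i p = (SOME f'. grad4 (%p. y1 p $ i) f' p) q"
definition "Y2 q i p = (SOME f'. grad4 (%p. y2 p $ i) f' p) q"
definition "v1 p j = vv1 (y1 p) j"
definition "v2 p j = vv2 (y2 p) j"
definition "w1 q p j = (if j = 1 \<or> j = 2 then 0 else Y1 q j p)"
definition "w2 q p j = (if j = 1 \<or> j = 2 then 0 else Y2 q j p)"

lemma Wn: "p \<in> W ==> norm p <= 1/8" using Wball by auto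

lemma gY: "p \<in> W ==> grad4 (%p. y1 p $ i) (%q. Y1 q i p) p" "p \<in> W ==> grad4 (%p. y2 p $ i) (%q. Y2 q i p) p"
 unfolding Y1_def Y2_def using someI_ex[OF dy(1)] someI_ex[OF dy(2)] by auto

lemma gv: "p \<in> W ==> grad4 (%p. v1 p j) (%q. w1 q p j) p" "p \<in> W ==> grad4 (%p. v2 p j) (%q. w2 q p j) p"
 unfolding v1_def v2_def vv1_def vv2_def w1_def w2_def using gY by (cases "j = 1"; cases "j = 2"; simp add: grad4_const)+

lemma E: "p \<in> W ==> (\<Sum>j\<in>UNIV. Mt p i j * v1 p j) - (\<Sum>j\<in>UNIV. Kt p i j * (y1 p $ 1 * v1 p j + y1 p $ 2 * v2 p j)) = 0"
 "p \<in> W ==> (\<Sum>j\<in>UNIV. Mt p i j * v2 p j) - (\<Sum>j\<in>UNIV. Kt p i j * (y2 p $ 1 * v1 p j + y2 p $ 2 * v2 p j)) = 0"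
 using eq1[of p i] eq2[of p i] unfolding Eq1_def Eq2_def v1_def v2_def by simp_all

lemma dE:
 assumes p: "p \<in> W"
 shows "(\<Sum>j\<in>UNIV. Mt p i j * w1 q p j + M1 q p i j * v1 p j)
   - (\<Sum>j\<in>UNIV. Kt p i j * ((y1 p $ 1 * w1 q p j + Y1 q 1 p * v1 p j) + (y1 p $ 2 * w2 q p j + Y1 q 2 p * v2 p j)) + K1 q p i j * (y1 p $ 1 * v1 p j + y1 p $ 2 * v2 p j)) = 0"
  "(\<Sum>j\<in>UNIV. Mt p i j * w2 q p j + M1 q p i j * v2 p j)
   - (\<Sum>j\<in>UNIV. Kt p i j * ((y2 p $ 1 * w1 q p j + Y2 q 1 p * v1 p j) + (y2 p $ 2 * w2 q p j + Y2 q 2 p * v2 p j)) + K1 q p i j * (y2 p $ 1 * v1 p j + y2 p $ 2 * v2 p j)) = 0"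
 by (rule grad4_zero[OF openW p E(1)], assumption, rule grad4_diff[OF grad4_sum[OF grad4_mult[OF grad4_Mt[OF Wn[OF p]] gv(1)[OF p]]]
    grad4_sum[OF grad4_mult[OF grad4_Kt(1) grad4_add[OF grad4_mult[OF gY(1)[OF p] gv(1)[OF p]] grad4_mult[OF gY(1)[OF p] gv(2)[OF p]]]]]])
   (rule grad4_zero[OF openW p E(2)], assumption, rule grad4_diff[OF grad4_sum[OF grad4_mult[OF grad4_Mt[OF Wn[OF p]] gv(2)[OF p]]]
    grad4_sum[OF grad4_mult[OF grad4_Kt(1) grad4_add[OF grad4_mult[OF gY(2)[OF p] gv(1)[OF p]] grad4_mult[OF gY(2)[OF p] gv(2)[OF p]]]]]])

definition "P11 p = QF (Kt p) (v1 p) (v1 p)"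
definition "P12 p = QF (Kt p) (v1 p) (v2 p)"
definition "P22 p = QF (Kt p) (v2 p) (v2 p)"
definition "R11 q p = QF (M1 q p) (v1 p) (v1 p) - (y1 p $ 1 * QF (K1 q p) (v1 p) (v1 p) + y1 p $ 2 * QF (K1 q p) (v1 p) (v2 p))"
definition "R21 q p = QF (M1 q p) (v2 p) (v1 p) - (y1 p $ 1 * QF (K1 q p) (v2 p) (v1 p) + y1 p $ 2 * QF (K1 q p) (v2 p) (v2 p))"
definition "R12 q p = QF (M1 q p) (v1 p) (v2 p) - (y2 p $ 1 * QF (K1 q p) (v1 p) (v1 p) + y2 p $ 2 * QF (K1 q p) (v1 p) (v2 p))"
definition "R22 q p = QF (M1 q p) (v2 p) (v2 p) - (y2 p $ 1 * QF (K1 q p) (v2 p) (v1 p) + y2 p $ 2 * QF (K1 q p) (v2 p) (v2 p))"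
definition "dt p = P11 p * P22 p - P12 p * P12 p"
text \<open>The trace of the inverse of P times R, which by \<open>trace_derivative\<close> is the
  q-th partial derivative of tr B.\<close>

definition "SS q p = (P22 p * R11 q p - P12 p * (R21 q p + R12 q p) + P11 p * R22 q p) * inverse (dt p)"

lemma sym_mat: "(!!i j. A i j = A j i) ==> x \<bullet> ((\<chi> i j. A i j) *v y) = y \<bullet> ((\<chi> i j. A i j) *v (x :: real^5))"
proof -
 assume s: "!!i j. A i j = A j i"
 have "x \<bullet> ((\<chi> i j. A i j) *v y) = (\<Sum>i\<in>UNIV. \<Sum>j\<in>UNIV. x$i * (A i j * y$j))"
  by (simp add: inner_vec_def matrix_vector_mult_def sum_distrib_left)
 also have "\<dots> = (\<Sum>j\<in>UNIV. \<Sum>i\<in>UNIV. x$i * (A i j * y$j))" by (rule sum.swap)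
 also have "\<dots> = y \<bullet> ((\<chi> i j. A i j) *v x)"
  using s by (simp add: inner_vec_def matrix_vector_mult_def sum_distrib_left mult.left_commute mult.commute)
 finally show ?thesis .
qed

lemma trace_grad:
 assumes p: "p \<in> W" and dt: "dt p \<noteq> 0"
 shows "grad4 (%p. y1 p $ 1 + y2 p $ 2) (%q. SS q p) p"
proof (rule grad4_cong[OF grad4_add[OF gY(1)[OF p] gY(2)[OF p]]])
 fix q
 define K M K' M' where "K = (\<chi> i j. Kt p i j)" and "M = (\<chi> i j. Mt p i j)" and "K' = (\<chi> i j. K1 q p i j)" and "M' = (\<chi> i j. M1 q p i j)"
 define x1 x2 u1 u2 where "x1 = (\<chi> i. v1 p i)" and "x2 = (\<chi> i. v2 p i)" and "u1 = (\<chi> i. w1 q p i)" and "u2 = (\<chi> i. w2 q p i)"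
 note defs = K_def M_def K'_def M'_def x1_def x2_def u1_def u2_def
 have "(x1 \<bullet> (K *v x1) * (x2 \<bullet> (K *v x2)) - x1 \<bullet> (K *v x2) * (x1 \<bullet> (K *v x2))) * (Y1 q 1 p + Y2 q 2 p)
  = x2 \<bullet> (K *v x2) * (x1 \<bullet> (M' *v x1) - (y1 p $ 1 * (x1 \<bullet> (K' *v x1)) + y1 p $ 2 * (x1 \<bullet> (K' *v x2))))
   - x1 \<bullet> (K *v x2) * ((x2 \<bullet> (M' *v x1) - (y1 p $ 1 * (x2 \<bullet> (K' *v x1)) + y1 p $ 2 * (x2 \<bullet> (K' *v x2))))
     + (x1 \<bullet> (M' *v x2) - (y2 p $ 1 * (x1 \<bullet> (K' *v x1)) + y2 p $ 2 * (x1 \<bullet> (K' *v x2)))))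
   + x1 \<bullet> (K *v x1) * (x2 \<bullet> (M' *v x2) - (y2 p $ 1 * (x2 \<bullet> (K' *v x1)) + y2 p $ 2 * (x2 \<bullet> (K' *v x2))))"
 proof (rule trace_derivative)
  show "x \<bullet> (K *v y) = y \<bullet> (K *v x)" "x \<bullet> (M *v y) = y \<bullet> (M *v x)" for x y
   unfolding K_def M_def by (rule sym_mat, rule KM_sym)+
  show "M *v x1 = K *v (y1 p $ 1 *\<^sub>R x1 + y1 p $ 2 *\<^sub>R x2)" "M *v x2 = K *v (y2 p $ 1 *\<^sub>R x1 + y2 p $ 2 *\<^sub>R x2)"
   using E[OF p] by (simp_all add: defs vec_eq_iff matrix_vector_mult_def)
  show "M' *v x1 + M *v u1 = K' *v (y1 p $ 1 *\<^sub>R x1 + y1 p $ 2 *\<^sub>R x2) + K *v (Y1 q 1 p *\<^sub>R x1 + y1 p $ 1 *\<^sub>R u1 + (Y1 q 2 p *\<^sub>R x2 + y1 p $ 2 *\<^sub>R u2))"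
   "M' *v x2 + M *v u2 = K' *v (y2 p $ 1 *\<^sub>R x1 + y2 p $ 2 *\<^sub>R x2) + K *v (Y2 q 1 p *\<^sub>R x1 + y2 p $ 1 *\<^sub>R u1 + (Y2 q 2 p *\<^sub>R x2 + y2 p $ 2 *\<^sub>R u2))"
   using dE[OF p, of _ q] by (simp_all add: defs vec_eq_iff matrix_vector_mult_def sum.distrib add.commute add.left_commute)
 qed
 then have "dt p * (Y1 q 1 p + Y2 q 2 p) = P22 p * R11 q p - P12 p * (R21 q p + R12 q p) + P11 p * R22 q p"
  unfolding defs inner_QF dt_def P11_def P12_def P22_def R11_def R21_def R12_def R22_def .
 then show "Y1 q 1 p + Y2 q 2 p = SS q p" using dt by (simp add: SS_def field_simps)
qed

text \<open>Negative reciprocals of the factors found in \<open>EF_derivative_inj\<close>: the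
  denominators of first-order perturbation theory.\<close>

definition cc :: "5 => real" where "cc i = (vector [2/pi^2, 2/pi^2, 4, 2/3, 2/3] :: real^5) $ i"

lemma v_0: "v1 0 = (%j. of_bool (j = 1))" "v2 0 = (%j. of_bool (j = 2))"
 by (rule ext, simp add: v1_def v2_def vv1_def vv2_def y0 axis_def)+

lemma Y_0: "Y1 q i 0 = cc i * NN q i 1" "Y2 q i 0 = cc i * NN q i 2"
proof -
 have a: "(\<Sum>j\<in>UNIV. f j * v1 0 j) = f 1" "(\<Sum>j\<in>UNIV. f j * v2 0 j) = f 2" "(\<Sum>j\<in>UNIV. f j * (s * v1 0 j + t * v2 0 j)) = s * f 1 + t * f 2" for f s t
  by (simp_all add: v_0 sum_5)
 have G: "md $ i * w1 q 0 i + M1 q 0 i 1 - (kd $ i * ((y1 0 $ 1 * w1 q 0 i + Y1 q 1 0 * v1 0 i) + (y1 0 $ 2 * w2 q 0 i + Y1 q 2 0 * v2 0 i)) + (y1 0 $ 1 * K1 q 0 i 1 + y1 0 $ 2 * K1 q 0 i 2)) = 0"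
  "md $ i * w2 q 0 i + M1 q 0 i 2 - (kd $ i * ((y2 0 $ 1 * w1 q 0 i + Y2 q 1 0 * v1 0 i) + (y2 0 $ 2 * w2 q 0 i + Y2 q 2 0 * v2 0 i)) + (y2 0 $ 1 * K1 q 0 i 1 + y2 0 $ 2 * K1 q 0 i 2)) = 0" for i
  using dE[OF W0, of i q] unfolding sum.distrib sum_KM_0 a .
 note d = y0 axis_def w1_def w2_def cc_def v_0 NN_def
 have e11: "Y1 q 1 0 = cc 1 * NN q 1 1" using G(1)[of 1] by (simp add: d; simp add: field_simps)
 have e12: "Y1 q 2 0 = cc 2 * NN q 2 1" using G(1)[of 2] by (simp add: d; simp add: field_simps)
 have e13: "Y1 q 3 0 = cc 3 * NN q 3 1" using G(1)[of 3] by (simp add: d; simp add: field_simps)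
 have e14: "Y1 q 4 0 = cc 4 * NN q 4 1" using G(1)[of 4] by (simp add: d; simp add: field_simps)
 have e15: "Y1 q 5 0 = cc 5 * NN q 5 1" using G(1)[of 5] by (simp add: d; simp add: field_simps)
 have e21: "Y2 q 1 0 = cc 1 * NN q 1 2" using G(2)[of 1] by (simp add: d; simp add: field_simps)
 have e22: "Y2 q 2 0 = cc 2 * NN q 2 2" using G(2)[of 2] by (simp add: d; simp add: field_simps)
 have e23: "Y2 q 3 0 = cc 3 * NN q 3 2" using G(2)[of 3] by (simp add: d; simp add: field_simps)
 have e24: "Y2 q 4 0 = cc 4 * NN q 4 2" using G(2)[of 4] by (simp add: d; simp add: field_simps)
 have e25: "Y2 q 5 0 = cc 5 * NN q 5 2" using G(2)[of 5] by (simp add: d; simp add: field_simps)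
 show "Y1 q i 0 = cc i * NN q i 1" by (rule all_5[where i=i]) (rule e11 e12 e13 e14 e15)+
 show "Y2 q i 0 = cc i * NN q i 2" by (rule all_5[where i=i]) (rule e21 e22 e23 e24 e25)+
qed

lemma grad4_P: "grad4 P11 (%r. K1 r 0 1 1) 0" "grad4 P12 (%r. 0) 0" "grad4 P22 (%r. K1 r 0 2 2) 0"
 unfolding P11_def[abs_def] P12_def[abs_def] P22_def[abs_def]
 by (rule grad4_cong[OF grad4_QF[OF grad4_Kt(1) gv(1)[OF W0] gv(1)[OF W0]]], simp add: v_0 QF_axis sum_of_bool sum_5 KM_0 w1_def)
   (rule grad4_cong[OF grad4_QF[OF grad4_Kt(1) gv(1)[OF W0] gv(2)[OF W0]]], simp add: v_0 QF_axis sum_of_bool sum_5 KM_0 w1_def w2_def K1_0,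
   rule grad4_cong[OF grad4_QF[OF grad4_Kt(1) gv(2)[OF W0] gv(2)[OF W0]]], simp add: v_0 QF_axis sum_of_bool sum_5 KM_0 w2_def)

lemma P_0: "P11 0 = pi^2 / 2" "P12 0 = 0" "P22 0 = pi^2 / 2" "y1 0 $ 1 = 1/pi^2" "y1 0 $ 2 = 0" "y2 0 $ 1 = 0" "y2 0 $ 2 = 1/pi^2"
 by (simp_all add: P11_def P12_def P22_def v_0 QF_axis sum_of_bool KM_0 y0 axis_def)

lemma R_0: "R11 q 0 = NN q 1 1" "R22 q 0 = NN q 2 2"
 by (simp_all add: R11_def R22_def P_0 v_0 QF_axis sum_of_bool NN_def)

lemma grad4_R:
 "grad4 (R11 q) (%r. M2 q r 1 1 - 1/pi^2 * K2 q r 0 1 1 + 2 * (\<Sum>i\<in>UNIV. w1 r 0 i * NN q i 1) - Y1 r 1 0 * K1 q 0 1 1) 0"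
 "grad4 (R22 q) (%r. M2 q r 2 2 - 1/pi^2 * K2 q r 0 2 2 + 2 * (\<Sum>i\<in>UNIV. w2 r 0 i * NN q i 2) - Y2 r 2 0 * K1 q 0 2 2) 0"
 "\<exists>f'. grad4 (R12 q) f' 0" "\<exists>f'. grad4 (R21 q) f' 0"
proof -
 note g = gv(1)[OF W0] gv(2)[OF W0]
 have s: "M1 q 0 1 j = M1 q 0 j 1" "M1 q 0 2 j = M1 q 0 j 2" "K1 q 0 1 j = K1 q 0 j 1" "K1 q 0 2 j = K1 q 0 j 2" for j
  by (rule M1_sym K1_sym, simp?)+
 note s' = s(1)[of 3] s(1)[of 4] s(1)[of 5] s(2)[of 3] s(2)[of 4] s(2)[of 5] s(3)[of 3] s(3)[of 4] s(3)[of 5] s(4)[of 3] s(4)[of 4] s(4)[of 5]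
 show "grad4 (R11 q) (%r. M2 q r 1 1 - 1/pi^2 * K2 q r 0 1 1 + 2 * (\<Sum>i\<in>UNIV. w1 r 0 i * NN q i 1) - Y1 r 1 0 * K1 q 0 1 1) 0"
  unfolding R11_def[abs_def]
  by (rule grad4_cong[OF grad4_diff[OF grad4_QF[OF grad4_M1_0 g(1) g(1)] grad4_add[OF grad4_mult[OF gY(1)[OF W0] grad4_QF[OF grad4_Kt(2) g(1) g(1)]] grad4_mult[OF gY(1)[OF W0] grad4_QF[OF grad4_Kt(2) g(1) g(2)]]]]])
    (simp add: v_0 QF_axis sum_of_bool sum_5 P_0 w1_def s' K1_0 NN_def algebra_simps diff_divide_distrib add_divide_distrib)
 show "grad4 (R22 q) (%r. M2 q r 2 2 - 1/pi^2 * K2 q r 0 2 2 + 2 * (\<Sum>i\<in>UNIV. w2 r 0 i * NN q i 2) - Y2 r 2 0 * K1 q 0 2 2) 0"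
  unfolding R22_def[abs_def]
  by (rule grad4_cong[OF grad4_diff[OF grad4_QF[OF grad4_M1_0 g(2) g(2)] grad4_add[OF grad4_mult[OF gY(2)[OF W0] grad4_QF[OF grad4_Kt(2) g(2) g(1)]] grad4_mult[OF gY(2)[OF W0] grad4_QF[OF grad4_Kt(2) g(2) g(2)]]]]])
    (simp add: v_0 QF_axis sum_of_bool sum_5 P_0 w2_def s' K1_0 NN_def algebra_simps diff_divide_distrib add_divide_distrib)
 show "\<exists>f'. grad4 (R12 q) f' 0" unfolding R12_def[abs_def]
  by (rule exI, rule grad4_diff[OF grad4_QF[OF grad4_M1_0 g(1) g(2)] grad4_add[OF grad4_mult[OF gY(2)[OF W0] grad4_QF[OF grad4_Kt(2) g(1) g(1)]] grad4_mult[OF gY(2)[OF W0] grad4_QF[OF grad4_Kt(2) g(1) g(2)]]]])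
 show "\<exists>f'. grad4 (R21 q) f' 0" unfolding R21_def[abs_def]
  by (rule exI, rule grad4_diff[OF grad4_QF[OF grad4_M1_0 g(2) g(1)] grad4_add[OF grad4_mult[OF gY(1)[OF W0] grad4_QF[OF grad4_Kt(2) g(2) g(1)]] grad4_mult[OF gY(1)[OF W0] grad4_QF[OF grad4_Kt(2) g(2) g(2)]]]])
qed

lemma dt_0: "dt 0 = (pi^2/2)^2" by (simp add: dt_def P_0 power2_eq_square)

lemma grad4_dt: "grad4 dt (%r. pi\<^sup>2/2 * (K1 r 0 1 1 + K1 r 0 2 2)) 0"
 unfolding dt_def[abs_def]
 by (rule grad4_cong[OF grad4_diff[OF grad4_mult[OF grad4_P(1,3)] grad4_mult[OF grad4_P(2,2)]]]) (simp add: P_0 algebra_simps)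

text \<open>Origin of 3232/27: in the b and c directions -32/pi^4 comes from the mean correction in
  the mass matrix, 128/pi^4 from coupling to the mode (1,1) and 640/(27 pi^4) from coupling to (2,0)
  and (0,2). The sum times 2/pi^2 is 2 \<open>rho_sharp\<close>. In the a and d directions no
  further mode is reached, and the second derivative of the trace is 0.\<close>

lemma grad4_SS: "grad4 (SS q) (%r. if q = r then (vector [0, 2 * rho_sharp, 2 * rho_sharp, 0] :: real^4) $ q else 0) 0"
proof -
 obtain f12 f21 where f: "grad4 (R12 q) f12 0" "grad4 (R21 q) f21 0" using grad4_R(3,4) by blast
 have dt: "dt 0 \<noteq> 0" by (simp add: dt_0)
 define RH where "RH r = (M2 q r 1 1 - 1/pi^2 * K2 q r 0 1 1) + (M2 q r 2 2 - 1/pi^2 * K2 q r 0 2 2) + 2 * (\<Sum>i\<in>UNIV. w1 r 0 i * NN q i 1) + 2 * (\<Sum>i\<in>UNIV. w2 r 0 i * NN q i 2)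
   - Y1 r 1 0 * K1 q 0 1 1 - Y2 r 2 0 * K1 q 0 2 2" for r
 have RH: "2/pi^2 * RH r - 4/pi^4 * (K1 r 0 1 1 * NN q 1 1 + K1 r 0 2 2 * NN q 2 2) = (if q = r then (vector [0, 2 * rho_sharp, 2 * rho_sharp, 0] :: real^4) $ q else 0)" for r
  unfolding RH_def trace_second
  by (rule all_4[where q=q]; rule all_4[where q=r])
    (simp_all add: sum_5 w1_def w2_def Y_0 cc_def NN_1 NN_2 K1_0 rho_sharp_def, (simp_all add: field_simps eval_nat_numeral)?)
 show ?thesis unfolding SS_def[abs_def]
 proof (rule grad4_cong[OF grad4_mult[OF grad4_add[OF grad4_diff[OF grad4_mult[OF grad4_P(3) grad4_R(1)] grad4_mult[OF grad4_P(2) grad4_add[OF f(2) f(1)]]] grad4_mult[OF grad4_P(1) grad4_R(2)]] grad4_inverse[OF grad4_dt dt]]])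
  fix r
  show "(P22 0 * R11 q 0 - P12 0 * (R21 q 0 + R12 q 0) + P11 0 * R22 q 0) * (- (pi^2 / 2 * (K1 r 0 1 1 + K1 r 0 2 2)) / (dt 0)^2)
   + (P22 0 * (M2 q r 1 1 - 1 / pi^2 * K2 q r 0 1 1 + 2 * (\<Sum>i\<in>UNIV. w1 r 0 i * NN q i 1) - Y1 r 1 0 * K1 q 0 1 1) + K1 r 0 2 2 * R11 q 0
     - (P12 0 * (f21 r + f12 r) + 0 * (R21 q 0 + R12 q 0))
     + (P11 0 * (M2 q r 2 2 - 1 / pi^2 * K2 q r 0 2 2 + 2 * (\<Sum>i\<in>UNIV. w2 r 0 i * NN q i 2) - Y2 r 2 0 * K1 q 0 2 2) + K1 r 0 1 1 * R22 q 0)) * inverse (dt 0)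
   = (if q = r then (vector [0, 2 * rho_sharp, 2 * rho_sharp, 0] :: real^4) $ q else 0)"
   unfolding RH[symmetric] RH_def P_0 R_0 dt_0 by (simp add: field_simps eval_nat_numeral)
 qed
qed

definition "tr p = (y1 p $ 1 + y2 p $ 2) * (1/2 * inverse (ar p))"
definition "G2 q p = (y1 p $ 1 + y2 p $ 2) * (1/2 * (- ar1 q p * (inverse (ar p) * inverse (ar p)))) + SS q p * (1/2 * inverse (ar p))"

lemma grad4_tr: "p \<in> W ==> dt p \<noteq> 0 ==> grad4 tr (%q. G2 q p) p"
 unfolding tr_def[abs_def] G2_def by (rule grad4_mult[OF trace_grad grad4_cmult[OF grad4_ar_inv[OF Wn]]])

text \<open>The factor 1/(2A) adds 2/pi^2 in the a and d directions, where the trace itself has no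
  second derivative.\<close>

lemma grad4_G2: "grad4 (G2 q) (%r. if q = r then (vector [2/pi^2, rho_sharp, rho_sharp, 2/pi^2] :: real^4) $ q else 0) 0"
proof -
 have dt: "dt 0 \<noteq> 0" by (simp add: dt_0)
 note i = grad4_ar_inv[OF Wn[OF W0]]
 show ?thesis unfolding G2_def[abs_def]
  by (rule grad4_cong[OF grad4_add[OF grad4_mult[OF trace_grad[OF W0 dt] grad4_cmult[OF grad4_mult[OF grad4_minus[OF grad4_ar(2)] grad4_mult[OF i i]]]]
    grad4_mult[OF grad4_SS grad4_cmult[OF i]]]])
    (rename_tac r, rule_tac all_4[where q=q]; rule_tac q=r in all_4; simp add: KM_0 P_0 ar2_def)
qed

end

section \<open>The two smallest eigenvalues\<close>

lemma dim_range_scaleR: "v \<noteq> 0 ==> dim (range (%t::real. t *\<^sub>R v)) = 1" for v :: "real^'n"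
proof -
 assume "v \<noteq> 0"
 then have "independent {v}" by (simp add: independent_insert)
 then show ?thesis using dim_span_eq_card_independent[of "{v}"] by (simp add: span_singleton)
qed

lemma gen_eigenvalue_eqI:
 assumes "k <= (\<Sum>l \<in> gen_eigenvalues A B \<inter> {..t}. dim (gen_eigenspace A B l))"
  and "!!s. s < t ==> (\<Sum>l \<in> gen_eigenvalues A B \<inter> {..s}. dim (gen_eigenspace A B l)) < k"
 shows "gen_eigenvalue k A B = t"
 unfolding gen_eigenvalue_def
proof (rule cInf_eq_minimum)
 show "t \<in> {t. k <= (\<Sum>l \<in> gen_eigenvalues A B \<inter> {..t}. dim (gen_eigenspace A B l))}" using assms(1) by simp
 fix s assume "s \<in> {t. k <= (\<Sum>l \<in> gen_eigenvalues A B \<inter> {..t}. dim (gen_eigenspace A B l))}"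
 then show "t <= s" using assms(2)[of s] by fastforce
qed

text \<open>In the plane of x1 and x2 the problem M x = nu K x has the matrix B. By
  \<open>co\<close> every eigenvector with nu > \<open>\<theta>\<close> lies in this plane, and by
  \<open>big\<close> both eigenvalues of B exceed \<open>\<theta>\<close>. So the two smallest
  generalized eigenvalues are the reciprocals of those of B, with multiplicity.\<close>

lemma two_smallest_eigenvalues:
 fixes K M :: "real^5^5" and x1 x2 :: "real^5"
 assumes symK: "!!x y. x \<bullet> (K *v y) = y \<bullet> (K *v x)" and symM: "!!x y. x \<bullet> (M *v y) = y \<bullet> (M *v x)"
  and posK: "!!x. x \<noteq> 0 ==> 0 < x \<bullet> (K *v x)" and posM: "!!x. x \<noteq> 0 ==> 0 < x \<bullet> (M *v x)"
  and co: "!!x. x \<noteq> 0 ==> x \<bullet> (K *v x1) = 0 ==> x \<bullet> (K *v x2) = 0 ==> x \<bullet> (M *v x) < \<theta> * (x \<bullet> (K *v x))"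
  and \<theta>: "0 < \<theta>"
  and x: "x1 $ 1 = 1" "x1 $ 2 = 0" "x2 $ 1 = 0" "x2 $ 2 = 1"
  and e: "M *v x1 = K *v (\<beta>11 *\<^sub>R x1 + \<beta>21 *\<^sub>R x2)" "M *v x2 = K *v (\<beta>12 *\<^sub>R x1 + \<beta>22 *\<^sub>R x2)"
  and big: "\<theta> < (\<beta>11 + \<beta>22 - sqrt ((\<beta>11 - \<beta>22)^2 + 4 * \<beta>12 * \<beta>21)) / 2"
 shows "1 / gen_eigenvalue 1 K M + 1 / gen_eigenvalue 2 K M = \<beta>11 + \<beta>22"
proof -
 define P11 P12 P22 where "P11 = x1 \<bullet> (K *v x1)" and "P12 = x1 \<bullet> (K *v x2)" and "P22 = x2 \<bullet> (K *v x2)"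
 note mv = matrix_vector_right_distrib matrix_vector_mult_scaleR inner_add_right inner_scaleR_right
 have P21: "x2 \<bullet> (K *v x1) = P12" unfolding P12_def by (rule symK)
 have comp: "(a1 *\<^sub>R x1 + a2 *\<^sub>R x2) $ 1 = a1" "(a1 *\<^sub>R x1 + a2 *\<^sub>R x2) $ 2 = a2" for a1 a2 by (simp_all add: x)
 have nz: "a1 *\<^sub>R x1 + a2 *\<^sub>R x2 \<noteq> 0" if "a1 \<noteq> 0 \<or> a2 \<noteq> 0" for a1 a2
  using comp[of a1 a2] that by (metis zero_index)
 have quad: "(a1 *\<^sub>R x1 + a2 *\<^sub>R x2) \<bullet> (K *v (a1 *\<^sub>R x1 + a2 *\<^sub>R x2)) = a1^2 * P11 + 2 * a1 * a2 * P12 + a2^2 * P22" for a1 a2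
  unfolding mv inner_add_left inner_scaleR_left P21 P11_def[symmetric] P12_def[symmetric] P22_def[symmetric]
  by (simp add: algebra_simps power2_eq_square)
 have P11: "P11 > 0" using posK[OF nz[of 1 0]] quad[of 1 0] by simp
 have det: "P11 * P22 - P12\<^sup>2 > 0"
 proof -
  have "0 < (- P12)\<^sup>2 * P11 + 2 * (- P12) * P11 * P12 + P11^2 * P22"
   using posK[OF nz[of "- P12" P11]] quad[of "- P12" P11] P11 by simp
  also have "\<dots> = P11 * (P11 * P22 - P12\<^sup>2)" by (simp add: algebra_simps power2_eq_square)
  finally show ?thesis using P11 by (simp add: zero_less_mult_iff)
 qed
 have S: "\<beta>12 * P11 + \<beta>22 * P12 = \<beta>11 * P12 + \<beta>21 * P22"
  using symM[of x1 x2] unfolding e mv P21 by (simp add: P11_def P12_def P22_def)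
 define D where "D = (\<beta>11 - \<beta>22)^2 + 4 * \<beta>12 * \<beta>21"
 \<comment> \<open>B is self-adjoint for the form P, so its discriminant is nonnegative and vanishes
   only if B is scalar; completing the square shows both.\<close>
 have D_eq: "P11^2 * D = ((\<beta>11 - \<beta>22) * P11 + 2 * \<beta>21 * P12)^2 + 4 * \<beta>21\<^sup>2 * (P11 * P22 - P12\<^sup>2)"
 proof -
  have "P11 * \<beta>12 = (\<beta>11 - \<beta>22) * P12 + \<beta>21 * P22" using S by (simp add: algebra_simps)
  moreover have "P11^2 * (4 * \<beta>12 * \<beta>21) = 4 * \<beta>21 * P11 * (P11 * \<beta>12)" by (simp add: power2_eq_square mult_ac)
  ultimately have "P11^2 * (4 * \<beta>12 * \<beta>21) = 4 * \<beta>21 * P11 * ((\<beta>11 - \<beta>22) * P12 + \<beta>21 * P22)" by (simp only:)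
  then show ?thesis unfolding D_def by (simp add: algebra_simps power2_eq_square)
 qed
 have D0: "D \<ge> 0"
 proof -
  have "P11^2 * D \<ge> 0" unfolding D_eq using det by simp
  then show ?thesis using P11 by (simp add: zero_le_mult_iff)
 qed
 have D_zero: "\<beta>11 = \<beta>22 \<and> \<beta>21 = 0 \<and> \<beta>12 = 0" if "D = 0"
 proof -
  have z: "((\<beta>11 - \<beta>22) * P11 + 2 * \<beta>21 * P12)^2 + 4 * \<beta>21\<^sup>2 * (P11 * P22 - P12\<^sup>2) = 0" using D_eq that by simp
  have "0 <= 4 * \<beta>21\<^sup>2 * (P11 * P22 - P12\<^sup>2)" using det by simp
  then have "4 * \<beta>21\<^sup>2 * (P11 * P22 - P12\<^sup>2) = 0" using z zero_le_power2[of "(\<beta>11 - \<beta>22) * P11 + 2 * \<beta>21 * P12"] by linarith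
  then have b: "\<beta>21 = 0" using det by simp
  then have "\<beta>11 = \<beta>22" using z P11 by simp
  then show ?thesis using b S P11 by simp
 qed
 define \<nu>1 \<nu>2 where "\<nu>1 = (\<beta>11 + \<beta>22 + sqrt D) / 2" and "\<nu>2 = (\<beta>11 + \<beta>22 - sqrt D) / 2"
 have \<nu>: "\<theta> < \<nu>2" "\<nu>2 <= \<nu>1" "\<nu>1 + \<nu>2 = \<beta>11 + \<beta>22" using big D0 by (simp_all add: \<nu>1_def \<nu>2_def D_def field_simps)
 have char: "(\<beta>11 - \<nu>) * (\<beta>22 - \<nu>) - \<beta>12 * \<beta>21 = (\<nu> - \<nu>1) * (\<nu> - \<nu>2)" for \<nu>
 proof -
  have "(\<nu> - \<nu>1) * (\<nu> - \<nu>2) = \<nu>\<^sup>2 - (\<beta>11 + \<beta>22) * \<nu> + ((\<beta>11 + \<beta>22)^2 - (sqrt D)\<^sup>2) / 4"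
   unfolding \<nu>1_def \<nu>2_def by (simp add: field_simps power2_eq_square)
  also have "(sqrt D)^2 = D" using D0 by simp
  finally show ?thesis by (simp add: D_def field_simps power2_eq_square)
 qed
 define Sol where "Sol \<nu> = {a :: real \<times> real. \<beta>11 * fst a + \<beta>12 * snd a = \<nu> * fst a \<and> \<beta>21 * fst a + \<beta>22 * snd a = \<nu> * snd a}" for \<nu>
 have eig: "(K *v z = l *\<^sub>R (M *v z)) \<longleftrightarrow> (\<exists>a \<in> Sol (1 / l). z = fst a *\<^sub>R x1 + snd a *\<^sub>R x2)" if l: "0 < l" "l < 1 / \<theta>" for l z
 proof -
  define \<nu> where "\<nu> = 1 / l"
  have \<nu>\<theta>: "\<theta> < \<nu>" using l \<theta> by (simp add: \<nu>_def field_simps)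
  have iff: "(K *v z = l *\<^sub>R (M *v z)) \<longleftrightarrow> M *v z = \<nu> *\<^sub>R (K *v z)"
  proof
   assume "K *v z = l *\<^sub>R (M *v z)"
   then show "M *v z = \<nu> *\<^sub>R (K *v z)" using l by (simp add: \<nu>_def)
  next
   assume "M *v z = \<nu> *\<^sub>R (K *v z)"
   then show "K *v z = l *\<^sub>R (M *v z)" using l by (simp add: \<nu>_def)
  qed
  have MV: "M *v (a1 *\<^sub>R x1 + a2 *\<^sub>R x2) = K *v ((\<beta>11 * a1 + \<beta>12 * a2) *\<^sub>R x1 + (\<beta>21 * a1 + \<beta>22 * a2) *\<^sub>R x2)" for a1 a2
   unfolding matrix_vector_right_distrib matrix_vector_mult_scaleR e by (simp add: algebra_simps)
  show ?thesis unfolding iff \<nu>_def[symmetric]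
  proof
   assume ev: "M *v z = \<nu> *\<^sub>R (K *v z)"
   define h1 h2 where "h1 = z \<bullet> (K *v x1)" and "h2 = z \<bullet> (K *v x2)"
   define dd where "dd = P11 * P22 - P12\<^sup>2"
   define a1 a2 where "a1 = (P22 * h1 - P12 * h2) / dd" and "a2 = (P11 * h2 - P12 * h1) / dd"
   have dd: "dd \<noteq> 0" using det by (simp add: dd_def)
   have a: "a1 * P11 + a2 * P12 = h1" "a1 * P12 + a2 * P22 = h2"
   proof -
    have "(a1 * P11 + a2 * P12) * dd = h1 * dd" "(a1 * P12 + a2 * P22) * dd = h2 * dd"
     using dd unfolding a1_def a2_def by (simp_all add: distrib_right) (simp_all add: dd_def algebra_simps power2_eq_square)
    then show "a1 * P11 + a2 * P12 = h1" "a1 * P12 + a2 * P22 = h2" using dd by simp_all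
   qed
   \<comment> \<open>d is the part of z that is K-orthogonal to the plane. Pairing the eigenvalue
     equation with d removes the plane and contradicts \<open>co\<close> unless d = 0.\<close>
   define d where "d = z - (a1 *\<^sub>R x1 + a2 *\<^sub>R x2)"
   have zd: "z = d + (a1 *\<^sub>R x1 + a2 *\<^sub>R x2)" by (simp add: d_def)
   have o: "d \<bullet> (K *v x1) = 0" "d \<bullet> (K *v x2) = 0"
    unfolding d_def inner_diff_left inner_add_left inner_scaleR_left h1_def[symmetric] h2_def[symmetric] P21 P11_def[symmetric] P12_def[symmetric] P22_def[symmetric]
    using a by simp_all
   define c1 c2 where "c1 = \<beta>11 * a1 + \<beta>12 * a2" and "c2 = \<beta>21 * a1 + \<beta>22 * a2"
   have eq: "M *v d + K *v (c1 *\<^sub>R x1 + c2 *\<^sub>R x2) = \<nu> *\<^sub>R (K *v d) + K *v ((\<nu> * a1) *\<^sub>R x1 + (\<nu> * a2) *\<^sub>R x2)"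
    using ev unfolding zd matrix_vector_right_distrib[of _ d] MV c1_def[symmetric] c2_def[symmetric]
    by (simp add: matrix_vector_right_distrib matrix_vector_mult_scaleR scaleR_add_right)
   have d0: "d = 0"
   proof (rule ccontr)
    assume d: "d \<noteq> 0"
    have "d \<bullet> (M *v d) = \<nu> * (d \<bullet> (K *v d))"
     using arg_cong[OF eq, of "%x. d \<bullet> x"] unfolding mv o by simp
    moreover have "d \<bullet> (M *v d) < \<theta> * (d \<bullet> (K *v d))" by (rule co[OF d o])
    moreover have "\<theta> * (d \<bullet> (K *v d)) <= \<nu> * (d \<bullet> (K *v d))" using \<nu>\<theta> posK[OF d] by (intro mult_right_mono) auto
    ultimately show False by linarith
   qed
   have "K *v ((c1 - \<nu> * a1) *\<^sub>R x1 + (c2 - \<nu> * a2) *\<^sub>R x2) = 0"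
    using eq unfolding d0 by (simp add: matrix_vector_right_distrib matrix_vector_mult_scaleR scaleR_left_diff_distrib algebra_simps)
   then have "(c1 - \<nu> * a1) *\<^sub>R x1 + (c2 - \<nu> * a2) *\<^sub>R x2 = 0" using posK by (metis inner_zero_right less_irrefl)
   then have "c1 - \<nu> * a1 = 0" "c2 - \<nu> * a2 = 0" using nz by blast+
   then have "(a1, a2) \<in> Sol \<nu>" by (simp add: Sol_def c1_def c2_def)
   moreover have "z = a1 *\<^sub>R x1 + a2 *\<^sub>R x2" using zd d0 by simp
   ultimately show "\<exists>a \<in> Sol \<nu>. z = fst a *\<^sub>R x1 + snd a *\<^sub>R x2" by force
  next
   assume "\<exists>a \<in> Sol \<nu>. z = fst a *\<^sub>R x1 + snd a *\<^sub>R x2"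
   then obtain a where a: "a \<in> Sol \<nu>" "z = fst a *\<^sub>R x1 + snd a *\<^sub>R x2" by blast
   have "M *v z = K *v ((\<nu> * fst a) *\<^sub>R x1 + (\<nu> * snd a) *\<^sub>R x2)" using a(1) unfolding a(2) MV by (simp add: Sol_def)
   also have "\<dots> = \<nu> *\<^sub>R (K *v z)" unfolding a(2) by (simp add: matrix_vector_right_distrib matrix_vector_mult_scaleR scaleR_add_right)
   finally show "M *v z = \<nu> *\<^sub>R (K *v z)" .
  qed
 qed
 have pos: "0 < l" if lG: "l \<in> gen_eigenvalues K M" for l
 proof -
  obtain z where z: "z \<noteq> 0" "K *v z = l *\<^sub>R (M *v z)" using lG unfolding gen_eigenvalues_def by blast
  have "z \<bullet> (K *v z) = l * (z \<bullet> (M *v z))" using z(2) by simp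
  then show ?thesis using posK[OF z(1)] posM[OF z(1)] by (metis zero_less_mult_pos2)
 qed
 have \<nu>0: "0 < \<nu>2" "0 < \<nu>1" using \<nu> \<theta> by linarith+
 have lam: "1 / \<nu>1 <= 1 / \<nu>2" "1 / \<nu>2 < 1 / \<theta>" "0 < 1 / \<nu>1" "0 < 1 / \<nu>2" using \<nu> \<theta> \<nu>0 by (simp_all add: field_simps)
 have Sol_nz: "\<nu> = \<nu>1 \<or> \<nu> = \<nu>2" if "a \<in> Sol \<nu>" "a \<noteq> 0" for a \<nu>
 proof -
  have s: "(\<beta>11 - \<nu>) * fst a + \<beta>12 * snd a = 0" "\<beta>21 * fst a + (\<beta>22 - \<nu>) * snd a = 0" using that(1) by (simp_all add: Sol_def algebra_simps)
  have "((\<beta>11 - \<nu>) * (\<beta>22 - \<nu>) - \<beta>12 * \<beta>21) * fst a = 0" "((\<beta>11 - \<nu>) * (\<beta>22 - \<nu>) - \<beta>12 * \<beta>21) * snd a = 0"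
   using s by algebra+
  then have "(\<beta>11 - \<nu>) * (\<beta>22 - \<nu>) - \<beta>12 * \<beta>21 = 0" using that(2) by (auto simp: prod_eq_iff)
  then show ?thesis unfolding char by simp
 qed
 have sub: "gen_eigenvalues K M \<inter> {..t} \<subseteq> {1 / \<nu>1, 1 / \<nu>2}" if t: "t <= 1 / \<nu>2" for t
 proof
  fix l assume l: "l \<in> gen_eigenvalues K M \<inter> {..t}"
  then obtain z where z: "z \<noteq> 0" "K *v z = l *\<^sub>R (M *v z)" unfolding gen_eigenvalues_def by blast
  have l': "0 < l" "l < 1 / \<theta>" using pos[of l] l t lam(2) by auto
  obtain a where a: "a \<in> Sol (1 / l)" "z = fst a *\<^sub>R x1 + snd a *\<^sub>R x2" using z(2) eig[OF l'] by blast
  have "a \<noteq> 0" using a(2) z(1) by auto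
  from Sol_nz[OF a(1) this] show "l \<in> {1 / \<nu>1, 1 / \<nu>2}" by auto
 qed
 show ?thesis
 proof (cases "D = 0")
  \<comment> \<open>B is scalar: a single value whose eigenspace is the whole plane, so both counts
    are reached there at once.\<close>
  case True
  have \<nu>12: "\<nu>1 = \<nu>2" using True by (simp add: \<nu>1_def \<nu>2_def)
  have b: "\<beta>11 = \<nu>2" "\<beta>22 = \<nu>2" "\<beta>12 = 0" "\<beta>21 = 0" using D_zero[OF True] True by (simp_all add: \<nu>2_def)
  have SolU: "Sol \<nu>2 = UNIV" by (auto simp: Sol_def b)
  have sp: "gen_eigenspace K M (1 / \<nu>2) = span {x1, x2}"
  proof (rule set_eqI)
   fix z
   show "z \<in> gen_eigenspace K M (1 / \<nu>2) \<longleftrightarrow> z \<in> span {x1, x2}"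
    unfolding gen_eigenspace_def mem_Collect_eq eig[OF lam(4) lam(2)] by (simp add: SolU span_insert span_singleton) (metis diff_eq_eq add.commute fst_conv snd_conv)
  qed
  have ne: "x1 \<noteq> x2" using x by auto
  have "x1 \<notin> span {x2}"
  proof
   assume "x1 \<in> span {x2}"
   then obtain t where "x1 = t *\<^sub>R x2" by (auto simp: span_singleton)
   then have "x1 $ 1 = t * x2 $ 1" by simp
   then show False using x by simp
  qed
  moreover have "x2 \<noteq> 0" using x by auto
  ultimately have "independent {x1, x2}" using ne by (simp add: independent_insert)
  then have dim: "dim (gen_eigenspace K M (1 / \<nu>2)) = 2" unfolding sp using ne by (simp add: dim_eq_card_independent)
  have "K *v x1 = (1 / \<nu>2) *\<^sub>R (M *v x1)"
   unfolding eig[OF lam(4) lam(2)] by (rule bexI[of _ "(1, 0)"]) (simp_all add: SolU)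
  moreover have "x1 \<noteq> 0" using x by auto
  ultimately have "1 / \<nu>2 \<in> gen_eigenvalues K M" unfolding gen_eigenvalues_def by blast
  then have I: "gen_eigenvalues K M \<inter> {..1 / \<nu>2} = {1 / \<nu>2}" using sub[of "1 / \<nu>2"] \<nu>12 by auto
  have I': "gen_eigenvalues K M \<inter> {..s} = {}" if "s < 1 / \<nu>2" for s using sub[of s] that \<nu>12 by auto
  have "gen_eigenvalue 1 K M = 1 / \<nu>2" "gen_eigenvalue 2 K M = 1 / \<nu>2"
   by (rule gen_eigenvalue_eqI; simp add: I I' dim)+
  then show ?thesis using \<nu>(3) \<nu>12 by simp
 next
  case False
  then have lt: "\<nu>2 < \<nu>1" using D0 by (simp add: \<nu>1_def \<nu>2_def)
  have lamlt: "1 / \<nu>1 < 1 / \<nu>2" using lt \<nu>0 by (simp add: field_simps)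
  have line: "\<exists>v. v \<noteq> 0 \<and> gen_eigenspace K M (1 / \<nu>) = range (%t. t *\<^sub>R v)" if "\<nu> = \<nu>1 \<or> \<nu> = \<nu>2" for \<nu>
  proof -
   have l: "0 < 1 / \<nu>" "1 / \<nu> < 1 / \<theta>" using that lam by auto
   have inv: "1 / (1 / \<nu>) = \<nu>" by simp
   have ch: "(\<beta>11 - \<nu>) * (\<beta>22 - \<nu>) = \<beta>12 * \<beta>21" using char[of \<nu>] that by auto
   have "\<exists>b. b \<noteq> 0 \<and> Sol \<nu> = range (%t. t *\<^sub>R b)"
   \<comment> \<open>An eigenvector is read off from a nonzero row of B - nu; both rows vanish only
     if D = 0.\<close>
   proof (cases "\<beta>11 - \<nu> = 0 \<and> \<beta>12 = 0")
    case False
    define n where "n = (\<beta>11 - \<nu>)^2 + \<beta>12\<^sup>2"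
    have n: "n \<noteq> 0" using False by (simp add: n_def sum_power2_eq_zero_iff)
    have "Sol \<nu> = range (%t. t *\<^sub>R (\<beta>12, \<nu> - \<beta>11))"
    proof (rule set_eqI, rule iffI)
     fix a assume "a \<in> Sol \<nu>"
     then have s: "(\<beta>11 - \<nu>) * fst a + \<beta>12 * snd a = 0" by (simp add: Sol_def algebra_simps)
     define t where "t = (\<beta>12 * fst a + (\<nu> - \<beta>11) * snd a) / n"
     have "n * fst a = (\<beta>12 * fst a + (\<nu> - \<beta>11) * snd a) * \<beta>12" "n * snd a = (\<beta>12 * fst a + (\<nu> - \<beta>11) * snd a) * (\<nu> - \<beta>11)"
      using s unfolding n_def by algebra+
     then have "fst a = t * \<beta>12" "snd a = t * (\<nu> - \<beta>11)" using n by (simp_all add: t_def field_simps)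
     then show "a \<in> range (%t. t *\<^sub>R (\<beta>12, \<nu> - \<beta>11))" by (intro range_eqI[of _ _ t]) (simp add: prod_eq_iff)
    next
     fix a assume "a \<in> range (%t. t *\<^sub>R (\<beta>12, \<nu> - \<beta>11))"
     then obtain t where a: "a = t *\<^sub>R (\<beta>12, \<nu> - \<beta>11)" by blast
     have "\<beta>21 * (t * \<beta>12) + \<beta>22 * (t * (\<nu> - \<beta>11)) = \<nu> * (t * (\<nu> - \<beta>11))" using ch by algebra
     then show "a \<in> Sol \<nu>" unfolding a by (simp add: Sol_def algebra_simps)
    qed
    moreover have "(\<beta>12, \<nu> - \<beta>11) \<noteq> 0" using False by (auto simp: zero_prod_def)
    ultimately show ?thesis by blast
   next
    case True
    have F2: "\<not> (\<beta>21 = 0 \<and> \<beta>22 - \<nu> = 0)"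
    proof
     assume "\<beta>21 = 0 \<and> \<beta>22 - \<nu> = 0"
     then have "D = 0" using True by (simp add: D_def)
     then show False using \<open>D \<noteq> 0\<close> by simp
    qed
    define n where "n = \<beta>21\<^sup>2 + (\<beta>22 - \<nu>)^2"
    have n: "n \<noteq> 0" using F2 by (simp add: n_def sum_power2_eq_zero_iff)
    have "Sol \<nu> = range (%t. t *\<^sub>R (\<nu> - \<beta>22, \<beta>21))"
    proof (rule set_eqI, rule iffI)
     fix a assume "a \<in> Sol \<nu>"
     then have s: "\<beta>21 * fst a + (\<beta>22 - \<nu>) * snd a = 0" by (simp add: Sol_def algebra_simps)
     define t where "t = ((\<nu> - \<beta>22) * fst a + \<beta>21 * snd a) / n"
     have "n * fst a = ((\<nu> - \<beta>22) * fst a + \<beta>21 * snd a) * (\<nu> - \<beta>22)" "n * snd a = ((\<nu> - \<beta>22) * fst a + \<beta>21 * snd a) * \<beta>21"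
      using s unfolding n_def by algebra+
     then have "fst a = t * (\<nu> - \<beta>22)" "snd a = t * \<beta>21" using n by (simp_all add: t_def field_simps)
     then show "a \<in> range (%t. t *\<^sub>R (\<nu> - \<beta>22, \<beta>21))" by (intro range_eqI[of _ _ t]) (simp add: prod_eq_iff)
    next
     fix a assume "a \<in> range (%t. t *\<^sub>R (\<nu> - \<beta>22, \<beta>21))"
     then obtain t where a: "a = t *\<^sub>R (\<nu> - \<beta>22, \<beta>21)" by blast
     show "a \<in> Sol \<nu>" unfolding a using True by (simp add: Sol_def algebra_simps)
    qed
    moreover have "(\<nu> - \<beta>22, \<beta>21) \<noteq> 0" using F2 by (auto simp: zero_prod_def)
    ultimately show ?thesis by blast
   qed
   then obtain b where b: "b \<noteq> 0" "Sol \<nu> = range (%t. t *\<^sub>R b)" by blast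
   define v where "v = fst b *\<^sub>R x1 + snd b *\<^sub>R x2"
   have "v \<noteq> 0" unfolding v_def by (rule nz) (use b(1) in \<open>auto simp: prod_eq_iff\<close>)
   moreover have "gen_eigenspace K M (1 / \<nu>) = range (%t. t *\<^sub>R v)"
    unfolding gen_eigenspace_def eig[OF l] inv b(2) v_def by (auto simp: scaleR_add_right)
   ultimately show ?thesis by blast
  qed
  have dim: "dim (gen_eigenspace K M (1 / \<nu>)) = 1" and mem: "1 / \<nu> \<in> gen_eigenvalues K M" if n: "\<nu> = \<nu>1 \<or> \<nu> = \<nu>2" for \<nu>
  proof -
   obtain v where v: "v \<noteq> 0" "gen_eigenspace K M (1 / \<nu>) = range (%t. t *\<^sub>R v)" using line[OF n] by blast
   show "dim (gen_eigenspace K M (1 / \<nu>)) = 1" unfolding v(2) by (rule dim_range_scaleR[OF v(1)])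
   have "v \<in> range (%t. t *\<^sub>R v)" by (rule range_eqI[of _ _ 1]) simp
   then have "v \<in> gen_eigenspace K M (1 / \<nu>)" unfolding v(2) .
   then show "1 / \<nu> \<in> gen_eigenvalues K M" unfolding gen_eigenvalues_def gen_eigenspace_def using v(1) by blast
  qed
  have I2: "gen_eigenvalues K M \<inter> {..1 / \<nu>2} = {1 / \<nu>1, 1 / \<nu>2}" using sub[of "1 / \<nu>2"] mem lam(1) by auto
  have I1: "gen_eigenvalues K M \<inter> {..s} = {1 / \<nu>1}" if "1 / \<nu>1 <= s" "s < 1 / \<nu>2" for s using sub[of s] mem[of \<nu>1] that by auto
  have I0: "gen_eigenvalues K M \<inter> {..s} = {}" if "s < 1 / \<nu>1" for s using sub[of s] that lamlt by auto
  have "gen_eigenvalue 1 K M = 1 / \<nu>1"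
   by (rule gen_eigenvalue_eqI) (simp_all add: I0 I1[OF order_refl lamlt] dim)
  moreover have "gen_eigenvalue 2 K M = 1 / \<nu>2"
  proof (rule gen_eigenvalue_eqI)
   have s2: "sum f {a, b} = f a + (f b :: nat)" if "a \<noteq> b" for f and a b :: real using that by simp
   have d12: "dim (gen_eigenspace K M (1 / \<nu>1)) = 1" "dim (gen_eigenspace K M (1 / \<nu>2)) = 1" by (rule dim; simp)+
   show "2 <= (\<Sum>l\<in>gen_eigenvalues K M \<inter> {..1 / \<nu>2}. dim (gen_eigenspace K M l))"
    unfolding I2 s2[OF less_imp_neq[OF lamlt]] d12 by simp
   fix s assume s: "s < 1 / \<nu>2"
   show "(\<Sum>l\<in>gen_eigenvalues K M \<inter> {..s}. dim (gen_eigenspace K M l)) < 2"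
   proof (cases "1 / \<nu>1 <= s")
    case True
    show ?thesis unfolding I1[OF True s] using d12(1) by simp
   next
    case False
    then have "s < 1 / \<nu>1" by simp
    from I0[OF this] show ?thesis by simp
   qed
  qed
  ultimately show ?thesis using \<nu>(3) by simp
 qed
qed

section \<open>The function \<open>f2\<close> near the origin\<close>

lemma isCont_nhds: "isCont f x ==> 0 < e ==> \<forall>\<^sub>F y in nhds x. \<bar>f y - f x\<bar> < (e :: real)" for f :: "real^4 => real"
 unfolding isCont_def tendsto_at_iff_tendsto_nhds by (drule (1) tendstoD) (simp add: dist_real_def)

text \<open>The diagonal contributes at least m |x|^2. Entrywise deviations below m/10 in a 5 by 5
  matrix cost at most half of it.\<close>

lemma posdef_near:
 fixes A :: "real^4 => 5 => 5 => real"
 assumes c: "!!i j. isCont (%p. A p i j) 0" and A0: "!!i j. A 0 i j = (if i = j then d i else 0)"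
  and d: "!!i. m <= d i" and m: "0 < m"
 shows "\<forall>\<^sub>F p in nhds 0. \<forall>x::real^5. x \<noteq> 0 --> 0 < QF (A p) (%i. x$i) (%i. x$i)"
proof -
 have "\<forall>\<^sub>F p in nhds 0. \<forall>i\<in>UNIV. \<forall>j\<in>UNIV. \<bar>A p i j - A 0 i j\<bar> < m / 10"
  using m by (intro eventually_ball_finite ballI isCont_nhds c) auto
 then show ?thesis
 proof eventually_elim
  fix p assume near: "\<forall>i\<in>UNIV. \<forall>j\<in>UNIV. \<bar>A p i j - A 0 i j\<bar> < m / 10"
  show "\<forall>x::real^5. x \<noteq> 0 --> 0 < QF (A p) (%i. x$i) (%i. x$i)"
  proof (intro allI impI)
   fix x :: "real^5" assume "x \<noteq> 0"
   define X where "X = (\<Sum>i\<in>UNIV. (x$i)\<^sup>2)"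
   have "X = x \<bullet> x" by (simp add: X_def inner_vec_def power2_eq_square)
   then have X: "X > 0" using \<open>x \<noteq> 0\<close> by simp
   have t: "x$i * (A p i j * x$j) \<ge> (if i = j then m * (x$i)^2 else 0) - m / 20 * ((x$i)^2 + (x$j)^2)" for i j
   proof -
    have "\<bar>(A p i j - A 0 i j) * (x$i * x$j)\<bar> <= m / 10 * (((x$i)^2 + (x$j)^2) / 2)"
    proof (rule abs_mult_le)
     show "\<bar>A p i j - A 0 i j\<bar> <= m / 10" using near by (simp add: less_imp_le)
     show "\<bar>x$i * x$j\<bar> <= ((x$i)^2 + (x$j)^2) / 2"
      using sum_squares_bound[of "\<bar>x$i\<bar>" "\<bar>x$j\<bar>"] by (simp add: abs_mult)
    qed
    moreover have "A 0 i j * (x$i * x$j) \<ge> (if i = j then m * (x$i)^2 else 0)"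
     by (cases "i = j") (auto simp: A0 power2_eq_square intro!: mult_right_mono d)
    moreover have "x$i * (A p i j * x$j) = A 0 i j * (x$i * x$j) + (A p i j - A 0 i j) * (x$i * x$j)" by (simp add: algebra_simps)
    ultimately show ?thesis by (simp only: abs_le_iff) (simp add: field_simps)
   qed
   have "(\<Sum>i\<in>UNIV. \<Sum>j\<in>UNIV. (if i = j then m * (x$i)^2 else 0) - m / 20 * ((x$i)^2 + (x$j)^2)) <= QF (A p) (%i. x$i) (%i. x$i)"
    unfolding QF_def by (intro sum_mono t)
   moreover have "(\<Sum>i\<in>UNIV. \<Sum>j\<in>UNIV. (if i = j then m * (x$i)^2 else 0) - m / 20 * ((x$i)^2 + (x$j)^2)) = m * X - m / 20 * (5 * X + 5 * X)"
    unfolding X_def by (simp add: sum_5) (simp add: field_simps)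
   moreover have "m * X - m / 20 * (5 * X + 5 * X) = m * X / 2" by (simp add: field_simps)
   moreover have "0 < m * X / 2" using m X by simp
   ultimately show "0 < QF (A p) (%i. x$i) (%i. x$i)" by linarith
  qed
 qed
qed

text \<open>On vectors orthogonal to f and g the squares vanish, so definiteness of the combination
  gives the strict inequality between the forms there. Unlike a condition on a complement that moves
  with p, definiteness is an open condition.\<close>

lemma QF_combination:
 "QF (%i j. \<theta> * A i j - B i j + (f i * f j + g i * g j)) a a = \<theta> * QF A a a - QF B a a + ((\<Sum>i\<in>UNIV. a i * f i)^2 + (\<Sum>i\<in>UNIV. a i * g i)^2)"
proof -
 have p: "(\<Sum>i\<in>UNIV. (a i * f i) * (\<Sum>j\<in>UNIV. a j * f j)) = (\<Sum>i\<in>UNIV. a i * f i)^2" for f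
  by (simp add: power2_eq_square sum_distrib_right)
 have "a i * ((\<theta> * A i j - B i j + (f i * f j + g i * g j)) * a j)
  = \<theta> * (a i * (A i j * a j)) - a i * (B i j * a j) + ((a i * f i) * (a j * f j) + (a i * g i) * (a j * g j))" for i j
  by (simp add: algebra_simps)
 then show ?thesis unfolding QF_def by (simp only: sum.distrib sum_subtractf sum_distrib_left[symmetric] p)
qed

lemma grad4_isCont: "grad4 f f' p ==> isCont f p"
 unfolding grad4_def by (rule has_derivative_continuous)

lemma QF_vec: "x \<bullet> ((\<chi> i j. A i j) *v x) = QF A (%i. x$i) (%i. x$i)"
 using inner_QF[of "%i. x$i" A "%i. x$i"] by simp

context branch begin

text \<open>The trace exceeds 9/5 nu, and the root of the discriminant is at most 3/10 nu.\<close>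

lemma spectral_gap:
 assumes small: "\<bar>\<beta>11 - \<nu>\<bar> < \<nu> / 10" "\<bar>\<beta>21\<bar> < \<nu> / 10" "\<bar>\<beta>12\<bar> < \<nu> / 10" "\<bar>\<beta>22 - \<nu>\<bar> < \<nu> / (10::real)"
 shows "3/5 * \<nu> < (\<beta>11 + \<beta>22 - sqrt ((\<beta>11 - \<beta>22)^2 + 4 * \<beta>12 * \<beta>21)) / 2"
proof -
 have n: "\<nu> > 0" using small(1) by linarith
 have "\<bar>\<beta>11 - \<beta>22\<bar> <= \<nu> / 5" using small by linarith
 then have 1: "(\<beta>11 - \<beta>22)^2 <= (\<nu> / 5)\<^sup>2" using n by (intro abs_le_square_iff[THEN iffD1]) simp
 have "\<bar>\<beta>12 * \<beta>21\<bar> <= (\<nu> / 10) * (\<nu> / 10)" by (rule abs_mult_le) (use small in linarith)+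
 then have 2: "\<beta>12 * \<beta>21 <= (\<nu> / 10) * (\<nu> / 10)" by (rule order_trans[OF abs_ge_self])
 have 3: "(\<nu> / 5)^2 + 4 * ((\<nu> / 10) * (\<nu> / 10)) <= (3/10 * \<nu>)\<^sup>2"
  using zero_le_square[of \<nu>] by (simp add: power2_eq_square)
 have "x + 4 * \<beta>12 * \<beta>21 <= z" if "x <= y" "y + 4 * u <= z" "\<beta>12 * \<beta>21 <= u" for x y z u using that by (simp add: mult.assoc)
 from this[OF 1 3 2] have "(\<beta>11 - \<beta>22)^2 + 4 * \<beta>12 * \<beta>21 <= (3/10 * \<nu>)\<^sup>2" .
 then have R: "sqrt ((\<beta>11 - \<beta>22)^2 + 4 * \<beta>12 * \<beta>21) <= 3/10 * \<nu>" using n by (intro real_le_lsqrt) auto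
 have b: "9/10 * \<nu> < \<beta>11" "9/10 * \<nu> < \<beta>22" using small(1,4) unfolding abs_less_iff by linarith+
 have "3/5 * \<nu> < (\<beta>11 + \<beta>22 - t) / 2" if "t <= 3/10 * \<nu>" for t
 proof -
  have "6/5 * \<nu> < \<beta>11 + \<beta>22 - t" using that b n by linarith
  then show ?thesis by (simp add: field_simps)
 qed
 from this[OF R] show ?thesis .
qed

lemma f2_eq: "\<forall>\<^sub>F p in nhds 0. f2 p = tr p"
proof -
 \<comment> \<open>3/5 lies between 1/2 and 1: at p = 0 the double eigenvalue of M x = nu K x is
   1/pi^2, and the next one is 1/(2 pi^2).\<close>
 define \<theta> where "\<theta> = 3/5 * (1/pi^2)"
 define k1 k2 where "k1 p i = (\<Sum>j\<in>UNIV. Kt p i j * v1 p j)" and "k2 p i = (\<Sum>j\<in>UNIV. Kt p i j * v2 p j)" for p i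
 have cK: "isCont (%p. Kt p i j) 0" and cM: "isCont (%p. Mt p i j) 0" for i j
  using grad4_isCont[OF grad4_Kt(1)] grad4_isCont[OF grad4_Mt[OF Wn[OF W0]]] by auto
 have cv: "isCont (%p. v1 p j) 0" "isCont (%p. v2 p j) 0" for j
  using grad4_isCont[OF gv(1)[OF W0]] grad4_isCont[OF gv(2)[OF W0]] by auto
 have cy: "isCont (%p. y1 p $ j) 0" "isCont (%p. y2 p $ j) 0" for j
  using grad4_isCont[OF gY(1)[OF W0]] grad4_isCont[OF gY(2)[OF W0]] by auto
 have ck: "isCont (%p. k1 p i) 0" "isCont (%p. k2 p i) 0" for i
  unfolding k1_def k2_def by (intro continuous_sum continuous_mult cK cv)+
 have p9: "pi^2 \<ge> 9" using pi_sq_bounds by simp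
 have k0: "k1 0 i = kd $ i * of_bool (i = 1)" "k2 0 i = kd $ i * of_bool (i = 2)" for i
  by (simp_all add: k1_def k2_def sum_KM_0 v_0)
 have K: "\<forall>\<^sub>F p in nhds 0. \<forall>x::real^5. x \<noteq> 0 --> 0 < QF (Kt p) (%i. x$i) (%i. x$i)"
 proof (rule posdef_near[OF cK KM_0(1)])
  show "1 <= kd $ i" for i by (rule all_5[where i=i]) (use p9 in simp_all)
 qed simp
 have M: "\<forall>\<^sub>F p in nhds 0. \<forall>x::real^5. x \<noteq> 0 --> 0 < QF (Mt p) (%i. x$i) (%i. x$i)"
 proof (rule posdef_near[OF cM KM_0(2)])
  show "1/4 <= md $ i" for i by (rule all_5[where i=i]) simp_all
 qed simp
 have N: "\<forall>\<^sub>F p in nhds 0. \<forall>x::real^5. x \<noteq> 0 --> 0 < QF (%i j. \<theta> * Kt p i j - Mt p i j + (k1 p i * k1 p j + k2 p i * k2 p j)) (%i. x$i) (%i. x$i)"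
 proof (rule posdef_near)
  show "isCont (%p. \<theta> * Kt p i j - Mt p i j + (k1 p i * k1 p j + k2 p i * k2 p j)) 0" for i j
   by (intro continuous_add continuous_diff continuous_mult continuous_const cK cM ck)
  show "\<theta> * Kt 0 i j - Mt 0 i j + (k1 0 i * k1 0 j + k2 0 i * k2 0 j) = (if i = j then \<theta> * kd $ i - md $ i + (k1 0 i * k1 0 i + k2 0 i * k2 0 i) else 0)" for i j
   by (cases "i = j") (auto simp: KM_0 k0)
  have "1 * 1 <= (pi^2 / 2) * (pi^2 / 2)" using p9 by (intro mult_mono) auto
  \<comment> \<open>1/20 = 3/10 - 1/4 is the value at the mode (1,1); in the first two components
    the added squares outweigh 3/10 - 1/2.\<close>
  then show "1/20 <= \<theta> * kd $ i - md $ i + (k1 0 i * k1 0 i + k2 0 i * k2 0 i)" for i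
   unfolding k0 by (rule_tac all_5[where i=i]) (simp_all add: \<theta>_def)
 qed simp
 have n0: "0 < 1/pi^2 / 10" by simp
 have b: "\<forall>\<^sub>F p in nhds 0. \<bar>y1 p $ 1 - 1/pi^2\<bar> < 1/pi^2 / 10" "\<forall>\<^sub>F p in nhds 0. \<bar>y1 p $ 2\<bar> < 1/pi^2 / 10"
  "\<forall>\<^sub>F p in nhds 0. \<bar>y2 p $ 1\<bar> < 1/pi^2 / 10" "\<forall>\<^sub>F p in nhds 0. \<bar>y2 p $ 2 - 1/pi^2\<bar> < 1/pi^2 / 10"
  using isCont_nhds[OF cy(1)[of 1] n0] isCont_nhds[OF cy(1)[of 2] n0] isCont_nhds[OF cy(2)[of 1] n0] isCont_nhds[OF cy(2)[of 2] n0]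
  unfolding P_0 by simp_all
 have W: "\<forall>\<^sub>F p in nhds 0. p \<in> W" using openW W0 by (rule eventually_nhds_in_open)
 show ?thesis using K M N b W
 proof eventually_elim
  case (elim p)
  have p: "p \<in> W" and n: "norm p <= 1/8" using elim(8) Wn by auto
  define KK MM where "KK = (\<chi> i j. Kt p i j)" and "MM = (\<chi> i j. Mt p i j)"
  have st: "stiffness p = KK" "mass p = MM" by (simp_all add: KK_def MM_def vec_eq_iff stiffness_eq[OF n] mass_eq[OF n])
  define x1 x2 where "x1 = (\<chi> i. v1 p i)" and "x2 = (\<chi> i. v2 p i)"
  have kx: "KK *v x1 = (\<chi> i. k1 p i)" "KK *v x2 = (\<chi> i. k2 p i)"
   by (simp_all add: KK_def x1_def x2_def k1_def k2_def matrix_vector_mult_def vec_eq_iff)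
  have "1 / gen_eigenvalue 1 KK MM + 1 / gen_eigenvalue 2 KK MM = y1 p $ 1 + y2 p $ 2"
  proof (rule two_smallest_eigenvalues)
   show "x \<bullet> (KK *v y) = y \<bullet> (KK *v x)" "x \<bullet> (MM *v y) = y \<bullet> (MM *v x)" for x y
    unfolding KK_def MM_def by (rule sym_mat, rule KM_sym)+
   show "0 < x \<bullet> (KK *v x)" "0 < x \<bullet> (MM *v x)" if "x \<noteq> 0" for x
    unfolding KK_def MM_def QF_vec using elim(1,2) that by blast+
   show "x \<bullet> (MM *v x) < \<theta> * (x \<bullet> (KK *v x))" if "x \<noteq> 0" "x \<bullet> (KK *v x1) = 0" "x \<bullet> (KK *v x2) = 0" for x
   proof -
    have s: "(\<Sum>i\<in>UNIV. x$i * k1 p i) = 0" "(\<Sum>i\<in>UNIV. x$i * k2 p i) = 0" using that(2,3) unfolding kx by (simp_all add: inner_vec_def)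
    have "0 < QF (%i j. \<theta> * Kt p i j - Mt p i j + (k1 p i * k1 p j + k2 p i * k2 p j)) (%i. x$i) (%i. x$i)"
     by (rule mp[OF spec[OF elim(3)] that(1)])
    then have "0 < \<theta> * QF (Kt p) (%i. x$i) (%i. x$i) - QF (Mt p) (%i. x$i) (%i. x$i) + (0\<^sup>2 + 0\<^sup>2)"
     unfolding QF_combination s .
    then show ?thesis unfolding KK_def MM_def QF_vec by simp
   qed
   show "0 < \<theta>" by (simp add: \<theta>_def)
   show "x1 $ 1 = 1" "x1 $ 2 = 0" "x2 $ 1 = 0" "x2 $ 2 = 1" by (simp_all add: x1_def x2_def v1_def v2_def vv1_def vv2_def)
   show "MM *v x1 = KK *v (y1 p $ 1 *\<^sub>R x1 + y1 p $ 2 *\<^sub>R x2)" "MM *v x2 = KK *v (y2 p $ 1 *\<^sub>R x1 + y2 p $ 2 *\<^sub>R x2)"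
    using E[OF p] by (simp_all add: KK_def MM_def x1_def x2_def vec_eq_iff matrix_vector_mult_def)
   show "\<theta> < (y1 p $ 1 + y2 p $ 2 - sqrt ((y1 p $ 1 - y2 p $ 2)^2 + 4 * y2 p $ 1 * y1 p $ 2)) / 2"
    unfolding \<theta>_def by (rule spectral_gap[OF elim(4-7)])
  qed
  moreover have "area p = ar p" using area_eq'[OF n] by (simp add: ar_def power2_eq_square)
  moreover have "1 / (2 * u) * v = v * (1/2 * inverse u)" for u v :: real by (simp add: field_simps)
  ultimately show "f2 p = tr p" unfolding f2_def st tr_def by (simp only:)
 qed
qed

lemma hessian_f2: "has_hessian f2 (\<chi> q r. if q = r then (vector [2/pi^2, rho_sharp, rho_sharp, 2/pi^2] :: real^4) $ q else 0) 0"
 unfolding has_hessian_def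
proof (intro exI conjI)
 have "isCont dt 0" by (rule grad4_isCont[OF grad4_dt])
 then have "\<forall>\<^sub>F p in nhds 0. \<bar>dt p - dt 0\<bar> < dt 0" by (rule isCont_nhds) (simp add: dt_0)
 then have "\<forall>\<^sub>F p in nhds 0. dt p \<noteq> 0" by eventually_elim auto
 moreover have "\<forall>\<^sub>F p in nhds 0. p \<in> W" using openW W0 by (rule eventually_nhds_in_open)
 ultimately have "\<forall>\<^sub>F p in nhds 0. f2 p = tr p \<and> dt p \<noteq> 0 \<and> p \<in> W" using f2_eq by eventually_elim auto
 then obtain S where S: "open S" "0 \<in> S" "!!p. p \<in> S ==> f2 p = tr p \<and> dt p \<noteq> 0 \<and> p \<in> W" unfolding eventually_nhds by blast
 show "\<forall>\<^sub>F y in nhds 0. (f2 has_derivative (%h. (\<chi> q. G2 q y) \<bullet> h)) (at y)"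
  unfolding eventually_nhds
 proof (intro exI conjI ballI)
  fix p assume p: "p \<in> S"
  have "(tr has_derivative (%h. (\<chi> q. G2 q p) \<bullet> h)) (at p)"
   using grad4_tr[of p] S(3)[OF p] by (simp add: grad4_def inner_vec_def)
  then show "(f2 has_derivative (%h. (\<chi> q. G2 q p) \<bullet> h)) (at p)"
   by (rule has_derivative_transform_within_open[OF _ S(1) p]) (use S(3) in auto)
 qed (use S in auto)
 let ?H = "(\<chi> q r. if q = r then (vector [2/pi^2, rho_sharp, rho_sharp, 2/pi^2] :: real^4) $ q else 0) :: real^4^4"
 have ax: "(\<Sum>i\<in>UNIV. f i *\<^sub>R axis i (1::real)) = (\<chi> i. f i)" for f :: "4 => real"
  by (simp add: vec_eq_iff axis_def if_distrib cong: if_cong)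
 define hq :: "4 => 4 => real" where "hq q r = (if q = r then (vector [2/pi^2, rho_sharp, rho_sharp, 2/pi^2] :: real^4) $ q else 0)" for q r
 have g: "(G2 q has_derivative (%x. \<Sum>r\<in>UNIV. hq q r * x$r)) (at 0)" for q
  using grad4_G2[of q] unfolding grad4_def hq_def .
 have "((%p. \<Sum>q\<in>UNIV. G2 q p *\<^sub>R axis q (1::real)) has_derivative (%h. \<Sum>q\<in>UNIV. (\<Sum>r\<in>UNIV. hq q r * h$r) *\<^sub>R axis q 1)) (at 0)"
  by (rule has_derivative_sum) (rule has_derivative_scaleR_left[OF g])
 moreover have "(%h. ?H *v h) = (%h. \<chi> q. \<Sum>r\<in>UNIV. hq q r * h$r)"
  by (rule ext) (simp only: matrix_vector_mult_def vec_lambda_beta hq_def)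
 ultimately show "((%p. \<chi> q. G2 q p) has_derivative (%h. ?H *v h)) (at 0)"
  by (simp only: ax)
qed

end

lemma least_eigenvalue_diagonal:
 fixes v :: "real^'n"
 shows "least_eigenvalue (\<chi> q r. if q = r then v $ q else 0) = Min (range (%q. v $ q))"
proof -
 have mv: "((\<chi> q r. if q = r then v $ q else 0) *v x) $ q = v $ q * x $ q" for x q
 proof -
  have "(if q = r then v $ q else 0) * x $ r = (if q = r then v $ q * x $ q else 0)" for r by simp
  then show ?thesis by (simp add: matrix_vector_mult_def)
 qed
 have "{l. \<exists>x. x \<noteq> 0 \<and> (\<chi> q r. if q = r then v $ q else 0) *v x = l *\<^sub>R x} = range (%q. v $ q)"
 proof (intro set_eqI iffI)
  fix l assume "l \<in> {l. \<exists>x. x \<noteq> 0 \<and> (\<chi> q r. if q = r then v $ q else 0) *v x = l *\<^sub>R x}"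
  then obtain x where x: "x \<noteq> 0" "(\<chi> q r. if q = r then v $ q else 0) *v x = l *\<^sub>R x" by blast
  obtain q where q: "x $ q \<noteq> 0" using x(1) by (auto simp: vec_eq_iff)
  have "v $ q * x $ q = l * x $ q" using arg_cong[OF x(2), of "%y. y $ q"] unfolding mv by simp
  then show "l \<in> range (%q. v $ q)" using q by auto
 next
  fix l assume "l \<in> range (%q. v $ q)"
  then obtain q where q: "l = v $ q" by blast
  have "(\<chi> q r. if q = r then v $ q else 0) *v axis q 1 = l *\<^sub>R axis q (1::real)"
   by (subst vec_eq_iff) (simp add: mv axis_def q)
  then show "l \<in> {l. \<exists>x. x \<noteq> 0 \<and> (\<chi> q r. if q = r then v $ q else 0) *v x = l *\<^sub>R x}"
   by (auto intro!: exI[of _ "axis q 1"] simp: axis_eq_0_iff)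
 qed
 then show ?thesis unfolding least_eigenvalue_def by simp
qed

lemma branch_exists:
 obtains W y1 y2 where "branch W y1 y2"
proof (rule invariant_subspace)
 fix W :: "(real^4) set" and y1 y2 :: "real^4 => real^5"
 assume a: "open W" "0 \<in> W" "W \<subseteq> ball 0 (1/8)" "y1 0 = axis 1 (1/pi^2)" "y2 0 = axis 2 (1/pi^2)"
  "!!p i. p \<in> W ==> Eq1 i (p, y1 p, y2 p) = 0" "!!p i. p \<in> W ==> Eq2 i (p, y1 p, y2 p) = 0"
  "!!p i. p \<in> W ==> \<exists>f'. grad4 (%p. y1 p $ i) f' p" "!!p i. p \<in> W ==> \<exists>f'. grad4 (%p. y2 p $ i) f' p"
 show thesis by (rule that[OF branch.intro[OF a]])
qed

text \<open>The Hessian is diagonal, and \<open>rho_sharp\<close> is its smallest entry because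
  2/pi^2 >= 1/5.\<close>

lemma hessian_exists: "\<exists>H. has_hessian f2 H 0 \<and> least_eigenvalue H = rho_sharp"
proof -
 obtain W y1 y2 where "branch W y1 y2" by (rule branch_exists)
 then interpret branch W y1 y2 .
 have u: "(UNIV :: 4 set) = {1, 2, 3, 4}" using exhaust_4 by auto
 have "rho_sharp <= 2 / pi^2"
 proof -
  have "1/5 <= 2 / pi^2" using pi_sq_bounds by (simp add: field_simps)
  then show ?thesis using rho_sharp_bounds by linarith
 qed
 then have "Min (range (%q. (vector [2/pi^2, rho_sharp, rho_sharp, 2/pi^2] :: real^4) $ q)) = rho_sharp"
  unfolding u by simp
 then have "least_eigenvalue (\<chi> q r. if q = r then (vector [2/pi^2, rho_sharp, rho_sharp, 2/pi^2] :: real^4) $ q else 0) = rho_sharp"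
  unfolding least_eigenvalue_diagonal .
 with hessian_f2 show ?thesis by (intro exI conjI)
qed

theorem corollary5p5:
  shows "\<bar>rho_sharp - 0.1245\<bar> < 0.00005
    \<and> (\<exists>H. has_hessian f2 H 0 \<and> least_eigenvalue H = rho_sharp)
    \<and> quad 0 = square
    \<and> (\<forall>p. is_arg_max (\<lambda>q. area q * mu1 (interior (quad q)))
               (\<lambda>q. q \<in> cball 0 rho_sharp \<inter> admissible) p
           \<longleftrightarrow> p = 0)"
proof (intro conjI allI)
 show "\<bar>rho_sharp - 0.1245\<bar> < 0.00005" using rho_sharp_bounds by simp
 show "\<exists>H. has_hessian f2 H 0 \<and> least_eigenvalue H = rho_sharp" by (rule hessian_exists)
 show "quad 0 = square" by (rule quad_0)
 interpret z: quad_map 0 by unfold_locales simp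
 \<comment> \<open>\<open>rho_sharp <= 1/8\<close> places the closed ball inside the range of
   \<open>quad_map\<close> and \<open>square_maximizes\<close>.\<close>
 have rho: "0 <= rho_sharp" "rho_sharp <= 1/8" using rho_sharp_bounds by linarith+
 have zero: "0 \<in> cball 0 rho_sharp \<inter> admissible" using z.admissible_p rho by simp
 have less: "area q * mu1 (interior (quad q)) < area 0 * mu1 (interior (quad 0))" if "q \<in> cball 0 rho_sharp \<inter> admissible" "q \<noteq> 0" for q
  using that rho by (intro square_maximizes) auto
 fix p
 show "is_arg_max (%q. area q * mu1 (interior (quad q))) (%q. q \<in> cball 0 rho_sharp \<inter> admissible) p \<longleftrightarrow> p = 0"
 proof
  assume "is_arg_max (%q. area q * mu1 (interior (quad q))) (%q. q \<in> cball 0 rho_sharp \<inter> admissible) p"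
  then show "p = 0" unfolding is_arg_max_def using zero less by blast
 next
  assume p: "p = 0"
  have "\<not> area 0 * mu1 (interior (quad 0)) < area y * mu1 (interior (quad y))" if "y \<in> cball 0 rho_sharp \<inter> admissible" for y
   using less[OF that] by (cases "y = 0") auto
  then show "is_arg_max (%q. area q * mu1 (interior (quad q))) (%q. q \<in> cball 0 rho_sharp \<inter> admissible) p"
   unfolding is_arg_max_def p using zero by blast
 qed
qed

end
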